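(* Let $\mathbf P$ be the multicategory of small permutative categories. (i) There is an operad $\Sigma_*$ for which an associative structure on a small permutative category $\mathcal A$ determines and is determined by a multifunctor $\Sigma_*\to\mathbf P$ sending the single object of $\Sigma_*$ to $\mathcal A$. (ii) There is an $E_\infty$ operad $E\Sigma_*$ for which a bipermutative structure on a small permutative category $\mathcal R$ determines and is determined by a multifunctor $E\Sigma_*\to\mathbf P$ sending the single object of $E\Sigma_*$ to $\mathcal R$.
   Context: **Multicategories.** A multicategory $\mathbf M$ (symmetric colored operad) has objects, sets $\mathbf M_k(a_1,\dots,a_k;b)$ of $k$-morphisms ($k\ge0$), right symmetric group actions $\sigma^*:\mathbf M_k(a_1,\dots,a_k;b)\to\mathbf M_k(a_{\sigma(1)},\dots,a_{\sigma(k)};b)$, units, and multiproducts $\Gamma(g;f_1,\dots,f_n)$ satisfying the usual operad identities; it is enriched over small categories if the $k$-morphisms are small categories and the structure maps functors (sets are regarded as discrete categories). An operad is a multicategory with one object. Multifunctors preserve all structure including enrichment. **Permutative categories.** A permutative category is a category $\mathcal C$ with a functor $\oplus$, an object $0$ and a natural isomorphism $\gamma:a\oplus b\cong b\oplus a$ such that $\oplus$ is strictly associative, $0$ is a strict unit, $\gamma_{a,0}=\mathrm{id}$, $\gamma_{b,a}\gamma_{a,b}=\mathrm{id}$, $\gamma_{a\oplus b,c}=(\gamma_{a,c}\oplus 1)(1\oplus\gamma_{b,c})$. **The multicategory $\mathbf P$.** Objects: small permutative categories. An object of the category $\mathbf P_k(\mathcal C_1,\dots,\mathcal C_k;\mathcal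 D)$ (a $k$-linear map) is a functor $f:\mathcal C_1\times\dots\times\mathcal C_k\to\mathcal D$ with $f(c_1,\dots,c_k)=0$ if any of the $c_i$ is $0$, with natural transformations $\delta_i:f(c_i)\oplus f(c_i')\to f(c_i\oplus c_i')$ in each variable ($1\le i\le k$, fixed variables suppressed), with $\delta_i=\mathrm{id}$ if $c_i$, $c_i'$ or any other $c_j$ is $0$, and $f(\gamma)\delta_i=\delta_i\gamma$; $\delta_i(\delta_i\oplus1)=\delta_i(1\oplus\delta_i)$; for $i\ne j$, $\delta_j(\delta_i\oplus\delta_i)=\delta_i(\delta_j\oplus\delta_j)(1\oplus\gamma\oplus1)$ as maps $f(c_i,c_j)\oplus f(c_i',c_j)\oplus f(c_i,c_j')\oplus f(c_i',c_j')\to f(c_i\oplus c_i',c_j\oplus c_j')$. A morphism $\phi:f\to g$ is a natural transformation with $\phi\,\delta_i^f=\delta_i^g(\phi\oplus\phi)$ for all $i$. $\sigma^*f(c_{\sigma(1)},\dots,c_{\sigma(k)})=f(c_1,\dots,c_k)$; $\Gamma(g;f_1,\dots,f_n)=g\circ(f_1\times\dots\times f_n)$ with distributivity maps $g(\delta_i^{f_j})\circ\delta_j^g$. A $0$-linear map to $\mathcal D$ is an object of $\mathcal D$. **Associative structure** on a permutative category $(\mathcal A,\oplus,0,\gamma)$ (making it an associative category): a functor $\otimes:\mathcal A\times\mathcal A\to\mathcal A$, strictly associative with strict unit object $1$, and natural distributivity maps $d_l(a,a';b):(a\otimes b)\oplus(a'\otimes b)\to(a\oplus a')\otimes b$ and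 $d_r(a;b,b'):(a\otimes b)\oplus(a\otimes b')\to a\otimes(b\oplus b')$ such that: (a) $a\otimes0=0\otimes a=0$ for all $a$; (b) $d_l(d_l\oplus1)=d_l(1\oplus d_l)$ on $(a\otimes b)\oplus(a'\otimes b)\oplus(a''\otimes b)$, and similarly for $d_r$; (c) $(\gamma\otimes1)d_l=d_l\gamma$ and $(1\otimes\gamma)d_r=d_r\gamma$; (d) $d_l(a,a';b\otimes c)=(d_l(a,a';b)\otimes1_c)\,d_l(a\otimes b,a'\otimes b;c)$ and $d_r(a\otimes b;c,c')=(1_a\otimes d_r(b;c,c'))\,d_r(a;b\otimes c,b\otimes c')$; (e) $(d_r(a;b,b')\otimes1_c)\,d_l(a\otimes b,a\otimes b';c)=(1_a\otimes d_l(b,b';c))\,d_r(a;b\otimes c,b'\otimes c)$; (f) $d_l(a,a';b\oplus b')(d_r(a;b,b')\oplus d_r(a';b,b'))=d_r(a\oplus a';b,b')(d_l(a,a';b)\oplus d_l(a,a';b'))(1\oplus\gamma\oplus1)$. **Bipermutative structure** on a permutative category $(\mathcal R,\oplus,0,\gamma)$: a second permutative structure $(\mathcal R,\otimes,1,\gamma^\otimes)$ and natural distributivity maps $d_l(a,a';b):(a\otimes b)\oplus(a'\otimes b)\to(a\oplus a')\otimes b$ and $d_r(a;b,b'):(a\otimes b)\oplus(a\otimes b')\to a\otimes(b\oplus b')$ satisfying (a), (b), (c), (d), (f) and, in place of (e), (e$'$) $\gamma^\otimes_{a\oplus a',b}\,d_l(a,a';b)=d_r(b;a,a')(\gamma^\otimes_{a,b}\oplus\gamma^\otimes_{a',b})$.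 **Operads.** $\Sigma_*$ has $k$-th set $\Sigma_k$ with right multiplication action, and $\Gamma(\sigma;\phi_1,\dots,\phi_k)=\sigma\langle j_1,\dots,j_k\rangle\circ(\phi_1\amalg\dots\amalg\phi_k)$ for $\phi_i\in\Sigma_{j_i}$, where $\sigma\langle j_1,\dots,j_k\rangle$ permutes the blocks $j_1\amalg\dots\amalg j_k\to j_{\sigma^{-1}(1)}\amalg\dots\amalg j_{\sigma^{-1}(k)}$. For a set $X$, $EX$ is the category with object set $X$ and exactly one morphism between each ordered pair of objects; $E\Sigma_*$ is the operad of categories with $k$-th category $E\Sigma_k$. It is $E_\infty$: the categories $E\Sigma_k$ are contractible with free $\Sigma_k$-action. The correspondence: for a multifunctor $T$, the 2-linear map $T(1_2)$ ($1_2\in\Sigma_2$ the identity) is $\otimes$ with $\delta_1=d_l$, $\delta_2=d_r$, the object $T(1_0)$ is the unit $1$, and in the bipermutative case $\gamma^\otimes$ is the image of the isomorphism between the two objects of $E\Sigma_2$.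
   Formalization: Associative and bipermutative structures are also required to have d_l, d_r identities if an argument is 0 or the distributed factor is 1 (forced by a multifunctor, not by (a)–(f)), and the conditions at 0 on the tensor product and on k-linear maps are imposed on morphisms too. *)

theory Defs
  imports "HOL-Library.FuncSet" "HOL-Combinatorics.Permutations"
begin

section \<open>Categories\<close>

text \<open>A small category is carried by sets of objects and arrows inside two arbitrary types.
  The fields are only meaningful on these carriers; \<open>cmp C g f\<close> is \<open>g\<close> after \<open>f\<close>.\<close>

record ('o, 'm) cat =
  Ob :: "'o set"
  Ar :: "'m set"
  cdom :: "'m \<Rightarrow> 'o"
  ccod :: "'m \<Rightarrow> 'o"
  ide :: "'o \<Rightarrow> 'm"
  cmp :: "'m \<Rightarrow> 'm \<Rightarrow> 'm"

definition hom :: "('o, 'm, 'z) cat_scheme \<Rightarrow> 'o \<Rightarrow> 'o \<Rightarrow> 'm set" where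
  "hom C a b = {f \<in> Ar C. cdom C f = a \<and> ccod C f = b}"

locale category =
  fixes C :: "('o, 'm, 'z) cat_scheme"
  assumes dom_in: "f \<in> Ar C \<Longrightarrow> cdom C f \<in> Ob C"
    and cod_in: "f \<in> Ar C \<Longrightarrow> ccod C f \<in> Ob C"
    and ide_in: "a \<in> Ob C \<Longrightarrow> ide C a \<in> hom C a a"
    and cmp_in: "f \<in> hom C a b \<Longrightarrow> g \<in> hom C b c \<Longrightarrow> cmp C g f \<in> hom C a c"
    and cmp_ide_right: "f \<in> hom C a b \<Longrightarrow> cmp C f (ide C a) = f"
    and cmp_ide_left: "f \<in> hom C a b \<Longrightarrow> cmp C (ide C b) f = f"
    and cmp_assoc: "f \<in> hom C a b \<Longrightarrow> g \<in> hom C b c \<Longrightarrow> h \<in> hom C c d \<Longrightarrow>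
      cmp C h (cmp C g f) = cmp C (cmp C h g) f"

locale cat_functor = source: category C + target: category D
  for C :: "('o, 'm, 'z) cat_scheme" and D :: "('p, 'n, 'y) cat_scheme" +
  fixes fo :: "'o \<Rightarrow> 'p" and fa :: "'m \<Rightarrow> 'n"
  assumes ob_in: "a \<in> Ob C \<Longrightarrow> fo a \<in> Ob D"
    and ar_in: "f \<in> hom C a b \<Longrightarrow> fa f \<in> hom D (fo a) (fo b)"
    and ar_ide: "a \<in> Ob C \<Longrightarrow> fa (ide C a) = ide D (fo a)"
    and ar_cmp: "f \<in> hom C a b \<Longrightarrow> g \<in> hom C b c \<Longrightarrow>
      fa (cmp C g f) = cmp D (fa g) (fa f)"

locale nat_trans =
  F: cat_functor C D fo fa + G: cat_functor C D go ga
  for C :: "('o, 'm, 'z) cat_scheme" and D :: "('p, 'n, 'y) cat_scheme"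
    and fo fa go ga +
  fixes \<eta> :: "'o \<Rightarrow> 'n"
  assumes component_in: "a \<in> Ob C \<Longrightarrow> \<eta> a \<in> hom D (fo a) (go a)"
    and naturality: "f \<in> hom C a b \<Longrightarrow> cmp D (\<eta> b) (fa f) = cmp D (ga f) (\<eta> a)"

definition is_iso :: "('o, 'm, 'z) cat_scheme \<Rightarrow> 'm \<Rightarrow> bool" where
  "is_iso C f \<longleftrightarrow> f \<in> Ar C \<and> (\<exists>g \<in> hom C (ccod C f) (cdom C f).
     cmp C g f = ide C (cdom C f) \<and> cmp C f g = ide C (ccod C f))"

definition equivalent_categories ::
  "('o, 'm, 'z) cat_scheme \<Rightarrow> ('p, 'n, 'y) cat_scheme \<Rightarrow> bool" where
  "equivalent_categories C D \<longleftrightarrow> (\<exists>fo fa go ga \<eta> \<epsilon>.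
     cat_functor C D fo fa \<and> cat_functor D C go ga \<and>
     nat_trans C C (\<lambda>a. a) (\<lambda>f. f) (go \<circ> fo) (ga \<circ> fa) \<eta> \<and> (\<forall>a \<in> Ob C. is_iso C (\<eta> a)) \<and>
     nat_trans D D (fo \<circ> go) (fa \<circ> ga) (\<lambda>b. b) (\<lambda>g. g) \<epsilon> \<and> (\<forall>b \<in> Ob D. is_iso D (\<epsilon> b)))"

definition discrete_cat :: "'a set \<Rightarrow> ('a, 'a) cat" where
  "discrete_cat X = \<lparr>Ob = X, Ar = X, cdom = (\<lambda>x. x), ccod = (\<lambda>x. x), ide = (\<lambda>x. x),
     cmp = (\<lambda>g f. f)\<rparr>"

text \<open>The category \<open>EX\<close>: the pair \<open>(x, y)\<close> is the unique arrow from \<open>x\<close> to \<open>y\<close>.\<close>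

definition indiscrete_cat :: "'a set \<Rightarrow> ('a, 'a \<times> 'a) cat" where
  "indiscrete_cat X = \<lparr>Ob = X, Ar = X \<times> X, cdom = fst, ccod = snd, ide = (\<lambda>x. (x, x)),
     cmp = (\<lambda>g f. (fst f, snd g))\<rparr>"

text \<open>Equivalence with the terminal category; in particular the classifying space
  is contractible.\<close>

definition contractible_category :: "('o, 'm, 'z) cat_scheme \<Rightarrow> bool" where
  "contractible_category C \<longleftrightarrow> equivalent_categories C (discrete_cat {()})"

text \<open>The product of a list of categories. The empty product is the terminal category.\<close>

definition prod_cat :: "('o, 'm, 'z) cat_scheme list \<Rightarrow> ('o list, 'm list) cat" where
  "prod_cat Cs = \<lparr>Ob = {xs. list_all2 (\<lambda>C x. x \<in> Ob C) Cs xs},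
     Ar = {us. list_all2 (\<lambda>C u. u \<in> Ar C) Cs us},
     cdom = (\<lambda>us. map2 cdom Cs us), ccod = (\<lambda>us. map2 ccod Cs us),
     ide = (\<lambda>xs. map2 ide Cs xs),
     cmp = (\<lambda>vs us. map2 (\<lambda>C (v, u). cmp C v u) Cs (zip vs us))\<rparr>"


section \<open>Multicategories enriched over small categories\<close>

text \<open>Permutations in \<open>\<Sigma>\<^sub>k\<close> are functions permuting \<open>{..<k}\<close>: indices start at \<open>0\<close>.
  Entry \<open>i\<close> of \<open>permute_list \<sigma> xs\<close> is \<open>xs ! \<sigma> i\<close>.

  An index of a concatenation of blocks of lengths \<open>js\<close> is split into its block and its
  position within the block.\<close>

fun block_pos :: "nat list \<Rightarrow> nat \<Rightarrow> nat \<times> nat" where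
  "block_pos [] n = (0, n)"
| "block_pos (j # js) n =
     (if n < j then (0, n) else (case block_pos js (n - j) of (i, r) \<Rightarrow> (Suc i, r)))"

definition block_start :: "nat list \<Rightarrow> nat \<Rightarrow> nat" where
  "block_start js i = sum_list (take i js)"

text \<open>\<open>\<sigma>\<langle>j\<^sub>1, \<dots>, j\<^sub>k\<rangle>\<close>: block \<open>i\<close> moves to place \<open>\<sigma> i\<close>, so that place \<open>p\<close> is
  taken by the block of length \<open>j\<close> at index \<open>\<sigma>\<^sup>-\<^sup>1 p\<close>.\<close>

definition block_perm :: "(nat \<Rightarrow> nat) \<Rightarrow> nat list \<Rightarrow> nat \<Rightarrow> nat" where
  "block_perm \<sigma> js n =
     (if n < sum_list js
      then (case block_pos js n of (i, r) \<Rightarrow> block_start (permute_list (inv \<sigma>) js) (\<sigma> i) + r)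
      else n)"

definition block_sum :: "(nat \<Rightarrow> nat) list \<Rightarrow> nat list \<Rightarrow> nat \<Rightarrow> nat" where
  "block_sum \<phi>s js n =
     (if n < sum_list js then (case block_pos js n of (i, r) \<Rightarrow> block_start js i + (\<phi>s ! i) r)
      else n)"

fun unconcat :: "nat list \<Rightarrow> 'a list \<Rightarrow> 'a list list" where
  "unconcat [] xs = []"
| "unconcat (k # ks) xs = take k xs # unconcat ks (drop k xs)"

text \<open>\<open>MHom M as b\<close> is the category of morphisms from the list \<open>as\<close> to \<open>b\<close>. As the carriers
  of these categories may overlap, the structure maps carry the objects as arguments. The
  suffixes distinguish the effect of the structure functors on objects and on arrows:
  \<open>act_o M \<sigma> as b\<close> and \<open>act_a M \<sigma> as b\<close> form the functor \<open>\<sigma>\<^sup>*\<close> on \<open>MHom M as b\<close>, and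
  \<open>gam_o M ass bs c g fs\<close> is \<open>\<Gamma>(g; fs)\<close> for \<open>g\<close> from \<open>bs\<close> to \<open>c\<close> and \<open>fs ! i\<close> from
  \<open>ass ! i\<close> to \<open>bs ! i\<close>.\<close>

record ('x, 'f, 'n) multicat =
  MOb :: "'x set"
  MHom :: "'x list \<Rightarrow> 'x \<Rightarrow> ('f, 'n) cat"
  act_o :: "(nat \<Rightarrow> nat) \<Rightarrow> 'x list \<Rightarrow> 'x \<Rightarrow> 'f \<Rightarrow> 'f"
  act_a :: "(nat \<Rightarrow> nat) \<Rightarrow> 'x list \<Rightarrow> 'x \<Rightarrow> 'n \<Rightarrow> 'n"
  munit :: "'x \<Rightarrow> 'f"
  gam_o :: "'x list list \<Rightarrow> 'x list \<Rightarrow> 'x \<Rightarrow> 'f \<Rightarrow> 'f list \<Rightarrow> 'f"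
  gam_a :: "'x list list \<Rightarrow> 'x list \<Rightarrow> 'x \<Rightarrow> 'n \<Rightarrow> 'n list \<Rightarrow> 'n"

definition composable ::
  "'x set \<Rightarrow> ('x list \<Rightarrow> 'x \<Rightarrow> 'f set) \<Rightarrow> 'x list list \<Rightarrow> 'x list \<Rightarrow> 'f list \<Rightarrow> bool" where
  "composable X H ass bs fs \<longleftrightarrow>
     length ass = length bs \<and> length fs = length bs \<and> bs \<in> lists X \<and> ass \<in> lists (lists X) \<and>
     (\<forall>i < length bs. fs ! i \<in> H (ass ! i) (bs ! i))"

text \<open>The identities of a multicategory in sets. They are used twice below, for the objects and
  for the arrows of the categories of morphisms.\<close>

locale multicat_laws =
  fixes X :: "'x set"
    and H :: "'x list \<Rightarrow> 'x \<Rightarrow> 'f set"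
    and act :: "(nat \<Rightarrow> nat) \<Rightarrow> 'x list \<Rightarrow> 'x \<Rightarrow> 'f \<Rightarrow> 'f"
    and un :: "'x \<Rightarrow> 'f"
    and gam :: "'x list list \<Rightarrow> 'x list \<Rightarrow> 'x \<Rightarrow> 'f \<Rightarrow> 'f list \<Rightarrow> 'f"
  assumes act_id:
    "as \<in> lists X \<Longrightarrow> b \<in> X \<Longrightarrow> f \<in> H as b \<Longrightarrow> act id as b f = f"
  and act_comp:
    "as \<in> lists X \<Longrightarrow> b \<in> X \<Longrightarrow> f \<in> H as b \<Longrightarrow>
     \<sigma> permutes {..<length as} \<Longrightarrow> \<tau> permutes {..<length as} \<Longrightarrow>
     act (\<sigma> \<circ> \<tau>) as b f = act \<tau> (permute_list \<sigma> as) b (act \<sigma> as b f)"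
  and unit_left:
    "as \<in> lists X \<Longrightarrow> b \<in> X \<Longrightarrow> f \<in> H as b \<Longrightarrow> gam [as] [b] b (un b) [f] = f"
  and unit_right:
    "as \<in> lists X \<Longrightarrow> b \<in> X \<Longrightarrow> f \<in> H as b \<Longrightarrow>
     gam (map (\<lambda>a. [a]) as) as b f (map un as) = f"
  and gam_assoc:
    "d \<in> X \<Longrightarrow> g \<in> H cs d \<Longrightarrow> composable X H bss cs fs \<Longrightarrow>
     length asss = length cs \<Longrightarrow> length hss = length cs \<Longrightarrow>
     (\<And>i. i < length cs \<Longrightarrow> composable X H (asss ! i) (bss ! i) (hss ! i)) \<Longrightarrow>
     gam (concat asss) (concat bss) d (gam bss cs d g fs) (concat hss) =
     gam (map concat asss) cs d g
       (map (\<lambda>i. gam (asss ! i) (bss ! i) (cs ! i) (fs ! i) (hss ! i)) [0..<length cs])"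
  and equivariance_outer:
    "c \<in> X \<Longrightarrow> g \<in> H bs c \<Longrightarrow> composable X H ass bs fs \<Longrightarrow>
     \<sigma> permutes {..<length bs} \<Longrightarrow>
     gam (permute_list \<sigma> ass) (permute_list \<sigma> bs) c (act \<sigma> bs c g) (permute_list \<sigma> fs) =
     act (block_perm \<sigma> (permute_list \<sigma> (map length ass))) (concat ass) c (gam ass bs c g fs)"
  and equivariance_inner:
    "c \<in> X \<Longrightarrow> g \<in> H bs c \<Longrightarrow> composable X H ass bs fs \<Longrightarrow>
     length \<tau>s = length bs \<Longrightarrow>
     (\<And>i. i < length bs \<Longrightarrow> (\<tau>s ! i) permutes {..<length (ass ! i)}) \<Longrightarrow>
     gam (map2 permute_list \<tau>s ass) bs c g
       (map (\<lambda>i. act (\<tau>s ! i) (ass ! i) (bs ! i) (fs ! i)) [0..<length bs]) =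
     act (block_sum \<tau>s (map length ass)) (concat ass) c (gam ass bs c g fs)"

locale multicategory =
  fixes M :: "('x, 'f, 'n, 'z) multicat_scheme"
  assumes hom_category:
    "as \<in> lists (MOb M) \<Longrightarrow> b \<in> MOb M \<Longrightarrow> category (MHom M as b)"
  and act_functor:
    "as \<in> lists (MOb M) \<Longrightarrow> b \<in> MOb M \<Longrightarrow> \<sigma> permutes {..<length as} \<Longrightarrow>
     cat_functor (MHom M as b) (MHom M (permute_list \<sigma> as) b) (act_o M \<sigma> as b) (act_a M \<sigma> as b)"
  and unit_in:
    "a \<in> MOb M \<Longrightarrow> munit M a \<in> Ob (MHom M [a] a)"
  and gam_functor:
    "ass \<in> lists (lists (MOb M)) \<Longrightarrow> bs \<in> lists (MOb M) \<Longrightarrow> c \<in> MOb M \<Longrightarrow>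
     length ass = length bs \<Longrightarrow>
     cat_functor (prod_cat (MHom M bs c # map2 (MHom M) ass bs)) (MHom M (concat ass) c)
       (\<lambda>fs. gam_o M ass bs c (hd fs) (tl fs)) (\<lambda>fs. gam_a M ass bs c (hd fs) (tl fs))"
  and laws_o:
    "multicat_laws (MOb M) (\<lambda>as b. Ob (MHom M as b)) (act_o M) (munit M) (gam_o M)"
  and laws_a:
    "multicat_laws (MOb M) (\<lambda>as b. Ar (MHom M as b)) (act_a M)
       (\<lambda>a. ide (MHom M [a] a) (munit M a)) (gam_a M)"

definition operad :: "('x, 'f, 'n, 'z) multicat_scheme \<Rightarrow> bool" where
  "operad M \<longleftrightarrow> multicategory M \<and> (\<exists>x. MOb M = {x})"

definition E_infinity_operad :: "('x, 'f, 'n, 'z) multicat_scheme \<Rightarrow> bool" where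
  "E_infinity_operad M \<longleftrightarrow> operad M \<and>
     (\<forall>x \<in> MOb M. \<forall>k. contractible_category (MHom M (replicate k x) x) \<and>
        (\<forall>\<sigma>. \<sigma> permutes {..<k} \<longrightarrow> \<sigma> \<noteq> id \<longrightarrow>
           (\<forall>f \<in> Ob (MHom M (replicate k x) x). act_o M \<sigma> (replicate k x) x f \<noteq> f) \<and>
           (\<forall>u \<in> Ar (MHom M (replicate k x) x). act_a M \<sigma> (replicate k x) x u \<noteq> u)))"

record ('x, 'f, 'n, 'y, 'g, 'p) mfun =
  F_ob :: "'x \<Rightarrow> 'y"
  F_o :: "'x list \<Rightarrow> 'x \<Rightarrow> 'f \<Rightarrow> 'g"
  F_a :: "'x list \<Rightarrow> 'x \<Rightarrow> 'n \<Rightarrow> 'p"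

locale multifunctor_laws =
  fixes X :: "'x set" and H :: "'x list \<Rightarrow> 'x \<Rightarrow> 'f set"
    and act un gam act' un' gam'
    and Fob :: "'x \<Rightarrow> 'y" and F :: "'x list \<Rightarrow> 'x \<Rightarrow> 'f \<Rightarrow> 'g"
  assumes pres_act:
    "as \<in> lists X \<Longrightarrow> b \<in> X \<Longrightarrow> f \<in> H as b \<Longrightarrow> \<sigma> permutes {..<length as} \<Longrightarrow>
     F (permute_list \<sigma> as) b (act \<sigma> as b f) = act' \<sigma> (map Fob as) (Fob b) (F as b f)"
  and pres_unit:
    "a \<in> X \<Longrightarrow> F [a] a (un a) = un' (Fob a)"
  and pres_gam:
    "c \<in> X \<Longrightarrow> g \<in> H bs c \<Longrightarrow> composable X H ass bs fs \<Longrightarrow>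
     F (concat ass) c (gam ass bs c g fs) =
     gam' (map (map Fob) ass) (map Fob bs) (Fob c) (F bs c g)
       (map (\<lambda>i. F (ass ! i) (bs ! i) (fs ! i)) [0..<length bs])"

text \<open>The values of a multifunctor outside its domain are fixed to \<open>undefined\<close>, so that equality of
  multifunctors is equality of the mathematical data.\<close>

locale multifunctor =
  fixes M :: "('x, 'f, 'n, 'z) multicat_scheme" and N :: "('y, 'g, 'p, 'w) multicat_scheme"
    and T :: "('x, 'f, 'n, 'y, 'g, 'p) mfun"
  assumes ob_in: "a \<in> MOb M \<Longrightarrow> F_ob T a \<in> MOb N"
  and hom_functor:
    "as \<in> lists (MOb M) \<Longrightarrow> b \<in> MOb M \<Longrightarrow>
     cat_functor (MHom M as b) (MHom N (map (F_ob T) as) (F_ob T b)) (F_o T as b) (F_a T as b)"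
  and laws_o:
    "multifunctor_laws (MOb M) (\<lambda>as b. Ob (MHom M as b)) (act_o M) (munit M) (gam_o M)
       (act_o N) (munit N) (gam_o N) (F_ob T) (F_o T)"
  and laws_a:
    "multifunctor_laws (MOb M) (\<lambda>as b. Ar (MHom M as b)) (act_a M)
       (\<lambda>a. ide (MHom M [a] a) (munit M a)) (gam_a M)
       (act_a N) (\<lambda>a. ide (MHom N [a] a) (munit N a)) (gam_a N) (F_ob T) (F_a T)"
  and ext_ob: "F_ob T \<in> extensional (MOb M)"
  and ext_o:
    "\<not> (as \<in> lists (MOb M) \<and> b \<in> MOb M \<and> f \<in> Ob (MHom M as b)) \<Longrightarrow> F_o T as b f = undefined"
  and ext_a:
    "\<not> (as \<in> lists (MOb M) \<and> b \<in> MOb M \<and> u \<in> Ar (MHom M as b)) \<Longrightarrow> F_a T as b u = undefined"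


section \<open>Permutative categories\<close>

locale strict_monoidal_structure = category C
  for C :: "('o, 'm, 'z) cat_scheme" +
  fixes to :: "'o \<Rightarrow> 'o \<Rightarrow> 'o" and ta :: "'m \<Rightarrow> 'm \<Rightarrow> 'm" and e :: 'o
  assumes to_in: "a \<in> Ob C \<Longrightarrow> b \<in> Ob C \<Longrightarrow> to a b \<in> Ob C"
    and ta_in: "u \<in> hom C a a' \<Longrightarrow> v \<in> hom C b b' \<Longrightarrow> ta u v \<in> hom C (to a b) (to a' b')"
    and ta_ide: "a \<in> Ob C \<Longrightarrow> b \<in> Ob C \<Longrightarrow> ta (ide C a) (ide C b) = ide C (to a b)"
    and ta_cmp: "u \<in> hom C a a' \<Longrightarrow> u' \<in> hom C a' a'' \<Longrightarrow> v \<in> hom C b b' \<Longrightarrow> v' \<in> hom C b' b'' \<Longrightarrow>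
      ta (cmp C u' u) (cmp C v' v) = cmp C (ta u' v') (ta u v)"
    and e_in: "e \<in> Ob C"
    and to_assoc: "a \<in> Ob C \<Longrightarrow> b \<in> Ob C \<Longrightarrow> c \<in> Ob C \<Longrightarrow> to (to a b) c = to a (to b c)"
    and ta_assoc: "u \<in> Ar C \<Longrightarrow> v \<in> Ar C \<Longrightarrow> w \<in> Ar C \<Longrightarrow> ta (ta u v) w = ta u (ta v w)"
    and to_unit: "a \<in> Ob C \<Longrightarrow> to e a = a" "a \<in> Ob C \<Longrightarrow> to a e = a"
    and ta_unit: "u \<in> Ar C \<Longrightarrow> ta (ide C e) u = u" "u \<in> Ar C \<Longrightarrow> ta u (ide C e) = u"

text \<open>The components of \<open>s\<close> are isomorphisms by \<open>sy_inv\<close>.\<close>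

locale permutative_structure = strict_monoidal_structure C to ta e
  for C :: "('o, 'm, 'z) cat_scheme" and to ta e +
  fixes s :: "'o \<Rightarrow> 'o \<Rightarrow> 'm"
  assumes sy_in: "a \<in> Ob C \<Longrightarrow> b \<in> Ob C \<Longrightarrow> s a b \<in> hom C (to a b) (to b a)"
    and sy_nat: "u \<in> hom C a a' \<Longrightarrow> v \<in> hom C b b' \<Longrightarrow>
      cmp C (s a' b') (ta u v) = cmp C (ta v u) (s a b)"
    and sy_unit: "a \<in> Ob C \<Longrightarrow> s a e = ide C a"
    and sy_inv: "a \<in> Ob C \<Longrightarrow> b \<in> Ob C \<Longrightarrow> cmp C (s b a) (s a b) = ide C (to a b)"
    and sy_hexagon: "a \<in> Ob C \<Longrightarrow> b \<in> Ob C \<Longrightarrow> c \<in> Ob C \<Longrightarrow>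
      s (to a b) c = cmp C (ta (s a c) (ide C b)) (ta (ide C a) (s b c))"

record ('o, 'm) permcat = "('o, 'm) cat" +
  osum :: "'o \<Rightarrow> 'o \<Rightarrow> 'o"
  asum :: "'m \<Rightarrow> 'm \<Rightarrow> 'm"
  zero :: 'o
  sym :: "'o \<Rightarrow> 'o \<Rightarrow> 'm"

locale permutative_category =
  permutative_structure A "osum A" "asum A" "zero A" "sym A"
  for A :: "('o, 'm, 'z) permcat_scheme"


section \<open>The multicategory of small permutative categories\<close>

text \<open>A \<open>k\<close>-linear map: the functor on objects and arrows of the product, and the distributivity
  maps. For variable \<open>i\<close>, the arrow \<open>m_delta f i xs x'\<close> goes from
  \<open>f(xs) \<oplus> f(xs[i := x'])\<close> to \<open>f(xs[i := xs ! i \<oplus> x'])\<close>.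
  For \<open>k = 0\<close> this is a functor on the terminal category, that is, an object.\<close>

record ('o, 'm) mlmap =
  m_ob :: "'o list \<Rightarrow> 'o"
  m_ar :: "'m list \<Rightarrow> 'm"
  m_delta :: "nat \<Rightarrow> 'o list \<Rightarrow> 'o \<Rightarrow> 'm"

definition delta_arg :: "('o, 'm) permcat list \<Rightarrow> nat \<Rightarrow> 'o list \<Rightarrow> 'o \<Rightarrow> bool" where
  "delta_arg Cs i xs x' \<longleftrightarrow> i < length Cs \<and> xs \<in> Ob (prod_cat Cs) \<and> x' \<in> Ob (Cs ! i)"

text \<open>The condition that \<open>f\<close> vanishes when some argument is \<open>0\<close> is a condition on the functor
  \<open>f\<close>, hence also on arrows: it is the identity of \<open>0\<close> if some argument is the identity of
  \<open>0\<close>. With objects only, the identity conditions on \<open>\<delta>\<close> would not be stable under composition.\<close>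

locale multilinear =
  fixes Cs :: "('o, 'm) permcat list" and D :: "('o, 'm) permcat" and f :: "('o, 'm) mlmap"
  assumes functoriality: "cat_functor (prod_cat Cs) D (m_ob f) (m_ar f)"
  and ext_ob: "m_ob f \<in> extensional (Ob (prod_cat Cs))"
  and ext_ar: "m_ar f \<in> extensional (Ar (prod_cat Cs))"
  and ext_delta: "\<not> delta_arg Cs i xs x' \<Longrightarrow> m_delta f i xs x' = undefined"
  and zero_ob:
    "xs \<in> Ob (prod_cat Cs) \<Longrightarrow> i < length Cs \<Longrightarrow> xs ! i = zero (Cs ! i) \<Longrightarrow> m_ob f xs = zero D"
  and zero_ar:
    "us \<in> Ar (prod_cat Cs) \<Longrightarrow> i < length Cs \<Longrightarrow> us ! i = ide (Cs ! i) (zero (Cs ! i)) \<Longrightarrow>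
     m_ar f us = ide D (zero D)"
  and delta_in:
    "delta_arg Cs i xs x' \<Longrightarrow>
     m_delta f i xs x' \<in> hom D (osum D (m_ob f xs) (m_ob f (xs[i := x'])))
       (m_ob f (xs[i := osum (Cs ! i) (xs ! i) x']))"
  and delta_nat:
    "us \<in> hom (prod_cat Cs) xs ys \<Longrightarrow> i < length Cs \<Longrightarrow> u' \<in> hom (Cs ! i) x' y' \<Longrightarrow>
     cmp D (m_ar f (us[i := asum (Cs ! i) (us ! i) u'])) (m_delta f i xs x') =
     cmp D (m_delta f i ys y') (asum D (m_ar f us) (m_ar f (us[i := u'])))"
  and delta_zero:
    "delta_arg Cs i xs x' \<Longrightarrow> x' = zero (Cs ! i) \<or> (\<exists>j < length Cs. xs ! j = zero (Cs ! j)) \<Longrightarrow>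
     m_delta f i xs x' = ide D (m_ob f (xs[i := osum (Cs ! i) (xs ! i) x']))"
  and delta_sym:
    "delta_arg Cs i xs x' \<Longrightarrow>
     cmp D (m_ar f ((ide (prod_cat Cs) xs)[i := sym (Cs ! i) (xs ! i) x'])) (m_delta f i xs x') =
     cmp D (m_delta f i (xs[i := x']) (xs ! i)) (sym D (m_ob f xs) (m_ob f (xs[i := x'])))"
  and delta_assoc:
    "delta_arg Cs i xs x' \<Longrightarrow> x'' \<in> Ob (Cs ! i) \<Longrightarrow>
     cmp D (m_delta f i (xs[i := osum (Cs ! i) (xs ! i) x']) x'')
       (asum D (m_delta f i xs x') (ide D (m_ob f (xs[i := x''])))) =
     cmp D (m_delta f i xs (osum (Cs ! i) x' x''))
       (asum D (ide D (m_ob f xs)) (m_delta f i (xs[i := x']) x''))"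
  and delta_delta:
    "delta_arg Cs i xs x' \<Longrightarrow> delta_arg Cs j xs y' \<Longrightarrow> i \<noteq> j \<Longrightarrow>
     cmp D (m_delta f j (xs[i := osum (Cs ! i) (xs ! i) x']) y')
       (asum D (m_delta f i xs x') (m_delta f i (xs[j := y']) x')) =
     cmp D (m_delta f i (xs[j := osum (Cs ! j) (xs ! j) y']) x')
       (cmp D (asum D (m_delta f j xs y') (m_delta f j (xs[i := x']) y'))
         (asum D (asum D (ide D (m_ob f xs)) (sym D (m_ob f (xs[i := x'])) (m_ob f (xs[j := y']))))
           (ide D (m_ob f (xs[i := x', j := y'])))))"

record ('o, 'm) mltrans =
  t_src :: "('o, 'm) mlmap"
  t_tgt :: "('o, 'm) mlmap"
  t_comp :: "'o list \<Rightarrow> 'm"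

locale multilinear_trans =
  fixes Cs :: "('o, 'm) permcat list" and D :: "('o, 'm) permcat" and \<phi> :: "('o, 'm) mltrans"
  assumes src: "multilinear Cs D (t_src \<phi>)"
  and tgt: "multilinear Cs D (t_tgt \<phi>)"
  and naturality: "nat_trans (prod_cat Cs) D (m_ob (t_src \<phi>)) (m_ar (t_src \<phi>))
    (m_ob (t_tgt \<phi>)) (m_ar (t_tgt \<phi>)) (t_comp \<phi>)"
  and ext_comp: "t_comp \<phi> \<in> extensional (Ob (prod_cat Cs))"
  and comp_delta:
    "delta_arg Cs i xs x' \<Longrightarrow>
     cmp D (t_comp \<phi> (xs[i := osum (Cs ! i) (xs ! i) x'])) (m_delta (t_src \<phi>) i xs x') =
     cmp D (m_delta (t_tgt \<phi>) i xs x') (asum D (t_comp \<phi> xs) (t_comp \<phi> (xs[i := x'])))"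

definition P_hom ::
  "('o, 'm) permcat list \<Rightarrow> ('o, 'm) permcat \<Rightarrow> (('o, 'm) mlmap, ('o, 'm) mltrans) cat" where
  "P_hom Cs D = \<lparr>Ob = {f. multilinear Cs D f}, Ar = {\<phi>. multilinear_trans Cs D \<phi>},
     cdom = t_src, ccod = t_tgt,
     ide = (\<lambda>f. \<lparr>t_src = f, t_tgt = f,
       t_comp = restrict (\<lambda>xs. ide D (m_ob f xs)) (Ob (prod_cat Cs))\<rparr>),
     cmp = (\<lambda>\<psi> \<phi>. \<lparr>t_src = t_src \<phi>, t_tgt = t_tgt \<psi>,
       t_comp = restrict (\<lambda>xs. cmp D (t_comp \<psi> xs) (t_comp \<phi> xs)) (Ob (prod_cat Cs))\<rparr>)\<rparr>"

definition restrict_mlmap ::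
  "('o, 'm) permcat list \<Rightarrow> ('o list \<Rightarrow> 'o) \<Rightarrow> ('m list \<Rightarrow> 'm) \<Rightarrow>
   (nat \<Rightarrow> 'o list \<Rightarrow> 'o \<Rightarrow> 'm) \<Rightarrow> ('o, 'm) mlmap" where
  "restrict_mlmap Cs fo fa d =
     \<lparr>m_ob = restrict fo (Ob (prod_cat Cs)), m_ar = restrict fa (Ar (prod_cat Cs)),
      m_delta = (\<lambda>i xs x'. if delta_arg Cs i xs x' then d i xs x' else undefined)\<rparr>"

text \<open>\<open>\<sigma>\<^sup>*f(permute_list \<sigma> cs) = f(cs)\<close>; variable \<open>i\<close> of \<open>\<sigma>\<^sup>*f\<close> is variable
  \<open>\<sigma> i\<close> of \<open>f\<close>.\<close>

definition P_act_o ::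
  "(nat \<Rightarrow> nat) \<Rightarrow> ('o, 'm) permcat list \<Rightarrow> ('o, 'm) permcat \<Rightarrow> ('o, 'm) mlmap \<Rightarrow> ('o, 'm) mlmap" where
  "P_act_o \<sigma> Cs D f = restrict_mlmap (permute_list \<sigma> Cs)
     (\<lambda>xs. m_ob f (permute_list (inv \<sigma>) xs)) (\<lambda>us. m_ar f (permute_list (inv \<sigma>) us))
     (\<lambda>i xs x'. m_delta f (\<sigma> i) (permute_list (inv \<sigma>) xs) x')"

definition P_act_a ::
  "(nat \<Rightarrow> nat) \<Rightarrow> ('o, 'm) permcat list \<Rightarrow> ('o, 'm) permcat \<Rightarrow> ('o, 'm) mltrans \<Rightarrow> ('o, 'm) mltrans" where
  "P_act_a \<sigma> Cs D \<phi> = \<lparr>t_src = P_act_o \<sigma> Cs D (t_src \<phi>), t_tgt = P_act_o \<sigma> Cs D (t_tgt \<phi>),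
     t_comp = restrict (\<lambda>xs. t_comp \<phi> (permute_list (inv \<sigma>) xs))
       (Ob (prod_cat (permute_list \<sigma> Cs)))\<rparr>"

definition P_unit :: "('o, 'm) permcat \<Rightarrow> ('o, 'm) mlmap" where
  "P_unit C = restrict_mlmap [C] hd hd (\<lambda>i xs x'. ide C (osum C (hd xs) x'))"

text \<open>In \<open>P_gam_o\<close>, variable \<open>i\<close> of the composite is variable \<open>r\<close> of \<open>fs ! j\<close>, and its
  distributivity map is \<open>g(\<delta>\<^sub>r) \<circ> \<delta>\<^sub>j\<close>.\<close>

definition P_gam_o ::
  "('o, 'm) permcat list list \<Rightarrow> ('o, 'm) permcat list \<Rightarrow> ('o, 'm) permcat \<Rightarrow>
   ('o, 'm) mlmap \<Rightarrow> ('o, 'm) mlmap list \<Rightarrow> ('o, 'm) mlmap" where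
  "P_gam_o Css Bs D g fs = restrict_mlmap (concat Css)
     (\<lambda>xs. m_ob g (map2 m_ob fs (unconcat (map length Css) xs)))
     (\<lambda>us. m_ar g (map2 m_ar fs (unconcat (map length Css) us)))
     (\<lambda>i xs x'. case block_pos (map length Css) i of (j, r) \<Rightarrow>
        let xss = unconcat (map length Css) xs; ys = map2 m_ob fs xss in
        cmp D (m_ar g ((ide (prod_cat Bs) ys)[j := m_delta (fs ! j) r (xss ! j) x']))
          (m_delta g j ys (m_ob (fs ! j) ((xss ! j)[r := x']))))"

definition P_gam_a ::
  "('o, 'm) permcat list list \<Rightarrow> ('o, 'm) permcat list \<Rightarrow> ('o, 'm) permcat \<Rightarrow>
   ('o, 'm) mltrans \<Rightarrow> ('o, 'm) mltrans list \<Rightarrow> ('o, 'm) mltrans" where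
  "P_gam_a Css Bs D \<psi> \<phi>s =
     \<lparr>t_src = P_gam_o Css Bs D (t_src \<psi>) (map t_src \<phi>s),
      t_tgt = P_gam_o Css Bs D (t_tgt \<psi>) (map t_tgt \<phi>s),
      t_comp = restrict (\<lambda>xs. let xss = unconcat (map length Css) xs in
          cmp D (t_comp \<psi> (map2 m_ob (map t_tgt \<phi>s) xss))
            (m_ar (t_src \<psi>) (map2 t_comp \<phi>s xss)))
        (Ob (prod_cat (concat Css)))\<rparr>"

definition Perm_multicat ::
  "(('o, 'm) permcat, ('o, 'm) mlmap, ('o, 'm) mltrans) multicat" where
  "Perm_multicat = \<lparr>MOb = {C. permutative_category C}, MHom = P_hom,
     act_o = P_act_o, act_a = P_act_a, munit = P_unit, gam_o = P_gam_o, gam_a = P_gam_a\<rparr>"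


section \<open>Associative and bipermutative structures\<close>

record ('o, 'm) tensor =
  otimes :: "'o \<Rightarrow> 'o \<Rightarrow> 'o"
  atimes :: "'m \<Rightarrow> 'm \<Rightarrow> 'm"
  tone :: 'o
  d_l :: "'o \<Rightarrow> 'o \<Rightarrow> 'o \<Rightarrow> 'm"
  d_r :: "'o \<Rightarrow> 'o \<Rightarrow> 'o \<Rightarrow> 'm"

text \<open>The data and conditions common to associative and bipermutative structures. As for
  multilinear maps, the condition on \<open>0\<close> is read as a condition on the functor \<open>\<otimes>\<close>, and the
  distributivity maps are normalized: they are identities if an argument is \<open>0\<close> or if the
  distributed factor is \<open>1\<close>. For distributivity maps that need not be invertible, this does
  not follow from the remaining conditions, and it holds for every structure coming from a
  multifunctor: the first by the identity conditions on \<open>\<delta>\<close>, the second because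
  \<open>\<Gamma>(1\<^sub>2; 1\<^sub>0, 1\<^sub>1) = 1\<^sub>1 = \<Gamma>(1\<^sub>2; 1\<^sub>1, 1\<^sub>0)\<close>.\<close>

locale distributive_structure =
  strict_monoidal_structure A "otimes S" "atimes S" "tone S"
  for A :: "('o, 'm, 'y) permcat_scheme" and S :: "('o, 'm, 'z) tensor_scheme" +
  assumes ext_otimes: "\<not> (a \<in> Ob A \<and> b \<in> Ob A) \<Longrightarrow> otimes S a b = undefined"
  and ext_atimes: "\<not> (u \<in> Ar A \<and> v \<in> Ar A) \<Longrightarrow> atimes S u v = undefined"
  and ext_d_l: "\<not> (a \<in> Ob A \<and> a' \<in> Ob A \<and> b \<in> Ob A) \<Longrightarrow> d_l S a a' b = undefined"
  and ext_d_r: "\<not> (a \<in> Ob A \<and> b \<in> Ob A \<and> b' \<in> Ob A) \<Longrightarrow> d_r S a b b' = undefined"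
  and d_l_in:
    "a \<in> Ob A \<Longrightarrow> a' \<in> Ob A \<Longrightarrow> b \<in> Ob A \<Longrightarrow>
     d_l S a a' b \<in> hom A (osum A (otimes S a b) (otimes S a' b)) (otimes S (osum A a a') b)"
  and d_r_in:
    "a \<in> Ob A \<Longrightarrow> b \<in> Ob A \<Longrightarrow> b' \<in> Ob A \<Longrightarrow>
     d_r S a b b' \<in> hom A (osum A (otimes S a b) (otimes S a b')) (otimes S a (osum A b b'))"
  and d_l_nat:
    "u \<in> hom A a c \<Longrightarrow> u' \<in> hom A a' c' \<Longrightarrow> v \<in> hom A b d \<Longrightarrow>
     cmp A (d_l S c c' d) (asum A (atimes S u v) (atimes S u' v)) =
     cmp A (atimes S (asum A u u') v) (d_l S a a' b)"
  and d_r_nat: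
    "u \<in> hom A a c \<Longrightarrow> v \<in> hom A b d \<Longrightarrow> v' \<in> hom A b' d' \<Longrightarrow>
     cmp A (d_r S c d d') (asum A (atimes S u v) (atimes S u v')) =
     cmp A (atimes S u (asum A v v')) (d_r S a b b')"
  and times_zero:
    "a \<in> Ob A \<Longrightarrow> otimes S a (zero A) = zero A"
    "a \<in> Ob A \<Longrightarrow> otimes S (zero A) a = zero A"
    "u \<in> Ar A \<Longrightarrow> atimes S u (ide A (zero A)) = ide A (zero A)"
    "u \<in> Ar A \<Longrightarrow> atimes S (ide A (zero A)) u = ide A (zero A)"
  and d_l_zero:
    "a \<in> Ob A \<Longrightarrow> a' \<in> Ob A \<Longrightarrow> b \<in> Ob A \<Longrightarrow> a = zero A \<or> a' = zero A \<or> b = zero A \<Longrightarrow>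
     d_l S a a' b = ide A (otimes S (osum A a a') b)"
  and d_r_zero:
    "a \<in> Ob A \<Longrightarrow> b \<in> Ob A \<Longrightarrow> b' \<in> Ob A \<Longrightarrow> a = zero A \<or> b = zero A \<or> b' = zero A \<Longrightarrow>
     d_r S a b b' = ide A (otimes S a (osum A b b'))"
  and d_l_one: "a \<in> Ob A \<Longrightarrow> a' \<in> Ob A \<Longrightarrow> d_l S a a' (tone S) = ide A (osum A a a')"
  and d_r_one: "b \<in> Ob A \<Longrightarrow> b' \<in> Ob A \<Longrightarrow> d_r S (tone S) b b' = ide A (osum A b b')"
  and d_l_assoc:
    "a \<in> Ob A \<Longrightarrow> a' \<in> Ob A \<Longrightarrow> a'' \<in> Ob A \<Longrightarrow> b \<in> Ob A \<Longrightarrow>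
     cmp A (d_l S (osum A a a') a'' b) (asum A (d_l S a a' b) (ide A (otimes S a'' b))) =
     cmp A (d_l S a (osum A a' a'') b) (asum A (ide A (otimes S a b)) (d_l S a' a'' b))"
  and d_r_assoc:
    "a \<in> Ob A \<Longrightarrow> b \<in> Ob A \<Longrightarrow> b' \<in> Ob A \<Longrightarrow> b'' \<in> Ob A \<Longrightarrow>
     cmp A (d_r S a (osum A b b') b'') (asum A (d_r S a b b') (ide A (otimes S a b''))) =
     cmp A (d_r S a b (osum A b' b'')) (asum A (ide A (otimes S a b)) (d_r S a b' b''))"
  and d_l_sym:
    "a \<in> Ob A \<Longrightarrow> a' \<in> Ob A \<Longrightarrow> b \<in> Ob A \<Longrightarrow>
     cmp A (atimes S (sym A a a') (ide A b)) (d_l S a a' b) =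
     cmp A (d_l S a' a b) (sym A (otimes S a b) (otimes S a' b))"
  and d_r_sym:
    "a \<in> Ob A \<Longrightarrow> b \<in> Ob A \<Longrightarrow> b' \<in> Ob A \<Longrightarrow>
     cmp A (atimes S (ide A a) (sym A b b')) (d_r S a b b') =
     cmp A (d_r S a b' b) (sym A (otimes S a b) (otimes S a b'))"
  and d_l_times:
    "a \<in> Ob A \<Longrightarrow> a' \<in> Ob A \<Longrightarrow> b \<in> Ob A \<Longrightarrow> c \<in> Ob A \<Longrightarrow>
     d_l S a a' (otimes S b c) =
     cmp A (atimes S (d_l S a a' b) (ide A c)) (d_l S (otimes S a b) (otimes S a' b) c)"
  and d_r_times:
    "a \<in> Ob A \<Longrightarrow> b \<in> Ob A \<Longrightarrow> c \<in> Ob A \<Longrightarrow> c' \<in> Ob A \<Longrightarrow>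
     d_r S (otimes S a b) c c' =
     cmp A (atimes S (ide A a) (d_r S b c c')) (d_r S a (otimes S b c) (otimes S b c'))"
  and d_l_d_r:
    "a \<in> Ob A \<Longrightarrow> a' \<in> Ob A \<Longrightarrow> b \<in> Ob A \<Longrightarrow> b' \<in> Ob A \<Longrightarrow>
     cmp A (d_l S a a' (osum A b b')) (asum A (d_r S a b b') (d_r S a' b b')) =
     cmp A (d_r S (osum A a a') b b')
       (cmp A (asum A (d_l S a a' b) (d_l S a a' b'))
         (asum A (asum A (ide A (otimes S a b)) (sym A (otimes S a b') (otimes S a' b)))
           (ide A (otimes S a' b'))))"

locale associative_structure = distributive_structure A S
  for A :: "('o, 'm) permcat" and S :: "('o, 'm) tensor" +
  assumes d_r_d_l_times:
    "a \<in> Ob A \<Longrightarrow> b \<in> Ob A \<Longrightarrow> b' \<in> Ob A \<Longrightarrow> c \<in> Ob A \<Longrightarrow>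
     cmp A (atimes S (d_r S a b b') (ide A c)) (d_l S (otimes S a b) (otimes S a b') c) =
     cmp A (atimes S (ide A a) (d_l S b b' c)) (d_r S a (otimes S b c) (otimes S b' c))"

record ('o, 'm) sym_tensor = "('o, 'm) tensor" +
  tsym :: "'o \<Rightarrow> 'o \<Rightarrow> 'm"

locale bipermutative_structure =
  distributive_structure A S + permutative_structure A "otimes S" "atimes S" "tone S" "tsym S"
  for A :: "('o, 'm) permcat" and S :: "('o, 'm) sym_tensor" +
  assumes ext_tsym: "\<not> (a \<in> Ob A \<and> b \<in> Ob A) \<Longrightarrow> tsym S a b = undefined"
  and tsym_d_l:
    "a \<in> Ob A \<Longrightarrow> a' \<in> Ob A \<Longrightarrow> b \<in> Ob A \<Longrightarrow>
     cmp A (tsym S (osum A a a') b) (d_l S a a' b) =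
     cmp A (d_r S b a a') (asum A (tsym S a b) (tsym S a' b))"


section \<open>The operads\<close>

definition Sym :: "nat \<Rightarrow> (nat \<Rightarrow> nat) set" where
  "Sym k = {\<sigma>. \<sigma> permutes {..<k}}"

definition Sym_gam :: "unit list list \<Rightarrow> (nat \<Rightarrow> nat) \<Rightarrow> (nat \<Rightarrow> nat) list \<Rightarrow> nat \<Rightarrow> nat" where
  "Sym_gam ass \<sigma> \<phi>s = block_perm \<sigma> (map length ass) \<circ> block_sum \<phi>s (map length ass)"

definition Sigma_operad :: "(unit, nat \<Rightarrow> nat, nat \<Rightarrow> nat) multicat" where
  "Sigma_operad = \<lparr>MOb = {()}, MHom = (\<lambda>as b. discrete_cat (Sym (length as))),
     act_o = (\<lambda>\<sigma> as b f. f \<circ> \<sigma>), act_a = (\<lambda>\<sigma> as b f. f \<circ> \<sigma>), munit = (\<lambda>a. id),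
     gam_o = (\<lambda>ass bs c g fs. Sym_gam ass g fs), gam_a = (\<lambda>ass bs c g fs. Sym_gam ass g fs)\<rparr>"

definition ESigma_operad :: "(unit, nat \<Rightarrow> nat, (nat \<Rightarrow> nat) \<times> (nat \<Rightarrow> nat)) multicat" where
  "ESigma_operad = \<lparr>MOb = {()}, MHom = (\<lambda>as b. indiscrete_cat (Sym (length as))),
     act_o = (\<lambda>\<sigma> as b f. f \<circ> \<sigma>), act_a = (\<lambda>\<sigma> as b u. (fst u \<circ> \<sigma>, snd u \<circ> \<sigma>)),
     munit = (\<lambda>a. id),
     gam_o = (\<lambda>ass bs c g fs. Sym_gam ass g fs),
     gam_a = (\<lambda>ass bs c v us. (Sym_gam ass (fst v) (map fst us), Sym_gam ass (snd v) (map snd us)))\<rparr>"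


section \<open>The structure determined by a multifunctor\<close>

definition associative_of ::
  "(unit, nat \<Rightarrow> nat, 'n, ('o, 'm) permcat, ('o, 'm) mlmap, ('o, 'm) mltrans) mfun \<Rightarrow> ('o, 'm) tensor" where
  "associative_of T = (let f = F_o T [(), ()] () id in
     \<lparr>otimes = (\<lambda>a b. m_ob f [a, b]), atimes = (\<lambda>u v. m_ar f [u, v]),
      tone = m_ob (F_o T [] () id) [],
      d_l = (\<lambda>a a' b. m_delta f 0 [a, b] a'), d_r = (\<lambda>a b b'. m_delta f 1 [a, b] b')\<rparr>)"

definition bipermutative_of ::
  "(unit, nat \<Rightarrow> nat, (nat \<Rightarrow> nat) \<times> (nat \<Rightarrow> nat),
    ('o, 'm) permcat, ('o, 'm) mlmap, ('o, 'm) mltrans) mfun \<Rightarrow> ('o, 'm) sym_tensor" where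
  "bipermutative_of T = tensor.extend (associative_of T)
     \<lparr>tsym = (\<lambda>a b. t_comp (F_a T [(), ()] () (id, Transposition.transpose 0 1)) [a, b])\<rparr>"

end

theory Submission
  imports Defs
begin

text \<open>The objects of \<open>\<Sigma>\<^sub>*\<close> are generated by \<open>1\<^sub>2\<close> and \<open>1\<^sub>0\<close>: every permutation is a translate
  \<open>\<sigma>\<^sup>*1\<^sub>k\<close>, and \<open>1\<^bsub>k+1\<^esub> = \<Gamma>(1\<^sub>2; 1\<^sub>1, 1\<^sub>k)\<close>. Hence a multifunctor out of \<open>\<Sigma>\<^sub>*\<close> is determined by a
  2-linear map \<open>\<otimes>\<close> and an object \<open>1\<close> (\<open>operad_action_eqI\<close>), and the equations
  \<open>\<Gamma>(1\<^sub>2; 1\<^sub>2, 1\<^sub>1) = 1\<^sub>3 = \<Gamma>(1\<^sub>2; 1\<^sub>1, 1\<^sub>2)\<close> and \<open>\<Gamma>(1\<^sub>2; 1\<^sub>0, 1\<^sub>1) = 1\<^sub>1 = \<Gamma>(1\<^sub>2; 1\<^sub>1, 1\<^sub>0)\<close>, read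
  off on objects, on arrows and on distributivity maps, are the axioms of an associative structure
  that go beyond the 2-linearity of \<open>\<otimes>\<close> (\<open>distributive_structure_two\<close>).

  Conversely, an associative structure gives a \<open>k\<close>-linear map for every \<open>k\<close>, the \<open>k\<close>-fold tensor
  product. Its distributivity map in the factor \<open>x\<close> of \<open>L \<otimes> x \<otimes> R\<close> is
  \<open>(d_r \<otimes> 1\<^sub>R) d_l(L \<otimes> x, L \<otimes> x'; R)\<close>, where \<open>L\<close> and \<open>R\<close> are the products of the remaining
  factors. The conditions on \<open>d_l\<close> and \<open>d_r\<close> at products say that such maps compose as \<open>\<Gamma>\<close> requires
  (\<open>delta_nested\<close>), so that the tensor products and their translates form a multifunctor
  (\<open>perm_tensor_gam\<close>). The condition on distributivity in two different variables is reduced to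
  the axiom for two factors (\<open>delta_interchange\<close>).

  For \<open>E\<Sigma>\<^sub>*\<close>, the arrow from \<open>1\<^sub>2\<close> to the transposition is mapped to the symmetry \<open>\<gamma>\<^sup>\<otimes>\<close>. Every arrow
  of \<open>E\<Sigma>\<^sub>k\<close> is a composite of translates of exchanges of two neighbours, which are
  obtained from this one by \<open>\<Gamma>\<close> (\<open>symmetric_action_eqI\<close>), so that \<open>\<gamma>\<^sup>\<otimes>\<close> determines the multifunctor.
  As there is only one arrow between two objects of \<open>E\<Sigma>\<^sub>k\<close>, the existence of the multifunctor is a
  coherence theorem. It is proved by an explicit choice of canonical arrows between
  rearrangements of a tensor product with labelled factors: they bring the factors to their places
  one after the other, and they are unchanged by an exchange of neighbours in the source
  (\<open>coh_swap\<close>). Therefore every statement about them, in particular their compatibility with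
  \<open>\<Gamma>\<close>, with translation and with the distributivity maps, can be proved for one exchange of
  neighbours (\<open>coh_induct\<close>). There the relation between \<open>\<gamma>\<^sup>\<otimes>\<close>, \<open>d_l\<close> and \<open>d_r\<close> is used; it also
  implies the mixed condition on \<open>d_l\<close> and \<open>d_r\<close> of an associative structure.

  The operad identities for \<open>\<Sigma>\<^sub>*\<close>, and the behaviour of rearranged products under \<open>\<Gamma>\<close>, follow
  from one description of the multiproduct: on a list of lists it rearranges each list and then
  the list of lists (\<open>place_Sym_gam\<close>).\<close>

section \<open>Permutations acting on lists\<close>

text \<open>The action by \<open>permute_list\<close> is from the right. The left action is the one that turns the
  composition of permutations, and the multiproduct, into successive rearrangements.\<close>

abbreviation (input) place :: "(nat \<Rightarrow> nat) \<Rightarrow> 'a list \<Rightarrow> 'a list" where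
  "place \<sigma> xs \<equiv> permute_list (inv \<sigma>) xs"

lemma permutes_less: "\<sigma> permutes {..<n} \<Longrightarrow> i < n \<Longrightarrow> \<sigma> i < n"
  using permutes_in_image[of \<sigma> "{..<n}" i] by simp

lemma nth_permute_list:
  "i < length xs \<Longrightarrow> permute_list f xs ! i = xs ! f i"
  by (simp add: permute_list_def)

lemma place_nth:
  assumes "\<sigma> permutes {..<length xs}" "i < length xs"
  shows "place \<sigma> xs ! \<sigma> i = xs ! i"
  using assms by (simp add: nth_permute_list permutes_less permutes_inverses)

lemma place_eqI:
  assumes \<rho>: "\<rho> permutes {..<length ys}" and len: "length zs = length ys"
    and nth: "\<And>i. i < length ys \<Longrightarrow> zs ! \<rho> i = ys ! i"
  shows "place \<rho> ys = zs"
proof (rule nth_equalityI)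
  show "length (place \<rho> ys) = length zs" by (simp add: len)
  fix i assume "i < length (place \<rho> ys)"
  then have i: "i < length ys" by simp
  then have "inv \<rho> i < length ys" by (rule permutes_less[OF permutes_inv[OF \<rho>]])
  from nth[OF this] show "place \<rho> ys ! i = zs ! i"
    using i by (simp add: nth_permute_list permutes_inverses[OF \<rho>])
qed

lemma place_upt_inject:
  assumes "\<rho> permutes {..<n}" "\<rho>' permutes {..<n}"
    and eq: "place \<rho> [0..<n] = place \<rho>' [0..<n]"
  shows "\<rho> = \<rho>'"
proof -
  have "inv \<rho> i = inv \<rho>' i" for i
  proof (cases "i < n")
    case True
    then have "place \<rho> [0..<n] ! i = inv \<rho> i" "place \<rho>' [0..<n] ! i = inv \<rho>' i"
      using permutes_less[OF permutes_inv[OF assms(1)] True]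
        permutes_less[OF permutes_inv[OF assms(2)] True] by (auto simp: nth_permute_list)
    with eq show ?thesis by simp
  next
    case False
    then show ?thesis
      using permutes_not_in[OF permutes_inv[OF assms(1)]]
        permutes_not_in[OF permutes_inv[OF assms(2)]] by simp
  qed
  then have "inv \<rho> = inv \<rho>'" ..
  then show ?thesis
    by (metis assms(1,2) permutes_inv_inv)
qed

lemma place_compose:
  assumes "\<sigma> permutes {..<length xs}" "\<tau> permutes {..<length xs}"
  shows "place (\<sigma> \<circ> \<tau>) xs = place \<sigma> (place \<tau> xs)"
proof (rule place_eqI)
  show "\<sigma> \<circ> \<tau> permutes {..<length xs}" using assms by (intro permutes_compose)
next
  fix i assume "i < length xs"
  then show "place \<sigma> (place \<tau> xs) ! (\<sigma> \<circ> \<tau>) i = xs ! i"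
    using assms place_nth[of \<sigma> "place \<tau> xs" "\<tau> i"] place_nth[of \<tau> xs i]
    by (simp add: permutes_less)
qed simp

lemma permute_list_place:
  assumes "\<sigma> permutes {..<length xs}"
  shows "permute_list \<sigma> (place \<sigma> xs) = xs" "place \<sigma> (permute_list \<sigma> xs) = xs"
  using assms by (auto intro!: nth_equalityI simp: nth_permute_list permutes_less permutes_inv permutes_inverses)

lemma map_place: "\<sigma> permutes {..<length xs} \<Longrightarrow> map f (place \<sigma> xs) = place \<sigma> (map f xs)"
  by (simp add: permute_list_map permutes_inv)

lemma place_list_update:
  assumes "\<sigma> permutes {..<length xs}" "i < length xs"
  shows "place \<sigma> (xs[i := y]) = (place \<sigma> xs)[\<sigma> i := y]"
proof (rule place_eqI)
  fix l assume "l < length (xs[i := y])"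
  then show "(place \<sigma> xs)[\<sigma> i := y] ! \<sigma> l = xs[i := y] ! l"
    using assms by (cases "l = i") (auto simp: permutes_less place_nth nth_list_update
        dest: injD[OF permutes_inj[OF assms(1)]])
qed (use assms in simp_all)

lemma permute_list_replicate [simp]:
  "\<sigma> permutes {..<n} \<Longrightarrow> permute_list \<sigma> (replicate n x) = replicate n x"
  by (auto intro!: nth_equalityI simp: nth_permute_list permutes_less)

lemma block_start_Cons: "block_start (j # js) (Suc i) = j + block_start js i"
  and block_start_0 [simp]: "block_start js 0 = 0"
  by (simp_all add: block_start_def)

lemma block_pos_start:
  "i < length js \<Longrightarrow> r < js ! i \<Longrightarrow> block_pos js (block_start js i + r) = (i, r)"
proof (induction js arbitrary: i)
  case (Cons j js)
  then show ?case by (cases i) (auto simp: block_start_Cons)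
qed simp

lemma block_start_less:
  "i < length js \<Longrightarrow> r < js ! i \<Longrightarrow> block_start js i + r < sum_list js"
proof (induction js arbitrary: i)
  case (Cons j js)
  then show ?case by (cases i) (auto simp: block_start_Cons)
qed simp

lemma block_cases:
  assumes "n < sum_list js"
  obtains i r where "i < length js" "r < js ! i" "n = block_start js i + r"
proof -
  have "\<exists>i r. i < length js \<and> r < js ! i \<and> n = block_start js i + r"
    using assms
  proof (induction js arbitrary: n)
    case (Cons j js)
    show ?case
    proof (cases "n < j")
      case True then show ?thesis by (intro exI[of _ 0] exI[of _ n]) simp
    next
      case False
      with Cons.prems have "n - j < sum_list js" by simp
      from Cons.IH[OF this] obtain i r
        where "i < length js" "r < js ! i" "n - j = block_start js i + r" by blast
      with False show ?thesis by (intro exI[of _ "Suc i"] exI[of _ r]) (simp add: block_start_Cons)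
    qed
  qed simp
  with that show thesis by blast
qed

lemma length_concat_take: "length (concat (take i xss)) = block_start (map length xss) i"
  by (simp add: block_start_def length_concat take_map)

lemma
  assumes "i < length xss" "r < length (xss ! i)"
  shows concat_nth_block: "concat xss ! (block_start (map length xss) i + r) = xss ! i ! r"
    and concat_take_block: "take (block_start (map length xss) i + r) (concat xss) =
      concat (take i xss) @ take r (xss ! i)"
    and concat_drop_block: "drop (Suc (block_start (map length xss) i + r)) (concat xss) =
      drop (Suc r) (xss ! i) @ concat (drop (Suc i) xss)"
proof -
  have eq: "concat xss = concat (take i xss) @ xss ! i @ concat (drop (Suc i) xss)"
    using assms(1) by (metis concat.simps(2) concat_append id_take_nth_drop)
  have len: "length (concat (take i xss)) = block_start (map length xss) i"
    by (rule length_concat_take)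
  show "concat xss ! (block_start (map length xss) i + r) = xss ! i ! r"
    using assms by (subst eq) (simp add: nth_append flip: len)
  show "take (block_start (map length xss) i + r) (concat xss) = concat (take i xss) @ take r (xss ! i)"
    using assms by (subst eq) (simp flip: len)
  show "drop (Suc (block_start (map length xss) i + r)) (concat xss) =
      drop (Suc r) (xss ! i) @ concat (drop (Suc i) xss)"
    using assms by (subst eq) (simp add: Suc_diff_le flip: len)
qed

lemma length_unconcat [simp]: "length (unconcat js xs) = length js"
  by (induction js arbitrary: xs) simp_all

lemma unconcat_concat: "unconcat (map length xss) (concat xss) = xss"
  by (induction xss) simp_all

lemma concat_unconcat: "length xs = sum_list js \<Longrightarrow> concat (unconcat js xs) = xs"
  by (induction js arbitrary: xs) simp_all

lemma map_length_unconcat: "length xs = sum_list js \<Longrightarrow> map length (unconcat js xs) = js"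
  by (induction js arbitrary: xs) simp_all

lemma block_list_cases:
  assumes "length xs = sum_list js"
  obtains xss where "xs = concat xss" "map length xss = js"
  using concat_unconcat[OF assms] map_length_unconcat[OF assms] by metis

text \<open>The permutations of the operad are given by formulas on blocks. That such a map is bijective
  follows from its effect on a list of distinct entries, which avoids a formula for the inverse.\<close>

lemma permutesI_place:
  assumes bound: "\<And>n. n < N \<Longrightarrow> \<rho> n < N" and id: "\<And>n. \<not> n < N \<Longrightarrow> \<rho> n = n"
    and nth: "\<And>n. n < N \<Longrightarrow> zs ! \<rho> n = n"
  shows "\<rho> permutes {..<N}"
proof -
  have inj: "inj_on \<rho> {..<N}"
    by (rule inj_onI) (metis lessThan_iff nth)
  have "\<rho> ` {..<N} = {..<N}"
    by (rule endo_inj_surj) (use bound inj in auto)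
  with inj have "bij_betw \<rho> {..<N} {..<N}" by (simp add: bij_betw_def)
  then show ?thesis by (rule bij_imp_permutes) (use id in auto)
qed

lemma block_perm_value:
  assumes "i < length js" "r < js ! i"
  shows "block_perm \<sigma> js (block_start js i + r) = block_start (permute_list (inv \<sigma>) js) (\<sigma> i) + r"
  using assms by (simp add: block_perm_def block_start_less block_pos_start)

lemma block_sum_value:
  assumes "i < length js" "r < js ! i"
  shows "block_sum \<phi>s js (block_start js i + r) = block_start js i + (\<phi>s ! i) r"
  using assms by (simp add: block_sum_def block_start_less block_pos_start)

lemma concat_place_nth:
  assumes \<sigma>: "\<sigma> permutes {..<length xss}" and i: "i < length xss" and r: "r < length (xss ! i)"
  defines "m \<equiv> block_start (place \<sigma> (map length xss)) (\<sigma> i) + r"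
  shows "concat (place \<sigma> xss) ! m = xss ! i ! r" "m < length (concat xss)"
proof -
  have m: "m = block_start (map length (place \<sigma> xss)) (\<sigma> i) + r"
    using \<sigma> by (simp add: m_def map_place)
  have \<sigma>i: "\<sigma> i < length (place \<sigma> xss)" using permutes_less[OF \<sigma> i] by simp
  have nth: "place \<sigma> xss ! \<sigma> i = xss ! i" by (rule place_nth[OF \<sigma> i])
  show "concat (place \<sigma> xss) ! m = xss ! i ! r"
    unfolding m using concat_nth_block[OF \<sigma>i] nth r by simp
  have "m < sum_list (place \<sigma> (map length xss))"
    unfolding m_def using \<sigma> \<sigma>i r nth by (intro block_start_less) (simp_all flip: map_place)
  also have "\<dots> = sum_list (map length xss)"
    using \<sigma> by (simp only: sum_mset_sum_list[symmetric] mset_permute_list permutes_inv length_map)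
  finally show "m < length (concat xss)" by (simp add: length_concat)
qed

lemma block_perm_permutes:
  assumes "\<sigma> permutes {..<length js}"
  shows "block_perm \<sigma> js permutes {..<sum_list js}"
proof -
  obtain xss where xs: "[0..<sum_list js] = concat xss" and js: "map length xss = js"
    by (rule block_list_cases[of "[0..<sum_list js]" js]) simp_all
  have lenxs: "length xss = length js" using js by (metis length_map)
  have len: "length (concat xss) = sum_list js" using js by (simp add: length_concat)
  have *: "block_perm \<sigma> js n < sum_list js \<and> concat (place \<sigma> xss) ! block_perm \<sigma> js n = n"
    if n: "n < sum_list js" for n
    using n
  proof (cases rule: block_cases)
    case (1 i r)
    have \<sigma>: "\<sigma> permutes {..<length xss}" using assms lenxs by simp
    have i: "i < length xss" using 1(1) lenxs by simp
    have r: "r < length (xss ! i)" using 1(2) nth_map[OF i, of length] unfolding js by simp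
    have "concat xss ! n = n" using n by (simp flip: xs)
    have "block_perm \<sigma> js n = block_start (place \<sigma> (map length xss)) (\<sigma> i) + r"
      unfolding 1(3) js by (rule block_perm_value[OF 1(1,2)])
    moreover have "xss ! i ! r = n"
      using concat_nth_block[OF i r] \<open>concat xss ! n = n\<close> unfolding js 1(3)[symmetric] by (rule trans[OF sym])
    ultimately show ?thesis
      using concat_place_nth[OF \<sigma> i r] len by metis
  qed
  show ?thesis
    by (rule permutesI_place[where zs = "concat (place \<sigma> xss)"])
       (use * in \<open>simp_all add: block_perm_def\<close>)
qed

lemma place_block_perm:
  assumes \<sigma>: "\<sigma> permutes {..<length xss}"
  shows "place (block_perm \<sigma> (map length xss)) (concat xss) = concat (place \<sigma> xss)"
proof (rule place_eqI)
  show "block_perm \<sigma> (map length xss) permutes {..<length (concat xss)}"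
    using block_perm_permutes[of \<sigma> "map length xss"] \<sigma> by (simp add: length_concat)
  show "length (concat (place \<sigma> xss)) = length (concat xss)"
    using \<sigma> by (simp only: length_concat map_place length_map sum_mset_sum_list[symmetric]
        mset_permute_list permutes_inv)
  fix n assume "n < length (concat xss)"
  then have "n < sum_list (map length xss)" by (simp add: length_concat)
  then show "concat (place \<sigma> xss) ! block_perm \<sigma> (map length xss) n = concat xss ! n"
  proof (cases rule: block_cases)
    case (1 i r)
    then show ?thesis
      using concat_place_nth[OF \<sigma>, of i r] concat_nth_block[of i xss r] block_perm_value[OF 1(1,2), of \<sigma>]
      by simp
  qed
qed

lemma concat_map2_place_nth:
  assumes "length \<phi>s = length xss" "i < length xss" "(\<phi>s ! i) permutes {..<length (xss ! i)}"
    "r < length (xss ! i)" "map length xss = js"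
    and "\<And>i. i < length xss \<Longrightarrow> (\<phi>s ! i) permutes {..<length (xss ! i)}"
  shows "concat (map2 (\<lambda>\<phi>. place \<phi>) \<phi>s xss) ! (block_start js i + (\<phi>s ! i) r) = xss ! i ! r"
    "block_start js i + (\<phi>s ! i) r < length (concat xss)"
proof -
  have js: "map length (map2 (\<lambda>\<phi>. place \<phi>) \<phi>s xss) = js"
    using assms by (auto intro!: nth_equalityI)
  have r: "(\<phi>s ! i) r < length (xss ! i)" using assms permutes_less by blast
  show "concat (map2 (\<lambda>\<phi>. place \<phi>) \<phi>s xss) ! (block_start js i + (\<phi>s ! i) r) = xss ! i ! r"
    using concat_nth_block[of i "map2 (\<lambda>\<phi>. place \<phi>) \<phi>s xss" "(\<phi>s ! i) r"] assms js r
    by (simp add: place_nth)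
  show "block_start js i + (\<phi>s ! i) r < length (concat xss)"
    using block_start_less[of i js "(\<phi>s ! i) r"] assms r by (auto simp: length_concat)
qed

lemma block_sum_permutes:
  assumes l: "length \<phi>s = length js" and \<phi>: "\<And>i. i < length js \<Longrightarrow> (\<phi>s ! i) permutes {..<js ! i}"
  shows "block_sum \<phi>s js permutes {..<sum_list js}"
proof -
  obtain xss where xs: "[0..<sum_list js] = concat xss" and js: "map length xss = js"
    by (rule block_list_cases[of "[0..<sum_list js]" js]) simp_all
  have lenxs: "length xss = length js" using js by (metis length_map)
  have len: "length (concat xss) = sum_list js" using js by (simp add: length_concat)
  have *: "block_sum \<phi>s js n < sum_list js \<and>
      concat (map2 (\<lambda>\<phi>. place \<phi>) \<phi>s xss) ! block_sum \<phi>s js n = n"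
    if n: "n < sum_list js" for n
    using n
  proof (cases rule: block_cases)
    case (1 i r)
    have i: "i < length xss" using 1(1) lenxs by simp
    have r: "r < length (xss ! i)" using 1(2) nth_map[OF i, of length] unfolding js by simp
    have \<phi>': "(\<phi>s ! i) permutes {..<length (xss ! i)}" if "i < length xss" for i
      using \<phi>[of i] that nth_map[OF that, of length] lenxs unfolding js by simp
    have "concat xss ! n = n" using n by (simp flip: xs)
    have "block_sum \<phi>s js n = block_start js i + (\<phi>s ! i) r"
      unfolding 1(3) by (rule block_sum_value[OF 1(1,2)])
    moreover have "xss ! i ! r = n"
      using concat_nth_block[OF i r] \<open>concat xss ! n = n\<close> unfolding js 1(3)[symmetric] by (rule trans[OF sym])
    ultimately show ?thesis
      using concat_map2_place_nth[OF _ i \<phi>'[OF i] r js \<phi>'] len l lenxs by metis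
  qed
  show ?thesis
    by (rule permutesI_place[where zs = "concat (map2 (\<lambda>\<phi>. place \<phi>) \<phi>s xss)"])
       (use * in \<open>simp_all add: block_sum_def\<close>)
qed

lemma place_block_sum:
  assumes l: "length \<phi>s = length xss"
    and \<phi>: "\<And>i. i < length xss \<Longrightarrow> (\<phi>s ! i) permutes {..<length (xss ! i)}"
  shows "place (block_sum \<phi>s (map length xss)) (concat xss) = concat (map2 (\<lambda>\<phi>. place \<phi>) \<phi>s xss)"
proof (rule place_eqI)
  show "block_sum \<phi>s (map length xss) permutes {..<length (concat xss)}"
    using block_sum_permutes[of \<phi>s "map length xss"] assms by (simp add: length_concat)
  have "map length (map2 (\<lambda>\<phi>. place \<phi>) \<phi>s xss) = map length xss"
    using l by (auto intro!: nth_equalityI)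
  then show "length (concat (map2 (\<lambda>\<phi>. place \<phi>) \<phi>s xss)) = length (concat xss)"
    by (simp only: length_concat)
  fix n assume "n < length (concat xss)"
  then have "n < sum_list (map length xss)" by (simp add: length_concat)
  then show "concat (map2 (\<lambda>\<phi>. place \<phi>) \<phi>s xss) ! block_sum \<phi>s (map length xss) n = concat xss ! n"
  proof (cases rule: block_cases)
    case (1 i r)
    then show ?thesis
      using concat_map2_place_nth[OF l, of i r "map length xss"] \<phi> concat_nth_block[of i xss r]
        block_sum_value[OF 1(1,2), of \<phi>s]
      by simp
  qed
qed

subsection \<open>The product of the operad of permutations\<close>

lemma Sym_iff: "\<sigma> \<in> Sym k \<longleftrightarrow> \<sigma> permutes {..<k}"
  by (simp add: Sym_def)

lemma Sym_gam_value:
  assumes "length ass = length fs" "i < length ass" "r < length (ass ! i)"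
    "(fs ! i) permutes {..<length (ass ! i)}"
  shows "Sym_gam ass g fs (block_start (map length ass) i + r) =
    block_start (place g (map length ass)) (g i) + (fs ! i) r"
  using assms block_sum_value[of i "map length ass" r fs]
    block_perm_value[of i "map length ass" "(fs ! i) r" g] permutes_less[OF assms(4,3)]
  by (simp add: Sym_gam_def)

lemma Sym_gam_permutes:
  assumes "g permutes {..<length ass}" "length fs = length ass"
    "\<And>i. i < length ass \<Longrightarrow> (fs ! i) permutes {..<length (ass ! i)}"
  shows "Sym_gam ass g fs permutes {..<length (concat ass)}"
  unfolding Sym_gam_def length_concat
  by (rule permutes_compose[OF block_sum_permutes block_perm_permutes]) (use assms in auto)

text \<open>As \<open>Sym_gam\<close> is determined by its action on lists, this property replaces the explicit
  formula: the operad identities become identities between rearrangements of nested lists, in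
  which \<open>concat\<close> and the actions of permutations commute.\<close>

lemma place_Sym_gam:
  assumes g: "g permutes {..<length ass}" and l: "length fs = length ass"
    and fs: "\<And>i. i < length ass \<Longrightarrow> (fs ! i) permutes {..<length (ass ! i)}"
    and len: "map length xss = map length ass"
  shows "place (Sym_gam ass g fs) (concat xss) = concat (place g (map2 (\<lambda>\<phi>. place \<phi>) fs xss))"
proof -
  have lx: "length xss = length ass" using len by (metis length_map)
  have lxi: "length (xss ! i) = length (ass ! i)" if "i < length ass" for i
    using len that lx by (metis nth_map)
  have len': "map length (map2 (\<lambda>\<phi>. place \<phi>) fs xss) = map length ass"
    using l lx lxi by (auto intro!: nth_equalityI)
  have s: "length (concat xss) = sum_list (map length ass)" by (simp add: length_concat len)
  have "place (Sym_gam ass g fs) (concat xss) =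
      place (block_perm g (map length ass)) (place (block_sum fs (map length ass)) (concat xss))"
    unfolding Sym_gam_def
    by (rule place_compose) (use block_perm_permutes[of g "map length ass"]
      block_sum_permutes[of fs "map length ass"] g l fs s in auto)
  also have "place (block_sum fs (map length ass)) (concat xss) = concat (map2 (\<lambda>\<phi>. place \<phi>) fs xss)"
    using place_block_sum[of fs xss] l lx fs lxi len by simp
  also have "place (block_perm g (map length ass)) \<dots> = concat (place g (map2 (\<lambda>\<phi>. place \<phi>) fs xss))"
    using place_block_perm[of g "map2 (\<lambda>\<phi>. place \<phi>) fs xss"] g len' l lx by simp
  finally show ?thesis .
qed

lemma map2_concat:
  "map length xss = map length yss \<Longrightarrow>
   map2 f (concat xss) (concat yss) = concat (map2 (map2 f) xss yss)"
proof (induction xss arbitrary: yss)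
  case (Cons xs xss)
  then obtain ys yss' where "yss = ys # yss'" by (cases yss) auto
  with Cons show ?case by simp
qed simp

lemma concat_map_concat: "concat (map concat xsss) = concat (concat xsss)"
  by (induction xsss) simp_all

text \<open>It is enough to compare the actions on one list of distinct entries. Grouping the entries in
  blocks is no restriction and brings the list into the form to which \<open>place_Sym_gam\<close> applies.\<close>

lemma Sym_gam_eqI:
  assumes "\<rho> permutes {..<sum_list js}" "\<rho>' permutes {..<sum_list js}"
    and "\<And>xss :: nat list list. map length xss = js \<Longrightarrow> place \<rho> (concat xss) = place \<rho>' (concat xss)"
  shows "\<rho> = \<rho>'"
proof -
  obtain xss where "[0..<sum_list js] = concat xss" "map length xss = js"
    by (rule block_list_cases[of "[0..<sum_list js]" js]) simp_all
  with assms show ?thesis by (metis place_upt_inject)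
qed

lemma composable_Sym:
  "composable X (\<lambda>as b. Sym (length as)) ass bs fs \<Longrightarrow>
     length fs = length ass \<and> length bs = length ass \<and>
     (\<forall>i < length ass. (fs ! i) permutes {..<length (ass ! i)})"
  by (auto simp: composable_def Sym_iff)

abbreviation (input) place_each :: "(nat \<Rightarrow> nat) list \<Rightarrow> 'a list list \<Rightarrow> 'a list list" where
  "place_each \<phi>s xss \<equiv> map2 (\<lambda>\<phi>. place \<phi>) \<phi>s xss"

lemma map_length_place_each: "length \<phi>s = length xss \<Longrightarrow> map length (place_each \<phi>s xss) = map length xss"
  by (auto intro!: nth_equalityI)

lemma Sym_gam_assoc:
  fixes asss :: "unit list list list"
  assumes g: "g permutes {..<length bss}" and fs: "length fs = length bss"
    "\<And>i. i < length bss \<Longrightarrow> (fs ! i) permutes {..<length (bss ! i)}"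
    and lens: "length asss = length bss" "length hss = length bss"
    "\<And>i. i < length bss \<Longrightarrow> length (asss ! i) = length (bss ! i) \<and> length (hss ! i) = length (bss ! i)"
    and hs: "\<And>i l. i < length bss \<Longrightarrow> l < length (bss ! i) \<Longrightarrow>
      (hss ! i ! l) permutes {..<length (asss ! i ! l)}"
  shows "Sym_gam (concat asss) (Sym_gam bss g fs) (concat hss) =
    Sym_gam (map concat asss) g (map (\<lambda>i. Sym_gam (asss ! i) (fs ! i) (hss ! i)) [0..<length bss])"
    (is "?L = Sym_gam _ _ ?inner")
proof (rule Sym_gam_eqI)
  have ml: "map length asss = map length bss" "map length hss = map length bss"
    using lens by (auto intro!: nth_equalityI)
  have lc: "length (concat asss) = length (concat bss)" "length (concat hss) = length (concat bss)"
    using ml by (simp_all add: length_concat)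
  have \<rho>: "Sym_gam bss g fs permutes {..<length (concat asss)}"
    unfolding lc by (rule Sym_gam_permutes[OF g fs])
  have hs': "(concat hss ! n) permutes {..<length (concat asss ! n)}" if n: "n < length (concat asss)" for n
  proof -
    have "n < sum_list (map length asss)" using n by (simp add: length_concat)
    then show ?thesis
    proof (cases rule: block_cases)
      case (1 i r)
      then show ?thesis
        using concat_nth_block[of i asss r] concat_nth_block[of i hss r] lens hs[of i r] ml by simp
    qed
  qed
  have inner: "(?inner ! i) permutes {..<length (map concat asss ! i)}" if "i < length bss" for i
    using that Sym_gam_permutes[of "fs ! i" "asss ! i" "hss ! i"] fs lens hs by simp
  show "?L permutes {..<sum_list (map length (concat asss))}"
    unfolding length_concat[symmetric] by (rule Sym_gam_permutes) (use \<rho> lc hs' in auto)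
  have "Sym_gam (map concat asss) g ?inner permutes {..<length (concat (map concat asss))}"
    by (rule Sym_gam_permutes) (use g inner lens in auto)
  then show "Sym_gam (map concat asss) g ?inner permutes {..<sum_list (map length (concat asss))}"
    unfolding length_concat[symmetric] concat_map_concat .
  fix xss :: "nat list list" assume xss: "map length xss = map length (concat asss)"
  then have "length xss = sum_list (map length asss)" by (metis length_map length_concat)
  then obtain xsss where x: "xss = concat xsss" and xl: "map length xsss = map length asss"
    by (rule block_list_cases)
  have lx: "length xsss = length bss" using xl lens by (metis length_map)
  have lxi: "length (xsss ! i) = length (bss ! i)" if "i < length bss" for i
    using that xl ml lx by (metis nth_map)
  have xi: "length (xsss ! i ! l) = length (asss ! i ! l)" if i: "i < length bss" "l < length (bss ! i)" for i l
  proof -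
    have n: "block_start (map length asss) i + l < length (concat asss)"
      unfolding length_concat by (rule block_start_less) (use that lens in auto)
    have n': "block_start (map length asss) i + l < length xss"
      using n xss by (metis length_map)
    have "length (xss ! (block_start (map length asss) i + l)) =
        length (concat asss ! (block_start (map length asss) i + l))"
      using xss n n' by (metis nth_map)
    then show ?thesis
      using concat_nth_block[of i asss l] concat_nth_block[of i xsss l] that lens lx lxi x xl by simp
  qed
  let ?Z = "map2 (\<lambda>\<phi>. place \<phi>) fs (map2 place_each hss xsss)"
  have "place ?L (concat xss) =
      concat (place (Sym_gam bss g fs) (place_each (concat hss) xss))"
    by (rule place_Sym_gam) (use \<rho> lc hs' xss in auto)
  also have "place_each (concat hss) xss = concat (map2 place_each hss xsss)"
    unfolding x by (rule map2_concat) (use ml xl in simp)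
  also have "place (Sym_gam bss g fs) \<dots> = concat (place g ?Z)"
    by (rule place_Sym_gam) (use g fs lens lx lxi in \<open>auto intro!: nth_equalityI\<close>)
  finally have L: "place ?L (concat xss) = concat (concat (place g ?Z))" .
  have "place (Sym_gam (map concat asss) g ?inner) (concat (map concat xsss)) =
      concat (place g (place_each ?inner (map concat xsss)))"
    by (rule place_Sym_gam) (use g inner lens lx lxi xi in
        \<open>auto intro!: nth_equalityI arg_cong[where f = sum_list] simp: length_concat\<close>)
  also have "place_each ?inner (map concat xsss) = map concat ?Z"
  proof (rule nth_equalityI)
    fix i assume "i < length (place_each ?inner (map concat xsss))"
    then have i: "i < length bss" using lx by simp
    have "place (Sym_gam (asss ! i) (fs ! i) (hss ! i)) (concat (xsss ! i)) =
        concat (place (fs ! i) (place_each (hss ! i) (xsss ! i)))"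
      by (rule place_Sym_gam) (use i fs lens hs lxi xi in \<open>auto intro!: nth_equalityI\<close>)
    then show "place_each ?inner (map concat xsss) ! i = map concat ?Z ! i"
      using i lens fs lx by simp
  qed (use lens fs lx in simp)
  also have "place g (map concat ?Z) = map concat (place g ?Z)"
    using map_place[of g ?Z concat] g fs lens lx by simp
  finally show "place ?L (concat xss) = place (Sym_gam (map concat asss) g ?inner) (concat xss)"
    using L by (simp add: x concat_map_concat)
qed

lemma Sym_gam_outer:
  fixes ass :: "unit list list"
  assumes g: "g permutes {..<length ass}" and fs: "length fs = length ass"
    "\<And>i. i < length ass \<Longrightarrow> (fs ! i) permutes {..<length (ass ! i)}"
    and \<sigma>: "\<sigma> permutes {..<length ass}"
  shows "Sym_gam (permute_list \<sigma> ass) (g \<circ> \<sigma>) (permute_list \<sigma> fs) =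
    Sym_gam ass g fs \<circ> block_perm \<sigma> (permute_list \<sigma> (map length ass))" (is "?L = ?R \<circ> ?B")
proof (rule Sym_gam_eqI)
  let ?js = "map length (permute_list \<sigma> ass)"
  have js: "permute_list \<sigma> (map length ass) = ?js" using \<sigma> by (simp add: permute_list_map)
  have sum: "sum_list ?js = sum_list (map length ass)"
    using \<sigma> by (simp only: sum_mset_sum_list[symmetric] mset_permute_list length_map flip: js)
  have fs': "(permute_list \<sigma> fs ! i) permutes {..<length (permute_list \<sigma> ass ! i)}" if "i < length ass" for i
    using that fs \<sigma> by (simp add: nth_permute_list permutes_less)
  have g\<sigma>: "g \<circ> \<sigma> permutes {..<length ass}" using g \<sigma> by (intro permutes_compose)
  show L: "?L permutes {..<sum_list ?js}"
    unfolding length_concat[symmetric] by (rule Sym_gam_permutes) (use g\<sigma> fs fs' in auto)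
  have B: "?B permutes {..<sum_list ?js}"
    unfolding js by (rule block_perm_permutes) (use \<sigma> in simp)
  have R: "?R permutes {..<sum_list ?js}"
    using Sym_gam_permutes[OF g fs] by (simp only: sum length_concat)
  show "?R \<circ> ?B permutes {..<sum_list ?js}" by (rule permutes_compose[OF B R])
  fix xss :: "nat list list" assume xss: "map length xss = ?js"
  have lx: "length xss = length ass" using xss by (metis length_map length_permute_list)
  have lc: "length (concat xss) = sum_list ?js" using xss by (simp add: length_concat)
  have "place ?L (concat xss) = concat (place (g \<circ> \<sigma>) (place_each (permute_list \<sigma> fs) xss))"
    by (rule place_Sym_gam) (use g\<sigma> fs fs' xss in auto)
  also have "place (g \<circ> \<sigma>) (place_each (permute_list \<sigma> fs) xss) =
      place g (place \<sigma> (place_each (permute_list \<sigma> fs) xss))"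
    by (rule place_compose) (use g \<sigma> fs lx in auto)
  also have "place \<sigma> (place_each (permute_list \<sigma> fs) xss) = place_each fs (place \<sigma> xss)"
  proof (rule place_eqI)
    fix i assume "i < length (place_each (permute_list \<sigma> fs) xss)"
    then have i: "i < length ass" using lx fs by simp
    have \<sigma>i: "\<sigma> i < length ass" using \<sigma> i by (rule permutes_less)
    have "place \<sigma> xss ! \<sigma> i = xss ! i" by (rule place_nth) (use \<sigma> lx i in auto)
    then show "place_each fs (place \<sigma> xss) ! \<sigma> i = place_each (permute_list \<sigma> fs) xss ! i"
      using i \<sigma>i fs lx by (simp add: nth_permute_list)
  qed (use \<sigma> fs lx in auto)
  finally have 1: "place ?L (concat xss) = concat (place g (place_each fs (place \<sigma> xss)))" .
  have "place (?R \<circ> ?B) (concat xss) = place ?R (place ?B (concat xss))"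
    by (rule place_compose) (use R B lc in auto)
  also have "place ?B (concat xss) = concat (place \<sigma> xss)"
    unfolding js xss[symmetric] by (rule place_block_perm) (use \<sigma> lx in simp)
  also have "place ?R \<dots> = concat (place g (place_each fs (place \<sigma> xss)))"
  proof (rule place_Sym_gam[OF g fs])
    have "map length (place \<sigma> xss) = place \<sigma> ?js"
      using map_place[of \<sigma> xss length] \<sigma> lx xss by simp
    also have "\<dots> = map length ass"
      using permute_list_place(2)[of \<sigma> "map length ass"] \<sigma> js by simp
    finally show "map length (place \<sigma> xss) = map length ass" .
  qed
  finally show "place ?L (concat xss) = place (?R \<circ> ?B) (concat xss)" using 1 by (simp only:)
qed

lemma Sym_gam_inner:
  fixes ass :: "unit list list"
  assumes g: "g permutes {..<length ass}" and fs: "length fs = length ass"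
    "\<And>i. i < length ass \<Longrightarrow> (fs ! i) permutes {..<length (ass ! i)}"
    and \<tau>s: "length \<tau>s = length ass"
    "\<And>i. i < length ass \<Longrightarrow> (\<tau>s ! i) permutes {..<length (ass ! i)}"
  shows "Sym_gam (map2 permute_list \<tau>s ass) g (map (\<lambda>i. fs ! i \<circ> \<tau>s ! i) [0..<length ass]) =
    Sym_gam ass g fs \<circ> block_sum \<tau>s (map length ass)" (is "Sym_gam ?ass' g ?fs' = ?R \<circ> ?B")
proof (rule Sym_gam_eqI)
  let ?js = "map length ass"
  have js: "map length ?ass' = ?js" using \<tau>s by (auto intro!: nth_equalityI)
  have l: "length ?ass' = length ass" using \<tau>s by simp
  have fs': "(?fs' ! i) permutes {..<length (?ass' ! i)}" if "i < length ass" for i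
    using that fs \<tau>s by (simp add: permutes_compose)
  show "Sym_gam ?ass' g ?fs' permutes {..<sum_list ?js}"
    unfolding js[symmetric] length_concat[symmetric]
    by (rule Sym_gam_permutes) (use l g fs' in auto)
  have B: "?B permutes {..<sum_list ?js}"
    by (rule block_sum_permutes) (use \<tau>s in auto)
  have R: "?R permutes {..<sum_list ?js}"
    unfolding length_concat[symmetric] by (rule Sym_gam_permutes[OF g fs])
  show "?R \<circ> ?B permutes {..<sum_list ?js}" by (rule permutes_compose[OF B R])
  fix xss :: "nat list list" assume xss: "map length xss = ?js"
  have lx: "length xss = length ass" using xss by (metis length_map)
  have lxi: "length (xss ! i) = length (ass ! i)" if "i < length ass" for i
    using that xss lx by (metis nth_map)
  have lc: "length (concat xss) = sum_list ?js" using xss by (simp add: length_concat)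
  have "place (Sym_gam ?ass' g ?fs') (concat xss) = concat (place g (place_each ?fs' xss))"
    by (rule place_Sym_gam) (use l g fs' xss js in auto)
  also have "place_each ?fs' xss = place_each fs (place_each \<tau>s xss)"
    by (rule nth_equalityI) (use fs \<tau>s lx lxi in \<open>auto simp: place_compose\<close>)
  also have "concat (place g \<dots>) = place ?R (concat (place_each \<tau>s xss))"
    by (rule place_Sym_gam[symmetric, OF g fs])
       (use \<tau>s lx in \<open>simp_all only: map_length_place_each xss\<close>)
  also have "concat (place_each \<tau>s xss) = place ?B (concat xss)"
    using place_block_sum[of \<tau>s xss] \<tau>s lx lxi xss by simp
  also have "place ?R \<dots> = place (?R \<circ> ?B) (concat xss)"
    by (rule place_compose[symmetric]) (use R B lc in auto)
  finally show "place (Sym_gam ?ass' g ?fs') (concat xss) = place (?R \<circ> ?B) (concat xss)" .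
qed

lemma Sym_gam_unit_left:
  assumes "f permutes {..<length as}"
  shows "Sym_gam [as] id [f] = f"
proof (rule Sym_gam_eqI)
  show "Sym_gam [as] id [f] permutes {..<sum_list [length as]}"
    using Sym_gam_permutes[of id "[as]" "[f]"] assms by (simp add: permutes_id)
  show "f permutes {..<sum_list [length as]}" using assms by simp
  fix xss :: "nat list list" assume "map length xss = [length as]"
  then obtain xs where xs: "xss = [xs]" "length xs = length as" by auto
  then show "place (Sym_gam [as] id [f]) (concat xss) = place f (concat xss)"
    using place_Sym_gam[of id "[as]" "[f]" xss] assms by (simp add: permutes_id)
qed

lemma Sym_gam_unit_right:
  assumes "f permutes {..<length as}"
  shows "Sym_gam (map (\<lambda>a. [a]) as) f (map (\<lambda>a. id) as) = f"
proof (rule place_upt_inject)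
  let ?x = "map (\<lambda>i. [i]) [0..<length as]"
  show "Sym_gam (map (\<lambda>a. [a]) as) f (map (\<lambda>a. id) as) permutes {..<length as}"
    using Sym_gam_permutes[of f "map (\<lambda>a. [a]) as" "map (\<lambda>a. id) as"] assms by (simp add: permutes_id)
  show "f permutes {..<length as}" by fact
  have "place (Sym_gam (map (\<lambda>a. [a]) as) f (map (\<lambda>a. id) as)) (concat ?x) =
      concat (place f (place_each (map (\<lambda>a. id) as) ?x))"
    by (rule place_Sym_gam) (use assms in \<open>auto simp: permutes_id intro!: nth_equalityI\<close>)
  also have "place_each (map (\<lambda>a. id) as) ?x = ?x"
    by (auto intro!: nth_equalityI)
  also have "concat (place f ?x) = place f [0..<length as]"
  proof -
    have "place f ?x = map (\<lambda>i. [i]) (place f [0..<length as])"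
      by (rule map_place[symmetric]) (use assms in simp)
    then show ?thesis by (simp only: concat_map_singleton list.map_ident)
  qed
  finally show "place (Sym_gam (map (\<lambda>a. [a]) as) f (map (\<lambda>a. id) as)) [0..<length as] =
      place f [0..<length as]" by (simp only: concat_map_singleton list.map_ident)
qed

lemma permutes_laws:
  "multicat_laws {()} (\<lambda>as b. Sym (length as)) (\<lambda>\<sigma> as b f. f \<circ> \<sigma>) (\<lambda>a. id)
     (\<lambda>ass bs c g fs. Sym_gam ass g fs)"
proof (unfold_locales, goal_cases)
  case (5 d g cs bss fs asss hss)
  note c = composable_Sym[OF 5(3)]
  have c': "length (hss ! i) = length (asss ! i) \<and> length (bss ! i) = length (asss ! i) \<and>
      (\<forall>l < length (asss ! i). (hss ! i ! l) permutes {..<length (asss ! i ! l)})" if "i < length cs" for i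
    using composable_Sym[OF 5(6)[OF that]] .
  from c have l: "length cs = length bss" by simp
  show ?case
    unfolding l by (rule Sym_gam_assoc) (use c c'[unfolded l] 5(2,4,5)[unfolded l Sym_iff] in auto)
next
  case (6 c g bs ass fs \<sigma>)
  note c = composable_Sym[OF 6(3)]
  then have l: "length bs = length ass" by simp
  show ?case
    by (rule Sym_gam_outer) (use c 6(2,4)[unfolded l Sym_iff] in auto)
next
  case (7 c g bs ass fs \<tau>s)
  note c = composable_Sym[OF 7(3)]
  then have l: "length bs = length ass" by simp
  show ?case
    unfolding l by (rule Sym_gam_inner) (use c 7(2,4,5)[unfolded l Sym_iff] in auto)
next
  case (4 as b f)
  show ?case by (rule Sym_gam_unit_right) (use 4(3) in \<open>simp add: Sym_iff\<close>)
qed (auto simp: Sym_iff Sym_gam_unit_left comp_assoc)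

section \<open>Products of categories and the two operads\<close>

lemma hom_iff: "f \<in> hom C a b \<longleftrightarrow> f \<in> Ar C \<and> cdom C f = a \<and> ccod C f = b"
  by (simp add: hom_def)

lemma Ob_prod: "xs \<in> Ob (prod_cat Cs) \<longleftrightarrow> length xs = length Cs \<and> (\<forall>i < length Cs. xs ! i \<in> Ob (Cs ! i))"
  by (auto simp: prod_cat_def list_all2_conv_all_nth)

lemma Ar_prod: "us \<in> Ar (prod_cat Cs) \<longleftrightarrow> length us = length Cs \<and> (\<forall>i < length Cs. us ! i \<in> Ar (Cs ! i))"
  by (auto simp: prod_cat_def list_all2_conv_all_nth)

lemma prod_cat_simps:
  "cdom (prod_cat Cs) us = map2 cdom Cs us" "ccod (prod_cat Cs) us = map2 ccod Cs us"
  "ide (prod_cat Cs) xs = map2 ide Cs xs"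
  "cmp (prod_cat Cs) vs us = map2 (\<lambda>C (v, u). cmp C v u) Cs (zip vs us)"
  by (simp_all add: prod_cat_def)

lemma hom_prod:
  "us \<in> hom (prod_cat Cs) xs ys \<longleftrightarrow> length us = length Cs \<and> length xs = length Cs \<and>
     length ys = length Cs \<and> (\<forall>i < length Cs. us ! i \<in> hom (Cs ! i) (xs ! i) (ys ! i))"
  by (auto simp: hom_iff Ar_prod prod_cat_simps list_eq_iff_nth_eq)

lemma category_prod_cat:
  assumes "\<And>C. C \<in> set Cs \<Longrightarrow> category C"
  shows "category (prod_cat Cs)"
proof
  have C: "category (Cs ! i)" if "i < length Cs" for i using that assms by simp
  show "cdom (prod_cat Cs) f \<in> Ob (prod_cat Cs)" "ccod (prod_cat Cs) f \<in> Ob (prod_cat Cs)"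
    if "f \<in> Ar (prod_cat Cs)" for f
    using that C by (auto simp: Ar_prod Ob_prod prod_cat_simps category.dom_in category.cod_in)
  show "ide (prod_cat Cs) a \<in> hom (prod_cat Cs) a a" if "a \<in> Ob (prod_cat Cs)" for a
    using that C by (auto simp: hom_prod Ob_prod prod_cat_simps category.ide_in)
  fix f a b assume f: "f \<in> hom (prod_cat Cs) a b"
  show "cmp (prod_cat Cs) f (ide (prod_cat Cs) a) = f" "cmp (prod_cat Cs) (ide (prod_cat Cs) b) f = f"
    using f C by (auto simp: hom_prod prod_cat_simps category.cmp_ide_right category.cmp_ide_left
        intro!: nth_equalityI)
  fix g c assume g: "g \<in> hom (prod_cat Cs) b c"
  show "cmp (prod_cat Cs) g f \<in> hom (prod_cat Cs) a c"
    using f g C by (auto simp: hom_prod prod_cat_simps category.cmp_in)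
  fix h d assume h: "h \<in> hom (prod_cat Cs) c d"
  show "cmp (prod_cat Cs) h (cmp (prod_cat Cs) g f) = cmp (prod_cat Cs) (cmp (prod_cat Cs) h g) f"
    by (rule nth_equalityI)
       (use f g h in \<open>auto simp: hom_prod prod_cat_simps intro!: category.cmp_assoc[OF C]\<close>)
qed

lemma category_discrete [simp]: "category (discrete_cat X)"
  by unfold_locales (auto simp: discrete_cat_def hom_def)

lemma category_indiscrete [simp]: "category (indiscrete_cat X)"
  by unfold_locales (auto simp: indiscrete_cat_def hom_def)

lemma discrete_cat_simps [simp]:
  "Ob (discrete_cat X) = X" "Ar (discrete_cat X) = X" "cdom (discrete_cat X) x = x"
  "ccod (discrete_cat X) x = x" "ide (discrete_cat X) x = x" "cmp (discrete_cat X) y x = x"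
  by (simp_all add: discrete_cat_def)

lemma indiscrete_cat_simps [simp]:
  "Ob (indiscrete_cat X) = X" "Ar (indiscrete_cat X) = X \<times> X" "cdom (indiscrete_cat X) u = fst u"
  "ccod (indiscrete_cat X) u = snd u" "ide (indiscrete_cat X) x = (x, x)"
  "cmp (indiscrete_cat X) v u = (fst u, snd v)"
  by (simp_all add: indiscrete_cat_def)

lemma functor_from_discrete:
  assumes "category D" "\<And>x. x \<in> X \<Longrightarrow> fo x \<in> Ob D" "\<And>x. x \<in> X \<Longrightarrow> fa x = ide D (fo x)"
  shows "cat_functor (discrete_cat X) D fo fa"
proof -
  interpret D: category D by fact
  show ?thesis
    by unfold_locales
      (use assms D.ide_in D.cmp_ide_left in \<open>force simp: hom_iff discrete_cat_def
          intro: category_discrete[unfolded category_def discrete_cat_def, simplified]\<close>)+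
qed

lemma functor_to_discrete:
  assumes C: "category C" and ob: "\<And>a. a \<in> Ob C \<Longrightarrow> fo a \<in> Y"
    and ar: "\<And>f. f \<in> Ar C \<Longrightarrow> fa f = fo (cdom C f) \<and> fa f = fo (ccod C f)"
  shows "cat_functor C (discrete_cat Y) fo fa"
proof -
  interpret C: category C by fact
  interpret Y: category "discrete_cat Y" by simp
  show ?thesis
  proof
    show "fo a \<in> Ob (discrete_cat Y)" if "a \<in> Ob C" for a using ob that by simp
    show "fa f \<in> hom (discrete_cat Y) (fo a) (fo b)" if "f \<in> hom C a b" for f a b
      using that ar[of f] ob[of a] C.dom_in[of f] unfolding hom_iff discrete_cat_simps by metis
    show "fa (ide C a) = ide (discrete_cat Y) (fo a)" if "a \<in> Ob C" for a
      using C.ide_in[OF that] ar[of "ide C a"] by (simp add: hom_iff)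
    show "fa (cmp C g f) = cmp (discrete_cat Y) (fa g) (fa f)"
      if "f \<in> hom C a b" "g \<in> hom C b c" for f g a b c
      using that C.cmp_in[OF that] ar[of "cmp C g f"] ar[of f] by (simp add: hom_iff)
  qed
qed

text \<open>A functor to \<open>EX\<close> is the same as a map on objects, so that all functoriality conditions for
  \<open>E\<Sigma>\<^sub>*\<close> hold automatically.\<close>

lemma functor_to_indiscrete:
  assumes C: "category C" and ob: "\<And>a. a \<in> Ob C \<Longrightarrow> fo a \<in> Y"
    and ar: "\<And>f. f \<in> Ar C \<Longrightarrow> fa f = (fo (cdom C f), fo (ccod C f))"
  shows "cat_functor C (indiscrete_cat Y) fo fa"
proof -
  interpret C: category C by fact
  interpret Y: category "indiscrete_cat Y" by simp
  show ?thesis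
  proof
    show "fo a \<in> Ob (indiscrete_cat Y)" if "a \<in> Ob C" for a using ob that by simp
    show "fa f \<in> hom (indiscrete_cat Y) (fo a) (fo b)" if "f \<in> hom C a b" for f a b
      using that ar[of f] ob C.dom_in[of f] C.cod_in[of f] by (auto simp: hom_iff)
    show "fa (ide C a) = ide (indiscrete_cat Y) (fo a)" if "a \<in> Ob C" for a
      using C.ide_in[OF that] ar[of "ide C a"] by (simp add: hom_iff)
    show "fa (cmp C g f) = cmp (indiscrete_cat Y) (fa g) (fa f)"
      if "f \<in> hom C a b" "g \<in> hom C b c" for f g a b c
      using that C.cmp_in[OF that] ar[of "cmp C g f"] ar[of f] ar[of g] by (simp add: hom_iff)
  qed
qed

text \<open>Replacing every set of morphisms by its square gives again a multicategory in sets. The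
  arrows of \<open>E\<Sigma>\<^sub>k\<close> are the square of its objects.\<close>

lemma multicat_laws_square:
  assumes "multicat_laws X H act un gam"
  shows "multicat_laws X (\<lambda>as b. H as b \<times> H as b)
    (\<lambda>\<sigma> as b u. (act \<sigma> as b (fst u), act \<sigma> as b (snd u))) (\<lambda>a. (un a, un a))
    (\<lambda>ass bs c v us. (gam ass bs c (fst v) (map fst us), gam ass bs c (snd v) (map snd us)))"
proof -
  interpret multicat_laws X H act un gam by fact
  have comp: "composable X H ass bs (map fst fs) \<and> composable X H ass bs (map snd fs)"
    if "composable X (\<lambda>as b. H as b \<times> H as b) ass bs fs" for ass bs and fs
    using that by (auto simp: composable_def mem_Times_iff)
  show ?thesis
  proof (unfold_locales, goal_cases)
    case (1 as b f)
    then show ?case using act_id[OF 1(1,2)] by auto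
  next
    case (2 as b f \<sigma> \<tau>)
    then show ?case using act_comp[OF 2(1,2) _ 2(4,5)] by auto
  next
    case (3 as b f)
    then show ?case using unit_left[OF 3(1,2)] by auto
  next
    case (4 as b f)
    then show ?case using unit_right[OF 4(1,2)] by (auto simp: comp_def)
  next
    case (5 d g cs bss fs asss hss)
    have h: "composable X H (asss ! i) (bss ! i) (map (map fst) hss ! i) \<and>
        composable X H (asss ! i) (bss ! i) (map (map snd) hss ! i)" if "i < length cs" for i
      using comp[OF 5(6)[OF that]] that 5(5) by simp
    have l: "length fs = length cs" using 5(3) by (simp add: composable_def)
    show ?case
      using gam_assoc[OF 5(1) _ _ 5(4), of "fst g" bss "map fst fs" "map (map fst) hss"]
        gam_assoc[OF 5(1) _ _ 5(4), of "snd g" bss "map snd fs" "map (map snd) hss"]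
        5(2,5) comp[OF 5(3)] h l
      by (auto simp: map_concat mem_Times_iff comp_def intro!: arg_cong[where f = "gam (map concat asss) cs d (fst g)"] arg_cong[where f = "gam (map concat asss) cs d (snd g)"])
  next
    case (6 c g bs ass fs \<sigma>)
    have l: "length fs = length bs" using 6(3) by (simp add: composable_def)
    show ?case
      using equivariance_outer[OF 6(1) _ _ 6(4), of "fst g" ass "map fst fs"]
        equivariance_outer[OF 6(1) _ _ 6(4), of "snd g" ass "map snd fs"]
        6(2) comp[OF 6(3)] l 6(4)
      by (auto simp: mem_Times_iff permute_list_map)
  next
    case (7 c g bs ass fs \<tau>s)
    have l: "length fs = length bs" using 7(3) by (simp add: composable_def)
    have m: "map (\<lambda>i. act (\<tau>s ! i) (ass ! i) (bs ! i) (map p fs ! i)) [0..<length bs] =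
        map (\<lambda>i. act (\<tau>s ! i) (ass ! i) (bs ! i) (p (fs ! i))) [0..<length bs]" for p
      using l by auto
    show ?case
      using equivariance_inner[OF 7(1) _ _ 7(4,5), of "fst g" "map fst fs"]
        equivariance_inner[OF 7(1) _ _ 7(4,5), of "snd g" "map snd fs"]
        7(2) comp[OF 7(3)] l
      by (auto simp: mem_Times_iff comp_def m)
  qed
qed

lemma multicategory_Sigma: "multicategory Sigma_operad"
proof (rule multicategory.intro, goal_cases)
  case (3 a)
  then show ?case by (simp add: Sigma_operad_def Sym_iff permutes_id)
next
  case (5)
  show ?case using permutes_laws by (simp add: Sigma_operad_def)
next
  case (6)
  show ?case using permutes_laws by (simp add: Sigma_operad_def)
next
  case (2 as b \<sigma>)
  then show ?case
    by (auto simp: Sigma_operad_def Sym_iff intro!: functor_to_discrete permutes_compose)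
next
  case (4 ass bs c)
  have "cat_functor (prod_cat (discrete_cat (Sym (length bs)) #
        map2 (\<lambda>as b. discrete_cat (Sym (length as))) ass bs)) (discrete_cat (Sym (length (concat ass))))
      (\<lambda>fs. Sym_gam ass (hd fs) (tl fs)) (\<lambda>fs. Sym_gam ass (hd fs) (tl fs))"
  proof (rule functor_to_discrete)
    show "category (prod_cat (discrete_cat (Sym (length bs)) #
        map2 (\<lambda>as b. discrete_cat (Sym (length as))) ass bs))"
      by (rule category_prod_cat) auto
  next
    fix fs assume "fs \<in> Ob (prod_cat (discrete_cat (Sym (length bs)) #
        map2 (\<lambda>as b. discrete_cat (Sym (length as))) ass bs))"
    then show "Sym_gam ass (hd fs) (tl fs) \<in> Sym (length (concat ass))"
      using Sym_gam_permutes[of "hd fs" ass "tl fs"] 4(4)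
      by (cases fs) (auto simp: Ob_prod Sym_iff length_concat All_less_Suc2)
  next
    fix fs assume "fs \<in> Ar (prod_cat (discrete_cat (Sym (length bs)) #
        map2 (\<lambda>as b. discrete_cat (Sym (length as))) ass bs))" (is "_ \<in> Ar (prod_cat ?Cs)")
    then have "map2 cdom ?Cs fs = fs \<and> map2 ccod ?Cs fs = fs"
      by (auto simp: Ar_prod list_eq_iff_nth_eq nth_Cons split: nat.split)
    then show "Sym_gam ass (hd fs) (tl fs) =
        Sym_gam ass (hd (cdom (prod_cat ?Cs) fs)) (tl (cdom (prod_cat ?Cs) fs)) \<and>
      Sym_gam ass (hd fs) (tl fs) =
        Sym_gam ass (hd (ccod (prod_cat ?Cs) fs)) (tl (ccod (prod_cat ?Cs) fs))"
      by (simp only: prod_cat_simps)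
  qed
  then show ?case by (simp add: Sigma_operad_def)
qed (auto simp: Sigma_operad_def)

lemma multicategory_ESigma: "multicategory ESigma_operad"
proof (rule multicategory.intro, goal_cases)
  case (3 a)
  then show ?case by (simp add: ESigma_operad_def Sym_iff permutes_id)
next
  case (5)
  show ?case using permutes_laws by (simp add: ESigma_operad_def)
next
  case (6)
  show ?case using multicat_laws_square[OF permutes_laws] by (simp add: ESigma_operad_def)
next
  case (2 as b \<sigma>)
  then show ?case
    by (auto simp: ESigma_operad_def Sym_iff intro!: functor_to_indiscrete permutes_compose)
next
  case (4 ass bs c)
  have "cat_functor (prod_cat (indiscrete_cat (Sym (length bs)) #
        map2 (\<lambda>as b. indiscrete_cat (Sym (length as))) ass bs)) (indiscrete_cat (Sym (length (concat ass))))
      (\<lambda>fs. Sym_gam ass (hd fs) (tl fs))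
      (\<lambda>fs. (Sym_gam ass (fst (hd fs)) (map fst (tl fs)), Sym_gam ass (snd (hd fs)) (map snd (tl fs))))"
  proof (rule functor_to_indiscrete)
    show "category (prod_cat (indiscrete_cat (Sym (length bs)) #
        map2 (\<lambda>as b. indiscrete_cat (Sym (length as))) ass bs))"
      by (rule category_prod_cat) auto
  next
    fix fs assume "fs \<in> Ob (prod_cat (indiscrete_cat (Sym (length bs)) #
        map2 (\<lambda>as b. indiscrete_cat (Sym (length as))) ass bs))"
    then show "Sym_gam ass (hd fs) (tl fs) \<in> Sym (length (concat ass))"
      using Sym_gam_permutes[of "hd fs" ass "tl fs"] 4(4)
      by (cases fs) (auto simp: Ob_prod Sym_iff length_concat All_less_Suc2)
  next
    fix fs assume "fs \<in> Ar (prod_cat (indiscrete_cat (Sym (length bs)) #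
        map2 (\<lambda>as b. indiscrete_cat (Sym (length as))) ass bs))" (is "_ \<in> Ar (prod_cat ?Cs)")
    then have "map2 cdom ?Cs fs = map fst fs \<and> map2 ccod ?Cs fs = map snd fs \<and> fs \<noteq> []"
      by (auto simp: Ar_prod list_eq_iff_nth_eq nth_Cons split: nat.split)
    then show "(Sym_gam ass (fst (hd fs)) (map fst (tl fs)), Sym_gam ass (snd (hd fs)) (map snd (tl fs))) =
        (Sym_gam ass (hd (cdom (prod_cat ?Cs) fs)) (tl (cdom (prod_cat ?Cs) fs)),
         Sym_gam ass (hd (ccod (prod_cat ?Cs) fs)) (tl (ccod (prod_cat ?Cs) fs)))"
      by (simp add: prod_cat_simps hd_map map_tl)
  qed
  then show ?case by (simp add: ESigma_operad_def)
qed (auto simp: ESigma_operad_def)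

lemma operad_Sigma: "operad Sigma_operad"
  by (simp add: operad_def multicategory_Sigma) (simp add: Sigma_operad_def)

lemma contractible_indiscrete:
  assumes x: "x \<in> X"
  shows "contractible_category (indiscrete_cat X)"
proof -
  have 1: "cat_functor (indiscrete_cat X) (discrete_cat {()}) (\<lambda>_. ()) (\<lambda>_. ())"
    by (rule functor_to_discrete) auto
  have 2: "cat_functor (discrete_cat {()}) (indiscrete_cat X) (\<lambda>_. x) (\<lambda>_. (x, x))"
    by (rule functor_from_discrete) (use x in auto)
  have 3: "nat_trans (indiscrete_cat X) (indiscrete_cat X) (\<lambda>a. a) (\<lambda>f. f) ((\<lambda>_. x) \<circ> (\<lambda>_. ()))
      ((\<lambda>_. (x, x)) \<circ> (\<lambda>_. ())) (\<lambda>a. (a, x))"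
    by (intro nat_trans.intro nat_trans_axioms.intro functor_to_indiscrete)
       (use x in \<open>auto simp: hom_iff\<close>)
  have 4: "nat_trans (discrete_cat {()}) (discrete_cat {()}) ((\<lambda>_. ()) \<circ> (\<lambda>_. x))
      ((\<lambda>_. ()) \<circ> (\<lambda>_. (x, x))) (\<lambda>b. b) (\<lambda>g. g) (\<lambda>b. b)"
    by (intro nat_trans.intro nat_trans_axioms.intro functor_to_discrete) (auto simp: hom_iff)
  have "\<forall>a \<in> X. is_iso (indiscrete_cat X) (a, x)" using x by (force simp: is_iso_def hom_iff)
  moreover have "is_iso (discrete_cat {()}) ()" by (simp add: is_iso_def hom_iff)
  ultimately show ?thesis
    unfolding contractible_category_def equivalent_categories_def using 1 2 3 4
    by (intro exI conjI) auto
qed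

lemma E_infinity_ESigma: "E_infinity_operad ESigma_operad"
proof -
  have "operad ESigma_operad"
    by (simp add: operad_def multicategory_ESigma) (simp add: ESigma_operad_def)
  moreover have "contractible_category (indiscrete_cat (Sym k))" for k
    by (rule contractible_indiscrete[of id]) (simp add: Sym_iff permutes_id)
  moreover have "f \<circ> \<sigma> \<noteq> f" if "f \<in> Sym k" "\<sigma> \<noteq> id" for f \<sigma> k
    using that permutes_inj[of f "{..<k}"] by (auto simp: Sym_iff fun_eq_iff inj_eq)
  ultimately show ?thesis
    by (auto simp: E_infinity_operad_def ESigma_operad_def)
qed

section \<open>The categories of multilinear maps\<close>

context category
begin

lemma Ob_dom [simp]: "f \<in> Ar C \<Longrightarrow> cdom C f \<in> Ob C"
  and Ob_cod [simp]: "f \<in> Ar C \<Longrightarrow> ccod C f \<in> Ob C"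
  by (fact dom_in, fact cod_in)

lemma ide_simps [simp]:
  "a \<in> Ob C \<Longrightarrow> ide C a \<in> Ar C" "a \<in> Ob C \<Longrightarrow> cdom C (ide C a) = a"
  "a \<in> Ob C \<Longrightarrow> ccod C (ide C a) = a"
  using ide_in[of a] by (simp_all add: hom_iff)

lemma cmp_simps [simp]:
  assumes "f \<in> Ar C" "g \<in> Ar C" "ccod C f = cdom C g"
  shows "cmp C g f \<in> Ar C" "cdom C (cmp C g f) = cdom C f" "ccod C (cmp C g f) = ccod C g"
  using cmp_in[of f "cdom C f" "ccod C f" g "ccod C g"] assms by (simp_all add: hom_iff)

lemma cmp_ide [simp]:
  "f \<in> Ar C \<Longrightarrow> cdom C f = a \<Longrightarrow> cmp C f (ide C a) = f"
  "f \<in> Ar C \<Longrightarrow> ccod C f = a \<Longrightarrow> cmp C (ide C a) f = f"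
  using cmp_ide_right[of f a] cmp_ide_left[of f _ a] by (simp_all add: hom_iff)

lemma assoc:
  "f \<in> Ar C \<Longrightarrow> g \<in> Ar C \<Longrightarrow> h \<in> Ar C \<Longrightarrow> ccod C f = cdom C g \<Longrightarrow> ccod C g = cdom C h \<Longrightarrow>
   cmp C (cmp C h g) f = cmp C h (cmp C g f)"
  using cmp_assoc[of f "cdom C f" "ccod C f" g "ccod C g" h "ccod C h"] by (simp add: hom_iff)

text \<open>Composites are kept bracketed to the right, so that an equation of two composites does not
  match inside of a longer one. This rule applies it there.\<close>

lemma cmp_rewrite:
  assumes "cmp C g f = cmp C g' f'"
    and "f \<in> Ar C" "g \<in> Ar C" "f' \<in> Ar C" "g' \<in> Ar C" "e \<in> Ar C"
    and "ccod C f = cdom C g" "ccod C f' = cdom C g'" "ccod C e = cdom C f" "cdom C f' = cdom C f"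
  shows "cmp C g (cmp C f e) = cmp C g' (cmp C f' e)"
  using assms assoc[of e f g] assoc[of e f' g'] by simp

end

context strict_monoidal_structure
begin

lemma to_Ob [simp]: "a \<in> Ob C \<Longrightarrow> b \<in> Ob C \<Longrightarrow> to a b \<in> Ob C"
  by (fact to_in)

lemma ta_simps [simp]:
  assumes "u \<in> Ar C" "v \<in> Ar C"
  shows "ta u v \<in> Ar C" "cdom C (ta u v) = to (cdom C u) (cdom C v)"
    "ccod C (ta u v) = to (ccod C u) (ccod C v)"
  using ta_in[of u "cdom C u" "ccod C u" v "cdom C v" "ccod C v"] assms by (simp_all add: hom_iff)

lemma ta_ide' [simp]: "a \<in> Ob C \<Longrightarrow> b \<in> Ob C \<Longrightarrow> ta (ide C a) (ide C b) = ide C (to a b)"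
  by (fact ta_ide)

lemma interchange:
  assumes "u \<in> Ar C" "u' \<in> Ar C" "v \<in> Ar C" "v' \<in> Ar C"
    "ccod C u = cdom C u'" "ccod C v = cdom C v'"
  shows "cmp C (ta u' v') (ta u v) = ta (cmp C u' u) (cmp C v' v)"
  using ta_cmp[of u "cdom C u" "ccod C u" u' "ccod C u'" v "cdom C v" "ccod C v" v' "ccod C v'"] assms
  by (simp add: hom_iff)

lemma e_Ob [simp]: "e \<in> Ob C"
  by (fact e_in)

lemmas unit_simps [simp] = to_unit ta_unit

end

context permutative_structure
begin

lemma sy_simps [simp]:
  assumes "a \<in> Ob C" "b \<in> Ob C"
  shows "s a b \<in> Ar C" "cdom C (s a b) = to a b" "ccod C (s a b) = to b a"
  using sy_in[OF assms] by (simp_all add: hom_iff)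

lemma sy_natural:
  assumes "u \<in> Ar C" "v \<in> Ar C" "cdom C u = a" "cdom C v = b" "ccod C u = a'" "ccod C v = b'"
  shows "cmp C (s a' b') (ta u v) = cmp C (ta v u) (s a b)"
  using sy_nat[of u a a' v b b'] assms by (simp add: hom_iff)

end

lemma nth_update_iff: "xs[i := x] ! j = (if i = j \<and> i < length xs then x else xs ! j)"
  by (cases "i < length xs") (auto simp: nth_list_update list_update_beyond)

lemma permutative_category_category: "permutative_category C \<Longrightarrow> category C"
  by (simp add: permutative_category_def permutative_structure_def strict_monoidal_structure_def)

lemma Ob_prod_update:
  "xs \<in> Ob (prod_cat Cs) \<Longrightarrow> x \<in> Ob (Cs ! i) \<Longrightarrow> xs[i := x] \<in> Ob (prod_cat Cs)"
  by (auto simp: Ob_prod nth_update_iff)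

text \<open>A composite of multilinear transformations is again compatible with the distributivity maps
  because \<open>\<oplus>\<close> is a functor.\<close>

lemma category_P_hom:
  assumes Cs: "\<And>C. C \<in> set Cs \<Longrightarrow> permutative_category C" and D: "permutative_category D"
  shows "category (P_hom Cs D)"
proof -
  interpret D: permutative_category D by fact
  interpret P: category "prod_cat Cs"
    by (rule category_prod_cat) (use Cs permutative_category_category in blast)
  have sum_in: "osum (Cs ! i) x y \<in> Ob (Cs ! i)"
    if "i < length Cs" "x \<in> Ob (Cs ! i)" "y \<in> Ob (Cs ! i)" for i x y
  proof -
    interpret C: permutative_category "Cs ! i" using that Cs by simp
    show ?thesis using that by simp
  qed
  have arg: "xs \<in> Ob (prod_cat Cs)" "xs[i := x'] \<in> Ob (prod_cat Cs)"
      "xs[i := osum (Cs ! i) (xs ! i) x'] \<in> Ob (prod_cat Cs)"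
    if "delta_arg Cs i xs x'" for i xs x'
    using that sum_in by (auto simp: delta_arg_def intro!: Ob_prod_update) (auto simp: Ob_prod)
  have delta: "m_delta f i xs x' \<in> Ar D"
      "cdom D (m_delta f i xs x') = osum D (m_ob f xs) (m_ob f (xs[i := x']))"
      "ccod D (m_delta f i xs x') = m_ob f (xs[i := osum (Cs ! i) (xs ! i) x'])"
    if "multilinear Cs D f" "delta_arg Cs i xs x'" for f i xs x'
    using multilinear.delta_in[OF that] by (simp_all add: hom_iff)
  have fob: "m_ob f xs \<in> Ob D" if "multilinear Cs D f" "xs \<in> Ob (prod_cat Cs)" for f xs
    using cat_functor.ob_in[OF multilinear.functoriality[OF that(1)] that(2)] .
  have far: "m_ar f us \<in> Ar D" "cdom D (m_ar f us) = m_ob f xs" "ccod D (m_ar f us) = m_ob f ys"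
    if "multilinear Cs D f" "us \<in> hom (prod_cat Cs) xs ys" for f us xs ys
    using cat_functor.ar_in[OF multilinear.functoriality[OF that(1)] that(2)] by (simp_all add: hom_iff)
  have comp: "t_comp \<phi> xs \<in> Ar D" "cdom D (t_comp \<phi> xs) = m_ob (t_src \<phi>) xs"
      "ccod D (t_comp \<phi> xs) = m_ob (t_tgt \<phi>) xs"
    if "multilinear_trans Cs D \<phi>" "xs \<in> Ob (prod_cat Cs)" for \<phi> xs
    using nat_trans.component_in[OF multilinear_trans.naturality[OF that(1)] that(2)]
    by (simp_all add: hom_iff)
  have nat: "cmp D (t_comp \<phi> ys) (m_ar (t_src \<phi>) us) = cmp D (m_ar (t_tgt \<phi>) us) (t_comp \<phi> xs)"
    if "multilinear_trans Cs D \<phi>" "us \<in> hom (prod_cat Cs) xs ys" for \<phi> us xs ys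
    using nat_trans.naturality[OF multilinear_trans.naturality[OF that(1)] that(2)] .
  have hom_Ob: "xs \<in> Ob (prod_cat Cs)" "ys \<in> Ob (prod_cat Cs)" if "us \<in> hom (prod_cat Cs) xs ys" for us xs ys
    using that P.dom_in[of us] P.cod_in[of us] by (auto simp: hom_iff)
  let ?ide = "\<lambda>f. \<lparr>t_src = f, t_tgt = f,
      t_comp = restrict (\<lambda>xs. ide D (m_ob f xs)) (Ob (prod_cat Cs))\<rparr>"
  have id: "multilinear_trans Cs D (?ide f)" if f: "multilinear Cs D f" for f
  proof (rule multilinear_trans.intro)
    interpret F: cat_functor "prod_cat Cs" D "m_ob f" "m_ar f"
      by (rule multilinear.functoriality[OF f])
    show "nat_trans (prod_cat Cs) D (m_ob (t_src (?ide f))) (m_ar (t_src (?ide f)))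
        (m_ob (t_tgt (?ide f))) (m_ar (t_tgt (?ide f))) (t_comp (?ide f))"
    proof (simp, unfold_locales)
      fix us xs ys assume us: "us \<in> hom (prod_cat Cs) xs ys"
      then show "cmp D (restrict (\<lambda>xs. ide D (m_ob f xs)) (Ob (prod_cat Cs)) ys) (m_ar f us) =
          cmp D (m_ar f us) (restrict (\<lambda>xs. ide D (m_ob f xs)) (Ob (prod_cat Cs)) xs)"
        using hom_Ob[OF us] far[OF f us] by simp
    qed (simp add: D.ide_in F.ob_in)
  qed (use f delta[OF f] fob[OF f] arg in simp_all)
  let ?cmp = "\<lambda>\<psi> \<phi>. \<lparr>t_src = t_src \<phi>, t_tgt = t_tgt \<psi>,
      t_comp = restrict (\<lambda>xs. cmp D (t_comp \<psi> xs) (t_comp \<phi> xs)) (Ob (prod_cat Cs))\<rparr>"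
  have cmp: "multilinear_trans Cs D (?cmp \<psi> \<phi>)"
    if \<phi>: "multilinear_trans Cs D \<phi>" and \<psi>: "multilinear_trans Cs D \<psi>" and eq: "t_tgt \<phi> = t_src \<psi>"
    for \<phi> \<psi>
  proof (rule multilinear_trans.intro)
    show src: "multilinear Cs D (t_src (?cmp \<psi> \<phi>))" "multilinear Cs D (t_tgt (?cmp \<psi> \<phi>))"
      using multilinear_trans.src[OF \<phi>] multilinear_trans.tgt[OF \<psi>] by simp_all
    show "t_comp (?cmp \<psi> \<phi>) \<in> extensional (Ob (prod_cat Cs))" by simp
    show "nat_trans (prod_cat Cs) D (m_ob (t_src (?cmp \<psi> \<phi>))) (m_ar (t_src (?cmp \<psi> \<phi>)))
        (m_ob (t_tgt (?cmp \<psi> \<phi>))) (m_ar (t_tgt (?cmp \<psi> \<phi>))) (t_comp (?cmp \<psi> \<phi>))"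
    proof (intro nat_trans.intro nat_trans_axioms.intro)
      show "cat_functor (prod_cat Cs) D (m_ob (t_src (?cmp \<psi> \<phi>))) (m_ar (t_src (?cmp \<psi> \<phi>)))"
        "cat_functor (prod_cat Cs) D (m_ob (t_tgt (?cmp \<psi> \<phi>))) (m_ar (t_tgt (?cmp \<psi> \<phi>)))"
        using src by (auto intro: multilinear.functoriality)
      fix xs assume "xs \<in> Ob (prod_cat Cs)"
      then show "t_comp (?cmp \<psi> \<phi>) xs \<in> hom D (m_ob (t_src (?cmp \<psi> \<phi>)) xs) (m_ob (t_tgt (?cmp \<psi> \<phi>)) xs)"
        using comp[OF \<phi>] comp[OF \<psi>] eq by (simp add: hom_iff)
    next
      fix us xs ys assume us: "us \<in> hom (prod_cat Cs) xs ys"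
      note [simp] = hom_Ob[OF us] comp[OF \<phi>] comp[OF \<psi>] far[OF multilinear_trans.src[OF \<phi>] us]
        far[OF multilinear_trans.tgt[OF \<phi>] us] far[OF multilinear_trans.tgt[OF \<psi>] us] far[OF multilinear_trans.src[OF \<psi>] us]
      have "cmp D (cmp D (t_comp \<psi> ys) (t_comp \<phi> ys)) (m_ar (t_src \<phi>) us) =
          cmp D (t_comp \<psi> ys) (cmp D (m_ar (t_tgt \<phi>) us) (t_comp \<phi> xs))"
        using nat[OF \<phi> us] eq by (simp add: D.assoc)
      also have "\<dots> = cmp D (m_ar (t_tgt \<psi>) us) (cmp D (t_comp \<psi> xs) (t_comp \<phi> xs))"
        by (rule D.cmp_rewrite) (use nat[OF \<psi> us] eq in simp_all)
      finally show "cmp D (t_comp (?cmp \<psi> \<phi>) ys) (m_ar (t_src (?cmp \<psi> \<phi>)) us) =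
          cmp D (m_ar (t_tgt (?cmp \<psi> \<phi>)) us) (t_comp (?cmp \<psi> \<phi>) xs)"
        by simp
    qed
    fix i xs x' assume a: "delta_arg Cs i xs x'"
    let ?y = "xs[i := osum (Cs ! i) (xs ! i) x']"
    note [simp] = arg[OF a] comp[OF \<phi>] comp[OF \<psi>] delta[OF multilinear_trans.src[OF \<phi>] a]
        delta[OF multilinear_trans.tgt[OF \<phi>] a] delta[OF multilinear_trans.tgt[OF \<psi>] a]
        delta[OF multilinear_trans.src[OF \<psi>] a]
    have "cmp D (cmp D (t_comp \<psi> ?y) (t_comp \<phi> ?y)) (m_delta (t_src \<phi>) i xs x') =
        cmp D (t_comp \<psi> ?y) (cmp D (m_delta (t_tgt \<phi>) i xs x') (asum D (t_comp \<phi> xs) (t_comp \<phi> (xs[i := x']))))"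
      using multilinear_trans.comp_delta[OF \<phi> a] eq by (simp add: D.assoc)
    also have "\<dots> = cmp D (m_delta (t_tgt \<psi>) i xs x')
        (cmp D (asum D (t_comp \<psi> xs) (t_comp \<psi> (xs[i := x']))) (asum D (t_comp \<phi> xs) (t_comp \<phi> (xs[i := x']))))"
      by (rule D.cmp_rewrite) (use multilinear_trans.comp_delta[OF \<psi> a] eq in simp_all)
    also have "\<dots> = cmp D (m_delta (t_tgt \<psi>) i xs x')
        (asum D (cmp D (t_comp \<psi> xs) (t_comp \<phi> xs)) (cmp D (t_comp \<psi> (xs[i := x'])) (t_comp \<phi> (xs[i := x']))))"
      using eq by (simp add: D.interchange)
    finally show "cmp D (t_comp (?cmp \<psi> \<phi>) ?y) (m_delta (t_src (?cmp \<psi> \<phi>)) i xs x') =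
        cmp D (m_delta (t_tgt (?cmp \<psi> \<phi>)) i xs x')
          (asum D (t_comp (?cmp \<psi> \<phi>) xs) (t_comp (?cmp \<psi> \<phi>) (xs[i := x'])))"
      by simp
  qed
  have comp_ext: "t_comp \<phi> xs = undefined" if "multilinear_trans Cs D \<phi>" "xs \<notin> Ob (prod_cat Cs)" for \<phi> xs
    using multilinear_trans.ext_comp[OF that(1)] that(2) by (auto simp: extensional_def)
  show ?thesis
  proof
    fix f g h :: "('a, 'b) mltrans" and a b c d :: "('a, 'b) mlmap"
    show "f \<in> Ar (P_hom Cs D) \<Longrightarrow> cdom (P_hom Cs D) f \<in> Ob (P_hom Cs D)"
      "f \<in> Ar (P_hom Cs D) \<Longrightarrow> ccod (P_hom Cs D) f \<in> Ob (P_hom Cs D)"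
      by (simp_all add: P_hom_def multilinear_trans.src multilinear_trans.tgt)
    show "a \<in> Ob (P_hom Cs D) \<Longrightarrow> ide (P_hom Cs D) a \<in> hom (P_hom Cs D) a a"
      using id by (simp add: P_hom_def hom_iff)
    assume f: "f \<in> hom (P_hom Cs D) a b"
    then show "cmp (P_hom Cs D) f (ide (P_hom Cs D) a) = f"
      by (auto simp: P_hom_def hom_iff fun_eq_iff restrict_def comp comp_ext intro!: mltrans.equality)
    show "cmp (P_hom Cs D) (ide (P_hom Cs D) b) f = f"
      using f by (auto simp: P_hom_def hom_iff fun_eq_iff restrict_def comp comp_ext intro!: mltrans.equality)
    assume g: "g \<in> hom (P_hom Cs D) b c"
    show "cmp (P_hom Cs D) g f \<in> hom (P_hom Cs D) a c"
      using f g cmp[of f g] by (auto simp: P_hom_def hom_iff)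
    assume h: "h \<in> hom (P_hom Cs D) c d"
    show "cmp (P_hom Cs D) h (cmp (P_hom Cs D) g f) = cmp (P_hom Cs D) (cmp (P_hom Cs D) h g) f"
      using f g h by (auto simp: P_hom_def hom_iff fun_eq_iff restrict_def comp D.assoc intro!: mltrans.equality)
  qed
qed

text \<open>All operations of a multifunctor out of an operad have powers of one category as source.\<close>

lemma Ob_pow: "xs \<in> Ob (prod_cat (replicate k A)) \<longleftrightarrow> length xs = k \<and> set xs \<subseteq> Ob A"
  by (auto simp: Ob_prod set_conv_nth)

lemma Ar_pow: "us \<in> Ar (prod_cat (replicate k A)) \<longleftrightarrow> length us = k \<and> set us \<subseteq> Ar A"
  by (auto simp: Ar_prod set_conv_nth)

lemma map2_replicate: "length xs = k \<Longrightarrow> map2 f (replicate k A) xs = map (f A) xs"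
  by (auto intro!: nth_equalityI)

lemma hom_pow:
  "us \<in> hom (prod_cat (replicate k A)) xs ys \<longleftrightarrow>
     length us = k \<and> set us \<subseteq> Ar A \<and> xs = map (cdom A) us \<and> ys = map (ccod A) us"
  by (auto simp: hom_iff Ar_pow prod_cat_simps map2_replicate)

lemma ide_pow: "length xs = k \<Longrightarrow> ide (prod_cat (replicate k A)) xs = map (ide A) xs"
  by (simp add: prod_cat_simps map2_replicate)

lemma cmp_pow:
  "length us = k \<Longrightarrow> length vs = k \<Longrightarrow> cmp (prod_cat (replicate k A)) vs us = map2 (cmp A) vs us"
  by (auto simp: prod_cat_simps intro!: nth_equalityI)

lemma delta_arg_pow:
  "delta_arg (replicate k A) i xs x' \<longleftrightarrow> i < k \<and> length xs = k \<and> set xs \<subseteq> Ob A \<and> x' \<in> Ob A"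
  by (auto simp: delta_arg_def Ob_pow)

lemma place_hom_pow:
  assumes "\<sigma> permutes {..<k}" "us \<in> hom (prod_cat (replicate k A)) xs ys"
  shows "place \<sigma> us \<in> hom (prod_cat (replicate k A)) (place \<sigma> xs) (place \<sigma> ys)"
  using assms by (auto simp: hom_pow map_place permutes_inv)

lemma P_act_o_pow:
  assumes "\<sigma> permutes {..<k}"
  shows "m_ob (P_act_o \<sigma> (replicate k A) A f) =
      restrict (\<lambda>xs. m_ob f (place \<sigma> xs)) (Ob (prod_cat (replicate k A)))"
    "m_ar (P_act_o \<sigma> (replicate k A) A f) =
      restrict (\<lambda>us. m_ar f (place \<sigma> us)) (Ar (prod_cat (replicate k A)))"
    "m_delta (P_act_o \<sigma> (replicate k A) A f) = (\<lambda>i xs x'.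
      if delta_arg (replicate k A) i xs x' then m_delta f (\<sigma> i) (place \<sigma> xs) x' else undefined)"
  using assms by (simp_all add: P_act_o_def restrict_mlmap_def)

text \<open>Every condition on a multilinear map is symmetric in the variables. Hence the condition for
  variable \<open>i\<close> of \<open>\<sigma>\<^sup>*f\<close> at \<open>xs\<close> is the condition for variable \<open>\<sigma> i\<close> of \<open>f\<close> at \<open>place \<sigma> xs\<close>.\<close>

lemma multilinear_act:
  assumes A: "permutative_category A" and f: "multilinear (replicate k A) A f" and \<sigma>: "\<sigma> permutes {..<k}"
  shows "multilinear (replicate k A) A (P_act_o \<sigma> (replicate k A) A f)" (is "multilinear ?Cs A ?g")
proof -
  interpret A: permutative_category A by fact
  interpret f: multilinear ?Cs A f by fact
  interpret F: cat_functor "prod_cat ?Cs" A "m_ob f" "m_ar f" by (rule f.functoriality)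
  note g = P_act_o_pow[OF \<sigma>, of A f]
  have Ob: "place \<sigma> xs \<in> Ob (prod_cat ?Cs)" if "xs \<in> Ob (prod_cat ?Cs)" for xs
    using that \<sigma> by (auto simp: Ob_pow permutes_inv)
  have Ar: "place \<sigma> us \<in> Ar (prod_cat ?Cs)" if "us \<in> Ar (prod_cat ?Cs)" for us
    using that \<sigma> by (auto simp: Ar_pow permutes_inv)
  have arg: "delta_arg ?Cs (\<sigma> i) (place \<sigma> xs) x'" if "delta_arg ?Cs i xs x'" for i xs x'
    using that \<sigma> by (auto simp: delta_arg_pow permutes_inv permutes_less)
  have upd: "place \<sigma> (xs[i := y]) = (place \<sigma> xs)[\<sigma> i := y]" if "length xs = k" "i < k" for xs :: "'c list" and i y
    using place_list_update[of \<sigma> xs i y] that \<sigma> by simp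
  have nth: "place \<sigma> xs ! \<sigma> i = xs ! i" if "length xs = k" "i < k" for xs :: "'c list" and i
    using place_nth[of \<sigma> xs i] that \<sigma> by simp
  note [simp] = upd nth
  have upd_Ob: "xs[i := y] \<in> Ob (prod_cat ?Cs)" if "xs \<in> Ob (prod_cat ?Cs)" "y \<in> Ob A" for xs i y
    using that set_update_subset_insert[of xs i y] by (auto simp: Ob_pow)
  have upd_Ar: "us[i := u] \<in> Ar (prod_cat ?Cs)" if "us \<in> Ar (prod_cat ?Cs)" "u \<in> Ar A" for us i u
    using that set_update_subset_insert[of us i u] by (auto simp: Ar_pow)
  have mem: "xs ! i \<in> Ob A" if "xs \<in> Ob (prod_cat ?Cs)" "i < k" for xs i
    using that by (auto simp: Ob_pow)
  have argD: "i < k" "length xs = k" "xs \<in> Ob (prod_cat ?Cs)" "x' \<in> Ob A" "xs ! i \<in> Ob A"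
    if "delta_arg ?Cs i xs x'" for i xs x'
    using that by (auto simp: delta_arg_pow Ob_pow)
  have argI: "delta_arg ?Cs i xs x'" if "i < k" "xs \<in> Ob (prod_cat ?Cs)" "x' \<in> Ob A" for i xs x'
    using that by (auto simp: delta_arg_pow Ob_pow)
  show ?thesis
  proof
    show "m_ob ?g a \<in> Ob A" if "a \<in> Ob (prod_cat ?Cs)" for a
      using that Ob[OF that] by (simp add: g F.ob_in)
    show "m_ar ?g u \<in> hom A (m_ob ?g a) (m_ob ?g b)" if u: "u \<in> hom (prod_cat ?Cs) a b" for u a b
    proof -
      have "u \<in> Ar (prod_cat ?Cs)" "a \<in> Ob (prod_cat ?Cs)" "b \<in> Ob (prod_cat ?Cs)"
        using u by (auto simp: hom_pow Ar_pow Ob_pow)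
      then show ?thesis using F.ar_in[OF place_hom_pow[OF \<sigma> u]] by (simp add: g)
    qed
    show "m_ar ?g (ide (prod_cat ?Cs) a) = ide A (m_ob ?g a)" if a: "a \<in> Ob (prod_cat ?Cs)" for a
    proof -
      have "ide (prod_cat ?Cs) a \<in> Ar (prod_cat ?Cs)" "place \<sigma> (ide (prod_cat ?Cs) a) = ide (prod_cat ?Cs) (place \<sigma> a)"
        using a \<sigma> by (auto simp: Ob_pow Ar_pow ide_pow map_place)
      then show ?thesis using a F.ar_ide[OF Ob[OF a]] by (simp add: g)
    qed
    show "m_ar ?g (cmp (prod_cat ?Cs) v u) = cmp A (m_ar ?g v) (m_ar ?g u)"
      if u: "u \<in> hom (prod_cat ?Cs) a b" and v: "v \<in> hom (prod_cat ?Cs) b c" for u v a b c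
    proof -
      have "u \<in> Ar (prod_cat ?Cs)" "v \<in> Ar (prod_cat ?Cs)" "cmp (prod_cat ?Cs) v u \<in> Ar (prod_cat ?Cs)"
        using u v F.source.cmp_in[OF u v] by (auto simp: hom_iff)
      moreover have "place \<sigma> (cmp (prod_cat ?Cs) v u) = cmp (prod_cat ?Cs) (place \<sigma> v) (place \<sigma> u)"
      proof -
        have l: "length u = k" "length v = k" using u v by (simp_all add: hom_pow)
        show ?thesis
          using l permutes_less[OF permutes_inv[OF \<sigma>]]
          by (intro nth_equalityI) (simp_all add: cmp_pow nth_permute_list)
      qed
      ultimately show ?thesis
        using F.ar_cmp[OF place_hom_pow[OF \<sigma> u] place_hom_pow[OF \<sigma> v]] by (simp only: g restrict_apply if_True)
    qed
    show "m_ob ?g \<in> extensional (Ob (prod_cat ?Cs))" "m_ar ?g \<in> extensional (Ar (prod_cat ?Cs))"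
      by (simp_all add: g)
    show "\<not> delta_arg ?Cs i xs x' \<Longrightarrow> m_delta ?g i xs x' = undefined" for i xs x'
      by (simp add: g)
    show "m_ob ?g xs = zero A" if "xs \<in> Ob (prod_cat ?Cs)" "i < length ?Cs" "xs ! i = zero (?Cs ! i)" for xs i
      using f.zero_ob[OF Ob[OF that(1)], of "\<sigma> i"] that \<sigma> by (auto simp: g permutes_less Ob_pow)
    show "m_ar ?g us = ide A (zero A)"
      if "us \<in> Ar (prod_cat ?Cs)" "i < length ?Cs" "us ! i = ide (?Cs ! i) (zero (?Cs ! i))" for us i
      using f.zero_ar[OF Ar[OF that(1)], of "\<sigma> i"] that \<sigma> place_nth[of \<sigma> us i]
      by (auto simp: g permutes_less Ar_pow)
    show "m_delta ?g i xs x' \<in> hom A (osum A (m_ob ?g xs) (m_ob ?g (xs[i := x'])))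
        (m_ob ?g (xs[i := osum (?Cs ! i) (xs ! i) x']))" if a: "delta_arg ?Cs i xs x'" for i xs x'
      using f.delta_in[OF arg[OF a]] argD[OF a] a \<sigma> by (simp add: g upd_Ob permutes_less)
    show "cmp A (m_ar ?g (us[i := asum (?Cs ! i) (us ! i) u'])) (m_delta ?g i xs x') =
        cmp A (m_delta ?g i ys y') (asum A (m_ar ?g us) (m_ar ?g (us[i := u'])))"
      if us: "us \<in> hom (prod_cat ?Cs) xs ys" and i: "i < length ?Cs" and u': "u' \<in> hom (?Cs ! i) x' y'"
      for us xs ys i u' x' y'
    proof -
      have i': "i < k" "\<sigma> i < k" using i \<sigma> by (auto simp: permutes_less)
      have us': "us \<in> Ar (prod_cat ?Cs)" "us ! i \<in> Ar A" "length us = k"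
        using us i by (auto simp: hom_pow Ar_pow)
      have xs': "xs \<in> Ob (prod_cat ?Cs)" "ys \<in> Ob (prod_cat ?Cs)"
        using F.source.dom_in[OF us'(1)] F.source.cod_in[OF us'(1)] us by (simp_all add: hom_iff)
      then have l: "length xs = k" "length ys = k" by (simp_all add: Ob_pow)
      have u'': "u' \<in> Ar A" "x' \<in> Ob A" "y' \<in> Ob A"
        using u' i by (auto simp: hom_iff)
      have 1: "m_ar ?g (us[i := w]) = m_ar f ((place \<sigma> us)[\<sigma> i := w])" if "w \<in> Ar A" for w
        using upd_Ar[OF us'(1) that] upd[OF us'(3) i'(1)] by (simp add: g)
      have 2: "m_delta ?g i xs x' = m_delta f (\<sigma> i) (place \<sigma> xs) x'"
        "m_delta ?g i ys y' = m_delta f (\<sigma> i) (place \<sigma> ys) y'" "m_ar ?g us = m_ar f (place \<sigma> us)"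
        using us' xs' u'' i' by (simp_all add: g argI)
      have 3: "place \<sigma> us ! \<sigma> i = us ! i" by (rule nth[OF us'(3) i'(1)])
      from f.delta_nat[OF place_hom_pow[OF \<sigma> us], of "\<sigma> i" u' x' y'] show ?thesis
        using us' i' u' u'' by (simp add: 1 2 3)
    qed
    show "m_delta ?g i xs x' = ide A (m_ob ?g (xs[i := osum (?Cs ! i) (xs ! i) x']))"
      if a: "delta_arg ?Cs i xs x'" and z: "x' = zero (?Cs ! i) \<or> (\<exists>j < length ?Cs. xs ! j = zero (?Cs ! j))"
      for i xs x'
    proof -
      have "x' = zero (?Cs ! \<sigma> i) \<or> (\<exists>j < length ?Cs. place \<sigma> xs ! j = zero (?Cs ! j))"
        using z
      proof
        assume "\<exists>j < length ?Cs. xs ! j = zero (?Cs ! j)"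
        then obtain j where "j < k" "xs ! j = zero A" by auto
        then have "\<sigma> j < length ?Cs \<and> place \<sigma> xs ! \<sigma> j = zero (?Cs ! \<sigma> j)"
          using argD[OF a] \<sigma> by (simp add: permutes_less)
        then show ?thesis by blast
      qed (use argD[OF a] \<sigma> in \<open>simp add: permutes_less\<close>)
      then show ?thesis
        using f.delta_zero[OF arg[OF a]] argD[OF a] a \<sigma> by (simp add: g upd_Ob permutes_less)
    qed
    show "cmp A (m_ar ?g ((ide (prod_cat ?Cs) xs)[i := sym (?Cs ! i) (xs ! i) x'])) (m_delta ?g i xs x') =
        cmp A (m_delta ?g i (xs[i := x']) (xs ! i)) (sym A (m_ob ?g xs) (m_ob ?g (xs[i := x'])))"
      if a: "delta_arg ?Cs i xs x'" for i xs x'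
    proof -
      have "(ide (prod_cat ?Cs) xs)[i := sym A (xs ! i) x'] \<in> Ar (prod_cat ?Cs)"
        by (rule upd_Ar) (use argD[OF a] F.source.ide_in[of xs] in \<open>auto simp: hom_iff\<close>)
      moreover have "place \<sigma> ((ide (prod_cat ?Cs) xs)[i := sym A (xs ! i) x']) =
          (ide (prod_cat ?Cs) (place \<sigma> xs))[\<sigma> i := sym A (xs ! i) x']"
        using place_list_update[of \<sigma> "map (ide A) xs" i] argD[OF a] \<sigma> by (simp add: ide_pow map_place)
      ultimately show ?thesis
        using f.delta_sym[OF arg[OF a]] argD[OF a] a \<sigma> by (simp add: g upd_Ob permutes_less argI)
    qed
    show "cmp A (m_delta ?g i (xs[i := osum (?Cs ! i) (xs ! i) x']) x'')
          (asum A (m_delta ?g i xs x') (ide A (m_ob ?g (xs[i := x''])))) =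
        cmp A (m_delta ?g i xs (osum (?Cs ! i) x' x''))
          (asum A (ide A (m_ob ?g xs)) (m_delta ?g i (xs[i := x']) x''))"
      if a: "delta_arg ?Cs i xs x'" and x: "x'' \<in> Ob (?Cs ! i)" for i xs x' x''
      using f.delta_assoc[OF arg[OF a], of x''] x argD[OF a] a \<sigma> by (simp add: g upd_Ob permutes_less argI)
    show "cmp A (m_delta ?g j (xs[i := osum (?Cs ! i) (xs ! i) x']) y')
          (asum A (m_delta ?g i xs x') (m_delta ?g i (xs[j := y']) x')) =
        cmp A (m_delta ?g i (xs[j := osum (?Cs ! j) (xs ! j) y']) x')
          (cmp A (asum A (m_delta ?g j xs y') (m_delta ?g j (xs[i := x']) y'))
            (asum A (asum A (ide A (m_ob ?g xs)) (sym A (m_ob ?g (xs[i := x'])) (m_ob ?g (xs[j := y']))))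
              (ide A (m_ob ?g (xs[i := x', j := y'])))))"
      if a: "delta_arg ?Cs i xs x'" and b: "delta_arg ?Cs j xs y'" and ij: "i \<noteq> j" for i j xs x' y'
    proof -
      have "\<sigma> i \<noteq> \<sigma> j" using ij permutes_inj[OF \<sigma>] by (auto dest: injD)
      from f.delta_delta[OF arg[OF a] arg[OF b] this] show ?thesis
        using argD[OF a] argD[OF b] a b \<sigma> by (simp add: g upd_Ob permutes_less argI)
    qed
  qed
qed

section \<open>Distributivity in one factor of a tensor product\<close>

text \<open>The conditions from which the operations for the objects of \<open>\<Sigma>\<^sub>*\<close> are built. The same
  permutations are the objects of \<open>E\<Sigma>\<^sub>*\<close>, and a bipermutative structure satisfies the last
  condition as well. The type of \<open>S\<close> leaves room for a symmetry as a further component.\<close>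

locale tensor_category = distributive_structure A S + add: permutative_category A
  for A :: "('o, 'm) permcat" and S :: "('o, 'm, 'z) tensor_scheme" +
  assumes d_r_d_l_times:
    "a \<in> Ob A \<Longrightarrow> b \<in> Ob A \<Longrightarrow> b' \<in> Ob A \<Longrightarrow> c \<in> Ob A \<Longrightarrow>
     cmp A (atimes S (d_r S a b b') (ide A c)) (d_l S (otimes S a b) (otimes S a b') c) =
     cmp A (atimes S (ide A a) (d_l S b b' c)) (d_r S a (otimes S b c) (otimes S b' c))"
begin

abbreviation oplus_ob (infixr \<open>\<oplus>\<close> 65) where "a \<oplus> b \<equiv> osum A a b"
abbreviation oplus_ar (infixr \<open>\<boxplus>\<close> 65) where "u \<boxplus> v \<equiv> asum A u v"
abbreviation otimes_ob (infixr \<open>\<otimes>\<close> 70) where "a \<otimes> b \<equiv> otimes S a b"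
abbreviation otimes_ar (infixr \<open>\<boxtimes>\<close> 70) where "u \<boxtimes> v \<equiv> atimes S u v"
abbreviation comp_ar (infixr \<open>\<cdot>\<close> 60) where "g \<cdot> f \<equiv> cmp A g f"
abbreviation ident (\<open>\<iota>\<close>) where "\<iota> a \<equiv> ide A a"
abbreviation swap_sum (\<open>\<gamma>\<close>) where "\<gamma> a b \<equiv> permcat.sym A a b"
abbreviation dl where "dl \<equiv> d_l S"
abbreviation dr where "dr \<equiv> d_r S"
abbreviation zob (\<open>\<zero>\<close>) where "\<zero> \<equiv> zero A"
abbreviation one (\<open>\<one>\<close>) where "\<one> \<equiv> tone S"

lemma d_simps [simp]:
  assumes "a \<in> Ob A" "b \<in> Ob A" "c \<in> Ob A"
  shows "dl a b c \<in> Ar A" "cdom A (dl a b c) = (a \<otimes> c) \<oplus> (b \<otimes> c)" "ccod A (dl a b c) = (a \<oplus> b) \<otimes> c"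
    "dr a b c \<in> Ar A" "cdom A (dr a b c) = (a \<otimes> b) \<oplus> (a \<otimes> c)" "ccod A (dr a b c) = a \<otimes> (b \<oplus> c)"
  using d_l_in[OF assms] d_r_in[OF assms] by (simp_all add: hom_iff)

lemma dl_natural:
  assumes "u \<in> Ar A" "u' \<in> Ar A" "v \<in> Ar A"
    "cdom A u = a" "cdom A u' = a'" "cdom A v = b" "ccod A u = c" "ccod A u' = c'" "ccod A v = d"
  shows "((u \<boxplus> u') \<boxtimes> v) \<cdot> dl a a' b = dl c c' d \<cdot> ((u \<boxtimes> v) \<boxplus> (u' \<boxtimes> v))"
  using d_l_nat[of u a c u' a' c' v b d] assms by (simp add: hom_iff)

lemma dr_natural:
  assumes "u \<in> Ar A" "v \<in> Ar A" "v' \<in> Ar A"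
    "cdom A u = a" "cdom A v = b" "cdom A v' = b'" "ccod A u = c" "ccod A v = d" "ccod A v' = d'"
  shows "(u \<boxtimes> (v \<boxplus> v')) \<cdot> dr a b b' = dr c d d' \<cdot> ((u \<boxtimes> v) \<boxplus> (u \<boxtimes> v'))"
  using d_r_nat[of u a c v b d v' b' d'] assms by (simp add: hom_iff)

lemma times_assoc [simp]:
  "a \<in> Ob A \<Longrightarrow> b \<in> Ob A \<Longrightarrow> c \<in> Ob A \<Longrightarrow> (a \<otimes> b) \<otimes> c = a \<otimes> b \<otimes> c"
  "u \<in> Ar A \<Longrightarrow> v \<in> Ar A \<Longrightarrow> w \<in> Ar A \<Longrightarrow> (u \<boxtimes> v) \<boxtimes> w = u \<boxtimes> v \<boxtimes> w"
  by (fact to_assoc, fact ta_assoc)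

lemma plus_assoc [simp]:
  "a \<in> Ob A \<Longrightarrow> b \<in> Ob A \<Longrightarrow> c \<in> Ob A \<Longrightarrow> (a \<oplus> b) \<oplus> c = a \<oplus> b \<oplus> c"
  "u \<in> Ar A \<Longrightarrow> v \<in> Ar A \<Longrightarrow> w \<in> Ar A \<Longrightarrow> (u \<boxplus> v) \<boxplus> w = u \<boxplus> v \<boxplus> w"
  by (fact add.to_assoc, fact add.ta_assoc)

declare times_zero [simp]

text \<open>The distributivity map of a product \<open>L \<otimes> x \<otimes> R\<close> in the variable \<open>x\<close>, where \<open>L\<close> and
  \<open>R\<close> are the products of the factors on the left and on the right. By the last condition of the
  locale, applying \<open>d_r\<close> before \<open>d_l\<close> would give the same map.\<close>

definition delta :: "'o \<Rightarrow> 'o \<Rightarrow> 'o \<Rightarrow> 'o \<Rightarrow> 'm" where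
  "delta L R x x' = (dr L x x' \<boxtimes> \<iota> R) \<cdot> dl (L \<otimes> x) (L \<otimes> x') R"

lemma delta_simps [simp]:
  assumes "L \<in> Ob A" "R \<in> Ob A" "x \<in> Ob A" "x' \<in> Ob A"
  shows "delta L R x x' \<in> Ar A" "cdom A (delta L R x x') = (L \<otimes> x \<otimes> R) \<oplus> (L \<otimes> x' \<otimes> R)"
    "ccod A (delta L R x x') = L \<otimes> (x \<oplus> x') \<otimes> R"
  using assms by (simp_all add: delta_def)

lemma delta_one:
  "L \<in> Ob A \<Longrightarrow> x \<in> Ob A \<Longrightarrow> x' \<in> Ob A \<Longrightarrow> delta L \<one> x x' = dr L x x'"
  "R \<in> Ob A \<Longrightarrow> x \<in> Ob A \<Longrightarrow> x' \<in> Ob A \<Longrightarrow> delta \<one> R x x' = dl x x' R"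
  by (simp_all add: delta_def d_l_one d_r_one)

lemma delta_natural:
  assumes "u \<in> Ar A" "w \<in> Ar A" "w' \<in> Ar A" "v \<in> Ar A"
    and [simp]: "cdom A u = L" "cdom A w = x" "cdom A w' = x'" "cdom A v = R"
      "ccod A u = M" "ccod A w = y" "ccod A w' = y'" "ccod A v = Q"
  shows "(u \<boxtimes> (w \<boxplus> w') \<boxtimes> v) \<cdot> delta L R x x' =
    delta M Q y y' \<cdot> ((u \<boxtimes> w \<boxtimes> v) \<boxplus> (u \<boxtimes> w' \<boxtimes> v))"
proof -
  note [simp] = assms(1-4)
  have [simp]: "L \<in> Ob A" "x \<in> Ob A" "x' \<in> Ob A" "R \<in> Ob A" "M \<in> Ob A" "y \<in> Ob A" "y' \<in> Ob A" "Q \<in> Ob A"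
    using assms(1-4)[THEN Ob_dom] assms(1-4)[THEN Ob_cod] by simp_all
  have "(u \<boxtimes> (w \<boxplus> w') \<boxtimes> v) \<cdot> delta L R x x' =
      (((u \<boxtimes> (w \<boxplus> w')) \<boxtimes> v) \<cdot> (dr L x x' \<boxtimes> \<iota> R)) \<cdot> dl (L \<otimes> x) (L \<otimes> x') R"
    by (simp add: delta_def assoc)
  also have "((u \<boxtimes> (w \<boxplus> w')) \<boxtimes> v) \<cdot> (dr L x x' \<boxtimes> \<iota> R) = ((u \<boxtimes> (w \<boxplus> w')) \<cdot> dr L x x') \<boxtimes> (v \<cdot> \<iota> R)"
    by (rule interchange) simp_all
  also have "\<dots> = (dr M y y' \<cdot> ((u \<boxtimes> w) \<boxplus> (u \<boxtimes> w'))) \<boxtimes> (\<iota> Q \<cdot> v)"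
    by (simp add: dr_natural)
  also have "\<dots> = (dr M y y' \<boxtimes> \<iota> Q) \<cdot> (((u \<boxtimes> w) \<boxplus> (u \<boxtimes> w')) \<boxtimes> v)"
    by (rule interchange[symmetric]) simp_all
  also have "\<dots> \<cdot> dl (L \<otimes> x) (L \<otimes> x') R =
      (dr M y y' \<boxtimes> \<iota> Q) \<cdot> ((((u \<boxtimes> w) \<boxplus> (u \<boxtimes> w')) \<boxtimes> v) \<cdot> dl (L \<otimes> x) (L \<otimes> x') R)"
    by (rule assoc) simp_all
  also have "(((u \<boxtimes> w) \<boxplus> (u \<boxtimes> w')) \<boxtimes> v) \<cdot> dl (L \<otimes> x) (L \<otimes> x') R =
      dl (M \<otimes> y) (M \<otimes> y') Q \<cdot> (((u \<boxtimes> w) \<boxtimes> v) \<boxplus> ((u \<boxtimes> w') \<boxtimes> v))"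
    by (rule dl_natural) simp_all
  finally show ?thesis by (simp add: delta_def assoc)
qed

lemma delta_is_zero:
  assumes "L \<in> Ob A" "R \<in> Ob A" "x \<in> Ob A" "x' \<in> Ob A"
    and "L = \<zero> \<or> R = \<zero> \<or> x = \<zero> \<or> x' = \<zero>"
  shows "delta L R x x' = \<iota> (L \<otimes> (x \<oplus> x') \<otimes> R)"
  using assms(5) assms(1-4)
  by (elim disjE) (simp_all add: delta_def d_l_zero d_r_zero)

lemma delta_swap:
  assumes [simp]: "L \<in> Ob A" "R \<in> Ob A" "x \<in> Ob A" "x' \<in> Ob A"
  shows "(\<iota> L \<boxtimes> \<gamma> x x' \<boxtimes> \<iota> R) \<cdot> delta L R x x' =
    delta L R x' x \<cdot> \<gamma> (L \<otimes> x \<otimes> R) (L \<otimes> x' \<otimes> R)"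
proof -
  have "(\<iota> L \<boxtimes> \<gamma> x x' \<boxtimes> \<iota> R) \<cdot> delta L R x x' =
      (((\<iota> L \<boxtimes> \<gamma> x x') \<boxtimes> \<iota> R) \<cdot> (dr L x x' \<boxtimes> \<iota> R)) \<cdot> dl (L \<otimes> x) (L \<otimes> x') R"
    by (simp add: delta_def assoc)
  also have "((\<iota> L \<boxtimes> \<gamma> x x') \<boxtimes> \<iota> R) \<cdot> (dr L x x' \<boxtimes> \<iota> R) =
      ((\<iota> L \<boxtimes> \<gamma> x x') \<cdot> dr L x x') \<boxtimes> (\<iota> R \<cdot> \<iota> R)"
    by (rule interchange) simp_all
  also have "\<dots> = (dr L x' x \<cdot> \<gamma> (L \<otimes> x) (L \<otimes> x')) \<boxtimes> (\<iota> R \<cdot> \<iota> R)"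
    by (simp add: d_r_sym)
  also have "\<dots> = (dr L x' x \<boxtimes> \<iota> R) \<cdot> (\<gamma> (L \<otimes> x) (L \<otimes> x') \<boxtimes> \<iota> R)"
    by (rule interchange[symmetric]) simp_all
  also have "\<dots> \<cdot> dl (L \<otimes> x) (L \<otimes> x') R =
      (dr L x' x \<boxtimes> \<iota> R) \<cdot> ((\<gamma> (L \<otimes> x) (L \<otimes> x') \<boxtimes> \<iota> R) \<cdot> dl (L \<otimes> x) (L \<otimes> x') R)"
    by (rule assoc) simp_all
  finally show ?thesis by (simp add: delta_def assoc d_l_sym)
qed

lemma delta_associative:
  assumes [simp]: "L \<in> Ob A" "R \<in> Ob A" "x \<in> Ob A" "x' \<in> Ob A" "x'' \<in> Ob A"
  shows "delta L R (x \<oplus> x') x'' \<cdot> (delta L R x x' \<boxplus> \<iota> (L \<otimes> x'' \<otimes> R)) =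
    delta L R x (x' \<oplus> x'') \<cdot> (\<iota> (L \<otimes> x \<otimes> R) \<boxplus> delta L R x' x'')"
proof -
  let ?a = "L \<otimes> x" and ?a' = "L \<otimes> x'" and ?a'' = "L \<otimes> x''"
  have "delta L R (x \<oplus> x') x'' \<cdot> (delta L R x x' \<boxplus> \<iota> (L \<otimes> x'' \<otimes> R)) =
      (dr L (x \<oplus> x') x'' \<boxtimes> \<iota> R) \<cdot> (dl (L \<otimes> (x \<oplus> x')) ?a'' R \<cdot>
        (((dr L x x' \<boxtimes> \<iota> R) \<cdot> dl ?a ?a' R) \<boxplus> ((\<iota> ?a'' \<boxtimes> \<iota> R) \<cdot> \<iota> (?a'' \<otimes> R))))"
    by (simp add: delta_def assoc)
  also have "\<dots> = (dr L (x \<oplus> x') x'' \<boxtimes> \<iota> R) \<cdot> (dl (L \<otimes> (x \<oplus> x')) ?a'' R \<cdot>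
        (((dr L x x' \<boxtimes> \<iota> R) \<boxplus> (\<iota> ?a'' \<boxtimes> \<iota> R)) \<cdot> (dl ?a ?a' R \<boxplus> \<iota> (?a'' \<otimes> R))))"
    by (subst add.interchange) simp_all
  also have "dl (L \<otimes> (x \<oplus> x')) ?a'' R \<cdot>
        (((dr L x x' \<boxtimes> \<iota> R) \<boxplus> (\<iota> ?a'' \<boxtimes> \<iota> R)) \<cdot> (dl ?a ?a' R \<boxplus> \<iota> (?a'' \<otimes> R))) =
      ((dr L x x' \<boxplus> \<iota> ?a'') \<boxtimes> \<iota> R) \<cdot> (dl (?a \<oplus> ?a') ?a'' R \<cdot> (dl ?a ?a' R \<boxplus> \<iota> (?a'' \<otimes> R)))"
    by (rule cmp_rewrite, rule dl_natural[symmetric]) simp_all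
  also have "dl (?a \<oplus> ?a') ?a'' R \<cdot> (dl ?a ?a' R \<boxplus> \<iota> (?a'' \<otimes> R)) =
      dl ?a (?a' \<oplus> ?a'') R \<cdot> (\<iota> (?a \<otimes> R) \<boxplus> dl ?a' ?a'' R)"
    by (rule d_l_assoc) simp_all
  also have "(dr L (x \<oplus> x') x'' \<boxtimes> \<iota> R) \<cdot> (((dr L x x' \<boxplus> \<iota> ?a'') \<boxtimes> \<iota> R) \<cdot>
        (dl ?a (?a' \<oplus> ?a'') R \<cdot> (\<iota> (?a \<otimes> R) \<boxplus> dl ?a' ?a'' R))) =
      (dr L x (x' \<oplus> x'') \<boxtimes> \<iota> R) \<cdot> (((\<iota> ?a \<boxplus> dr L x' x'') \<boxtimes> \<iota> R) \<cdot>
        (dl ?a (?a' \<oplus> ?a'') R \<cdot> (\<iota> (?a \<otimes> R) \<boxplus> dl ?a' ?a'' R)))"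
    by (rule cmp_rewrite) (simp_all add: interchange d_r_assoc)
  also have "((\<iota> ?a \<boxplus> dr L x' x'') \<boxtimes> \<iota> R) \<cdot>
        (dl ?a (?a' \<oplus> ?a'') R \<cdot> (\<iota> (?a \<otimes> R) \<boxplus> dl ?a' ?a'' R)) =
      dl ?a (L \<otimes> (x' \<oplus> x'')) R \<cdot> (((\<iota> ?a \<boxtimes> \<iota> R) \<boxplus> (dr L x' x'' \<boxtimes> \<iota> R)) \<cdot> (\<iota> (?a \<otimes> R) \<boxplus> dl ?a' ?a'' R))"
    by (rule cmp_rewrite, rule dl_natural) simp_all
  finally show ?thesis by (simp add: delta_def assoc add.interchange)
qed

text \<open>If \<open>L \<otimes> x \<otimes> R\<close> is itself a factor of a product, one can first distribute over the outer
  factors and then over the inner ones. As \<open>\<Gamma>\<close> composes distributivity maps in this way, this is why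
  iterated products are stable under \<open>\<Gamma>\<close>. The two conditions on \<open>d_l\<close> and \<open>d_r\<close> at products
  treat the nesting on one side, and the mixed condition exchanges the inner \<open>d_l\<close> with the
  outer \<open>d_r\<close>.\<close>

lemma delta_nested:
  assumes [simp]: "L \<in> Ob A" "R \<in> Ob A" "L' \<in> Ob A" "R' \<in> Ob A" "x \<in> Ob A" "x' \<in> Ob A"
  shows "(\<iota> L' \<boxtimes> delta L R x x' \<boxtimes> \<iota> R') \<cdot> delta L' R' (L \<otimes> x \<otimes> R) (L \<otimes> x' \<otimes> R) =
    delta (L' \<otimes> L) (R \<otimes> R') x x'"
proof -
  let ?y = "L \<otimes> x" and ?y' = "L \<otimes> x'"
  have "(\<iota> L' \<boxtimes> delta L R x x') \<cdot> dr L' (?y \<otimes> R) (?y' \<otimes> R) =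
      (\<iota> L' \<boxtimes> dr L x x' \<boxtimes> \<iota> R) \<cdot> ((\<iota> L' \<boxtimes> dl ?y ?y' R) \<cdot> dr L' (?y \<otimes> R) (?y' \<otimes> R))"
    using interchange[of "\<iota> L'" "\<iota> L'" "dl ?y ?y' R" "dr L x x' \<boxtimes> \<iota> R"]
    by (simp add: delta_def flip: assoc)
  also have "(\<iota> L' \<boxtimes> dl ?y ?y' R) \<cdot> dr L' (?y \<otimes> R) (?y' \<otimes> R) =
      (dr L' ?y ?y' \<boxtimes> \<iota> R) \<cdot> dl (L' \<otimes> ?y) (L' \<otimes> ?y') R"
    by (rule d_r_d_l_times[symmetric]) simp_all
  also have "(\<iota> L' \<boxtimes> dr L x x' \<boxtimes> \<iota> R) \<cdot> \<dots> = (dr (L' \<otimes> L) x x' \<boxtimes> \<iota> R) \<cdot> dl (L' \<otimes> ?y) (L' \<otimes> ?y') R"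
    using interchange[of "dr L' ?y ?y'" "\<iota> L' \<boxtimes> dr L x x'" "\<iota> R" "\<iota> R"]
    by (simp add: d_r_times flip: assoc)
  finally have 1: "(\<iota> L' \<boxtimes> delta L R x x') \<cdot> dr L' (?y \<otimes> R) (?y' \<otimes> R) =
      (dr (L' \<otimes> L) x x' \<boxtimes> \<iota> R) \<cdot> dl (L' \<otimes> ?y) (L' \<otimes> ?y') R" .
  have "(\<iota> L' \<boxtimes> delta L R x x' \<boxtimes> \<iota> R') \<cdot> delta L' R' (?y \<otimes> R) (?y' \<otimes> R) =
      (((\<iota> L' \<boxtimes> delta L R x x') \<boxtimes> \<iota> R') \<cdot> (dr L' (?y \<otimes> R) (?y' \<otimes> R) \<boxtimes> \<iota> R')) \<cdot>
        dl (L' \<otimes> ?y \<otimes> R) (L' \<otimes> ?y' \<otimes> R) R'"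
    by (simp add: delta_def assoc)
  also have "((\<iota> L' \<boxtimes> delta L R x x') \<boxtimes> \<iota> R') \<cdot> (dr L' (?y \<otimes> R) (?y' \<otimes> R) \<boxtimes> \<iota> R') =
      ((dr (L' \<otimes> L) x x' \<boxtimes> \<iota> R) \<cdot> dl (L' \<otimes> ?y) (L' \<otimes> ?y') R) \<boxtimes> (\<iota> R' \<cdot> \<iota> R')"
    unfolding 1[symmetric] by (rule interchange) simp_all
  also have "\<dots> = ((dr (L' \<otimes> L) x x' \<boxtimes> \<iota> R) \<boxtimes> \<iota> R') \<cdot> (dl (L' \<otimes> ?y) (L' \<otimes> ?y') R \<boxtimes> \<iota> R')"
    by (rule interchange[symmetric]) simp_all
  finally show ?thesis
    using d_l_times[of "L' \<otimes> ?y" "L' \<otimes> ?y'" R R'] by (simp add: delta_def assoc)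
qed

lemma delta_split:
  assumes [simp]: "L \<in> Ob A" "M \<in> Ob A" "R \<in> Ob A" "x \<in> Ob A" "x' \<in> Ob A"
  shows "delta L (M \<otimes> R) x x' = (delta L M x x' \<boxtimes> \<iota> R) \<cdot> dl (L \<otimes> x \<otimes> M) (L \<otimes> x' \<otimes> M) R"
  using delta_nested[of L M \<one> R x x'] by (simp add: delta_one)

lemma dl_middle:
  assumes [simp]: "P \<in> Ob A" "Q \<in> Ob A" "X \<in> Ob A" "Y \<in> Ob A" "R \<in> Ob A"
  shows "dl (P \<oplus> Q) (X \<oplus> Y) R \<cdot> (dl P Q R \<boxplus> dl X Y R) =
    dl P (Q \<oplus> X \<oplus> Y) R \<cdot> (\<iota> (P \<otimes> R) \<boxplus> (dl (Q \<oplus> X) Y R \<cdot> (dl Q X R \<boxplus> \<iota> (Y \<otimes> R))))"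
proof -
  have "dl (P \<oplus> Q) (X \<oplus> Y) R \<cdot> (dl P Q R \<boxplus> dl X Y R) =
      dl (P \<oplus> Q) (X \<oplus> Y) R \<cdot> ((dl P Q R \<boxplus> \<iota> ((X \<oplus> Y) \<otimes> R)) \<cdot> (\<iota> ((P \<otimes> R) \<oplus> (Q \<otimes> R)) \<boxplus> dl X Y R))"
    by (simp add: add.interchange)
  also have "\<dots> = dl P (Q \<oplus> X \<oplus> Y) R \<cdot>
      ((\<iota> (P \<otimes> R) \<boxplus> dl Q (X \<oplus> Y) R) \<cdot> (\<iota> ((P \<otimes> R) \<oplus> (Q \<otimes> R)) \<boxplus> dl X Y R))"
    by (rule cmp_rewrite) (simp_all add: d_l_assoc)
  also have "(\<iota> (P \<otimes> R) \<boxplus> dl Q (X \<oplus> Y) R) \<cdot> (\<iota> ((P \<otimes> R) \<oplus> (Q \<otimes> R)) \<boxplus> dl X Y R) =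
      \<iota> (P \<otimes> R) \<boxplus> (dl Q (X \<oplus> Y) R \<cdot> (\<iota> (Q \<otimes> R) \<boxplus> dl X Y R))"
    using add.interchange[of "\<iota> (P \<otimes> R)" "\<iota> (P \<otimes> R)" "\<iota> (Q \<otimes> R) \<boxplus> dl X Y R" "dl Q (X \<oplus> Y) R"]
      plus_assoc(2)[of "\<iota> (P \<otimes> R)" "\<iota> (Q \<otimes> R)" "dl X Y R"]
    by simp
  finally show ?thesis by (simp add: d_l_assoc)
qed

text \<open>A fourfold sum in \<open>_ \<otimes> R\<close> can be formed after an exchange of the two middle terms. Moving
  the brackets to the middle terms by \<open>dl_middle\<close> reduces the claim to the compatibility of \<open>d_l\<close>
  with the symmetry of the sum.\<close>

lemma dl_four:
  assumes [simp]: "P \<in> Ob A" "Q \<in> Ob A" "X \<in> Ob A" "Y \<in> Ob A" "R \<in> Ob A"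
  shows "((\<iota> P \<boxplus> \<gamma> Q X \<boxplus> \<iota> Y) \<boxtimes> \<iota> R) \<cdot> (dl (P \<oplus> Q) (X \<oplus> Y) R \<cdot> (dl P Q R \<boxplus> dl X Y R)) =
    dl (P \<oplus> X) (Q \<oplus> Y) R \<cdot> ((dl P X R \<boxplus> dl Q Y R) \<cdot> (\<iota> (P \<otimes> R) \<boxplus> \<gamma> (Q \<otimes> R) (X \<otimes> R) \<boxplus> \<iota> (Y \<otimes> R)))"
proof -
  let ?E = "dl (Q \<oplus> X) Y R \<cdot> (dl Q X R \<boxplus> \<iota> (Y \<otimes> R))"
  let ?E' = "dl (X \<oplus> Q) Y R \<cdot> (dl X Q R \<boxplus> \<iota> (Y \<otimes> R))"
  have "((\<gamma> Q X \<boxplus> \<iota> Y) \<boxtimes> \<iota> R) \<cdot> ?E = dl (X \<oplus> Q) Y R \<cdot> (((\<gamma> Q X \<boxtimes> \<iota> R) \<boxplus> (\<iota> Y \<boxtimes> \<iota> R)) \<cdot> (dl Q X R \<boxplus> \<iota> (Y \<otimes> R)))"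
    by (rule cmp_rewrite, rule dl_natural) simp_all
  also have "\<dots> = ?E' \<cdot> (\<gamma> (Q \<otimes> R) (X \<otimes> R) \<boxplus> \<iota> (Y \<otimes> R))"
    by (simp add: add.interchange d_l_sym assoc)
  finally have E: "((\<gamma> Q X \<boxplus> \<iota> Y) \<boxtimes> \<iota> R) \<cdot> ?E = ?E' \<cdot> (\<gamma> (Q \<otimes> R) (X \<otimes> R) \<boxplus> \<iota> (Y \<otimes> R))" .
  have "((\<iota> P \<boxplus> \<gamma> Q X \<boxplus> \<iota> Y) \<boxtimes> \<iota> R) \<cdot> (dl P (Q \<oplus> X \<oplus> Y) R \<cdot> (\<iota> (P \<otimes> R) \<boxplus> ?E)) =
      dl P (X \<oplus> Q \<oplus> Y) R \<cdot> (((\<iota> P \<boxtimes> \<iota> R) \<boxplus> ((\<gamma> Q X \<boxplus> \<iota> Y) \<boxtimes> \<iota> R)) \<cdot> (\<iota> (P \<otimes> R) \<boxplus> ?E))"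
    by (rule cmp_rewrite, rule dl_natural) simp_all
  also have "((\<iota> P \<boxtimes> \<iota> R) \<boxplus> ((\<gamma> Q X \<boxplus> \<iota> Y) \<boxtimes> \<iota> R)) \<cdot> (\<iota> (P \<otimes> R) \<boxplus> ?E) =
      (\<iota> (P \<otimes> R) \<boxplus> ?E') \<cdot> (\<iota> (P \<otimes> R) \<boxplus> \<gamma> (Q \<otimes> R) (X \<otimes> R) \<boxplus> \<iota> (Y \<otimes> R))"
    by (simp add: add.interchange E)
  also have "dl P (X \<oplus> Q \<oplus> Y) R \<cdot> \<dots> = (dl P (X \<oplus> Q \<oplus> Y) R \<cdot> (\<iota> (P \<otimes> R) \<boxplus> ?E')) \<cdot>
      (\<iota> (P \<otimes> R) \<boxplus> \<gamma> (Q \<otimes> R) (X \<otimes> R) \<boxplus> \<iota> (Y \<otimes> R))"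
    by (rule assoc[symmetric]) simp_all
  finally show ?thesis
    by (simp add: dl_middle[of P Q X Y] dl_middle[of P X Q Y, symmetric] assoc)
qed

text \<open>The condition that relates distributivity in two variables, for the two variables of
  \<open>a \<otimes> y \<otimes> R\<close>. Without the factor \<open>R\<close> it is an axiom; tensoring the axiom with \<open>R\<close> brings in
  the fourfold sums of \<open>dl_four\<close>.\<close>

lemma delta_dl:
  assumes [simp]: "a \<in> Ob A" "a' \<in> Ob A" "y \<in> Ob A" "y' \<in> Ob A" "R \<in> Ob A"
  shows "dl a a' ((y \<oplus> y') \<otimes> R) \<cdot> (delta a R y y' \<boxplus> delta a' R y y') =
    delta (a \<oplus> a') R y y' \<cdot> ((dl a a' (y \<otimes> R) \<boxplus> dl a a' (y' \<otimes> R)) \<cdot>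
      (\<iota> (a \<otimes> y \<otimes> R) \<boxplus> \<gamma> (a \<otimes> y' \<otimes> R) (a' \<otimes> y \<otimes> R) \<boxplus> \<iota> (a' \<otimes> y' \<otimes> R)))"
proof -
  let ?P = "a \<otimes> y" and ?Q = "a \<otimes> y'" and ?X = "a' \<otimes> y" and ?Y = "a' \<otimes> y'"
  let ?s = "\<iota> ?P \<boxplus> \<gamma> ?Q ?X \<boxplus> \<iota> ?Y"
  let ?S = "\<iota> (?P \<otimes> R) \<boxplus> \<gamma> (?Q \<otimes> R) (?X \<otimes> R) \<boxplus> \<iota> (?Y \<otimes> R)"
  let ?d = "dl a a' y" and ?d' = "dl a a' y'"
  have f: "dl a a' (y \<oplus> y') \<cdot> (dr a y y' \<boxplus> dr a' y y') = dr (a \<oplus> a') y y' \<cdot> ((?d \<boxplus> ?d') \<cdot> ?s)"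
    using d_l_d_r[of a a' y y'] by simp
  have "dl a a' ((y \<oplus> y') \<otimes> R) \<cdot> (delta a R y y' \<boxplus> delta a' R y y') =
      (dl a a' (y \<oplus> y') \<boxtimes> \<iota> R) \<cdot> (dl (a \<otimes> (y \<oplus> y')) (a' \<otimes> (y \<oplus> y')) R \<cdot>
        (((dr a y y' \<boxtimes> \<iota> R) \<boxplus> (dr a' y y' \<boxtimes> \<iota> R)) \<cdot> (dl ?P ?Q R \<boxplus> dl ?X ?Y R)))"
    by (simp add: d_l_times delta_def assoc add.interchange)
  also have "dl (a \<otimes> (y \<oplus> y')) (a' \<otimes> (y \<oplus> y')) R \<cdot>
        (((dr a y y' \<boxtimes> \<iota> R) \<boxplus> (dr a' y y' \<boxtimes> \<iota> R)) \<cdot> (dl ?P ?Q R \<boxplus> dl ?X ?Y R)) =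
      ((dr a y y' \<boxplus> dr a' y y') \<boxtimes> \<iota> R) \<cdot> (dl (?P \<oplus> ?Q) (?X \<oplus> ?Y) R \<cdot> (dl ?P ?Q R \<boxplus> dl ?X ?Y R))"
    by (rule cmp_rewrite, rule dl_natural[symmetric]) simp_all
  also have "(dl a a' (y \<oplus> y') \<boxtimes> \<iota> R) \<cdot> \<dots> = (dr (a \<oplus> a') y y' \<boxtimes> \<iota> R) \<cdot> (((?d \<boxplus> ?d') \<boxtimes> \<iota> R) \<cdot>
      ((?s \<boxtimes> \<iota> R) \<cdot> (dl (?P \<oplus> ?Q) (?X \<oplus> ?Y) R \<cdot> (dl ?P ?Q R \<boxplus> dl ?X ?Y R))))"
    by (simp add: interchange f flip: assoc)
  also have "(?s \<boxtimes> \<iota> R) \<cdot> (dl (?P \<oplus> ?Q) (?X \<oplus> ?Y) R \<cdot> (dl ?P ?Q R \<boxplus> dl ?X ?Y R)) =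
      dl (?P \<oplus> ?X) (?Q \<oplus> ?Y) R \<cdot> ((dl ?P ?X R \<boxplus> dl ?Q ?Y R) \<cdot> ?S)"
    by (rule dl_four) simp_all
  also have "((?d \<boxplus> ?d') \<boxtimes> \<iota> R) \<cdot> \<dots> =
      dl ((a \<oplus> a') \<otimes> y) ((a \<oplus> a') \<otimes> y') R \<cdot> (((?d \<boxtimes> \<iota> R) \<boxplus> (?d' \<boxtimes> \<iota> R)) \<cdot> ((dl ?P ?X R \<boxplus> dl ?Q ?Y R) \<cdot> ?S))"
    by (rule cmp_rewrite, rule dl_natural) simp_all
  also have "((?d \<boxtimes> \<iota> R) \<boxplus> (?d' \<boxtimes> \<iota> R)) \<cdot> ((dl ?P ?X R \<boxplus> dl ?Q ?Y R) \<cdot> ?S) =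
      (dl a a' (y \<otimes> R) \<boxplus> dl a a' (y' \<otimes> R)) \<cdot> ?S"
    by (simp add: add.interchange d_l_times flip: assoc)
  finally show ?thesis by (simp add: delta_def assoc)
qed

text \<open>The general case of two variables \<open>x\<close> and \<open>y\<close> arises from \<open>delta_dl\<close> with
  \<open>a = L \<otimes> x \<otimes> M\<close>, because distributivity in \<open>x\<close> factors through \<open>d_l\<close> for the sum of the two
  values of \<open>a\<close>.\<close>

lemma delta_interchange:
  assumes [simp]: "L \<in> Ob A" "M \<in> Ob A" "R \<in> Ob A" "x \<in> Ob A" "x' \<in> Ob A" "y \<in> Ob A" "y' \<in> Ob A"
  shows "delta L (M \<otimes> (y \<oplus> y') \<otimes> R) x x' \<cdot> (delta (L \<otimes> x \<otimes> M) R y y' \<boxplus> delta (L \<otimes> x' \<otimes> M) R y y') =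
    delta (L \<otimes> (x \<oplus> x') \<otimes> M) R y y' \<cdot>
      ((delta L (M \<otimes> y \<otimes> R) x x' \<boxplus> delta L (M \<otimes> y' \<otimes> R) x x') \<cdot>
      (\<iota> (L \<otimes> x \<otimes> M \<otimes> y \<otimes> R) \<boxplus> \<gamma> (L \<otimes> x \<otimes> M \<otimes> y' \<otimes> R) (L \<otimes> x' \<otimes> M \<otimes> y \<otimes> R) \<boxplus>
        \<iota> (L \<otimes> x' \<otimes> M \<otimes> y' \<otimes> R)))"
    (is "_ = _ \<cdot> (_ \<cdot> ?S)")
proof -
  let ?a = "L \<otimes> x \<otimes> M" and ?a' = "L \<otimes> x' \<otimes> M" and ?d = "delta L M x x'"
  let ?y = "(y \<oplus> y') \<otimes> R"
  have "delta L (M \<otimes> ?y) x x' \<cdot> (delta ?a R y y' \<boxplus> delta ?a' R y y') =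
      (?d \<boxtimes> \<iota> ?y) \<cdot> (dl ?a ?a' ?y \<cdot> (delta ?a R y y' \<boxplus> delta ?a' R y y'))"
    by (subst delta_split) (simp_all add: assoc)
  also have "dl ?a ?a' ?y \<cdot> (delta ?a R y y' \<boxplus> delta ?a' R y y') =
      delta (?a \<oplus> ?a') R y y' \<cdot> ((dl ?a ?a' (y \<otimes> R) \<boxplus> dl ?a ?a' (y' \<otimes> R)) \<cdot> ?S)"
    using delta_dl[of ?a ?a' y y' R] by simp
  also have "(?d \<boxtimes> \<iota> ?y) \<cdot> \<dots> = delta (L \<otimes> (x \<oplus> x') \<otimes> M) R y y' \<cdot>
      (((?d \<boxtimes> \<iota> y \<boxtimes> \<iota> R) \<boxplus> (?d \<boxtimes> \<iota> y' \<boxtimes> \<iota> R)) \<cdot>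
        ((dl ?a ?a' (y \<otimes> R) \<boxplus> dl ?a ?a' (y' \<otimes> R)) \<cdot> ?S))"
    by (rule cmp_rewrite)
       (use delta_natural[of ?d "\<iota> y" "\<iota> y'" "\<iota> R" "?a \<oplus> ?a'" y y' R "L \<otimes> (x \<oplus> x') \<otimes> M" y y' R] in simp_all)
  also have "((?d \<boxtimes> \<iota> y \<boxtimes> \<iota> R) \<boxplus> (?d \<boxtimes> \<iota> y' \<boxtimes> \<iota> R)) \<cdot>
        ((dl ?a ?a' (y \<otimes> R) \<boxplus> dl ?a ?a' (y' \<otimes> R)) \<cdot> ?S) =
      (delta L (M \<otimes> y \<otimes> R) x x' \<boxplus> delta L (M \<otimes> y' \<otimes> R) x x') \<cdot> ?S"
    by (simp add: delta_split add.interchange flip: assoc)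
  finally show ?thesis .
qed

lemma middle_swap_inverse:
  assumes [simp]: "P \<in> Ob A" "Q \<in> Ob A" "X \<in> Ob A" "Y \<in> Ob A"
  shows "(\<iota> P \<boxplus> \<gamma> Q X \<boxplus> \<iota> Y) \<cdot> (\<iota> P \<boxplus> \<gamma> X Q \<boxplus> \<iota> Y) = \<iota> (P \<oplus> X \<oplus> Q \<oplus> Y)"
  by (simp add: add.interchange add.sy_inv)

text \<open>The same condition with the variables in the opposite order. It is equivalent since the
  exchange of the middle terms is invertible.\<close>

lemma delta_interchange':
  assumes [simp]: "L \<in> Ob A" "M \<in> Ob A" "R \<in> Ob A" "x \<in> Ob A" "x' \<in> Ob A" "y \<in> Ob A" "y' \<in> Ob A"
  shows "delta (L \<otimes> (x \<oplus> x') \<otimes> M) R y y' \<cdot>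
      (delta L (M \<otimes> y \<otimes> R) x x' \<boxplus> delta L (M \<otimes> y' \<otimes> R) x x') =
    delta L (M \<otimes> (y \<oplus> y') \<otimes> R) x x' \<cdot>
      ((delta (L \<otimes> x \<otimes> M) R y y' \<boxplus> delta (L \<otimes> x' \<otimes> M) R y y') \<cdot>
      (\<iota> (L \<otimes> x \<otimes> M \<otimes> y \<otimes> R) \<boxplus> \<gamma> (L \<otimes> x' \<otimes> M \<otimes> y \<otimes> R) (L \<otimes> x \<otimes> M \<otimes> y' \<otimes> R) \<boxplus>
        \<iota> (L \<otimes> x' \<otimes> M \<otimes> y' \<otimes> R)))"
    (is "?p \<cdot> ?q = ?r \<cdot> (?s \<cdot> ?S)")
proof -
  let ?S' = "\<iota> (L \<otimes> x \<otimes> M \<otimes> y \<otimes> R) \<boxplus> \<gamma> (L \<otimes> x \<otimes> M \<otimes> y' \<otimes> R) (L \<otimes> x' \<otimes> M \<otimes> y \<otimes> R) \<boxplus>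
        \<iota> (L \<otimes> x' \<otimes> M \<otimes> y' \<otimes> R)"
  have "?r \<cdot> (?s \<cdot> ?S) = (?r \<cdot> ?s) \<cdot> ?S" by (rule assoc[symmetric]) simp_all
  also have "\<dots> = ?p \<cdot> (?q \<cdot> (?S' \<cdot> ?S))" by (simp add: delta_interchange assoc)
  finally show ?thesis by (simp add: middle_swap_inverse)
qed

end

section \<open>Iterated tensor products\<close>

lemma restrict_mlmap_cong:
  assumes "\<And>xs. xs \<in> Ob (prod_cat Cs) \<Longrightarrow> fo xs = fo' xs"
    "\<And>us. us \<in> Ar (prod_cat Cs) \<Longrightarrow> fa us = fa' us"
    "\<And>i xs x'. delta_arg Cs i xs x' \<Longrightarrow> d i xs x' = d' i xs x'"
  shows "restrict_mlmap Cs fo fa d = restrict_mlmap Cs fo' fa' d'"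
  using assms by (auto simp: restrict_mlmap_def fun_eq_iff restrict_def)

lemma split_two:
  assumes "i < j" "j < length xs"
  obtains p x q y r where "xs = p @ x # q @ y # r" "length p = i" "Suc (i + length q) = j"
proof -
  obtain p x s where xs: "xs = p @ x # s" and p: "length p = i"
    using assms id_take_nth_drop[of i xs] by (metis length_take less_trans min.absorb2 nat_less_le)
  then have "j - Suc i < length s" using assms by auto
  then obtain q y r where "s = q @ y # r" "length q = j - Suc i"
    using id_take_nth_drop[of "j - Suc i" s] by (metis length_take min.absorb2 nat_less_le)
  with that xs p assms show thesis by auto
qed

context tensor_category
begin

definition tensor_ob :: "'o list \<Rightarrow> 'o" where "tensor_ob xs = foldr (otimes S) xs \<one>"
definition tensor_ar :: "'m list \<Rightarrow> 'm" where "tensor_ar us = foldr (atimes S) us (\<iota> \<one>)"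

lemma tensor_ob_simps [simp]: "tensor_ob [] = \<one>" "tensor_ob (x # xs) = x \<otimes> tensor_ob xs"
  by (simp_all add: tensor_ob_def)

lemma tensor_ar_simps [simp]: "tensor_ar [] = \<iota> \<one>" "tensor_ar (u # us) = u \<boxtimes> tensor_ar us"
  by (simp_all add: tensor_ar_def)

lemma tensor_ob_in [simp]: "set xs \<subseteq> Ob A \<Longrightarrow> tensor_ob xs \<in> Ob A"
  by (induction xs) auto

lemma tensor_ob_append: "set xs \<subseteq> Ob A \<Longrightarrow> set ys \<subseteq> Ob A \<Longrightarrow> tensor_ob (xs @ ys) = tensor_ob xs \<otimes> tensor_ob ys"
  by (induction xs) auto

lemma tensor_ar_in [simp]:
  "set us \<subseteq> Ar A \<Longrightarrow> tensor_ar us \<in> Ar A"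
  "set us \<subseteq> Ar A \<Longrightarrow> cdom A (tensor_ar us) = tensor_ob (map (cdom A) us)"
  "set us \<subseteq> Ar A \<Longrightarrow> ccod A (tensor_ar us) = tensor_ob (map (ccod A) us)"
proof -
  have "set us \<subseteq> Ar A \<longrightarrow> tensor_ar us \<in> Ar A \<and> cdom A (tensor_ar us) = tensor_ob (map (cdom A) us) \<and>
      ccod A (tensor_ar us) = tensor_ob (map (ccod A) us)"
    by (induction us) auto
  then show "set us \<subseteq> Ar A \<Longrightarrow> tensor_ar us \<in> Ar A"
    "set us \<subseteq> Ar A \<Longrightarrow> cdom A (tensor_ar us) = tensor_ob (map (cdom A) us)"
    "set us \<subseteq> Ar A \<Longrightarrow> ccod A (tensor_ar us) = tensor_ob (map (ccod A) us)" by auto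
qed

lemma tensor_ar_append: "set us \<subseteq> Ar A \<Longrightarrow> set vs \<subseteq> Ar A \<Longrightarrow> tensor_ar (us @ vs) = tensor_ar us \<boxtimes> tensor_ar vs"
  by (induction us) auto

lemma tensor_ar_ide: "set xs \<subseteq> Ob A \<Longrightarrow> tensor_ar (map \<iota> xs) = \<iota> (tensor_ob xs)"
  by (induction xs) auto

lemma tensor_ar_cmp:
  assumes "length us = length vs" "set us \<subseteq> Ar A" "set vs \<subseteq> Ar A" "map (ccod A) us = map (cdom A) vs"
  shows "tensor_ar (map2 (cmp A) vs us) = tensor_ar vs \<cdot> tensor_ar us"
  using assms by (induction us vs rule: list_induct2) (auto simp: interchange)

lemma tensor_ob_zero: "set xs \<subseteq> Ob A \<Longrightarrow> \<zero> \<in> set xs \<Longrightarrow> tensor_ob xs = \<zero>"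
  by (induction xs) auto

lemma tensor_ar_zero: "set us \<subseteq> Ar A \<Longrightarrow> \<iota> \<zero> \<in> set us \<Longrightarrow> tensor_ar us = \<iota> \<zero>"
  by (induction us) auto

lemma tensor_ob_concat:
  "(\<And>xs. xs \<in> set xss \<Longrightarrow> set xs \<subseteq> Ob A) \<Longrightarrow> tensor_ob (map tensor_ob xss) = tensor_ob (concat xss)"
  by (induction xss) (auto simp: tensor_ob_append UN_subset_iff)

lemma tensor_ar_concat:
  "(\<And>us. us \<in> set uss \<Longrightarrow> set us \<subseteq> Ar A) \<Longrightarrow> tensor_ar (map tensor_ar uss) = tensor_ar (concat uss)"
  by (induction uss) (auto simp: tensor_ar_append UN_subset_iff)

lemma subset_take_drop:
  assumes "set xs \<subseteq> X"
  shows "set (take i xs) \<subseteq> X" "set (drop i xs) \<subseteq> X" "i < length xs \<Longrightarrow> xs ! i \<in> X"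
  using assms set_take_subset[of i xs] set_drop_subset[of i xs] by auto

lemma tensor_ob_update:
  assumes "set xs \<subseteq> Ob A" "i < length xs" "y \<in> Ob A"
  shows "tensor_ob (xs[i := y]) = tensor_ob (take i xs) \<otimes> y \<otimes> tensor_ob (drop (Suc i) xs)"
  using assms subset_take_drop[OF assms(1)] by (simp add: upd_conv_take_nth_drop tensor_ob_append)

lemma tensor_ob_nth:
  assumes "set xs \<subseteq> Ob A" "i < length xs"
  shows "tensor_ob xs = tensor_ob (take i xs) \<otimes> (xs ! i) \<otimes> tensor_ob (drop (Suc i) xs)"
  using tensor_ob_update[OF assms subset_take_drop(3)[OF assms]] by simp

lemma tensor_ar_update:
  assumes "set us \<subseteq> Ar A" "i < length us" "v \<in> Ar A"
  shows "tensor_ar (us[i := v]) = tensor_ar (take i us) \<boxtimes> v \<boxtimes> tensor_ar (drop (Suc i) us)"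
  using assms subset_take_drop[OF assms(1)] by (simp add: upd_conv_take_nth_drop tensor_ar_append)

lemma tensor_ar_nth:
  assumes "set us \<subseteq> Ar A" "i < length us"
  shows "tensor_ar us = tensor_ar (take i us) \<boxtimes> (us ! i) \<boxtimes> tensor_ar (drop (Suc i) us)"
  using tensor_ar_update[OF assms subset_take_drop(3)[OF assms]] by simp

lemma tensor_ar_ide_update:
  assumes "set xs \<subseteq> Ob A" "i < length xs" "v \<in> Ar A"
  shows "tensor_ar ((map \<iota> xs)[i := v]) = \<iota> (tensor_ob (take i xs)) \<boxtimes> v \<boxtimes> \<iota> (tensor_ob (drop (Suc i) xs))"
proof -
  have "set (map \<iota> xs) \<subseteq> Ar A" using assms(1) by auto
  then show ?thesis
    using assms tensor_ar_update[of "map \<iota> xs" i v] subset_take_drop[OF assms(1)]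
    by (simp add: take_map drop_map tensor_ar_ide)
qed

definition tensor_delta :: "nat \<Rightarrow> 'o list \<Rightarrow> 'o \<Rightarrow> 'm" where
  "tensor_delta i xs x' = delta (tensor_ob (take i xs)) (tensor_ob (drop (Suc i) xs)) (xs ! i) x'"

definition tensor_map :: "nat \<Rightarrow> ('o, 'm) mlmap" where
  "tensor_map k = restrict_mlmap (replicate k A) tensor_ob tensor_ar tensor_delta"

lemma tensor_map_simps:
  "xs \<in> Ob (prod_cat (replicate k A)) \<Longrightarrow> m_ob (tensor_map k) xs = tensor_ob xs"
  "us \<in> Ar (prod_cat (replicate k A)) \<Longrightarrow> m_ar (tensor_map k) us = tensor_ar us"
  "delta_arg (replicate k A) i xs x' \<Longrightarrow> m_delta (tensor_map k) i xs x' = tensor_delta i xs x'"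
  by (simp_all add: tensor_map_def restrict_mlmap_def)

text \<open>Splitting the list at the two positions gives the two orders of the variables, which are the
  two forms of the interchange condition.\<close>

lemma tensor_delta_delta:
  assumes xs: "set xs \<subseteq> Ob A" and ij: "i < length xs" "j < length xs" "i \<noteq> j"
    and x': "x' \<in> Ob A" and y': "y' \<in> Ob A"
  shows "tensor_delta j (xs[i := (xs ! i) \<oplus> x']) y' \<cdot> (tensor_delta i xs x' \<boxplus> tensor_delta i (xs[j := y']) x') =
    tensor_delta i (xs[j := (xs ! j) \<oplus> y']) x' \<cdot> ((tensor_delta j xs y' \<boxplus> tensor_delta j (xs[i := x']) y') \<cdot>
      ((\<iota> (tensor_ob xs) \<boxplus> \<gamma> (tensor_ob (xs[i := x'])) (tensor_ob (xs[j := y']))) \<boxplus>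
        \<iota> (tensor_ob (xs[i := x', j := y']))))"
proof (cases "i < j")
  case True
  obtain p x q y r where "xs = p @ x # q @ y # r" "length p = i" "Suc (i + length q) = j"
    using split_two[OF True ij(2)] .
  then show ?thesis
    using xs x' y' delta_interchange'[of "tensor_ob p" "tensor_ob q" "tensor_ob r" x x' y y']
    by (auto simp: tensor_delta_def tensor_ob_append nth_append list_update_append)
next
  case False
  then have "j < i" using ij by simp
  obtain p y q x r where "xs = p @ y # q @ x # r" "length p = j" "Suc (j + length q) = i"
    using split_two[OF \<open>j < i\<close> ij(1)] .
  then show ?thesis
    using xs x' y' delta_interchange[of "tensor_ob p" "tensor_ob q" "tensor_ob r" y y' x x']
    by (auto simp: tensor_delta_def tensor_ob_append nth_append list_update_append)
qed

lemma multilinear_tensor: "multilinear (replicate k A) A (tensor_map k)" (is "multilinear ?Cs A ?f")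
proof -
  have cat: "category (prod_cat ?Cs)"
    by (rule category_prod_cat) (use category_axioms in simp)
  note [simp] = tensor_map_simps
  have upd: "xs[i := y] \<in> Ob (prod_cat ?Cs)" if "xs \<in> Ob (prod_cat ?Cs)" "y \<in> Ob A" for xs i y
    using that set_update_subset_insert[of xs i y] by (auto simp: Ob_pow)
  have upda: "us[i := u] \<in> Ar (prod_cat ?Cs)" if "us \<in> Ar (prod_cat ?Cs)" "u \<in> Ar A" for us i u
    using that set_update_subset_insert[of us i u] by (auto simp: Ar_pow)
  have argD: "i < k" "length xs = k" "xs \<in> Ob (prod_cat ?Cs)" "set xs \<subseteq> Ob A" "x' \<in> Ob A" "xs ! i \<in> Ob A"
    "tensor_ob (take i xs) \<in> Ob A" "tensor_ob (drop (Suc i) xs) \<in> Ob A"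
    if "delta_arg ?Cs i xs x'" for i xs x'
    using that subset_take_drop[of xs "Ob A"] by (auto simp: delta_arg_pow Ob_pow)
  have argI: "delta_arg ?Cs i xs x'" if "i < k" "xs \<in> Ob (prod_cat ?Cs)" "x' \<in> Ob A" for i xs x'
    using that by (auto simp: delta_arg_pow Ob_pow)
  show ?thesis
  proof (rule multilinear.intro)
    show "cat_functor (prod_cat ?Cs) A (m_ob ?f) (m_ar ?f)"
    proof (intro cat_functor.intro cat_functor_axioms.intro cat category_axioms)
      show "m_ob ?f a \<in> Ob A" if "a \<in> Ob (prod_cat ?Cs)" for a
        using that by (simp add: Ob_pow)
      show "m_ar ?f us \<in> hom A (m_ob ?f xs) (m_ob ?f ys)" if us: "us \<in> hom (prod_cat ?Cs) xs ys" for us xs ys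
      proof -
        have "us \<in> Ar (prod_cat ?Cs)" "xs \<in> Ob (prod_cat ?Cs)" "ys \<in> Ob (prod_cat ?Cs)"
          using us by (auto simp: hom_pow Ar_pow Ob_pow)
        with us show ?thesis by (auto simp: hom_pow hom_iff[of _ A])
      qed
      show "m_ar ?f (ide (prod_cat ?Cs) xs) = \<iota> (m_ob ?f xs)" if xs: "xs \<in> Ob (prod_cat ?Cs)" for xs
      proof -
        have "ide (prod_cat ?Cs) xs \<in> Ar (prod_cat ?Cs)" using category.ide_in[OF cat xs] by (simp add: hom_iff)
        with xs show ?thesis by (simp add: ide_pow Ob_pow tensor_ar_ide)
      qed
      fix us vs xs ys zs assume us: "us \<in> hom (prod_cat ?Cs) xs ys" and vs: "vs \<in> hom (prod_cat ?Cs) ys zs"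
      have "us \<in> Ar (prod_cat ?Cs)" "vs \<in> Ar (prod_cat ?Cs)" "cmp (prod_cat ?Cs) vs us \<in> Ar (prod_cat ?Cs)"
        using us vs category.cmp_in[OF cat us vs] by (simp_all add: hom_iff)
      moreover have "cmp (prod_cat ?Cs) vs us = map2 (cmp A) vs us"
        using us vs by (auto simp: hom_pow intro: cmp_pow)
      moreover have "tensor_ar (map2 (cmp A) vs us) = tensor_ar vs \<cdot> tensor_ar us"
        using us vs by (intro tensor_ar_cmp) (auto simp: hom_pow)
      ultimately show "m_ar ?f (cmp (prod_cat ?Cs) vs us) = m_ar ?f vs \<cdot> m_ar ?f us" by simp
    qed
    show "m_ob ?f \<in> extensional (Ob (prod_cat ?Cs))" "m_ar ?f \<in> extensional (Ar (prod_cat ?Cs))"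
      by (simp_all add: tensor_map_def restrict_mlmap_def)
    show "\<not> delta_arg ?Cs i xs x' \<Longrightarrow> m_delta ?f i xs x' = undefined" for i xs x'
      by (simp add: tensor_map_def restrict_mlmap_def)
    show "m_ob ?f xs = \<zero>" if "xs \<in> Ob (prod_cat ?Cs)" "i < length ?Cs" "xs ! i = zero (?Cs ! i)" for xs i
      using that nth_mem[of i xs] tensor_ob_zero[of xs] by (auto simp: Ob_pow)
    show "m_ar ?f us = \<iota> \<zero>"
      if "us \<in> Ar (prod_cat ?Cs)" "i < length ?Cs" "us ! i = ide (?Cs ! i) (zero (?Cs ! i))" for us i
      using that nth_mem[of i us] tensor_ar_zero[of us] by (auto simp: Ar_pow)
    fix i xs x'
    show "m_delta ?f i xs x' \<in> hom A (osum A (m_ob ?f xs) (m_ob ?f (xs[i := x'])))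
        (m_ob ?f (xs[i := osum (?Cs ! i) (xs ! i) x']))" if a: "delta_arg ?Cs i xs x'"
      using argD[OF a] a tensor_ob_nth[of xs i]
      by (simp add: upd tensor_ob_update tensor_delta_def hom_iff)
    show "m_delta ?f i xs x' = \<iota> (m_ob ?f (xs[i := osum (?Cs ! i) (xs ! i) x']))"
      if a: "delta_arg ?Cs i xs x'" and z: "x' = zero (?Cs ! i) \<or> (\<exists>j < length ?Cs. xs ! j = zero (?Cs ! j))"
    proof -
      have "x' = \<zero> \<or> \<zero> \<in> set xs" using z argD[OF a] by (auto simp: in_set_conv_nth)
      moreover have "set xs = set (take i xs) \<union> {xs ! i} \<union> set (drop (Suc i) xs)"
        using argD[OF a] by (subst id_take_nth_drop[of i xs]) auto
      ultimately have "tensor_ob (take i xs) = \<zero> \<or> tensor_ob (drop (Suc i) xs) = \<zero> \<or> xs ! i = \<zero> \<or> x' = \<zero>"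
        using tensor_ob_zero subset_take_drop[OF argD(4)[OF a]] by auto
      then show ?thesis
        using argD[OF a] a by (simp add: upd tensor_ob_update tensor_delta_def delta_is_zero)
    qed
    show "m_ar ?f ((ide (prod_cat ?Cs) xs)[i := permcat.sym (?Cs ! i) (xs ! i) x']) \<cdot> m_delta ?f i xs x' =
        m_delta ?f i (xs[i := x']) (xs ! i) \<cdot> \<gamma> (m_ob ?f xs) (m_ob ?f (xs[i := x']))"
      if a: "delta_arg ?Cs i xs x'"
    proof -
      have "(ide (prod_cat ?Cs) xs)[i := \<gamma> (xs ! i) x'] \<in> Ar (prod_cat ?Cs)"
        by (rule upda) (use argD[OF a] category.ide_in[OF cat, of xs] in \<open>auto simp: hom_iff\<close>)
      then show ?thesis
        using argD[OF a] a delta_swap[of "tensor_ob (take i xs)" "tensor_ob (drop (Suc i) xs)" "xs ! i" x']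
          tensor_ob_nth[of xs i]
        by (simp add: ide_pow tensor_ar_ide_update tensor_delta_def upd argI tensor_ob_update)
    qed
    show "m_delta ?f i (xs[i := osum (?Cs ! i) (xs ! i) x']) x'' \<cdot>
          (m_delta ?f i xs x' \<boxplus> \<iota> (m_ob ?f (xs[i := x'']))) =
        m_delta ?f i xs (osum (?Cs ! i) x' x'') \<cdot>
          (\<iota> (m_ob ?f xs) \<boxplus> m_delta ?f i (xs[i := x']) x'')"
      if a: "delta_arg ?Cs i xs x'" and x: "x'' \<in> Ob (?Cs ! i)" for x''
      using argD[OF a] a x tensor_ob_nth[of xs i]
        delta_associative[of "tensor_ob (take i xs)" "tensor_ob (drop (Suc i) xs)" "xs ! i" x' x'']
      by (simp add: tensor_delta_def upd argI tensor_ob_update)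
    show "m_delta ?f j (xs[i := osum (?Cs ! i) (xs ! i) x']) y' \<cdot>
          (m_delta ?f i xs x' \<boxplus> m_delta ?f i (xs[j := y']) x') =
        m_delta ?f i (xs[j := osum (?Cs ! j) (xs ! j) y']) x' \<cdot>
          ((m_delta ?f j xs y' \<boxplus> m_delta ?f j (xs[i := x']) y') \<cdot>
            ((\<iota> (m_ob ?f xs) \<boxplus> \<gamma> (m_ob ?f (xs[i := x'])) (m_ob ?f (xs[j := y']))) \<boxplus>
              \<iota> (m_ob ?f (xs[i := x', j := y']))))"
      if a: "delta_arg ?Cs i xs x'" and b: "delta_arg ?Cs j xs y'" and ij: "i \<noteq> j" for j y'
      using tensor_delta_delta[of xs i j x' y'] argD[OF a] argD[OF b] a b ij by (simp add: upd argI)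
  next
    fix us xs ys i u' x' y'
    assume us: "us \<in> hom (prod_cat ?Cs) xs ys" and i: "i < length ?Cs" and u': "u' \<in> hom (?Cs ! i) x' y'"
    have us': "us \<in> Ar (prod_cat ?Cs)" "length us = k" "set us \<subseteq> Ar A" "us ! i \<in> Ar A" and u'': "u' \<in> Ar A"
        "cdom A u' = x'" "ccod A u' = y'"
      and xs: "xs = map (cdom A) us" and ys: "ys = map (ccod A) us"
      using us i u' by (auto simp: hom_pow Ar_pow hom_iff[of _ A])
    have x: "xs \<in> Ob (prod_cat ?Cs)" "ys \<in> Ob (prod_cat ?Cs)" "x' \<in> Ob A" "y' \<in> Ob A"
      using us' u'' xs ys by (auto simp: Ob_pow)
    note s = subset_take_drop[OF us'(3)]
    have "(tensor_ar (take i us) \<boxtimes> ((us ! i) \<boxplus> u') \<boxtimes> tensor_ar (drop (Suc i) us)) \<cdot> tensor_delta i xs x' =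
        tensor_delta i ys y' \<cdot> ((tensor_ar (take i us) \<boxtimes> (us ! i) \<boxtimes> tensor_ar (drop (Suc i) us)) \<boxplus>
          (tensor_ar (take i us) \<boxtimes> u' \<boxtimes> tensor_ar (drop (Suc i) us)))"
      unfolding tensor_delta_def by (rule delta_natural) (use i us' u'' s xs ys in \<open>simp_all add: take_map drop_map\<close>)
    then show "m_ar ?f (us[i := asum (?Cs ! i) (us ! i) u']) \<cdot> m_delta ?f i xs x' =
        m_delta ?f i ys y' \<cdot> (m_ar ?f us \<boxplus> m_ar ?f (us[i := u']))"
      using i us' u'' x tensor_ar_nth[of us i] by (simp add: upda argI tensor_ar_update)
  qed
qed

text \<open>This is the value at \<open>\<sigma>\<close> of the multifunctor that is constructed below. As \<open>\<sigma> = \<sigma>\<^sup>*1\<close> in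
  \<open>\<Sigma>\<^sub>k\<close>, equivariance leaves no other choice.\<close>

definition perm_tensor :: "nat \<Rightarrow> (nat \<Rightarrow> nat) \<Rightarrow> ('o, 'm) mlmap" where
  "perm_tensor k \<sigma> = P_act_o \<sigma> (replicate k A) A (tensor_map k)"

lemma multilinear_perm_tensor:
  "\<sigma> permutes {..<k} \<Longrightarrow> multilinear (replicate k A) A (perm_tensor k \<sigma>)"
  unfolding perm_tensor_def by (intro multilinear_act add.permutative_category_axioms multilinear_tensor)

lemma perm_tensor_eq:
  assumes \<sigma>: "\<sigma> permutes {..<k}"
  shows "perm_tensor k \<sigma> = restrict_mlmap (replicate k A) (\<lambda>xs. tensor_ob (place \<sigma> xs))
    (\<lambda>us. tensor_ar (place \<sigma> us)) (\<lambda>i xs x'. tensor_delta (\<sigma> i) (place \<sigma> xs) x')"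
  unfolding perm_tensor_def P_act_o_def permute_list_replicate[OF \<sigma>]
  by (rule restrict_mlmap_cong)
     (use \<sigma> in \<open>auto simp: tensor_map_simps Ob_pow Ar_pow delta_arg_pow permutes_inv permutes_less\<close>)

lemma perm_tensor_simps:
  assumes "\<sigma> permutes {..<k}"
  shows "xs \<in> Ob (prod_cat (replicate k A)) \<Longrightarrow> m_ob (perm_tensor k \<sigma>) xs = tensor_ob (place \<sigma> xs)"
    "us \<in> Ar (prod_cat (replicate k A)) \<Longrightarrow> m_ar (perm_tensor k \<sigma>) us = tensor_ar (place \<sigma> us)"
    "delta_arg (replicate k A) i xs x' \<Longrightarrow>
      m_delta (perm_tensor k \<sigma>) i xs x' = tensor_delta (\<sigma> i) (place \<sigma> xs) x'"
  by (simp_all add: perm_tensor_eq[OF assms] restrict_mlmap_def)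

lemma perm_tensor_act:
  assumes \<sigma>: "\<sigma> permutes {..<k}" and \<tau>: "\<tau> permutes {..<k}"
  shows "P_act_o \<tau> (replicate k A) A (perm_tensor k \<sigma>) = perm_tensor k (\<sigma> \<circ> \<tau>)"
  unfolding perm_tensor_eq[OF permutes_compose[OF \<tau> \<sigma>]]
  unfolding P_act_o_def permute_list_replicate[OF \<tau>]
  by (rule restrict_mlmap_cong)
     (use \<sigma> \<tau> in \<open>auto simp: perm_tensor_simps[OF \<sigma>] Ob_pow Ar_pow delta_arg_pow permutes_inv permutes_less place_compose\<close>)

lemma perm_tensor_unit: "perm_tensor 1 id = P_unit A"
proof -
  have pow: "replicate 1 A = [A]" by simp
  note pow_simps = Ob_pow[where k = 1 and A = A, unfolded pow] Ar_pow[where k = 1 and A = A, unfolded pow]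
    delta_arg_pow[where k = 1 and A = A, unfolded pow]
  show ?thesis
    unfolding perm_tensor_eq[OF permutes_id] P_unit_def pow
    by (rule restrict_mlmap_cong)
       (auto simp: pow_simps length_Suc_conv tensor_delta_def delta_def d_l_one d_r_one)
qed

text \<open>On objects and arrows both sides multiply the same rearranged list, by \<open>place_Sym_gam\<close>. For
  the distributivity maps, an index of the concatenation is split into a block and a position \<open>r\<close>
  in it; then \<open>\<Gamma>\<close> distributes over the blocks and over the factors of one block, and
  \<open>delta_nested\<close> identifies the result with the distributivity map of the long product.\<close>

lemma perm_tensor_gam:
  fixes ass :: "unit list list"
  assumes g: "g permutes {..<length ass}" and l: "length fs = length ass"
    and fs: "\<And>i. i < length ass \<Longrightarrow> (fs ! i) permutes {..<length (ass ! i)}"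
  shows "P_gam_o (map (\<lambda>as. replicate (length as) A) ass) (replicate (length ass) A) A
      (perm_tensor (length ass) g) (map (\<lambda>i. perm_tensor (length (ass ! i)) (fs ! i)) [0..<length ass]) =
    perm_tensor (length (concat ass)) (Sym_gam ass g fs)"
    (is "P_gam_o ?Css ?Bs A ?G ?F = perm_tensor ?N ?\<rho>")
proof -
  let ?js = "map length ass"
  have Css: "concat ?Css = replicate ?N A"
    by (induction ass) (simp_all add: replicate_add)
  have js: "map length ?Css = ?js" by simp
  have \<rho>: "?\<rho> permutes {..<?N}" by (rule Sym_gam_permutes[OF g l fs])
  have *: "\<exists>xss. xs = concat xss \<and> map length xss = ?js \<and> unconcat ?js xs = xss \<and>
      length xss = length ass \<and> (\<forall>i < length ass. length (xss ! i) = length (ass ! i) \<and> set (xss ! i) \<subseteq> X) \<and>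
      concat (place g (place_each fs xss)) = place ?\<rho> xs"
    if "length xs = ?N" "set xs \<subseteq> X" for xs :: "'c list" and X
  proof -
    have "length xs = sum_list ?js" using that(1) by (simp add: length_concat)
    then obtain xss where x: "xs = concat xss" "map length xss = ?js" by (rule block_list_cases)
    then have lx: "length xss = length ass" by (metis length_map)
    moreover have "length (xss ! i) = length (ass ! i)" if "i < length ass" for i
      using that x(2) lx by (metis nth_map)
    moreover have "set (xss ! i) \<subseteq> X" if "i < length ass" for i
      using UN_upper[of "xss ! i" "set xss" set] that lx \<open>set xs \<subseteq> X\<close> unfolding x(1) by simp
    moreover have "concat (place g (place_each fs xss)) = place ?\<rho> (concat xss)"
      by (rule place_Sym_gam[symmetric, OF g l fs x(2)])
    ultimately show ?thesis using x unconcat_concat[of xss] by (intro exI[of _ xss]) simp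
  qed
  have ob: "map2 m_ob ?F xss = map tensor_ob (place_each fs xss)"
    if "length xss = length ass" "\<And>i. i < length ass \<Longrightarrow> length (xss ! i) = length (ass ! i) \<and> set (xss ! i) \<subseteq> Ob A" for xss
    using that l by (auto intro!: nth_equalityI simp: perm_tensor_simps[OF fs] Ob_pow)
  have ar: "map2 m_ar ?F uss = map tensor_ar (place_each fs uss)"
    if "length uss = length ass" "\<And>i. i < length ass \<Longrightarrow> length (uss ! i) = length (ass ! i) \<and> set (uss ! i) \<subseteq> Ar A" for uss
    using that l by (auto intro!: nth_equalityI simp: perm_tensor_simps[OF fs] Ar_pow)
  have set_each: "set zs \<subseteq> X" if zs: "zs \<in> set (place g (place_each fs xss))"
    and lx: "length xss = length ass" and mem: "\<And>i. i < length ass \<Longrightarrow> length (xss ! i) = length (ass ! i) \<and> set (xss ! i) \<subseteq> X"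
    for xss :: "'c list list" and zs X
  proof -
    have "zs \<in> set (place_each fs xss)" using zs lx g l by (simp add: permutes_inv)
    then obtain i where "i < length ass" "zs = place (fs ! i) (xss ! i)"
      using l lx by (auto simp: in_set_conv_nth)
    then show ?thesis using mem[of i] fs[of i] by (simp add: permutes_inv)
  qed
  show ?thesis
    unfolding P_gam_o_def Css js perm_tensor_eq[OF \<rho>]
  proof (rule restrict_mlmap_cong)
    fix xs assume "xs \<in> Ob (prod_cat (replicate ?N A))"
    then obtain xss where xss: "unconcat ?js xs = xss" "length xss = length ass"
      "\<And>i. i < length ass \<Longrightarrow> length (xss ! i) = length (ass ! i) \<and> set (xss ! i) \<subseteq> Ob A"
      and eq: "concat (place g (place_each fs xss)) = place ?\<rho> xs"
      using *[of xs "Ob A"] by (auto simp: Ob_pow)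
    let ?ys = "map tensor_ob (place_each fs xss)"
    have "?ys \<in> Ob (prod_cat ?Bs)"
      using xss fs l by (auto simp: Ob_prod intro!: tensor_ob_in) (metis permutes_inv set_permute_list subsetD)
    moreover have "map2 m_ob ?F (unconcat ?js xs) = ?ys"
      unfolding xss(1) by (rule ob[OF xss(2,3)])
    ultimately have "m_ob ?G (map2 m_ob ?F (unconcat ?js xs)) = tensor_ob (place g ?ys)"
      by (simp only: perm_tensor_simps[OF g])
    also have "place g ?ys = map tensor_ob (place g (place_each fs xss))"
      by (rule map_place[symmetric]) (use g l xss in simp)
    also have "tensor_ob \<dots> = tensor_ob (place ?\<rho> xs)"
      unfolding eq[symmetric] by (rule tensor_ob_concat) (use set_each[OF _ xss(2,3)] in blast)
    finally show "m_ob ?G (map2 m_ob ?F (unconcat ?js xs)) = tensor_ob (place ?\<rho> xs)" .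
  next
    fix us assume "us \<in> Ar (prod_cat (replicate ?N A))"
    then obtain uss where uss: "unconcat ?js us = uss" "length uss = length ass"
      "\<And>i. i < length ass \<Longrightarrow> length (uss ! i) = length (ass ! i) \<and> set (uss ! i) \<subseteq> Ar A"
      and eq: "concat (place g (place_each fs uss)) = place ?\<rho> us"
      using *[of us "Ar A"] by (auto simp: Ar_pow)
    let ?vs = "map tensor_ar (place_each fs uss)"
    have "?vs \<in> Ar (prod_cat ?Bs)"
      using uss fs l by (auto simp: Ar_prod intro!: tensor_ar_in) (metis permutes_inv set_permute_list subsetD)
    moreover have "map2 m_ar ?F (unconcat ?js us) = ?vs"
      unfolding uss(1) by (rule ar[OF uss(2,3)])
    ultimately have "m_ar ?G (map2 m_ar ?F (unconcat ?js us)) = tensor_ar (place g ?vs)"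
      by (simp only: perm_tensor_simps[OF g])
    also have "place g ?vs = map tensor_ar (place g (place_each fs uss))"
      by (rule map_place[symmetric]) (use g l uss in simp)
    also have "tensor_ar \<dots> = tensor_ar (place ?\<rho> us)"
      unfolding eq[symmetric] by (rule tensor_ar_concat) (use set_each[OF _ uss(2,3)] in blast)
    finally show "m_ar ?G (map2 m_ar ?F (unconcat ?js us)) = tensor_ar (place ?\<rho> us)" .
  next
    fix i xs x' assume a: "delta_arg (replicate ?N A) i xs x'"
    then obtain xss where xs: "xs = concat xss" "map length xss = ?js" and
      xss: "unconcat ?js xs = xss" "length xss = length ass"
      "\<And>i. i < length ass \<Longrightarrow> length (xss ! i) = length (ass ! i) \<and> set (xss ! i) \<subseteq> Ob A"
      and eq: "concat (place g (place_each fs xss)) = place ?\<rho> xs"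
      using *[of xs "Ob A"] by (auto simp: delta_arg_pow)
    have x': "x' \<in> Ob A" using a by (simp add: delta_arg_pow)
    have "i < sum_list ?js" using a by (simp add: delta_arg_pow length_concat)
    then obtain j r where j: "j < length ass" and r: "r < length (ass ! j)" and i: "i = block_start ?js j + r"
      by (rule block_cases) simp
    have bp: "block_pos ?js i = (j, r)" unfolding i by (rule block_pos_start) (use j r in auto)
    let ?\<phi> = "fs ! j" and ?Z = "place g (place_each fs xss)"
    let ?z = "place ?\<phi> (xss ! j)" and ?ys = "map tensor_ob (place_each fs xss)"
    let ?q = "?\<phi> r" and ?p = "g j"
    have \<phi>: "?\<phi> permutes {..<length (ass ! j)}" by (rule fs[OF j])
    have q: "?q < length ?z" using permutes_less[OF \<phi> r] xss(3)[OF j] by simp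
    have lZ: "length ?Z = length ass" using l xss by simp
    have p: "?p < length ?Z" using permutes_less[OF g j] lZ by simp
    have Zp: "?Z ! ?p = ?z"
      using place_nth[of g "place_each fs xss" j] g j l xss by simp
    have Z_in: "set zs \<subseteq> Ob A" if "zs \<in> set ?Z" for zs
      using set_each[OF that xss(2,3)] .
    have z_in: "set ?z \<subseteq> Ob A" using Z_in nth_mem[OF p] Zp by simp
    have xj: "xss ! j ! r = ?z ! ?q"
      using place_nth[of ?\<phi> "xss ! j" r] \<phi> xss(3)[OF j] r by simp
    have ys: "?ys \<in> Ob (prod_cat ?Bs)"
      using xss fs l by (auto simp: Ob_prod intro!: tensor_ob_in) (metis permutes_inv set_permute_list subsetD)
    have gys: "place g ?ys = map tensor_ob ?Z"
      by (rule map_place[symmetric]) (use g l xss in simp)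
    have ysj: "?ys ! j = tensor_ob ?z" using j l xss by simp
    let ?L = "tensor_ob (take ?q ?z)" and ?R = "tensor_ob (drop (Suc ?q) ?z)"
    let ?L' = "tensor_ob (concat (take ?p ?Z))" and ?R' = "tensor_ob (concat (drop (Suc ?p) ?Z))"
    have mem: "?L \<in> Ob A" "?R \<in> Ob A" "?z ! ?q \<in> Ob A"
      using subset_take_drop[OF z_in] q by auto
    have Z_in': "set (concat (take ?p ?Z)) \<subseteq> Ob A" "set (concat (drop (Suc ?p) ?Z)) \<subseteq> Ob A"
      using Z_in set_take_subset[of ?p ?Z] set_drop_subset[of "Suc ?p" ?Z] by fastforce+
    then have mem': "?L' \<in> Ob A" "?R' \<in> Ob A" by simp_all
    have T: "tensor_ob (take ?p (place g ?ys)) = ?L'" "tensor_ob (drop (Suc ?p) (place g ?ys)) = ?R'"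
      unfolding gys take_map drop_map
      by (rule tensor_ob_concat, use Z_in in \<open>meson in_set_takeD in_set_dropD\<close>)+
    have obF: "map2 m_ob ?F xss = ?ys" by (rule ob[OF xss(2,3)])
    \<comment> \<open>values of the two maps that \<open>\<Gamma>\<close> composes, for the block \<open>?z\<close> at place \<open>?p\<close>\<close>
    have y': "m_ob (?F ! j) ((xss ! j)[r := x']) = ?L \<otimes> x' \<otimes> ?R"
    proof -
      have "(xss ! j)[r := x'] \<in> Ob (prod_cat (replicate (length (ass ! j)) A))"
        using xss(3)[OF j] x' set_update_subset_insert[of "xss ! j" r x'] by (auto simp: Ob_pow)
      then have "m_ob (?F ! j) ((xss ! j)[r := x']) = tensor_ob (place ?\<phi> ((xss ! j)[r := x']))"
        using j perm_tensor_simps(1)[OF \<phi>] by simp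
      also have "place ?\<phi> ((xss ! j)[r := x']) = ?z[?q := x']"
        by (rule place_list_update) (use \<phi> xss(3)[OF j] r in auto)
      finally show ?thesis using tensor_ob_update[OF z_in q x'] by simp
    qed
    have df: "m_delta (?F ! j) r (xss ! j) x' = delta ?L ?R (?z ! ?q) x'"
    proof -
      have "delta_arg (replicate (length (ass ! j)) A) r (xss ! j) x'"
        using xss(3)[OF j] r x' by (simp add: delta_arg_pow)
      then show ?thesis using j perm_tensor_simps(3)[OF \<phi>] by (simp add: tensor_delta_def)
    qed
    have dg: "m_delta ?G j ?ys (?L \<otimes> x' \<otimes> ?R) = delta ?L' ?R' (?L \<otimes> (?z ! ?q) \<otimes> ?R) (?L \<otimes> x' \<otimes> ?R)"
    proof -
      have "delta_arg ?Bs j ?ys (?L \<otimes> x' \<otimes> ?R)"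
        using ys j mem x' by (simp add: delta_arg_def)
      then have "m_delta ?G j ?ys (?L \<otimes> x' \<otimes> ?R) = tensor_delta ?p (place g ?ys) (?L \<otimes> x' \<otimes> ?R)"
        by (rule perm_tensor_simps(3)[OF g])
      then show ?thesis
        using T p Zp tensor_ob_nth[OF z_in q] unfolding tensor_delta_def gys by simp
    qed
    have ag: "m_ar ?G ((ide (prod_cat ?Bs) ?ys)[j := delta ?L ?R (?z ! ?q) x']) =
        \<iota> ?L' \<boxtimes> delta ?L ?R (?z ! ?q) x' \<boxtimes> \<iota> ?R'"
    proof -
      have ly: "length ?ys = length ass" using l xss by simp
      have ide: "ide (prod_cat ?Bs) ?ys = map \<iota> ?ys" by (rule ide_pow[OF ly])
      have d: "delta ?L ?R (?z ! ?q) x' \<in> Ar A" using mem x' by simp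
      have "(map \<iota> ?ys)[j := delta ?L ?R (?z ! ?q) x'] \<in> Ar (prod_cat ?Bs)"
        using ys d set_update_subset_insert[of "map \<iota> ?ys" j] unfolding Ob_pow Ar_pow by fastforce
      then have "m_ar ?G ((map \<iota> ?ys)[j := delta ?L ?R (?z ! ?q) x']) =
          tensor_ar (place g ((map \<iota> ?ys)[j := delta ?L ?R (?z ! ?q) x']))"
        by (rule perm_tensor_simps(2)[OF g])
      also have "place g ((map \<iota> ?ys)[j := delta ?L ?R (?z ! ?q) x']) =
          (place g (map \<iota> ?ys))[?p := delta ?L ?R (?z ! ?q) x']"
        by (rule place_list_update) (use g j l xss in auto)
      also have "place g (map \<iota> ?ys) = map \<iota> (place g ?ys)"
        by (rule map_place[symmetric]) (use g ly in simp)
      also have "tensor_ar ((map \<iota> (place g ?ys))[?p := delta ?L ?R (?z ! ?q) x']) =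
          \<iota> (tensor_ob (take ?p (place g ?ys))) \<boxtimes> delta ?L ?R (?z ! ?q) x' \<boxtimes>
          \<iota> (tensor_ob (drop (Suc ?p) (place g ?ys)))"
        by (rule tensor_ar_ide_update) (use p d Z_in gys in auto)
      finally show ?thesis unfolding T ide .
    qed
    \<comment> \<open>the same position in the concatenated list\<close>
    have "map length ?Z = place g ?js"
      using map_place[of g "place_each fs xss" length] map_length_place_each[of fs xss] g l xss xs(2) by simp
    then have \<rho>i: "?\<rho> i = block_start (map length ?Z) ?p + ?q"
      unfolding i using Sym_gam_value[of ass fs j r g] l j r \<phi> by simp
    have tr: "take (?\<rho> i) (place ?\<rho> xs) = concat (take ?p ?Z) @ take ?q ?z"
      "drop (Suc (?\<rho> i)) (place ?\<rho> xs) = drop (Suc ?q) ?z @ concat (drop (Suc ?p) ?Z)"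
      "place ?\<rho> xs ! ?\<rho> i = ?z ! ?q"
      unfolding eq[symmetric] \<rho>i
      using concat_take_block[OF p, of ?q] concat_drop_block[OF p, of ?q] concat_nth_block[OF p, of ?q] q
      unfolding Zp by simp_all
    have "tensor_delta (?\<rho> i) (place ?\<rho> xs) x' = delta (?L' \<otimes> ?L) (?R \<otimes> ?R') (?z ! ?q) x'"
      unfolding tensor_delta_def tr
      using tensor_ob_append[OF Z_in'(1), of "take ?q ?z"] tensor_ob_append[OF _ Z_in'(2), of "drop (Suc ?q) ?z"]
        subset_take_drop[OF z_in] by simp
    then show "(case block_pos ?js i of (j, r) \<Rightarrow>
        let xss = unconcat ?js xs; ys = map2 m_ob ?F xss in
        m_ar ?G ((ide (prod_cat ?Bs) ys)[j := m_delta (?F ! j) r (xss ! j) x']) \<cdot>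
          m_delta ?G j ys (m_ob (?F ! j) ((xss ! j)[r := x']))) = tensor_delta (?\<rho> i) (place ?\<rho> xs) x'"
      unfolding bp xss(1) Let_def prod.case obF y' df dg ag
      using delta_nested[of ?L ?R ?L' ?R' "?z ! ?q" x'] mem mem' x' by simp
  qed
qed

end

section \<open>Coherence of the multiplicative symmetry\<close>

context permutative_structure
begin

lemma sy_unit_left: "a \<in> Ob C \<Longrightarrow> s e a = ide C a"
  using sy_inv[of a e] sy_unit[of a] by simp

text \<open>Both sides are inverse to the symmetry in the other direction, which the hexagon axiom decomposes.\<close>

lemma sy_hexagon_right:
  assumes [simp]: "a \<in> Ob C" "b \<in> Ob C" "c \<in> Ob C"
  shows "s c (to a b) = cmp C (ta (ide C a) (s c b)) (ta (s c a) (ide C b))" (is "_ = ?Z")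
proof -
  have [simp]: "to (to a b) c = to a (to b c)" "to (to a c) b = to a (to c b)" "to (to c a) b = to c (to a b)"
    by (simp_all add: to_assoc)
  have "cmp C (s (to a b) c) ?Z =
      cmp C (ta (s a c) (ide C b)) (cmp C (ta (ide C a) (s b c)) (cmp C (ta (ide C a) (s c b)) (ta (s c a) (ide C b))))"
    by (simp add: sy_hexagon assoc)
  also have "cmp C (ta (ide C a) (s b c)) (cmp C (ta (ide C a) (s c b)) (ta (s c a) (ide C b))) = ta (s c a) (ide C b)"
    by (simp add: interchange sy_inv flip: assoc)
  also have "cmp C (ta (s a c) (ide C b)) \<dots> = ide C (to c (to a b))"
    by (simp add: interchange sy_inv)
  finally have "cmp C (s (to a b) c) ?Z = ide C (to c (to a b))" .
  then have "s c (to a b) = cmp C (s c (to a b)) (cmp C (s (to a b) c) ?Z)" by simp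
  also have "\<dots> = cmp C (cmp C (s c (to a b)) (s (to a b) c)) ?Z" by (rule assoc[symmetric]) simp_all
  finally show ?thesis by (simp add: sy_inv)
qed

end

locale bipermutative_category = bipermutative_structure A S + add: permutative_category A
  for A :: "('o, 'm) permcat" and S :: "('o, 'm) sym_tensor"
begin

text \<open>The mixed condition on \<open>d_r\<close> and \<open>d_l\<close> is a consequence of the symmetry: after replacing
  \<open>d_l\<close> by \<open>d_r\<close>, both sides are \<open>d_r\<close> at a product of \<open>a\<close> and \<open>c\<close>, in the two orders, and they
  agree by the naturality of \<open>d_r\<close> with respect to the symmetry of \<open>a\<close> and \<open>c\<close>.\<close>

sublocale tensor_category A S
proof
  fix a b b' c assume [simp]: "a \<in> Ob A" "b \<in> Ob A" "b' \<in> Ob A" "c \<in> Ob A"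
  interpret distributive_structure A S by (rule distributive_structure_axioms)
  have [simp]: "d_l S x y z \<in> Ar A" "cdom A (d_l S x y z) = osum A (otimes S x z) (otimes S y z)"
    "ccod A (d_l S x y z) = otimes S (osum A x y) z"
    "d_r S x y z \<in> Ar A" "cdom A (d_r S x y z) = osum A (otimes S x y) (otimes S x z)"
    "ccod A (d_r S x y z) = otimes S x (osum A y z)"
    if "x \<in> Ob A" "y \<in> Ob A" "z \<in> Ob A" for x y z
    using d_l_in[OF that] d_r_in[OF that] by (simp_all add: hom_iff)
  note [simp] = to_assoc ta_assoc
  let ?X = "osum A b b'" and ?\<tau> = "tsym S"
  let ?u = "asum A (atimes S (ide A a) (?\<tau> b c)) (atimes S (ide A a) (?\<tau> b' c))"
  have dl_via: "d_l S x y z = cmp A (?\<tau> z (osum A x y)) (cmp A (d_r S z x y) (asum A (?\<tau> x z) (?\<tau> y z)))"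
    if [simp]: "x \<in> Ob A" "y \<in> Ob A" "z \<in> Ob A" for x y z
  proof -
    have "d_l S x y z = cmp A (cmp A (?\<tau> z (osum A x y)) (?\<tau> (osum A x y) z)) (d_l S x y z)"
      by (simp add: sy_inv)
    also have "\<dots> = cmp A (?\<tau> z (osum A x y)) (cmp A (?\<tau> (osum A x y) z) (d_l S x y z))"
      by (rule assoc) simp_all
    finally show ?thesis by (simp add: tsym_d_l)
  qed
  have dr_nat: "cmp A (atimes S u (asum A v v')) (d_r S x y y') =
      cmp A (d_r S x2 y2 y2') (asum A (atimes S u v) (atimes S u v'))"
    if "u \<in> Ar A" "v \<in> Ar A" "v' \<in> Ar A" "cdom A u = x" "cdom A v = y" "cdom A v' = y'"
      "ccod A u = x2" "ccod A v = y2" "ccod A v' = y2'" for u v v' x y y' x2 y2 y2'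
    using d_r_nat[of u x x2 v y y2 v' y' y2'] that by (simp add: hom_iff)
  have "cmp A (atimes S (d_r S a b b') (ide A c)) (d_l S (otimes S a b) (otimes S a b') c) =
      cmp A (atimes S (d_r S a b b') (ide A c)) (cmp A (?\<tau> c (osum A (otimes S a b) (otimes S a b')))
        (cmp A (d_r S c (otimes S a b) (otimes S a b')) (asum A (?\<tau> (otimes S a b) c) (?\<tau> (otimes S a b') c))))"
    by (simp add: dl_via)
  also have "\<dots> = cmp A (?\<tau> c (otimes S a ?X)) (cmp A (atimes S (ide A c) (d_r S a b b'))
        (cmp A (d_r S c (otimes S a b) (otimes S a b')) (asum A (?\<tau> (otimes S a b) c) (?\<tau> (otimes S a b') c))))"
    by (rule cmp_rewrite, rule sy_natural[symmetric]) simp_all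
  also have "\<dots> = cmp A (?\<tau> c (otimes S a ?X)) (cmp A (d_r S (otimes S c a) b b')
        (asum A (?\<tau> (otimes S a b) c) (?\<tau> (otimes S a b') c)))"
    by (simp add: d_r_times assoc)
  also have "asum A (?\<tau> (otimes S a b) c) (?\<tau> (otimes S a b') c) =
      cmp A (asum A (atimes S (?\<tau> a c) (ide A b)) (atimes S (?\<tau> a c) (ide A b'))) ?u"
    by (simp add: sy_hexagon add.interchange)
  also have "cmp A (d_r S (otimes S c a) b b') \<dots> =
      cmp A (atimes S (?\<tau> a c) (asum A (ide A b) (ide A b'))) (cmp A (d_r S (otimes S a c) b b') ?u)"
    by (rule cmp_rewrite, rule dr_nat[symmetric]) simp_all
  also have "cmp A (?\<tau> c (otimes S a ?X)) \<dots> =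
      cmp A (atimes S (ide A a) (?\<tau> c ?X)) (cmp A (atimes S (?\<tau> c a) (ide A ?X))
        (cmp A (atimes S (?\<tau> a c) (ide A ?X)) (cmp A (d_r S (otimes S a c) b b') ?u)))"
    by (simp add: sy_hexagon_right assoc)
  also have "cmp A (atimes S (?\<tau> c a) (ide A ?X))
        (cmp A (atimes S (?\<tau> a c) (ide A ?X)) (cmp A (d_r S (otimes S a c) b b') ?u)) =
      cmp A (d_r S (otimes S a c) b b') ?u"
    by (simp add: interchange sy_inv flip: assoc)
  finally have L: "cmp A (atimes S (d_r S a b b') (ide A c)) (d_l S (otimes S a b) (otimes S a b') c) =
      cmp A (atimes S (ide A a) (?\<tau> c ?X)) (cmp A (d_r S (otimes S a c) b b') ?u)" .
  let ?w = "asum A (?\<tau> b c) (?\<tau> b' c)"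
  have "atimes S (ide A a) (d_l S b b' c) =
      cmp A (atimes S (ide A a) (?\<tau> c ?X)) (cmp A (atimes S (ide A a) (d_r S c b b')) (atimes S (ide A a) ?w))"
    by (simp add: dl_via interchange)
  then have "cmp A (atimes S (ide A a) (d_l S b b' c)) (d_r S a (otimes S b c) (otimes S b' c)) =
      cmp A (atimes S (ide A a) (?\<tau> c ?X)) (cmp A (atimes S (ide A a) (d_r S c b b'))
        (cmp A (atimes S (ide A a) ?w) (d_r S a (otimes S b c) (otimes S b' c))))"
    by (simp add: assoc)
  also have "cmp A (atimes S (ide A a) ?w) (d_r S a (otimes S b c) (otimes S b' c)) =
      cmp A (d_r S a (otimes S c b) (otimes S c b')) ?u"
    by (rule dr_nat) simp_all
  finally show "cmp A (atimes S (d_r S a b b') (ide A c)) (d_l S (otimes S a b) (otimes S a b') c) =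
      cmp A (atimes S (ide A a) (d_l S b b' c)) (d_r S a (otimes S b c) (otimes S b' c))"
    unfolding L by (simp add: d_r_times assoc)
qed

abbreviation swap_tensor (\<open>\<tau>\<close>) where "\<tau> a b \<equiv> tsym S a b"

lemma swap_dr:
  assumes [simp]: "a \<in> Ob A" "b \<in> Ob A" "b' \<in> Ob A"
  shows "\<tau> a (b \<oplus> b') \<cdot> dr a b b' = dl b b' a \<cdot> (\<tau> a b \<boxplus> \<tau> a b')"
proof -
  have "dr a b b' = dr a b b' \<cdot> ((\<tau> b a \<boxplus> \<tau> b' a) \<cdot> (\<tau> a b \<boxplus> \<tau> a b'))"
    by (simp add: add.interchange sy_inv)
  also have "\<dots> = (dr a b b' \<cdot> (\<tau> b a \<boxplus> \<tau> b' a)) \<cdot> (\<tau> a b \<boxplus> \<tau> a b')"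
    by (rule assoc[symmetric]) simp_all
  also have "dr a b b' \<cdot> (\<tau> b a \<boxplus> \<tau> b' a) = \<tau> (b \<oplus> b') a \<cdot> dl b b' a"
    by (rule tsym_d_l[symmetric]) simp_all
  finally have "dr a b b' = \<tau> (b \<oplus> b') a \<cdot> (dl b b' a \<cdot> (\<tau> a b \<boxplus> \<tau> a b'))"
    by (simp add: assoc)
  then have "\<tau> a (b \<oplus> b') \<cdot> dr a b b' = (\<tau> a (b \<oplus> b') \<cdot> \<tau> (b \<oplus> b') a) \<cdot> (dl b b' a \<cdot> (\<tau> a b \<boxplus> \<tau> a b'))"
    by (simp add: assoc)
  then show ?thesis by (simp add: sy_inv)
qed

text \<open>A permutation of equal factors is not the identity arrow in general. Therefore distinct labels
  \<open>ls\<close> and a family \<open>x\<close> of objects encode a tensor product whose factors can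
  be told apart even if they are equal. The canonical arrow to a rearrangement \<open>ms\<close> of \<open>ls\<close> moves
  the factors to their places from the left to the right.\<close>

abbreviation ten where "ten x ls \<equiv> tensor_ob (map x ls)"

definition pull_front :: "('l \<Rightarrow> 'o) \<Rightarrow> 'l \<Rightarrow> 'l list \<Rightarrow> 'm" where
  "pull_front x a ls = \<tau> (ten x (takeWhile (\<lambda>b. b \<noteq> a) ls)) (x a) \<boxtimes> \<iota> (ten x (tl (dropWhile (\<lambda>b. b \<noteq> a) ls)))"

primrec coh :: "('l \<Rightarrow> 'o) \<Rightarrow> 'l list \<Rightarrow> 'l list \<Rightarrow> 'm" where
  "coh x ls [] = \<iota> \<one>"
| "coh x ls (a # ms) = (\<iota> (x a) \<boxtimes> coh x (remove1 a ls) ms) \<cdot> pull_front x a ls"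

abbreviation adj_swap where "adj_swap x p a b q \<equiv> \<iota> (ten x p) \<boxtimes> \<tau> (x a) (x b) \<boxtimes> \<iota> (ten x q)"

lemma pull_front_split:
  assumes "a \<notin> set p"
  shows "pull_front x a (p @ a # q) = \<tau> (ten x p) (x a) \<boxtimes> \<iota> (ten x q)"
proof -
  have "takeWhile (\<lambda>b. b \<noteq> a) (p @ a # q) = p" "dropWhile (\<lambda>b. b \<noteq> a) (p @ a # q) = a # q"
    using assms by (auto simp: takeWhile_append dropWhile_append)
  then show ?thesis by (simp add: pull_front_def)
qed

lemma ten_in [simp]: "x ` set ls \<subseteq> Ob A \<Longrightarrow> ten x ls \<in> Ob A"
  by simp

declare tensor_ob_append [simp] image_Un [simp]

lemma interchange_three:
  assumes "u \<in> Ar A" "v \<in> Ar A" "w \<in> Ar A" "u' \<in> Ar A" "v' \<in> Ar A" "w' \<in> Ar A"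
    "ccod A u = cdom A u'" "ccod A v = cdom A v'" "ccod A w = cdom A w'"
  shows "(u' \<boxtimes> v' \<boxtimes> w') \<cdot> (u \<boxtimes> v \<boxtimes> w) = (u' \<cdot> u) \<boxtimes> (v' \<cdot> v) \<boxtimes> (w' \<cdot> w)"
  using assms by (simp add: interchange)

lemma remove_split: "a \<notin> set p \<Longrightarrow> remove1 a (p @ a # q) = p @ q"
  by (simp add: remove1_append)

lemma split_mset:
  assumes "mset ls = mset (a # ms)"
  obtains p q where "ls = p @ a # q" "a \<notin> set p" "mset (p @ q) = mset ms"
proof -
  have "a \<in> set ls" using mset_eq_setD[OF assms] by simp
  then obtain p q where "ls = p @ a # q" "a \<notin> set p" by (meson split_list_first)
  with assms that show thesis by simp
qed

lemma coh_in:
  assumes "mset ls = mset ms" "x ` set ls \<subseteq> Ob A"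
  shows "coh x ls ms \<in> Ar A \<and> cdom A (coh x ls ms) = ten x ls \<and> ccod A (coh x ls ms) = ten x ms"
  using assms
proof (induction ms arbitrary: ls)
  case (Cons a ms)
  from Cons.prems(1) obtain p q where ls: "ls = p @ a # q" "a \<notin> set p" "mset (p @ q) = mset ms"
    by (rule split_mset)
  have x: "x ` set p \<subseteq> Ob A" "x ` set q \<subseteq> Ob A" "x a \<in> Ob A" using Cons.prems(2) ls(1) by auto
  have "coh x (p @ q) ms \<in> Ar A \<and> cdom A (coh x (p @ q) ms) = ten x (p @ q) \<and> ccod A (coh x (p @ q) ms) = ten x ms"
    using Cons.IH[OF ls(3)] x by auto
  then show ?case using ls(2) x by (simp add: ls(1) pull_front_split remove_split)
qed simp

lemma coh_simps [simp]:
  assumes "mset ls = mset ms" "x ` set ls \<subseteq> Ob A"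
  shows "coh x ls ms \<in> Ar A" "cdom A (coh x ls ms) = ten x ls" "ccod A (coh x ls ms) = ten x ms"
  using coh_in[OF assms] by auto

lemma coh_self: "distinct ls \<Longrightarrow> x ` set ls \<subseteq> Ob A \<Longrightarrow> coh x ls ls = \<iota> (ten x ls)"
proof (induction ls)
  case (Cons a ls)
  then show ?case using pull_front_split[of a "[]" x ls] by (simp add: sy_unit_left)
qed simp

text \<open>The arrows \<open>coh x ls ms\<close> for fixed \<open>ms\<close> are invariant under a transposition of neighbours
  in \<open>ls\<close>. This is the coherence theorem: every rearrangement is a composite of such transpositions,
  and all composites from \<open>ls\<close> to \<open>ms\<close> agree with \<open>coh x ls ms\<close>.\<close>

lemma coh_swap:
  assumes "distinct (p @ a # b # q)" "mset (p @ a # b # q) = mset ms" "x ` set (p @ a # b # q) \<subseteq> Ob A"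
  shows "coh x (p @ a # b # q) ms = coh x (p @ b # a # q) ms \<cdot> adj_swap x p a b q"
  using assms
proof (induction ms arbitrary: p q)
  case (Cons c ms)
  have x: "x ` set p \<subseteq> Ob A" "x ` set q \<subseteq> Ob A" and [simp]: "x a \<in> Ob A" "x b \<in> Ob A"
    using Cons.prems(3) by auto
  have ab: "a \<noteq> b" "a \<notin> set p" "b \<notin> set p" "a \<notin> set q" "b \<notin> set q" using Cons.prems(1) by auto
  have "c \<in> set (p @ a # b # q)" using mset_eq_setD[OF Cons.prems(2)] by simp
  then consider "c \<in> set p" | "c = a" | "c = b" | "c \<in> set q" by auto
  then show ?case
  proof cases
    case 1
    then obtain p1 p2 where p: "p = p1 @ c # p2" "c \<notin> set p1" by (meson split_list_first)
    have [simp]: "x ` set p1 \<subseteq> Ob A" "x ` set p2 \<subseteq> Ob A" "x ` set q \<subseteq> Ob A" "x c \<in> Ob A" using x p(1) by auto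
    let ?C = "coh x ((p1 @ p2) @ b # a # q) ms"
    let ?w = "\<iota> (ten x p2) \<boxtimes> \<tau> (x a) (x b) \<boxtimes> \<iota> (ten x q)"
    have m: "mset ((p1 @ p2) @ a # b # q) = mset ms" "mset ((p1 @ p2) @ b # a # q) = mset ms"
      using Cons.prems(2) p(1) by (auto simp: add_mset_commute)
    have C: "?C \<in> Ar A" "cdom A ?C = ten x ((p1 @ p2) @ b # a # q)" "ccod A ?C = ten x ms"
      using coh_in[OF m(2), of x] x p(1) by auto
    have w: "adj_swap x (p1 @ p2) a b q = \<iota> (ten x p1) \<boxtimes> ?w"
      using times_assoc(2)[of "\<iota> (ten x p1)" "\<iota> (ten x p2)" "\<tau> (x a) (x b) \<boxtimes> \<iota> (ten x q)"] by simp
    have IH: "coh x ((p1 @ p2) @ a # b # q) ms = ?C \<cdot> (\<iota> (ten x p1) \<boxtimes> ?w)"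
      unfolding w[symmetric] by (rule Cons.IH) (use Cons.prems p(1) m in auto)
    have "coh x (p @ a # b # q) (c # ms) =
        (\<iota> (x c) \<boxtimes> (?C \<cdot> (\<iota> (ten x p1) \<boxtimes> ?w))) \<cdot> (\<tau> (ten x p1) (x c) \<boxtimes> \<iota> (ten x (p2 @ a # b # q)))"
      using p pull_front_split[OF p(2), of x "p2 @ a # b # q"] remove_split[OF p(2), of "p2 @ a # b # q"] IH
      by simp
    also have "\<iota> (x c) \<boxtimes> (?C \<cdot> (\<iota> (ten x p1) \<boxtimes> ?w)) = (\<iota> (x c) \<boxtimes> ?C) \<cdot> (\<iota> (x c \<otimes> ten x p1) \<boxtimes> ?w)"
      using interchange[of "\<iota> (x c)" "\<iota> (x c)" "\<iota> (ten x p1) \<boxtimes> ?w" ?C] C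
        times_assoc(2)[of "\<iota> (x c)" "\<iota> (ten x p1)" ?w] by simp
    also have "((\<iota> (x c) \<boxtimes> ?C) \<cdot> (\<iota> (x c \<otimes> ten x p1) \<boxtimes> ?w)) \<cdot> (\<tau> (ten x p1) (x c) \<boxtimes> \<iota> (ten x (p2 @ a # b # q))) =
        (\<iota> (x c) \<boxtimes> ?C) \<cdot> ((\<iota> (x c \<otimes> ten x p1) \<boxtimes> ?w) \<cdot> (\<tau> (ten x p1) (x c) \<boxtimes> \<iota> (ten x (p2 @ a # b # q))))"
      by (rule assoc) (use C in simp_all)
    also have "(\<iota> (x c \<otimes> ten x p1) \<boxtimes> ?w) \<cdot> (\<tau> (ten x p1) (x c) \<boxtimes> \<iota> (ten x (p2 @ a # b # q))) =
        (\<tau> (ten x p1) (x c) \<boxtimes> \<iota> (ten x (p2 @ b # a # q))) \<cdot> (\<iota> (ten x p1 \<otimes> x c) \<boxtimes> ?w)"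
      by (subst interchange; simp)+
    also have "(\<iota> (x c) \<boxtimes> ?C) \<cdot> \<dots> =
        ((\<iota> (x c) \<boxtimes> ?C) \<cdot> (\<tau> (ten x p1) (x c) \<boxtimes> \<iota> (ten x (p2 @ b # a # q)))) \<cdot> (\<iota> (ten x p1 \<otimes> x c) \<boxtimes> ?w)"
      by (rule assoc[symmetric]) (use C in simp_all)
    also have "(\<iota> (x c) \<boxtimes> ?C) \<cdot> (\<tau> (ten x p1) (x c) \<boxtimes> \<iota> (ten x (p2 @ b # a # q))) =
        coh x (p @ b # a # q) (c # ms)"
      using p pull_front_split[OF p(2), of x "p2 @ b # a # q"] remove_split[OF p(2), of "p2 @ b # a # q"] by simp
    also have "\<iota> (ten x p1 \<otimes> x c) \<boxtimes> ?w = adj_swap x p a b q"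
      using p(1) times_assoc(2)[of "\<iota> (ten x p1 \<otimes> x c)" "\<iota> (ten x p2)" "\<tau> (x a) (x b) \<boxtimes> \<iota> (ten x q)"] by simp
    finally show ?thesis .
  next
    case 2
    note [simp] = x
    let ?C = "\<iota> (x a) \<boxtimes> coh x (p @ b # q) ms"
    have m: "mset (p @ b # q) = mset ms" using Cons.prems(2) 2 by simp
    have C: "?C \<in> Ar A" "cdom A ?C = x a \<otimes> ten x p \<otimes> x b \<otimes> ten x q"
      using coh_in[OF m, of x] by simp_all
    have "coh x (p @ b # a # q) (c # ms) \<cdot> adj_swap x p a b q =
        (?C \<cdot> (\<tau> (ten x p \<otimes> x b) (x a) \<boxtimes> \<iota> (ten x q))) \<cdot> ((\<iota> (ten x p) \<boxtimes> \<tau> (x a) (x b)) \<boxtimes> \<iota> (ten x q))"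
      using ab pull_front_split[of a "p @ [b]" x q] remove_split[of a "p @ [b]" q] 2 by simp
    also have "\<dots> = ?C \<cdot> ((\<tau> (ten x p \<otimes> x b) (x a) \<boxtimes> \<iota> (ten x q)) \<cdot> ((\<iota> (ten x p) \<boxtimes> \<tau> (x a) (x b)) \<boxtimes> \<iota> (ten x q)))"
      by (rule assoc) (use C in simp_all)
    also have "(\<tau> (ten x p \<otimes> x b) (x a) \<boxtimes> \<iota> (ten x q)) \<cdot> ((\<iota> (ten x p) \<boxtimes> \<tau> (x a) (x b)) \<boxtimes> \<iota> (ten x q)) =
        (\<tau> (ten x p \<otimes> x b) (x a) \<cdot> (\<iota> (ten x p) \<boxtimes> \<tau> (x a) (x b))) \<boxtimes> (\<iota> (ten x q) \<cdot> \<iota> (ten x q))"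
      by (rule interchange) simp_all
    also have "\<tau> (ten x p \<otimes> x b) (x a) \<cdot> (\<iota> (ten x p) \<boxtimes> \<tau> (x a) (x b)) = \<tau> (ten x p) (x a) \<boxtimes> \<iota> (x b)"
      by (simp add: sy_hexagon assoc interchange sy_inv)
    finally show ?thesis
      using ab pull_front_split[of a p x "b # q"] remove_split[of a p "b # q"] 2 by simp
  next
    case 3
    note [simp] = x
    let ?C = "\<iota> (x b) \<boxtimes> coh x (p @ a # q) ms"
    have m: "mset (p @ a # q) = mset ms" using Cons.prems(2) 3 by simp
    have C: "?C \<in> Ar A" "cdom A ?C = x b \<otimes> ten x p \<otimes> x a \<otimes> ten x q"
      using coh_in[OF m, of x] by simp_all
    have "coh x (p @ a # b # q) (c # ms) = ?C \<cdot> (\<tau> (ten x p \<otimes> x a) (x b) \<boxtimes> \<iota> (ten x q))"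
      using ab pull_front_split[of b "p @ [a]" x q] remove_split[of b "p @ [a]" q] 3 by simp
    also have "\<tau> (ten x p \<otimes> x a) (x b) \<boxtimes> \<iota> (ten x q) =
        ((\<tau> (ten x p) (x b) \<boxtimes> \<iota> (x a)) \<boxtimes> \<iota> (ten x q)) \<cdot> ((\<iota> (ten x p) \<boxtimes> \<tau> (x a) (x b)) \<boxtimes> \<iota> (ten x q))"
      by (subst interchange; simp add: sy_hexagon)
    also have "?C \<cdot> \<dots> = (?C \<cdot> ((\<tau> (ten x p) (x b) \<boxtimes> \<iota> (x a)) \<boxtimes> \<iota> (ten x q))) \<cdot>
        ((\<iota> (ten x p) \<boxtimes> \<tau> (x a) (x b)) \<boxtimes> \<iota> (ten x q))"
      by (rule assoc[symmetric]) (use C in simp_all)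
    finally show ?thesis
      using ab pull_front_split[of b p x "a # q"] remove_split[of b p "a # q"] 3 by simp
  next
    case 4
    then obtain q1 q2 where q: "q = q1 @ c # q2" "c \<notin> set q1" by (meson split_list_first)
    have [simp]: "x ` set q1 \<subseteq> Ob A" "x ` set q2 \<subseteq> Ob A" "x ` set p \<subseteq> Ob A" "x c \<in> Ob A" using x q(1) by auto
    have c: "c \<notin> set p" "c \<noteq> a" "c \<noteq> b" using Cons.prems(1) 4 by auto
    let ?C = "coh x (p @ b # a # (q1 @ q2)) ms"
    let ?w = "\<iota> (ten x p) \<boxtimes> \<tau> (x a) (x b) \<boxtimes> \<iota> (ten x q1)"
    let ?P = "ten x p \<otimes> x a \<otimes> x b \<otimes> ten x q1" and ?P' = "ten x p \<otimes> x b \<otimes> x a \<otimes> ten x q1" and ?Q = "ten x q2"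
    have m: "mset (p @ a # b # (q1 @ q2)) = mset ms" "mset (p @ b # a # (q1 @ q2)) = mset ms"
      using Cons.prems(2) q(1) by (auto simp: add_mset_commute)
    have C: "?C \<in> Ar A" "cdom A ?C = ?P' \<otimes> ?Q"
      using coh_in[OF m(2), of x] by simp_all
    have IH: "coh x (p @ a # b # (q1 @ q2)) ms = ?C \<cdot> (?w \<boxtimes> \<iota> ?Q)"
      using Cons.IH[of p "q1 @ q2"] Cons.prems q(1) m by auto
    have "coh x (p @ a # b # q) (c # ms) = (\<iota> (x c) \<boxtimes> (?C \<cdot> (?w \<boxtimes> \<iota> ?Q))) \<cdot> (\<tau> ?P (x c) \<boxtimes> \<iota> ?Q)"
      using q c pull_front_split[of c "p @ a # b # q1" x q2] remove_split[of c "p @ a # b # q1" q2] IH by simp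
    also have "\<iota> (x c) \<boxtimes> (?C \<cdot> (?w \<boxtimes> \<iota> ?Q)) = (\<iota> (x c) \<boxtimes> ?C) \<cdot> ((\<iota> (x c) \<boxtimes> ?w) \<boxtimes> \<iota> ?Q)"
      using interchange[of "\<iota> (x c)" "\<iota> (x c)" "?w \<boxtimes> \<iota> ?Q" ?C] C by simp
    also have "\<dots> \<cdot> (\<tau> ?P (x c) \<boxtimes> \<iota> ?Q) = (\<iota> (x c) \<boxtimes> ?C) \<cdot> (((\<iota> (x c) \<boxtimes> ?w) \<boxtimes> \<iota> ?Q) \<cdot> (\<tau> ?P (x c) \<boxtimes> \<iota> ?Q))"
      by (rule assoc) (use C in simp_all)
    also have "((\<iota> (x c) \<boxtimes> ?w) \<boxtimes> \<iota> ?Q) \<cdot> (\<tau> ?P (x c) \<boxtimes> \<iota> ?Q) = ((\<iota> (x c) \<boxtimes> ?w) \<cdot> \<tau> ?P (x c)) \<boxtimes> (\<iota> ?Q \<cdot> \<iota> ?Q)"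
      by (rule interchange) simp_all
    also have "(\<iota> (x c) \<boxtimes> ?w) \<cdot> \<tau> ?P (x c) = \<tau> ?P' (x c) \<cdot> (?w \<boxtimes> \<iota> (x c))"
      by (rule sy_natural[symmetric]) simp_all
    also have "\<dots> \<boxtimes> (\<iota> ?Q \<cdot> \<iota> ?Q) = (\<tau> ?P' (x c) \<boxtimes> \<iota> ?Q) \<cdot> ((?w \<boxtimes> \<iota> (x c)) \<boxtimes> \<iota> ?Q)"
      by (rule interchange[symmetric]) simp_all
    also have "(\<iota> (x c) \<boxtimes> ?C) \<cdot> \<dots> = ((\<iota> (x c) \<boxtimes> ?C) \<cdot> (\<tau> ?P' (x c) \<boxtimes> \<iota> ?Q)) \<cdot> ((?w \<boxtimes> \<iota> (x c)) \<boxtimes> \<iota> ?Q)"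
      by (rule assoc[symmetric]) (use C in simp_all)
    also have "(\<iota> (x c) \<boxtimes> ?C) \<cdot> (\<tau> ?P' (x c) \<boxtimes> \<iota> ?Q) = coh x (p @ b # a # q) (c # ms)"
      using q c pull_front_split[of c "p @ b # a # q1" x q2] remove_split[of c "p @ b # a # q1" q2] by simp
    also have "(?w \<boxtimes> \<iota> (x c)) \<boxtimes> \<iota> ?Q = adj_swap x p a b q" using q(1) by simp
    finally show ?thesis .
  qed
qed simp

end

text \<open>Insertion sort: every rearrangement is a sequence of exchanges of neighbours.\<close>

lemma adjacent_swap_induct:
  assumes "mset ls = mset ms" "P ms"
    and step: "\<And>p a b q. mset (p @ a # b # q) = mset ms \<Longrightarrow> P (p @ b # a # q) \<Longrightarrow> P (p @ a # b # q)"
  shows "P ls"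
proof -
  have "P (pre @ ls)" if "mset ls = mset ns" "mset (pre @ ns) = mset ms" "P (pre @ ns)" for pre ls ns
    using that
  proof (induction ns arbitrary: pre ls)
    case (Cons c ns)
    have "c \<in> set ls" using mset_eq_setD[OF Cons.prems(1)] by simp
    then obtain p q where ls: "ls = p @ c # q" by (meson split_list)
    have m: "mset (p @ q) = mset ns" using Cons.prems(1) ls by simp
    have "P ((pre @ [c]) @ p @ q)"
      by (rule Cons.IH[OF m]) (use Cons.prems in simp_all)
    moreover have "P (pre @ p @ c # r)" if "P (pre @ c # p @ r)" "mset (p @ r) = mset ns" for r
      using that
    proof (induction p arbitrary: r rule: rev_induct)
      case (snoc d p)
      have "P (pre @ p @ c # d # r)" using snoc.IH[of "d # r"] snoc.prems by simp
      moreover have "mset ((pre @ p) @ d # c # r) = mset ms"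
        using Cons.prems(2) snoc.prems(2)[symmetric] by (simp add: add_mset_commute)
      ultimately show ?case using step[of "pre @ p" d c r] by simp
    qed simp
    ultimately show ?case using m ls by simp
  qed simp
  from this[of ls ms "[]"] assms(1,2) show ?thesis by simp
qed

context bipermutative_category
begin

lemma adj_swap_in:
  assumes "x ` set (p @ a # b # q) \<subseteq> Ob A"
  shows "adj_swap x p a b q \<in> Ar A" "cdom A (adj_swap x p a b q) = ten x (p @ a # b # q)"
    "ccod A (adj_swap x p a b q) = ten x (p @ b # a # q)"
  using assms by (simp_all add: image_Un)

text \<open>To prove a statement on canonical arrows it is enough to treat one transposition of neighbours.\<close>

lemma coh_induct [consumes 3, case_names self swap]:
  assumes "mset ls = mset ms" "distinct ms" "x ` set ms \<subseteq> Ob A"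
    and self: "P ms (\<iota> (ten x ms))"
    and swap: "\<And>p a b q. distinct (p @ a # b # q) \<Longrightarrow> mset (p @ a # b # q) = mset ms \<Longrightarrow>
      x ` set (p @ a # b # q) \<subseteq> Ob A \<Longrightarrow> P (p @ b # a # q) (coh x (p @ b # a # q) ms) \<Longrightarrow>
      P (p @ a # b # q) (coh x (p @ b # a # q) ms \<cdot> adj_swap x p a b q)"
  shows "P ls (coh x ls ms)"
  using assms(1)
proof (rule adjacent_swap_induct)
  show "P ms (coh x ms ms)" using self coh_self[OF assms(2,3)] by simp
next
  fix p a b q assume m: "mset (p @ a # b # q) = mset ms" and "P (p @ b # a # q) (coh x (p @ b # a # q) ms)"
  have d: "distinct (p @ a # b # q)" using mset_eq_imp_distinct_iff[OF m] assms(2) by simp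
  have x: "x ` set (p @ a # b # q) \<subseteq> Ob A" using mset_eq_setD[OF m] assms(3) by simp
  show "P (p @ a # b # q) (coh x (p @ a # b # q) ms)"
    unfolding coh_swap[OF d m x] by (rule swap) fact+
qed

lemma coh_trans:
  assumes "mset ls = mset ms" "mset ms = mset ns" "distinct ms" "x ` set ms \<subseteq> Ob A"
  shows "coh x ms ns \<cdot> coh x ls ms = coh x ls ns"
  using assms(1,3,4)
proof (induction rule: coh_induct)
  case self
  then show ?case using assms by simp
next
  case (swap p a b q)
  have m: "mset (p @ b # a # q) = mset ms" "x ` set (p @ b # a # q) \<subseteq> Ob A" using swap(2,3) by (auto simp: add_mset_commute)
  have "coh x (p @ a # b # q) ns = coh x (p @ b # a # q) ns \<cdot> adj_swap x p a b q"
    by (rule coh_swap) (use swap(1-3) assms(2) in simp_all)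
  also have "\<dots> = (coh x ms ns \<cdot> coh x (p @ b # a # q) ms) \<cdot> adj_swap x p a b q" using swap(4) by simp
  also have "\<dots> = coh x ms ns \<cdot> (coh x (p @ b # a # q) ms \<cdot> adj_swap x p a b q)"
    by (rule assoc) (use adj_swap_in[OF swap(3)] coh_in[OF m(1,2)] coh_in[OF assms(2,4)] in simp_all)
  finally show ?case by simp
qed

lemma coh_adjacent:
  assumes "distinct (p @ a # b # q)" "x ` set (p @ a # b # q) \<subseteq> Ob A"
  shows "coh x (p @ a # b # q) (p @ b # a # q) = adj_swap x p a b q"
proof -
  have d: "distinct (p @ b # a # q)" "x ` set (p @ b # a # q) \<subseteq> Ob A" using assms by auto
  then show ?thesis
    using coh_swap[OF assms(1) _ assms(2), of "p @ b # a # q"] coh_self[OF d] adj_swap_in[OF assms(2)] by simp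
qed

lemma coh_natural:
  assumes m: "mset ls = mset ms" "distinct ms" and u: "u ` set ms \<subseteq> Ar A"
    and x: "\<And>l. l \<in> set ms \<Longrightarrow> x l = cdom A (u l)" and y: "\<And>l. l \<in> set ms \<Longrightarrow> y l = ccod A (u l)"
  shows "tensor_ar (map u ms) \<cdot> coh x ls ms = coh y ls ms \<cdot> tensor_ar (map u ls)"
proof -
  have xy: "x ` set ms \<subseteq> Ob A" "y ` set ms \<subseteq> Ob A" using u x y by auto
  have mu: "tensor_ar (map u l) \<in> Ar A \<and> cdom A (tensor_ar (map u l)) = ten x l \<and> ccod A (tensor_ar (map u l)) = ten y l"
    if "set l \<subseteq> set ms" for l
  proof -
    have "set (map u l) \<subseteq> Ar A" using that u by auto
    moreover have "map (cdom A) (map u l) = map x l" "map (ccod A) (map u l) = map y l" using that x y by auto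
    ultimately show ?thesis by (simp only: tensor_ar_in)
  qed
  from m(1,2) xy(1) show ?thesis
  proof (induction rule: coh_induct)
    case self
    then show ?case using mu[of ms] coh_self[OF m(2) xy(2)] by simp
  next
    case (swap p a b q)
    have s: "set (p @ a # b # q) = set ms" using mset_eq_setD[OF swap(2)] .
    then have sub: "set p \<subseteq> set ms" "set q \<subseteq> set ms" "a \<in> set ms" "b \<in> set ms" by auto
    have y': "y ` set (p @ a # b # q) \<subseteq> Ob A" using s xy(2) by simp
    have m': "mset (p @ b # a # q) = mset ms" using swap(2) by (simp add: add_mset_commute)
    have uu: "set (map u p) \<subseteq> Ar A" "set (map u q) \<subseteq> Ar A" "u a \<in> Ar A" "u b \<in> Ar A" using sub u by auto
    note [simp] = mu[OF sub(1)] mu[OF sub(2)] uu(3,4) x[OF sub(3)] x[OF sub(4)] y[OF sub(3)] y[OF sub(4)]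
    have xs: "x ` set p \<subseteq> Ob A" "x ` set q \<subseteq> Ob A" "y ` set p \<subseteq> Ob A" "y ` set q \<subseteq> Ob A"
      using sub xy by blast+
    have sw: "tensor_ar (map u (p @ b # a # q)) \<cdot> adj_swap x p a b q =
        adj_swap y p a b q \<cdot> tensor_ar (map u (p @ a # b # q))"
    proof -
      have e: "tensor_ar (map u (p @ c # d # q)) = tensor_ar (map u p) \<boxtimes> (u c \<boxtimes> u d) \<boxtimes> tensor_ar (map u q)"
        if "u c \<in> Ar A" "u d \<in> Ar A" for c d
        using uu that by (simp add: tensor_ar_append)
      have "tensor_ar (map u (p @ b # a # q)) \<cdot> adj_swap x p a b q =
          (tensor_ar (map u p) \<cdot> \<iota> (ten x p)) \<boxtimes> ((u b \<boxtimes> u a) \<cdot> \<tau> (x a) (x b)) \<boxtimes> (tensor_ar (map u q) \<cdot> \<iota> (ten x q))"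
        unfolding e[OF uu(4,3)] by (rule interchange_three) (use xs in simp_all)
      also have "\<dots> = (\<iota> (ten y p) \<cdot> tensor_ar (map u p)) \<boxtimes> (\<tau> (y a) (y b) \<cdot> (u a \<boxtimes> u b)) \<boxtimes>
          (\<iota> (ten y q) \<cdot> tensor_ar (map u q))"
        using xs sy_natural[of "u a" "u b"] by simp
      also have "\<dots> = adj_swap y p a b q \<cdot> tensor_ar (map u (p @ a # b # q))"
        unfolding e[OF uu(3,4)] by (rule interchange_three[symmetric]) (use xs in simp_all)
      finally show ?thesis .
    qed
    have s': "set (p @ b # a # q) = set ms" using mset_eq_setD[OF m'] .
    have X: "x ` set (p @ b # a # q) \<subseteq> Ob A" "y ` set (p @ b # a # q) \<subseteq> Ob A"
      unfolding s' by (fact xy)+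
    note cs = mu[OF subset_refl] mu[of "p @ b # a # q", unfolded s', OF subset_refl]
      mu[of "p @ a # b # q", unfolded s, OF subset_refl] coh_in[OF m' X(1)] coh_in[OF m' X(2)]
      adj_swap_in[OF swap(3)] adj_swap_in[OF y']
    have "tensor_ar (map u ms) \<cdot> (coh x (p @ b # a # q) ms \<cdot> adj_swap x p a b q) =
        coh y (p @ b # a # q) ms \<cdot> (tensor_ar (map u (p @ b # a # q)) \<cdot> adj_swap x p a b q)"
      by (rule cmp_rewrite[OF swap(4)]) (use cs in \<open>simp_all only:\<close>)
    also have "\<dots> = (coh y (p @ b # a # q) ms \<cdot> adj_swap y p a b q) \<cdot> tensor_ar (map u (p @ a # b # q))"
      unfolding sw by (rule assoc[symmetric]) (use cs in \<open>simp_all only:\<close>)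
    also have "coh y (p @ b # a # q) ms \<cdot> adj_swap y p a b q = coh y (p @ a # b # q) ms"
      by (rule coh_swap[symmetric, OF swap(1,2) y'])
    finally show ?case .
  qed
qed

lemma coh_append:
  assumes "mset l = mset l'" "mset m = mset m'" "distinct (l @ m)" "x ` set (l @ m) \<subseteq> Ob A"
  shows "coh x (l @ m) (l' @ m') = coh x l l' \<boxtimes> coh x m m'"
proof -
  have s: "set l' = set l" "set m' = set m" using assms(1,2) by (metis mset_eq_setD)+
  have d: "distinct l'" "distinct m'" using assms(1-3) by (metis distinct_append mset_eq_imp_distinct_iff)+
  have x: "x ` set l' \<subseteq> Ob A" "x ` set m' \<subseteq> Ob A" "x ` set l \<subseteq> Ob A" "x ` set m \<subseteq> Ob A" using assms(4) s by auto
  note [simp] = x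
  have D: "distinct (l' @ m)" "distinct (l' @ m')" using d assms(3) s by auto
  have 1: "coh x (l @ m) (l' @ m) = coh x l l' \<boxtimes> \<iota> (ten x m)"
    using assms(1) d(1) x(1)
  proof (induction rule: coh_induct)
    case self
    then show ?case using coh_self[OF D(1), of x] by simp
  next
    case (swap p a b q)
    have y: "x ` set (p @ a # b # q @ m) \<subseteq> Ob A" "x ` set p \<subseteq> Ob A" "x ` set q \<subseteq> Ob A" "x a \<in> Ob A" "x b \<in> Ob A"
      using swap(3) by auto
    have ds: "distinct (p @ a # b # q @ m)"
      using swap(1) D(1) mset_eq_setD[OF swap(2)] by auto
    have m': "mset (p @ b # a # q) = mset l'" "x ` set (p @ b # a # q) \<subseteq> Ob A" using swap(2,3) by (auto simp: add_mset_commute)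
    have "coh x ((p @ a # b # q) @ m) (l' @ m) = coh x ((p @ b # a # q) @ m) (l' @ m) \<cdot> adj_swap x p a b (q @ m)"
      using coh_swap[OF ds _ y(1), of "l' @ m"] swap(2) by (simp add: add_mset_commute)
    also have "\<dots> = (coh x (p @ b # a # q) l' \<boxtimes> \<iota> (ten x m)) \<cdot> (adj_swap x p a b q \<boxtimes> \<iota> (ten x m))"
      unfolding swap(4) using y by simp
    also have "\<dots> = (coh x (p @ b # a # q) l' \<cdot> adj_swap x p a b q) \<boxtimes> (\<iota> (ten x m) \<cdot> \<iota> (ten x m))"
      by (rule interchange) (use coh_in[OF m'] adj_swap_in[OF swap(3)] in simp_all)
    finally show ?case by simp
  qed
  have 2: "coh x (l' @ m) (l' @ m') = \<iota> (ten x l') \<boxtimes> coh x m m'"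
    using assms(2) d(2) x(2)
  proof (induction rule: coh_induct)
    case self
    then show ?case using coh_self[OF D(2), of x] by simp
  next
    case (swap p a b q)
    have y: "x ` set ((l' @ p) @ a # b # q) \<subseteq> Ob A" "x ` set p \<subseteq> Ob A" "x ` set q \<subseteq> Ob A" "x a \<in> Ob A" "x b \<in> Ob A"
      using swap(3) x(1) by auto
    have ds: "distinct ((l' @ p) @ a # b # q)"
      using swap(1) D(2) mset_eq_setD[OF swap(2)] by auto
    have m': "mset (p @ b # a # q) = mset m'" "x ` set (p @ b # a # q) \<subseteq> Ob A" using swap(2,3) by (auto simp: add_mset_commute)
    have "coh x (l' @ (p @ a # b # q)) (l' @ m') = coh x (l' @ (p @ b # a # q)) (l' @ m') \<cdot> adj_swap x (l' @ p) a b q"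
      using coh_swap[OF ds _ y(1), of "l' @ m'"] swap(2) by (simp add: add_mset_commute)
    also have "\<dots> = (\<iota> (ten x l') \<boxtimes> coh x (p @ b # a # q) m') \<cdot> (\<iota> (ten x l') \<boxtimes> adj_swap x p a b q)"
      unfolding swap(4) using y by (simp flip: ta_ide)
    also have "\<dots> = (\<iota> (ten x l') \<cdot> \<iota> (ten x l')) \<boxtimes> (coh x (p @ b # a # q) m' \<cdot> adj_swap x p a b q)"
      by (rule interchange) (use coh_in[OF m'] adj_swap_in[OF swap(3)] in simp_all)
    finally show ?case by simp
  qed
  have "coh x (l @ m) (l' @ m') = coh x (l' @ m) (l' @ m') \<cdot> coh x (l @ m) (l' @ m)"
    by (rule coh_trans[symmetric]) (use assms D x in auto)
  also have "\<dots> = coh x l l' \<boxtimes> coh x m m'"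
    unfolding 1 2 using assms(1,2) by (simp add: interchange)
  finally show ?thesis .
qed

text \<open>Moving one block past another is canonical, by the two hexagon equations: one moves a single
  factor past a block, and the other composes these moves.\<close>

lemma coh_block_swap:
  assumes "distinct (l @ m)" "x ` set (l @ m) \<subseteq> Ob A"
  shows "coh x (l @ m) (m @ l) = \<tau> (ten x l) (ten x m)"
proof -
  have single: "coh x (a # m) (m @ [a]) = \<tau> (x a) (ten x m)"
    if "distinct (a # m)" "x ` set (a # m) \<subseteq> Ob A" for a m
    using that
  proof (induction m)
    case Nil
    then show ?case using coh_self[of "[a]" x] by (simp add: sy_unit)
  next
    case (Cons b m)
    have [simp]: "x a \<in> Ob A" "x b \<in> Ob A" "x ` set m \<subseteq> Ob A" using Cons.prems by auto
    have "coh x (a # b # m) (b # m @ [a]) = coh x (b # a # m) (b # m @ [a]) \<cdot> coh x (a # b # m) (b # a # m)"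
      by (rule coh_trans[symmetric]) (use Cons.prems in auto)
    also have "coh x (b # a # m) (b # m @ [a]) = \<iota> (x b) \<boxtimes> \<tau> (x a) (ten x m)"
      using coh_append[of "[b]" "[b]" "a # m" "m @ [a]" x] coh_self[of "[b]" x] Cons by auto
    also have "coh x (a # b # m) (b # a # m) = \<tau> (x a) (x b) \<boxtimes> \<iota> (ten x m)"
      using coh_adjacent[of "[]" a b m x] Cons.prems by simp
    also have "(\<iota> (x b) \<boxtimes> \<tau> (x a) (ten x m)) \<cdot> (\<tau> (x a) (x b) \<boxtimes> \<iota> (ten x m)) = \<tau> (x a) (x b \<otimes> ten x m)"
      by (rule sy_hexagon_right[symmetric]) simp_all
    finally show ?case by simp
  qed
  show ?thesis using assms
  proof (induction l)
    case Nil
    then show ?case using coh_self[of m x] by (simp add: sy_unit_left)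
  next
    case (Cons a l)
    have [simp]: "x a \<in> Ob A" "x ` set l \<subseteq> Ob A" "x ` set m \<subseteq> Ob A" using Cons.prems by auto
    have "coh x (a # l @ m) (m @ a # l) = coh x (a # m @ l) (m @ a # l) \<cdot> coh x (a # l @ m) (a # m @ l)"
      by (rule coh_trans[symmetric]) (use Cons.prems in auto)
    also have "coh x (a # l @ m) (a # m @ l) = \<iota> (x a) \<boxtimes> \<tau> (ten x l) (ten x m)"
      using coh_append[of "[a]" "[a]" "l @ m" "m @ l" x] coh_self[of "[a]" x] Cons by auto
    also have "coh x (a # m @ l) (m @ a # l) = \<tau> (x a) (ten x m) \<boxtimes> \<iota> (ten x l)"
      using coh_append[of "a # m" "m @ [a]" l l x] coh_self[of l x] single[of a m] Cons.prems by auto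
    also have "(\<tau> (x a) (ten x m) \<boxtimes> \<iota> (ten x l)) \<cdot> (\<iota> (x a) \<boxtimes> \<tau> (ten x l) (ten x m)) = \<tau> (x a \<otimes> ten x l) (ten x m)"
      by (rule sy_hexagon[symmetric]) simp_all
    finally show ?case by simp
  qed
qed

text \<open>A canonical arrow between products of products is canonical for the long product. It is enough
  to exchange two neighbouring blocks. This expresses the compatibility of the canonical arrows
  with \<open>\<Gamma>\<close> in the outer variable; \<open>tensor_ar_coh\<close> treats the inner variables.\<close>

lemma coh_concat:
  assumes "mset ls = mset ms" "distinct ms" "distinct (concat (map blk ms))"
    and x: "\<And>l. l \<in> set ms \<Longrightarrow> x ` set (blk l) \<subseteq> Ob A"
    and y: "\<And>l. l \<in> set ms \<Longrightarrow> y l = ten x (blk l)"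
  shows "coh y ls ms = coh x (concat (map blk ls)) (concat (map blk ms))"
proof -
  have yO: "y ` set ms \<subseteq> Ob A" using x y by auto
  have ten: "ten y l = ten x (concat (map blk l))" if "set l \<subseteq> set ms" for l
    using that
  proof (induction l)
    case (Cons a l)
    have "x ` set (concat (map blk l)) \<subseteq> Ob A" using Cons.prems x by fastforce
    then show ?case using Cons x y by simp
  qed simp
  from assms(1,2) yO show ?thesis
  proof (induction rule: coh_induct)
    case self
    have "x ` set (concat (map blk ms)) \<subseteq> Ob A" using x by fastforce
    from coh_self[OF assms(3) this] show ?case using ten[of ms] by simp
  next
    case (swap p a b q)
    let ?p = "concat (map blk p)" and ?q = "concat (map blk q)"
    let ?c = "concat (map blk ms)"
    have s: "set (p @ a # b # q) = set ms" using mset_eq_setD[OF swap(2)] .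
    have mc: "mset (concat (map blk l)) = mset ?c" if "mset l = mset ms" for l
    proof -
      have "mset (concat (map blk l)) = sum_mset (image_mset (mset \<circ> blk) (mset l))"
        by (induction l) simp_all
      also have "\<dots> = mset ?c" unfolding that by (induction ms) simp_all
      finally show ?thesis .
    qed
    have m: "mset (?p @ blk a @ blk b @ ?q) = mset ?c" "mset (?p @ blk b @ blk a @ ?q) = mset ?c"
      using mc[OF swap(2)] mc[of "p @ b # a # q"] swap(2) by (simp_all add: add_mset_commute)
    have d: "distinct (?p @ blk a @ blk b @ ?q)" "distinct (?p @ blk b @ blk a @ ?q)"
      using mset_eq_imp_distinct_iff[OF m(1)] mset_eq_imp_distinct_iff[OF m(2)] assms(3) by auto
    have xa: "x ` set (blk a) \<subseteq> Ob A" "x ` set (blk b) \<subseteq> Ob A" "x ` set ?p \<subseteq> Ob A" "x ` set ?q \<subseteq> Ob A"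
      using x s by (auto simp: image_subset_iff)
    have yab: "y a = ten x (blk a)" "y b = ten x (blk b)" using y s by auto
    have "coh x (blk a @ blk b) (blk b @ blk a) = \<tau> (y a) (y b)"
      unfolding yab by (rule coh_block_swap) (use d xa in \<open>auto simp: Int_Un_distrib\<close>)
    moreover have "coh x ((blk a @ blk b) @ ?q) ((blk b @ blk a) @ ?q) = coh x (blk a @ blk b) (blk b @ blk a) \<boxtimes> coh x ?q ?q"
      by (rule coh_append) (use d xa in auto)
    moreover have "coh x ?q ?q = \<iota> (ten y q)" "coh x ?p ?p = \<iota> (ten y p)"
    proof -
      have pq: "set p \<subseteq> set ms" "set q \<subseteq> set ms" using s by auto
      show "coh x ?q ?q = \<iota> (ten y q)" "coh x ?p ?p = \<iota> (ten y p)"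
        unfolding ten[OF pq(1)] ten[OF pq(2)] using coh_self[of ?q x] coh_self[of ?p x] d xa by simp_all
    qed
    moreover have "coh x (?p @ blk a @ blk b @ ?q) (?p @ blk b @ blk a @ ?q) =
        coh x ?p ?p \<boxtimes> coh x (blk a @ blk b @ ?q) (blk b @ blk a @ ?q)"
      by (rule coh_append) (use d xa in auto)
    ultimately have "coh x (?p @ blk a @ blk b @ ?q) (?p @ blk b @ blk a @ ?q) = adj_swap y p a b q"
      by simp
    moreover have "coh x (?p @ blk b @ blk a @ ?q) ?c \<cdot> coh x (?p @ blk a @ blk b @ ?q) (?p @ blk b @ blk a @ ?q) =
        coh x (?p @ blk a @ blk b @ ?q) ?c"
      by (rule coh_trans) (use m d xa in \<open>auto simp: image_Un\<close>)
    ultimately show ?case using swap(4) by simp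
  qed
qed

lemma tensor_ar_coh:
  assumes "\<And>l. l \<in> set ls \<Longrightarrow> mset (blk l) = mset (blk' l)" "distinct (concat (map blk ls))"
    "\<And>l. l \<in> set ls \<Longrightarrow> x ` set (blk l) \<subseteq> Ob A"
  shows "tensor_ar (map (\<lambda>l. coh x (blk l) (blk' l)) ls) = coh x (concat (map blk ls)) (concat (map blk' ls))"
  using assms
proof (induction ls)
  case (Cons l ls)
  have m: "mset (concat (map blk ls)) = mset (concat (map blk' ls))"
    using Cons.prems(1) by (induction ls) auto
  have "coh x (blk l @ concat (map blk ls)) (blk' l @ concat (map blk' ls)) =
      coh x (blk l) (blk' l) \<boxtimes> coh x (concat (map blk ls)) (concat (map blk' ls))"
    by (rule coh_append) (use Cons.prems m in \<open>auto simp: image_subset_iff\<close>)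
  then show ?case using Cons by simp
qed simp

lemma coh_map:
  assumes "mset ls = mset ms" "distinct ms" "inj_on f (set ms)" "x ` f ` set ms \<subseteq> Ob A"
  shows "coh x (map f ls) (map f ms) = coh (x \<circ> f) ls ms"
proof -
  have 1: "(x \<circ> f) ` set ms \<subseteq> Ob A" using assms(4) by (simp add: image_comp)
  have d: "distinct (map f ms)" using assms(2,3) by (simp add: distinct_map)
  from assms(1,2) 1 show ?thesis
  proof (induction rule: coh_induct)
    case self
    then show ?case using coh_self[OF d, of x] assms(4) by (simp add: comp_def)
  next
    case (swap p a b q)
    have s: "mset (map f (p @ a # b # q)) = mset (map f ms)" using swap(2) by (metis mset_map)
    then have "distinct (map f (p @ a # b # q))" "x ` set (map f (p @ a # b # q)) \<subseteq> Ob A"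
      using d mset_eq_imp_distinct_iff[OF s] mset_eq_setD[OF s] assms(4) by auto
    then have "coh x (map f (p @ a # b # q)) (map f ms) =
        coh x (map f (p @ b # a # q)) (map f ms) \<cdot> adj_swap x (map f p) (f a) (f b) (map f q)"
      using coh_swap[of "map f p" "f a" "f b" "map f q" "map f ms" x] s by simp
    then show ?case using swap(4) by (simp add: comp_def)
  qed
qed

lemma coh_cong:
  assumes "\<And>l. l \<in> set ls \<union> set ms \<Longrightarrow> x l = y l"
  shows "coh x ls ms = coh y ls ms"
  using assms
proof (induction ms arbitrary: ls)
  case (Cons a ms)
  have "map x (takeWhile (\<lambda>b. b \<noteq> a) ls) = map y (takeWhile (\<lambda>b. b \<noteq> a) ls)"
    using Cons.prems by (auto dest: set_takeWhileD)
  moreover have "map x (tl (dropWhile (\<lambda>b. b \<noteq> a) ls)) = map y (tl (dropWhile (\<lambda>b. b \<noteq> a) ls))"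
    using Cons.prems in_set_dropD[of _ 1 "dropWhile (\<lambda>b. b \<noteq> a) ls"]
    by (auto simp: drop_Suc dest: set_dropWhileD)
  moreover have "coh x (remove1 a ls) ms = coh y (remove1 a ls) ms"
    by (rule Cons.IH) (use Cons.prems set_remove1_subset[of a ls] in auto)
  moreover have "x a = y a" using Cons.prems by simp
  ultimately show ?case by (simp only: coh.simps pull_front_def)
qed simp

text \<open>The distributivity map of \<open>ten x ls\<close> in the factor with label \<open>i\<close>. The position of this factor
  changes along a canonical arrow, but its label does not.\<close>

definition label_delta :: "('l \<Rightarrow> 'o) \<Rightarrow> 'l list \<Rightarrow> 'l \<Rightarrow> 'o \<Rightarrow> 'm" where
  "label_delta x ls i x' = delta (ten x (takeWhile (\<lambda>b. b \<noteq> i) ls)) (ten x (tl (dropWhile (\<lambda>b. b \<noteq> i) ls))) (x i) x'"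

lemma label_delta_split:
  assumes "i \<notin> set p"
  shows "label_delta x (p @ i # q) i x' = delta (ten x p) (ten x q) (x i) x'"
proof -
  have "takeWhile (\<lambda>b. b \<noteq> i) (p @ i # q) = p" "dropWhile (\<lambda>b. b \<noteq> i) (p @ i # q) = i # q"
    using assms by (auto simp: takeWhile_append dropWhile_append)
  then show ?thesis by (simp add: label_delta_def)
qed

lemma ten_update: "i \<notin> set p \<Longrightarrow> ten (x(i := y)) p = ten x p"
  by (metis (mono_tags, lifting) fun_upd_other map_cong)

text \<open>Moving the distributed factor past a neighbour \<open>b\<close> exchanges \<open>d_l\<close> and \<open>d_r\<close>; this is where
  the condition relating both to the symmetry enters.\<close>

lemma delta_swap_factor:
  assumes [simp]: "P \<in> Ob A" "Q \<in> Ob A" "a \<in> Ob A" "a' \<in> Ob A" "b \<in> Ob A"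
  shows "(\<iota> P \<boxtimes> \<tau> (a \<oplus> a') b \<boxtimes> \<iota> Q) \<cdot> delta P (b \<otimes> Q) a a' =
      delta (P \<otimes> b) Q a a' \<cdot> ((\<iota> P \<boxtimes> \<tau> a b \<boxtimes> \<iota> Q) \<boxplus> (\<iota> P \<boxtimes> \<tau> a' b \<boxtimes> \<iota> Q))"
    and "(\<iota> P \<boxtimes> \<tau> b (a \<oplus> a') \<boxtimes> \<iota> Q) \<cdot> delta (P \<otimes> b) Q a a' =
      delta P (b \<otimes> Q) a a' \<cdot> ((\<iota> P \<boxtimes> \<tau> b a \<boxtimes> \<iota> Q) \<boxplus> (\<iota> P \<boxtimes> \<tau> b a' \<boxtimes> \<iota> Q))"
proof -
  have l: "delta P (b \<otimes> Q) a a' = (\<iota> P \<boxtimes> dl a a' b \<boxtimes> \<iota> Q) \<cdot> delta P Q (a \<otimes> b) (a' \<otimes> b)"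
    using delta_nested[of \<one> b P Q a a'] by (simp add: delta_one)
  have r: "delta (P \<otimes> b) Q a a' = (\<iota> P \<boxtimes> dr b a a' \<boxtimes> \<iota> Q) \<cdot> delta P Q (b \<otimes> a) (b \<otimes> a')"
    using delta_nested[of b \<one> P Q a a'] by (simp add: delta_one)
  have three: "(\<iota> P \<boxtimes> v \<boxtimes> \<iota> Q) \<cdot> (\<iota> P \<boxtimes> u \<boxtimes> \<iota> Q) = \<iota> P \<boxtimes> (v \<cdot> u) \<boxtimes> \<iota> Q"
    if "u \<in> Ar A" "v \<in> Ar A" "ccod A u = cdom A v" for u v
    using that by (simp add: interchange)
  have "(\<iota> P \<boxtimes> \<tau> (a \<oplus> a') b \<boxtimes> \<iota> Q) \<cdot> delta P (b \<otimes> Q) a a' =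
      (\<iota> P \<boxtimes> dr b a a' \<boxtimes> \<iota> Q) \<cdot> ((\<iota> P \<boxtimes> (\<tau> a b \<boxplus> \<tau> a' b) \<boxtimes> \<iota> Q) \<cdot> delta P Q (a \<otimes> b) (a' \<otimes> b))"
    unfolding l by (rule cmp_rewrite) (simp_all add: three tsym_d_l)
  also have "(\<iota> P \<boxtimes> (\<tau> a b \<boxplus> \<tau> a' b) \<boxtimes> \<iota> Q) \<cdot> delta P Q (a \<otimes> b) (a' \<otimes> b) =
      delta P Q (b \<otimes> a) (b \<otimes> a') \<cdot> ((\<iota> P \<boxtimes> \<tau> a b \<boxtimes> \<iota> Q) \<boxplus> (\<iota> P \<boxtimes> \<tau> a' b \<boxtimes> \<iota> Q))"
    by (rule delta_natural) simp_all
  finally show "(\<iota> P \<boxtimes> \<tau> (a \<oplus> a') b \<boxtimes> \<iota> Q) \<cdot> delta P (b \<otimes> Q) a a' =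
      delta (P \<otimes> b) Q a a' \<cdot> ((\<iota> P \<boxtimes> \<tau> a b \<boxtimes> \<iota> Q) \<boxplus> (\<iota> P \<boxtimes> \<tau> a' b \<boxtimes> \<iota> Q))"
    by (simp add: r assoc)
  have "(\<iota> P \<boxtimes> \<tau> b (a \<oplus> a') \<boxtimes> \<iota> Q) \<cdot> delta (P \<otimes> b) Q a a' =
      (\<iota> P \<boxtimes> dl a a' b \<boxtimes> \<iota> Q) \<cdot> ((\<iota> P \<boxtimes> (\<tau> b a \<boxplus> \<tau> b a') \<boxtimes> \<iota> Q) \<cdot> delta P Q (b \<otimes> a) (b \<otimes> a'))"
    unfolding r by (rule cmp_rewrite) (simp_all add: three swap_dr)
  also have "(\<iota> P \<boxtimes> (\<tau> b a \<boxplus> \<tau> b a') \<boxtimes> \<iota> Q) \<cdot> delta P Q (b \<otimes> a) (b \<otimes> a') =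
      delta P Q (a \<otimes> b) (a' \<otimes> b) \<cdot> ((\<iota> P \<boxtimes> \<tau> b a \<boxtimes> \<iota> Q) \<boxplus> (\<iota> P \<boxtimes> \<tau> b a' \<boxtimes> \<iota> Q))"
    by (rule delta_natural) simp_all
  finally show "(\<iota> P \<boxtimes> \<tau> b (a \<oplus> a') \<boxtimes> \<iota> Q) \<cdot> delta (P \<otimes> b) Q a a' =
      delta P (b \<otimes> Q) a a' \<cdot> ((\<iota> P \<boxtimes> \<tau> b a \<boxtimes> \<iota> Q) \<boxplus> (\<iota> P \<boxtimes> \<tau> b a' \<boxtimes> \<iota> Q))"
    by (simp add: l assoc)
qed

lemma label_delta_in:
  assumes "i \<in> set ls" "distinct ls" "x ` set ls \<subseteq> Ob A" "x' \<in> Ob A"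
  shows "label_delta x ls i x' \<in> Ar A" "cdom A (label_delta x ls i x') = ten x ls \<oplus> ten (x(i := x')) ls"
    "ccod A (label_delta x ls i x') = ten (x(i := x i \<oplus> x')) ls"
proof -
  obtain p q where ls: "ls = p @ i # q" "i \<notin> set p" using assms(1) by (meson split_list_first)
  have "i \<notin> set q" using assms(2) ls(1) by simp
  moreover have "x ` set p \<subseteq> Ob A" "x ` set q \<subseteq> Ob A" "x i \<in> Ob A" using assms(3) ls(1) by auto
  moreover have "(x(i := z)) ` set p \<subseteq> Ob A" "(x(i := z)) ` set q \<subseteq> Ob A" for z
    using calculation ls(2) by auto
  ultimately show "label_delta x ls i x' \<in> Ar A" "cdom A (label_delta x ls i x') = ten x ls \<oplus> ten (x(i := x')) ls"
    "ccod A (label_delta x ls i x') = ten (x(i := x i \<oplus> x')) ls"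
    using ls(2) assms(4) unfolding ls(1) label_delta_split[OF ls(2)] by (simp_all add: ten_update del: fun_upd_apply) auto
qed

lemma adj_swap_delta:
  assumes d: "distinct (p @ a # b # q)" and x: "x ` set (p @ a # b # q) \<subseteq> Ob A"
    and i: "i \<in> set (p @ a # b # q)" and [simp]: "x' \<in> Ob A"
  shows "adj_swap (x(i := x i \<oplus> x')) p a b q \<cdot> label_delta x (p @ a # b # q) i x' =
    label_delta x (p @ b # a # q) i x' \<cdot> (adj_swap x p a b q \<boxplus> adj_swap (x(i := x')) p a b q)"
proof -
  have [simp]: "x a \<in> Ob A" "x b \<in> Ob A" and xp: "x ` set p \<subseteq> Ob A" and xq: "x ` set q \<subseteq> Ob A" using x by auto
  have n: "a \<noteq> b" "a \<notin> set p" "b \<notin> set p" "a \<notin> set q" "b \<notin> set q" using d by auto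
  consider "i \<in> set p" | "i = a" | "i = b" | "i \<in> set q" using i by auto
  then show ?thesis
  proof cases
    case 1
    then obtain p1 p2 where p: "p = p1 @ i # p2" "i \<notin> set p1" by (meson split_list_first)
    have i': "i \<notin> set p2" "i \<notin> set q" "i \<noteq> a" "i \<noteq> b" using d p(1) by auto
    have [simp]: "x ` set p1 \<subseteq> Ob A" "x ` set p2 \<subseteq> Ob A" "x ` set q \<subseteq> Ob A" "x i \<in> Ob A" using xp xq p(1) by auto
    let ?w = "\<iota> (ten x p2) \<boxtimes> \<tau> (x a) (x b) \<boxtimes> \<iota> (ten x q)"
    have sw: "adj_swap (x(i := z)) p a b q = \<iota> (ten x p1) \<boxtimes> \<iota> z \<boxtimes> ?w" if "z \<in> Ob A" for z
      using that i' p by (simp add: ten_update tensor_ob_append flip: ta_ide)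
    have sx: "adj_swap x p a b q = \<iota> (ten x p1) \<boxtimes> \<iota> (x i) \<boxtimes> ?w"
      using sw[of "x i"] by simp
    have D: "label_delta x (p @ a # b # q) i x' = delta (ten x p1) (ten x p2 \<otimes> x a \<otimes> x b \<otimes> ten x q) (x i) x'"
      "label_delta x (p @ b # a # q) i x' = delta (ten x p1) (ten x p2 \<otimes> x b \<otimes> x a \<otimes> ten x q) (x i) x'"
      using label_delta_split[OF p(2), of x "p2 @ a # b # q" x'] label_delta_split[OF p(2), of x "p2 @ b # a # q" x'] p(1)
      by simp_all
    show ?thesis
      unfolding D sx using sw[of x'] sw[of "x i \<oplus> x'"]
        delta_natural[of "\<iota> (ten x p1)" "\<iota> (x i)" "\<iota> x'" ?w "ten x p1" "x i" x' "ten x p2 \<otimes> x a \<otimes> x b \<otimes> ten x q"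
          "ten x p1" "x i" x' "ten x p2 \<otimes> x b \<otimes> x a \<otimes> ten x q"]
      by simp
  next
    case 2
    note [simp] = xp xq
    have D: "label_delta x (p @ a # b # q) i x' = delta (ten x p) (x b \<otimes> ten x q) (x a) x'"
      "label_delta x (p @ b # a # q) i x' = delta (ten x p \<otimes> x b) (ten x q) (x a) x'"
      using label_delta_split[of a p x "b # q" x'] label_delta_split[of a "p @ [b]" x q x'] n 2 by simp_all
    show ?thesis unfolding D using n 2 delta_swap_factor(1)[of "ten x p" "ten x q" "x a" x' "x b"]
      by (simp add: ten_update)
  next
    case 3
    note [simp] = xp xq
    have D: "label_delta x (p @ a # b # q) i x' = delta (ten x p \<otimes> x a) (ten x q) (x b) x'"
      "label_delta x (p @ b # a # q) i x' = delta (ten x p) (x a \<otimes> ten x q) (x b) x'"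
      using label_delta_split[of b p x "a # q" x'] label_delta_split[of b "p @ [a]" x q x'] n 3 by simp_all
    show ?thesis unfolding D using n 3 delta_swap_factor(2)[of "ten x p" "ten x q" "x b" x' "x a"]
      by (simp add: ten_update)
  next
    case 4
    then obtain q1 q2 where q: "q = q1 @ i # q2" "i \<notin> set q1" by (meson split_list_first)
    have i': "i \<notin> set q2" "i \<notin> set p" "i \<noteq> a" "i \<noteq> b" using d q(1) by auto
    have [simp]: "x ` set q1 \<subseteq> Ob A" "x ` set q2 \<subseteq> Ob A" "x ` set p \<subseteq> Ob A" "x i \<in> Ob A" using xp xq q(1) by auto
    let ?w = "\<iota> (ten x p) \<boxtimes> \<tau> (x a) (x b) \<boxtimes> \<iota> (ten x q1)"
    have sw: "adj_swap (x(i := z)) p a b q = ?w \<boxtimes> \<iota> z \<boxtimes> \<iota> (ten x q2)" if "z \<in> Ob A" for z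
      using that i' q by (simp add: ten_update tensor_ob_append flip: ta_ide)
    have sx: "adj_swap x p a b q = ?w \<boxtimes> \<iota> (x i) \<boxtimes> \<iota> (ten x q2)"
      using sw[of "x i"] by simp
    have D: "label_delta x (p @ a # b # q) i x' = delta (ten x p \<otimes> x a \<otimes> x b \<otimes> ten x q1) (ten x q2) (x i) x'"
      "label_delta x (p @ b # a # q) i x' = delta (ten x p \<otimes> x b \<otimes> x a \<otimes> ten x q1) (ten x q2) (x i) x'"
      using label_delta_split[of i "p @ a # b # q1" x q2 x'] label_delta_split[of i "p @ b # a # q1" x q2 x'] q i'
      by simp_all
    show ?thesis
      unfolding D sx using sw[of x'] sw[of "x i \<oplus> x'"]
        delta_natural[of ?w "\<iota> (x i)" "\<iota> x'" "\<iota> (ten x q2)" "ten x p \<otimes> x a \<otimes> x b \<otimes> ten x q1" "x i" x' "ten x q2"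
          "ten x p \<otimes> x b \<otimes> x a \<otimes> ten x q1" "x i" x' "ten x q2"]
      by simp
  qed
qed

text \<open>Canonical arrows are multilinear in the factors: \<open>adj_swap_delta\<close> shows this for an exchange of
  neighbours, either by naturality or by \<open>delta_swap_factor\<close>.\<close>

lemma coh_delta:
  assumes m: "mset ls = mset ms" "distinct ms" and x: "x ` set ms \<subseteq> Ob A"
    and i: "i \<in> set ms" and x': "x' \<in> Ob A"
  shows "coh (x(i := x i \<oplus> x')) ls ms \<cdot> label_delta x ls i x' =
    label_delta x ms i x' \<cdot> (coh x ls ms \<boxplus> coh (x(i := x')) ls ms)"
proof -
  let ?y = "x(i := x')" and ?z = "x(i := x i \<oplus> x')"
  have y: "?y ` set ms \<subseteq> Ob A" and z: "?z ` set ms \<subseteq> Ob A" using x i x' by auto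
  from m x show ?thesis
  proof (induction rule: coh_induct)
    case self
    have [simp]: "ten x ms \<in> Ob A" "ten ?y ms \<in> Ob A" "ten ?z ms \<in> Ob A"
      using x y z by (simp_all only: ten_in)
    show ?case
      using coh_self[OF m(2) y] coh_self[OF m(2) z] label_delta_in[OF i m(2) x x'] by (simp del: fun_upd_apply)
  next
    case (swap p a b q)
    let ?l = "p @ a # b # q" and ?l' = "p @ b # a # q"
    have s: "set ?l = set ms" using mset_eq_setD[OF swap(2)] .
    have m': "mset ?l' = mset ms" using swap(2) by (simp add: add_mset_commute)
    have s': "set ?l' = set ms" using mset_eq_setD[OF m'] .
    have d': "distinct ?l'" using swap(1) by auto
    have X: "x ` set ?l \<subseteq> Ob A" "?y ` set ?l \<subseteq> Ob A" "?z ` set ?l \<subseteq> Ob A"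
      "x ` set ?l' \<subseteq> Ob A" "?y ` set ?l' \<subseteq> Ob A" "?z ` set ?l' \<subseteq> Ob A"
      unfolding s s' by (fact x y z)+
    note cs = coh_in[OF m' X(4)] coh_in[OF m' X(5)] coh_in[OF m' X(6)]
      adj_swap_in[OF X(1)] adj_swap_in[OF X(2)] adj_swap_in[OF X(3)]
      label_delta_in[OF _ swap(1) X(1) x', unfolded s, OF i] label_delta_in[OF _ d' X(4) x', unfolded s', OF i]
      label_delta_in[OF i m(2) x x']
    have "coh ?z ?l ms \<cdot> label_delta x ?l i x' = coh ?z ?l' ms \<cdot> (adj_swap ?z p a b q \<cdot> label_delta x ?l i x')"
      unfolding coh_swap[OF swap(1,2) X(3)] by (rule assoc) (use cs in \<open>simp_all only:\<close>)
    also have "adj_swap ?z p a b q \<cdot> label_delta x ?l i x' =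
        label_delta x ?l' i x' \<cdot> (adj_swap x p a b q \<boxplus> adj_swap ?y p a b q)"
      by (rule adj_swap_delta[OF swap(1) X(1) _ x']) (simp only: s i)
    also have "coh ?z ?l' ms \<cdot> \<dots> = label_delta x ms i x' \<cdot>
        ((coh x ?l' ms \<boxplus> coh ?y ?l' ms) \<cdot> (adj_swap x p a b q \<boxplus> adj_swap ?y p a b q))"
      by (rule cmp_rewrite[OF swap(4)]) (use cs in \<open>simp_all only: add.ta_simps\<close>)
    also have "(coh x ?l' ms \<boxplus> coh ?y ?l' ms) \<cdot> (adj_swap x p a b q \<boxplus> adj_swap ?y p a b q) =
        (coh x ?l' ms \<cdot> adj_swap x p a b q) \<boxplus> (coh ?y ?l' ms \<cdot> adj_swap ?y p a b q)"
      by (rule add.interchange) (use cs in \<open>simp_all only:\<close>)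
    also have "coh ?y ?l' ms \<cdot> adj_swap ?y p a b q = coh ?y ?l ms"
      by (rule coh_swap[symmetric, OF swap(1,2) X(2)])
    finally show ?case .
  qed
qed

end

section \<open>The multifunctor determined by a structure\<close>

lemma permutes_surj_upt: "\<sigma> permutes {..<k} \<Longrightarrow> set (place \<sigma> [0..<k]) = {..<k}"
  by (simp add: permutes_inv lessThan_atLeast0)

lemma permutes_distinct_upt: "\<sigma> permutes {..<k} \<Longrightarrow> distinct (place \<sigma> [0..<k])"
  by (simp add: permutes_inv)

lemma permutes_mset_upt: "\<sigma> permutes {..<k} \<Longrightarrow> mset (place \<sigma> [0..<k]) = mset [0..<k]"
  by (simp add: permutes_inv)

lemma place_eq_map_nth: "\<sigma> permutes {..<length xs} \<Longrightarrow> place \<sigma> xs = map (\<lambda>i. xs ! i) (place \<sigma> [0..<length xs])"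
  using map_place[of \<sigma> "[0..<length xs]" "\<lambda>i. xs ! i"] by (simp add: map_nth)

lemma nth_image_subset: "set xs \<subseteq> X \<Longrightarrow> k \<le> length xs \<Longrightarrow> (\<lambda>i. xs ! i) ` {..<k} \<subseteq> X"
  by (auto dest!: nth_mem)

lemma P_hom_simps:
  "Ob (P_hom Cs D) = {f. multilinear Cs D f}" "Ar (P_hom Cs D) = {\<phi>. multilinear_trans Cs D \<phi>}"
  "cdom (P_hom Cs D) = t_src" "ccod (P_hom Cs D) = t_tgt"
  "ide (P_hom Cs D) f = \<lparr>t_src = f, t_tgt = f,
       t_comp = restrict (\<lambda>xs. ide D (m_ob f xs)) (Ob (prod_cat Cs))\<rparr>"
  "cmp (P_hom Cs D) \<psi> \<phi> = \<lparr>t_src = t_src \<phi>, t_tgt = t_tgt \<psi>,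
       t_comp = restrict (\<lambda>xs. cmp D (t_comp \<psi> xs) (t_comp \<phi> xs)) (Ob (prod_cat Cs))\<rparr>"
  by (simp_all add: P_hom_def)

lemma P_act_a_ide:
  assumes "\<sigma> permutes {..<k}"
  shows "P_act_a \<sigma> (replicate k A) A (ide (P_hom (replicate k A) A) f) =
    ide (P_hom (replicate k A) A) (P_act_o \<sigma> (replicate k A) A f)"
  using assms by (auto simp: P_act_a_def P_hom_simps P_act_o_pow fun_eq_iff restrict_def Ob_pow permutes_inv)

lemma concat_replicates: "concat (map (\<lambda>as. replicate (length as) A) ass) = replicate (length (concat ass)) A"
  by (induction ass) (simp_all add: replicate_add)

text \<open>As the arrows of \<open>\<Sigma>\<^sub>*\<close> are identities, this reduces the conditions on arrows to those on
  objects.\<close>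

lemma P_gam_a_ide:
  fixes ass :: "unit list list"
  assumes g: "multilinear (replicate (length ass) A) A g" and l: "length fs = length ass"
    and fs: "\<And>i. i < length ass \<Longrightarrow> multilinear (replicate (length (ass ! i)) A) A (fs ! i)"
  defines "Css \<equiv> map (\<lambda>as. replicate (length as) A) ass"
  shows "P_gam_a Css (replicate (length ass) A) A (ide (P_hom (replicate (length ass) A) A) g)
      (map (\<lambda>i. ide (P_hom (replicate (length (ass ! i)) A) A) (fs ! i)) [0..<length ass]) =
    ide (P_hom (concat Css) A) (P_gam_o Css (replicate (length ass) A) A g fs)"
    (is "P_gam_a _ ?Bs _ _ ?F = _")
proof -
  interpret G: cat_functor "prod_cat ?Bs" A "m_ob g" "m_ar g" by (rule multilinear.functoriality[OF g])
  have st: "map t_src ?F = fs" "map t_tgt ?F = fs" using l by (auto simp: P_hom_simps intro!: nth_equalityI)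
  have *: "cmp A (ide A (m_ob g ys)) (m_ar g (map2 t_comp ?F xss)) = ide A (m_ob g ys) \<and> ys \<in> Ob (prod_cat ?Bs)"
    if xs: "xs \<in> Ob (prod_cat (concat Css))" and xss: "xss = unconcat (map length Css) xs"
      and ys: "ys = map2 m_ob fs xss" for xs xss ys
  proof -
    have lx: "length xs = sum_list (map length Css)" using xs by (simp add: Ob_prod length_concat)
    have x: "concat xss = xs" "map length xss = map length ass"
      unfolding xss using concat_unconcat[OF lx] map_length_unconcat[OF lx] by (simp_all add: Css_def comp_def)
    have lxs: "length xss = length ass" using x(2) by (metis length_map)
    have xi: "xss ! i \<in> Ob (prod_cat (replicate (length (ass ! i)) A))" if i: "i < length ass" for i
    proof -
      have "length (xss ! i) = length (ass ! i)" using x(2) i lxs by (metis nth_map)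
      moreover have "set (xss ! i) \<subseteq> set (concat xss)"
        using UN_upper[of "xss ! i" "set xss" set] i lxs by simp
      ultimately show ?thesis
        using xs unfolding x(1) Css_def concat_replicates Ob_pow by blast
    qed
    have ysO: "ys \<in> Ob (prod_cat ?Bs)"
      using ys l lxs xi cat_functor.ob_in[OF multilinear.functoriality[OF fs]] by (auto simp: Ob_prod)
    have "map2 t_comp ?F xss = ide (prod_cat ?Bs) ys"
      using ys l lxs xi by (auto simp: prod_cat_simps P_hom_simps intro!: nth_equalityI)
    then show ?thesis
      using G.ar_ide[OF ysO] G.ob_in[OF ysO] ysO G.target.cmp_ide_left[OF G.target.ide_in] by simp
  qed
  show ?thesis
    unfolding P_gam_a_def
    using st * by (auto simp: P_hom_simps P_gam_o_def restrict_mlmap_def Let_def fun_eq_iff restrict_def)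
qed

context tensor_category
begin

definition tensor_fo :: "unit list \<Rightarrow> unit \<Rightarrow> (nat \<Rightarrow> nat) \<Rightarrow> ('o, 'm) mlmap" where
  "tensor_fo as b f = (if f \<in> Sym (length as) then perm_tensor (length as) f else undefined)"

lemma map_map_const: "map (map (\<lambda>_. A)) ass = map (\<lambda>as. replicate (length as) A) ass"
  by (simp add: map_replicate_const)

lemma tensor_fo_laws:
  "multifunctor_laws {()} (\<lambda>as b. Sym (length as)) (\<lambda>\<sigma> as b f. f \<circ> \<sigma>) (\<lambda>a. id)
     (\<lambda>ass bs c g fs. Sym_gam ass g fs) P_act_o P_unit P_gam_o (\<lambda>_. A) tensor_fo"
proof (unfold_locales, goal_cases)
  case (1 as b f \<sigma>)
  then show ?case
    by (simp add: tensor_fo_def Sym_iff permutes_compose perm_tensor_act map_replicate_const)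
next
  case (2 a)
  then show ?case using perm_tensor_unit by (simp add: tensor_fo_def Sym_iff permutes_id)
next
  case (3 c g bs ass fs)
  note c = composable_Sym[OF 3(3)]
  have g: "g permutes {..<length ass}" using 3(2) c by (simp add: Sym_iff)
  have "Sym_gam ass g fs permutes {..<length (concat ass)}" by (rule Sym_gam_permutes[OF g]) (use c in auto)
  moreover have "map (\<lambda>i. tensor_fo (ass ! i) (bs ! i) (fs ! i)) [0..<length bs] =
      map (\<lambda>i. perm_tensor (length (ass ! i)) (fs ! i)) [0..<length ass]"
    using c by (simp add: tensor_fo_def Sym_iff)
  ultimately show ?case
    using perm_tensor_gam[OF g, of fs] c g
    by (simp only: tensor_fo_def Sym_iff map_map_const map_replicate_const if_True)
qed

lemma associative_of_perm_tensor:
  assumes "F_o T [] () id = perm_tensor 0 id" "F_o T [(), ()] () id = perm_tensor 2 id"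
  shows "associative_of T = \<lparr>otimes = otimes S, atimes = atimes S, tone = \<one>, d_l = dl, d_r = dr\<rparr>"
proof -
  have two: "replicate 2 A = [A, A]" by (simp add: numeral_2_eq_2)
  have O: "[a, b] \<in> Ob (prod_cat (replicate 2 A)) \<longleftrightarrow> a \<in> Ob A \<and> b \<in> Ob A"
    and R: "[u, v] \<in> Ar (prod_cat (replicate 2 A)) \<longleftrightarrow> u \<in> Ar A \<and> v \<in> Ar A"
    and D: "delta_arg (replicate 2 A) i [a, b] c \<longleftrightarrow> i < 2 \<and> a \<in> Ob A \<and> b \<in> Ob A \<and> c \<in> Ob A" for a b c u v i
    by (auto simp: Ob_pow Ar_pow delta_arg_pow)
  have E: "[] \<in> Ob (prod_cat (replicate 0 A))" unfolding Ob_pow by simp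
  have "m_ob (perm_tensor 2 id) [a, b] = a \<otimes> b" for a b
    using ext_otimes[of a b] by (cases "a \<in> Ob A \<and> b \<in> Ob A")
      (auto simp: perm_tensor_eq[OF permutes_id] restrict_mlmap_def O)
  moreover have "m_ar (perm_tensor 2 id) [u, v] = u \<boxtimes> v" for u v
    using ext_atimes[of u v] by (cases "u \<in> Ar A \<and> v \<in> Ar A")
      (auto simp: perm_tensor_eq[OF permutes_id] restrict_mlmap_def R)
  moreover have "m_delta (perm_tensor 2 id) 0 [a, b] a' = dl a a' b" for a b a'
    using ext_d_l[of a a' b] by (cases "a \<in> Ob A \<and> a' \<in> Ob A \<and> b \<in> Ob A")
      (auto simp: perm_tensor_eq[OF permutes_id] restrict_mlmap_def D tensor_delta_def delta_one)
  moreover have "m_delta (perm_tensor 2 id) 1 [a, b] b' = dr a b b'" for a b b'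
    using ext_d_r[of a b b'] by (cases "a \<in> Ob A \<and> b \<in> Ob A \<and> b' \<in> Ob A")
      (auto simp: perm_tensor_eq[OF permutes_id] restrict_mlmap_def D tensor_delta_def delta_one)
  moreover have "m_ob (perm_tensor 0 id) [] = \<one>"
    using perm_tensor_simps(1)[OF permutes_id E] by simp
  ultimately show ?thesis
    by (simp add: associative_of_def assms fun_eq_iff)
qed

definition associative_multifunctor ::
  "(unit, nat \<Rightarrow> nat, nat \<Rightarrow> nat, ('o, 'm) permcat, ('o, 'm) mlmap, ('o, 'm) mltrans) mfun" where
  "associative_multifunctor = \<lparr>F_ob = (\<lambda>_. A), F_o = tensor_fo,
     F_a = (\<lambda>as b f. if f \<in> Sym (length as)
       then ide (P_hom (replicate (length as) A) A) (perm_tensor (length as) f) else undefined)\<rparr>"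

lemma category_P_hom_pow: "category (P_hom (replicate k A) A)"
  by (rule category_P_hom) (use add.permutative_category_axioms in \<open>auto split: if_splits\<close>)

lemma multifunctor_associative: "multifunctor Sigma_operad Perm_multicat associative_multifunctor"
proof (rule multifunctor.intro, goal_cases)
  case (1 a)
  show ?case using add.permutative_category_axioms by (simp add: associative_multifunctor_def Perm_multicat_def)
next
  case (2 as b)
  have "cat_functor (discrete_cat (Sym (length as))) (P_hom (replicate (length as) A) A)
      (F_o associative_multifunctor as b) (F_a associative_multifunctor as b)"
    by (rule functor_from_discrete[OF category_P_hom_pow])
       (auto simp: associative_multifunctor_def tensor_fo_def P_hom_simps(1) multilinear_perm_tensor Sym_iff)
  then show ?case
    by (simp add: associative_multifunctor_def Perm_multicat_def Sigma_operad_def map_replicate_const)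
next
  case 3
  show ?case using tensor_fo_laws
    by (simp add: associative_multifunctor_def Perm_multicat_def Sigma_operad_def)
next
  case 4
  let ?F = "\<lambda>as (b :: unit) f. if f \<in> Sym (length as)
       then ide (P_hom (replicate (length as) A) A) (perm_tensor (length as) f) else undefined"
  have "multifunctor_laws {()} (\<lambda>as b. Sym (length as)) (\<lambda>\<sigma> as b f. f \<circ> \<sigma>) (\<lambda>a. id)
     (\<lambda>ass bs c g fs. Sym_gam ass g fs) P_act_a (\<lambda>a. ide (P_hom [a] a) (P_unit a)) P_gam_a (\<lambda>_. A) ?F"
  proof (unfold_locales, goal_cases)
    case (1 as b f \<sigma>)
    then show ?case
      by (simp add: Sym_iff permutes_compose P_act_a_ide perm_tensor_act map_replicate_const)
  next
    case (2 a)
    then show ?case using perm_tensor_unit by (simp add: Sym_iff permutes_id)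
  next
    case (3 c g bs ass fs)
    note c = composable_Sym[OF 3(3)]
    have g: "g permutes {..<length ass}" using 3(2) c by (simp add: Sym_iff)
    have \<rho>: "Sym_gam ass g fs permutes {..<length (concat ass)}" by (rule Sym_gam_permutes[OF g]) (use c in auto)
    let ?fs = "map (\<lambda>i. perm_tensor (length (ass ! i)) (fs ! i)) [0..<length ass]"
    have "map (\<lambda>i. ?F (ass ! i) (bs ! i) (fs ! i)) [0..<length bs] =
        map (\<lambda>i. ide (P_hom (replicate (length (ass ! i)) A) A) (?fs ! i)) [0..<length ass]"
      using c by (simp add: Sym_iff)
    moreover have "P_gam_a (map (\<lambda>as. replicate (length as) A) ass) (replicate (length ass) A) A
        (ide (P_hom (replicate (length ass) A) A) (perm_tensor (length ass) g))
        (map (\<lambda>i. ide (P_hom (replicate (length (ass ! i)) A) A) (?fs ! i)) [0..<length ass]) =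
      ide (P_hom (replicate (length (concat ass)) A) A) (perm_tensor (length (concat ass)) (Sym_gam ass g fs))"
      using P_gam_a_ide[of ass A "perm_tensor (length ass) g" ?fs] multilinear_perm_tensor g c
        perm_tensor_gam[OF g, of fs] by (simp add: concat_replicates)
    ultimately show ?case using c g \<rho>
      by (simp only: Sym_iff map_map_const map_replicate_const if_True)
  qed
  then show ?case
    by (simp add: associative_multifunctor_def Perm_multicat_def Sigma_operad_def)
next
  case 5
  show ?case by (auto simp: extensional_def Sigma_operad_def)
next
  case (6 as b f)
  then show ?case by (auto simp: associative_multifunctor_def Sigma_operad_def tensor_fo_def)
next
  case (7 as b f)
  then show ?case by (auto simp: associative_multifunctor_def Sigma_operad_def)
qed

end

context bipermutative_category
begin

text \<open>The image of the arrow \<open>(\<sigma>, \<rho>)\<close> of \<open>E\<Sigma>\<^sub>k\<close>. The factors of \<open>place \<sigma> xs\<close> are labelled by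
  their indices in \<open>xs\<close>.\<close>

definition perm_coh :: "nat \<Rightarrow> (nat \<Rightarrow> nat) \<Rightarrow> (nat \<Rightarrow> nat) \<Rightarrow> ('o, 'm) mltrans" where
  "perm_coh k \<sigma> \<rho> = \<lparr>t_src = perm_tensor k \<sigma>, t_tgt = perm_tensor k \<rho>,
     t_comp = restrict (\<lambda>xs. coh (\<lambda>i. xs ! i) (place \<sigma> [0..<k]) (place \<rho> [0..<k]))
       (Ob (prod_cat (replicate k A)))\<rparr>"

lemma tensor_delta_label:
  assumes "distinct ls" "n < length ls"
  shows "tensor_delta n (map x ls) x' = label_delta x ls (ls ! n) x'"
proof -
  have ls: "ls = take n ls @ ls ! n # drop (Suc n) ls" using assms(2) by (rule id_take_nth_drop)
  then have n: "ls ! n \<notin> set (take n ls)" using assms(1) by (metis disjoint_iff distinct_append list.set_intros(1))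
  have "label_delta x ls (ls ! n) x' = label_delta x (take n ls @ ls ! n # drop (Suc n) ls) (ls ! n) x'"
    by (rule arg_cong[where f = "\<lambda>l. label_delta x l (ls ! n) x'", OF ls])
  then show ?thesis
    unfolding label_delta_split[OF n] using assms by (simp add: tensor_delta_def take_map drop_map)
qed

lemma multilinear_trans_perm_coh:
  assumes \<sigma>: "\<sigma> permutes {..<k}" and \<rho>: "\<rho> permutes {..<k}"
  shows "multilinear_trans (replicate k A) A (perm_coh k \<sigma> \<rho>)" (is "multilinear_trans ?Cs A ?\<phi>")
proof (rule multilinear_trans.intro)
  let ?l = "place \<sigma> [0..<k]" and ?m = "place \<rho> [0..<k]"
  note s = multilinear_perm_tensor[OF \<sigma>] multilinear_perm_tensor[OF \<rho>]
  have m: "mset ?l = mset ?m" "distinct ?l" "distinct ?m" "set ?l = {..<k}" "set ?m = {..<k}"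
    using permutes_mset_upt[OF \<sigma>] permutes_mset_upt[OF \<rho>] permutes_distinct_upt[OF \<sigma>]
      permutes_distinct_upt[OF \<rho>] permutes_surj_upt[OF \<sigma>] permutes_surj_upt[OF \<rho>] by auto
  have pl: "place \<sigma> xs = map (\<lambda>i. xs ! i) ?l" "place \<rho> xs = map (\<lambda>i. xs ! i) ?m" if "length xs = k" for xs :: "'c list"
    using place_eq_map_nth[of \<sigma> xs] place_eq_map_nth[of \<rho> xs] that \<sigma> \<rho> by auto
  have x: "(\<lambda>i. xs ! i) ` {..<k} \<subseteq> Ob A" "length xs = k" if "xs \<in> Ob (prod_cat ?Cs)" for xs
    using that by (auto simp: Ob_pow)
  have upd: "xs[i := y] \<in> Ob (prod_cat ?Cs)" if "xs \<in> Ob (prod_cat ?Cs)" "y \<in> Ob A" for xs i y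
    using that set_update_subset_insert[of xs i y] by (auto simp: Ob_pow)
  show "multilinear ?Cs A (t_src ?\<phi>)" "multilinear ?Cs A (t_tgt ?\<phi>)" using s by (simp_all add: perm_coh_def)
  show "t_comp ?\<phi> \<in> extensional (Ob (prod_cat ?Cs))" by (simp add: perm_coh_def)
  show "nat_trans (prod_cat ?Cs) A (m_ob (t_src ?\<phi>)) (m_ar (t_src ?\<phi>)) (m_ob (t_tgt ?\<phi>)) (m_ar (t_tgt ?\<phi>)) (t_comp ?\<phi>)"
  proof (intro nat_trans.intro nat_trans_axioms.intro)
    show "cat_functor (prod_cat ?Cs) A (m_ob (t_src ?\<phi>)) (m_ar (t_src ?\<phi>))"
      "cat_functor (prod_cat ?Cs) A (m_ob (t_tgt ?\<phi>)) (m_ar (t_tgt ?\<phi>))"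
      using s by (simp_all add: perm_coh_def multilinear.functoriality)
    fix xs assume xs: "xs \<in> Ob (prod_cat ?Cs)"
    then show "t_comp ?\<phi> xs \<in> hom A (m_ob (t_src ?\<phi>) xs) (m_ob (t_tgt ?\<phi>) xs)"
      using coh_in[OF m(1), of "\<lambda>i. xs ! i"] x[OF xs] m(4) pl[of xs]
      by (simp add: perm_coh_def perm_tensor_simps[OF \<sigma>] perm_tensor_simps[OF \<rho>] hom_iff)
  next
    fix us xs ys assume us: "us \<in> hom (prod_cat ?Cs) xs ys"
    then have u: "us \<in> Ar (prod_cat ?Cs)" "length us = k" "set us \<subseteq> Ar A" "xs = map (cdom A) us" "ys = map (ccod A) us"
      by (auto simp: hom_pow Ar_pow)
    then have xy: "xs \<in> Ob (prod_cat ?Cs)" "ys \<in> Ob (prod_cat ?Cs)" by (auto simp: Ob_pow)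
    have "tensor_ar (map (\<lambda>i. us ! i) ?m) \<cdot> coh (\<lambda>i. xs ! i) ?l ?m =
        coh (\<lambda>i. ys ! i) ?l ?m \<cdot> tensor_ar (map (\<lambda>i. us ! i) ?l)"
      by (rule coh_natural[OF m(1,3)]) (use u m in auto)
    then show "t_comp ?\<phi> ys \<cdot> m_ar (t_src ?\<phi>) us = m_ar (t_tgt ?\<phi>) us \<cdot> t_comp ?\<phi> xs"
      using pl[OF u(2)] u(1) xy by (simp add: perm_coh_def perm_tensor_simps[OF \<sigma>] perm_tensor_simps[OF \<rho>])
  qed
  fix i xs x' assume a: "delta_arg ?Cs i xs x'"
  then have xs: "xs \<in> Ob (prod_cat ?Cs)" "i < k" "x' \<in> Ob A" "length xs = k" "xs ! i \<in> Ob A"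
    by (auto simp: delta_arg_pow Ob_pow)
  have fu: "(\<lambda>j. xs[i := y] ! j) = (\<lambda>j. xs ! j)(i := y)" for y
    using xs(2,4) by (auto simp: nth_update_iff)
  have d: "tensor_delta (\<sigma> i) (place \<sigma> xs) x' = label_delta (\<lambda>j. xs ! j) ?l i x'"
    "tensor_delta (\<rho> i) (place \<rho> xs) x' = label_delta (\<lambda>j. xs ! j) ?m i x'"
    using tensor_delta_label[OF m(2), of "\<sigma> i" "\<lambda>j. xs ! j" x'] tensor_delta_label[OF m(3), of "\<rho> i" "\<lambda>j. xs ! j" x']
      pl[OF xs(4)] permutes_less[OF \<sigma> xs(2)] permutes_less[OF \<rho> xs(2)]
      place_nth[of \<sigma> "[0..<k]" i] place_nth[of \<rho> "[0..<k]" i] \<sigma> \<rho> xs(2) by simp_all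
  have "coh ((\<lambda>j. xs ! j)(i := xs ! i \<oplus> x')) ?l ?m \<cdot> label_delta (\<lambda>j. xs ! j) ?l i x' =
      label_delta (\<lambda>j. xs ! j) ?m i x' \<cdot> (coh (\<lambda>j. xs ! j) ?l ?m \<boxplus> coh ((\<lambda>j. xs ! j)(i := x')) ?l ?m)"
    by (rule coh_delta[OF m(1,3)]) (use x[OF xs(1)] m(5) xs in auto)
  then show "t_comp ?\<phi> (xs[i := osum (?Cs ! i) (xs ! i) x']) \<cdot> m_delta (t_src ?\<phi>) i xs x' =
      m_delta (t_tgt ?\<phi>) i xs x' \<cdot> (t_comp ?\<phi> xs \<boxplus> t_comp ?\<phi> (xs[i := x']))"
    using xs a by (simp add: perm_coh_def perm_tensor_simps[OF \<sigma>] perm_tensor_simps[OF \<rho>] upd d fu)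
qed

lemma perm_coh_ide:
  assumes "\<sigma> permutes {..<k}"
  shows "perm_coh k \<sigma> \<sigma> = ide (P_hom (replicate k A) A) (perm_tensor k \<sigma>)"
proof -
  have "coh (\<lambda>i. xs ! i) (place \<sigma> [0..<k]) (place \<sigma> [0..<k]) = \<iota> (m_ob (perm_tensor k \<sigma>) xs)"
    if "xs \<in> Ob (prod_cat (replicate k A))" for xs
    using coh_self[OF permutes_distinct_upt[OF assms], of "\<lambda>i. xs ! i"] that permutes_surj_upt[OF assms]
      place_eq_map_nth[of \<sigma> xs] nth_image_subset[of xs "Ob A" k] assms
    by (auto simp: perm_tensor_simps[OF assms] Ob_pow)
  then show ?thesis by (auto simp: perm_coh_def P_hom_simps restrict_def)
qed

lemma perm_coh_cmp:
  assumes "\<sigma> permutes {..<k}" "\<rho> permutes {..<k}" "\<pi> permutes {..<k}"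
  shows "cmp (P_hom (replicate k A) A) (perm_coh k \<rho> \<pi>) (perm_coh k \<sigma> \<rho>) = perm_coh k \<sigma> \<pi>"
proof -
  have "coh (\<lambda>i. xs ! i) (place \<rho> [0..<k]) (place \<pi> [0..<k]) \<cdot> coh (\<lambda>i. xs ! i) (place \<sigma> [0..<k]) (place \<rho> [0..<k]) =
      coh (\<lambda>i. xs ! i) (place \<sigma> [0..<k]) (place \<pi> [0..<k])"
    if "xs \<in> Ob (prod_cat (replicate k A))" for xs
    by (rule coh_trans)
       (use that assms permutes_mset_upt permutes_distinct_upt permutes_surj_upt in \<open>auto simp: Ob_pow\<close>)
  then show ?thesis by (auto simp: perm_coh_def P_hom_simps restrict_def)
qed

text \<open>Acting by \<open>\<sigma>\<close> changes the labels by \<open>\<sigma>\<^sup>-\<^sup>1\<close>, and canonical arrows do not depend on the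
  choice of the labels.\<close>

lemma perm_coh_act:
  assumes \<sigma>: "\<sigma> permutes {..<k}" and f: "f permutes {..<k}" and g: "g permutes {..<k}"
  shows "P_act_a \<sigma> (replicate k A) A (perm_coh k f g) = perm_coh k (f \<circ> \<sigma>) (g \<circ> \<sigma>)"
proof -
  have "coh (\<lambda>i. place \<sigma> xs ! i) (place f [0..<k]) (place g [0..<k]) =
      coh (\<lambda>i. xs ! i) (place (f \<circ> \<sigma>) [0..<k]) (place (g \<circ> \<sigma>) [0..<k])"
    if xs: "xs \<in> Ob (prod_cat (replicate k A))" for xs
  proof -
    have lx: "length xs = k" using xs by (simp add: Ob_pow)
    have inv: "place \<sigma> [0..<k] = map (inv \<sigma>) [0..<k]"
      using permutes_less[OF permutes_inv[OF \<sigma>]] by (auto intro!: nth_equalityI simp: nth_permute_list)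
    have pc: "place (h \<circ> \<sigma>) [0..<k] = map (inv \<sigma>) (place h [0..<k])" if h: "h permutes {..<k}" for h
      using place_compose[of h "[0..<k]" \<sigma>] h \<sigma> map_place[of h "[0..<k]" "inv \<sigma>"] inv by simp
    have "coh (\<lambda>i. xs ! i) (map (inv \<sigma>) (place f [0..<k])) (map (inv \<sigma>) (place g [0..<k])) =
        coh ((\<lambda>i. xs ! i) \<circ> inv \<sigma>) (place f [0..<k]) (place g [0..<k])"
    proof (rule coh_map)
      show "mset (place f [0..<k]) = mset (place g [0..<k])" "distinct (place g [0..<k])"
        using permutes_mset_upt[OF f] permutes_mset_upt[OF g] permutes_distinct_upt[OF g] by simp_all
      show "inj_on (inv \<sigma>) (set (place g [0..<k]))"
        using permutes_inj[OF permutes_inv[OF \<sigma>]] by (rule inj_on_subset) simp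
      show "(\<lambda>i. xs ! i) ` inv \<sigma> ` set (place g [0..<k]) \<subseteq> Ob A"
        unfolding permutes_surj_upt[OF g] using permutes_less[OF permutes_inv[OF \<sigma>]] xs
        by (auto simp: Ob_pow)
    qed
    also have "\<dots> = coh (\<lambda>i. place \<sigma> xs ! i) (place f [0..<k]) (place g [0..<k])"
      by (rule coh_cong) (use lx permutes_surj_upt[OF f] permutes_surj_upt[OF g] in \<open>auto simp: nth_permute_list\<close>)
    finally show ?thesis unfolding pc[OF f] pc[OF g] by simp
  qed
  moreover have "place \<sigma> xs \<in> Ob (prod_cat (replicate k A))" if "xs \<in> Ob (prod_cat (replicate k A))" for xs
    using that \<sigma> by (auto simp: Ob_pow permutes_inv)
  ultimately show ?thesis
    using \<sigma> by (auto simp: P_act_a_def perm_coh_def perm_tensor_act[OF f \<sigma>] perm_tensor_act[OF g \<sigma>] restrict_def fun_eq_iff)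
qed

text \<open>\<open>\<Gamma>\<close> first applies the canonical arrows inside the blocks and then exchanges the blocks. Both
  steps are canonical for the long product, by \<open>tensor_ar_coh\<close> and \<open>coh_concat\<close>, and so is their
  composite.\<close>

lemma perm_coh_gam:
  fixes ass :: "unit list list"
  assumes g: "g permutes {..<length ass}" and h: "h permutes {..<length ass}"
    and l: "length fs = length ass" "length gs = length ass"
    and fs: "\<And>i. i < length ass \<Longrightarrow> (fs ! i) permutes {..<length (ass ! i)}"
    and gs: "\<And>i. i < length ass \<Longrightarrow> (gs ! i) permutes {..<length (ass ! i)}"
  shows "P_gam_a (map (\<lambda>as. replicate (length as) A) ass) (replicate (length ass) A) A
      (perm_coh (length ass) g h)
      (map (\<lambda>i. perm_coh (length (ass ! i)) (fs ! i) (gs ! i)) [0..<length ass]) =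
    perm_coh (length (concat ass)) (Sym_gam ass g fs) (Sym_gam ass h gs)"
    (is "P_gam_a ?Css ?Bs A ?G ?F = perm_coh ?N ?\<rho> ?\<rho>'")
proof -
  let ?js = "map length ass" and ?n = "length ass"
  have Css: "concat ?Css = replicate ?N A" by (rule concat_replicates)
  have js: "map length ?Css = ?js" by simp
  have \<rho>: "?\<rho> permutes {..<?N}" "?\<rho>' permutes {..<?N}" by (rule Sym_gam_permutes; fact)+
  have src: "map t_src ?F = map (\<lambda>i. perm_tensor (length (ass ! i)) (fs ! i)) [0..<?n]"
    "map t_tgt ?F = map (\<lambda>i. perm_tensor (length (ass ! i)) (gs ! i)) [0..<?n]"
    by (simp_all add: perm_coh_def)
  have comp: "t_comp ?G (map2 m_ob (map t_tgt ?F) (unconcat ?js xs)) \<cdot>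
        m_ar (t_src ?G) (map2 t_comp ?F (unconcat ?js xs)) =
      coh (\<lambda>i. xs ! i) (place ?\<rho> [0..<?N]) (place ?\<rho>' [0..<?N])"
    if xs: "xs \<in> Ob (prod_cat (replicate ?N A))" for xs
  proof -
    let ?X = "\<lambda>i. xs ! i"
    have lx: "length xs = ?N" and xO: "set xs \<subseteq> Ob A" using xs by (simp_all add: Ob_pow)
    obtain nss where nss: "[0..<?N] = concat nss" "map length nss = ?js"
      by (rule block_list_cases[of "[0..<?N]" ?js]) (simp_all add: length_concat)
    have ln: "length nss = ?n" using nss(2) by (metis length_map)
    have lni: "length (nss ! i) = length (ass ! i)" if "i < ?n" for i
      using that nss(2) ln by (metis nth_map)
    have nsub: "set (nss ! i) \<subseteq> {..<?N}" if "i < ?n" for i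
    proof -
      have "set (nss ! i) \<subseteq> set (concat nss)" using UN_upper[of "nss ! i" "set nss" set] that ln by simp
      then show ?thesis unfolding nss(1)[symmetric] by (simp add: lessThan_atLeast0)
    qed
    have dn: "distinct (concat nss)" unfolding nss(1)[symmetric] by simp
    have dni: "distinct (nss ! i)" if "i < ?n" for i
      using dn that ln by (simp add: distinct_concat_iff)
    have "xs = map ?X (concat nss)" using lx map_nth[of xs] unfolding nss(1)[symmetric] by simp
    then have xss: "unconcat ?js xs = map (map ?X) nss"
      using unconcat_concat[of "map (map ?X) nss"] nss(2) by (simp add: map_concat comp_def)
    let ?b = "\<lambda>i. place (fs ! i) (nss ! i)" and ?b' = "\<lambda>i. place (gs ! i) (nss ! i)"
    let ?I = "place g [0..<?n]" and ?J = "place h [0..<?n]"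
    have sb: "set (?b i) = set (nss ! i)" "set (?b' i) = set (nss ! i)" "mset (?b i) = mset (?b' i)"
      if "i < ?n" for i
      using fs[OF that] gs[OF that] lni[OF that] by (simp_all add: permutes_inv)
    have I: "set ?I = {..<?n}" "set ?J = {..<?n}" "mset ?I = mset ?J" "distinct ?I" "distinct ?J"
      using permutes_surj_upt[OF g] permutes_surj_upt[OF h] permutes_mset_upt[OF g] permutes_mset_upt[OF h]
        permutes_distinct_upt[OF g] permutes_distinct_upt[OF h] by auto
    have lab: "place ?\<rho> [0..<?N] = concat (map ?b ?I)" "place ?\<rho>' [0..<?N] = concat (map ?b' ?J)"
    proof -
      have e: "place_each fs nss = map ?b [0..<?n]" "place_each gs nss = map ?b' [0..<?n]"
        using l ln by (auto intro!: nth_equalityI)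
      have m: "place g (map ?b [0..<?n]) = map ?b ?I" "place h (map ?b' [0..<?n]) = map ?b' ?J"
        by (rule map_place[symmetric], use g h in simp)+
      have "place ?\<rho> (concat nss) = concat (place g (place_each fs nss))"
        by (rule place_Sym_gam[OF g l(1) fs nss(2)])
      moreover have "place ?\<rho>' (concat nss) = concat (place h (place_each gs nss))"
        by (rule place_Sym_gam[OF h l(2) gs nss(2)])
      ultimately show "place ?\<rho> [0..<?N] = concat (map ?b ?I)" "place ?\<rho>' [0..<?N] = concat (map ?b' ?J)"
        by (simp_all only: nss(1) e m)
    qed
    have XO: "?X ` set (nss ! i) \<subseteq> Ob A" if "i < ?n" for i
      using image_mono[OF nsub[OF that], of ?X] nth_image_subset[OF xO, of ?N] lx by (metis order_refl subset_trans)
    \<comment> \<open>labels inside of a block are replaced by labels in the long list\<close>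
    have c: "map2 t_comp ?F (map (map ?X) nss) = map (\<lambda>i. coh ?X (?b i) (?b' i)) [0..<?n]"
    proof (rule nth_equalityI)
      fix i assume "i < length (map2 t_comp ?F (map (map ?X) nss))"
      then have i: "i < ?n" using ln by simp
      let ?k = "length (ass ! i)"
      have fi: "fs ! i permutes {..<?k}" and gi: "gs ! i permutes {..<?k}" using fs gs i by auto
      have "map ?X (nss ! i) \<in> Ob (prod_cat (replicate ?k A))"
        using XO[OF i] lni[OF i] by (simp add: Ob_pow)
      then have "map2 t_comp ?F (map (map ?X) nss) ! i =
          coh (\<lambda>r. map ?X (nss ! i) ! r) (place (fs ! i) [0..<?k]) (place (gs ! i) [0..<?k])"
        using i ln by (simp add: perm_coh_def)
      also have "\<dots> = coh (?X \<circ> (\<lambda>r. nss ! i ! r)) (place (fs ! i) [0..<?k]) (place (gs ! i) [0..<?k])"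
        by (rule coh_cong) (use permutes_surj_upt[OF fi] permutes_surj_upt[OF gi] lni[OF i] in auto)
      also have "\<dots> = coh ?X (map (\<lambda>r. nss ! i ! r) (place (fs ! i) [0..<?k])) (map (\<lambda>r. nss ! i ! r) (place (gs ! i) [0..<?k]))"
      proof (rule coh_map[symmetric])
        show "mset (place (fs ! i) [0..<?k]) = mset (place (gs ! i) [0..<?k])" "distinct (place (gs ! i) [0..<?k])"
          using permutes_mset_upt[OF fi] permutes_mset_upt[OF gi] permutes_distinct_upt[OF gi] by simp_all
        show "inj_on (\<lambda>r. nss ! i ! r) (set (place (gs ! i) [0..<?k]))"
          using inj_on_nth[OF dni[OF i], of "{..<?k}"] lni[OF i] permutes_surj_upt[OF gi] by simp
        show "?X ` (\<lambda>r. nss ! i ! r) ` set (place (gs ! i) [0..<?k]) \<subseteq> Ob A"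
          using XO[OF i] lni[OF i] permutes_surj_upt[OF gi] by auto
      qed
      also have "\<dots> = coh ?X (?b i) (?b' i)"
        using place_eq_map_nth[of "fs ! i" "nss ! i"] place_eq_map_nth[of "gs ! i" "nss ! i"] lni[OF i] fi gi by simp
      finally show "map2 t_comp ?F (map (map ?X) nss) ! i = map (\<lambda>i. coh ?X (?b i) (?b' i)) [0..<?n] ! i"
        using i by simp
    qed (use ln in simp)
    have o: "map2 m_ob (map t_tgt ?F) (map (map ?X) nss) = map (\<lambda>i. ten ?X (?b' i)) [0..<?n]"
    proof (rule nth_equalityI)
      fix i assume "i < length (map2 m_ob (map t_tgt ?F) (map (map ?X) nss))"
      then have i: "i < ?n" using ln by simp
      have "map ?X (nss ! i) \<in> Ob (prod_cat (replicate (length (ass ! i)) A))"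
        using XO[OF i] lni[OF i] by (simp add: Ob_pow)
      then show "map2 m_ob (map t_tgt ?F) (map (map ?X) nss) ! i = map (\<lambda>i. ten ?X (?b' i)) [0..<?n] ! i"
        using i ln lni[OF i] gs[OF i] map_place[of "gs ! i" "nss ! i" ?X]
        by (simp add: perm_coh_def perm_tensor_simps)
    qed (use ln in simp)
    have bO: "?X ` set (?b i) \<subseteq> Ob A" "?X ` set (?b' i) \<subseteq> Ob A" if "i < ?n" for i
      using XO[OF that] sb[OF that] by simp_all
    have mc: "mset (concat (map ?b ls)) = mset (concat (map ?b' ls))" if "set ls \<subseteq> {..<?n}" for ls
      using that sb(3) by (induction ls) auto
    have dd: "distinct (concat (map ?b ?I))" "distinct (concat (map ?b' ?J))" "distinct (concat (map ?b' ?I))"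
    proof -
      show "distinct (concat (map ?b ?I))" "distinct (concat (map ?b' ?J))"
        using permutes_distinct_upt[OF \<rho>(1)] permutes_distinct_upt[OF \<rho>(2)] unfolding lab by simp_all
      then show "distinct (concat (map ?b' ?I))"
        using mset_eq_imp_distinct_iff[OF mc[of ?I]] I(1) by simp
    qed
    have "m_ar (t_src ?G) (map (\<lambda>i. coh ?X (?b i) (?b' i)) [0..<?n]) =
        tensor_ar (map (\<lambda>i. coh ?X (?b i) (?b' i)) ?I)"
    proof -
      have "map (\<lambda>i. coh ?X (?b i) (?b' i)) [0..<?n] \<in> Ar (prod_cat (replicate ?n A))"
        using coh_in sb(3) bO by (auto simp: Ar_pow)
      then show ?thesis
        using map_place[of g "[0..<?n]" "\<lambda>i. coh ?X (?b i) (?b' i)"] g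
        by (simp add: perm_coh_def perm_tensor_simps[OF g])
    qed
    also have "\<dots> = coh ?X (concat (map ?b ?I)) (concat (map ?b' ?I))"
      by (rule tensor_ar_coh[OF _ dd(1)]) (use sb bO I(1) in auto)
    finally have inner: "m_ar (t_src ?G) (map (\<lambda>i. coh ?X (?b i) (?b' i)) [0..<?n]) =
        coh ?X (concat (map ?b ?I)) (concat (map ?b' ?I))" .
    let ?y = "map (\<lambda>i. ten ?X (?b' i)) [0..<?n]"
    have "?y \<in> Ob (prod_cat (replicate ?n A))" using bO by (auto simp: Ob_pow)
    then have "t_comp ?G ?y = coh (\<lambda>i. ?y ! i) ?I ?J" by (simp add: perm_coh_def)
    also have "\<dots> = coh ?X (concat (map ?b' ?I)) (concat (map ?b' ?J))"
      by (rule coh_concat[OF I(3,5) dd(2)]) (use bO I(2) in auto)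
    finally have outer: "t_comp ?G ?y = coh ?X (concat (map ?b' ?I)) (concat (map ?b' ?J))" .
    have "mset (concat (map ?b' ?I)) = mset (concat (map ?b' ?J))"
    proof -
      have "mset (concat (map ?b ?I)) = mset (concat (map ?b' ?J))"
        unfolding lab[symmetric] using permutes_mset_upt[OF \<rho>(1)] permutes_mset_upt[OF \<rho>(2)] by simp
      then show ?thesis using mc[of ?I] I(1) by simp
    qed
    then have "coh ?X (concat (map ?b' ?I)) (concat (map ?b' ?J)) \<cdot> coh ?X (concat (map ?b ?I)) (concat (map ?b' ?I)) =
        coh ?X (concat (map ?b ?I)) (concat (map ?b' ?J))"
    proof (intro coh_trans)
      show "mset (concat (map ?b ?I)) = mset (concat (map ?b' ?I))" using mc[of ?I] I(1) by simp
      show "?X ` set (concat (map ?b' ?I)) \<subseteq> Ob A"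
      proof (rule image_subsetI)
        fix z assume "z \<in> set (concat (map ?b' ?I))"
        then obtain i where "i < ?n" "z \<in> set (?b' i)" using I(1) by auto
        then show "?X z \<in> Ob A" using bO(2)[of i] by blast
      qed
    qed (use dd(3) in simp_all)
    then show ?thesis unfolding xss c o inner outer lab .
  qed
  have r: "restrict (\<lambda>xs. let xss = unconcat ?js xs in
        t_comp ?G (map2 m_ob (map t_tgt ?F) xss) \<cdot> m_ar (t_src ?G) (map2 t_comp ?F xss))
      (Ob (prod_cat (replicate ?N A))) =
    restrict (\<lambda>xs. coh (\<lambda>i. xs ! i) (place ?\<rho> [0..<?N]) (place ?\<rho>' [0..<?N])) (Ob (prod_cat (replicate ?N A)))"
    by (rule restrict_ext) (simp only: Let_def comp)
  have G: "t_src ?G = perm_tensor ?n g" "t_tgt ?G = perm_tensor ?n h" by (simp_all add: perm_coh_def)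
  show ?thesis
    unfolding P_gam_a_def Css js r unfolding G src perm_coh_def[of ?N]
    using perm_tensor_gam[OF g l(1) fs] perm_tensor_gam[OF h l(2) gs] by simp
qed

definition bipermutative_multifunctor ::
  "(unit, nat \<Rightarrow> nat, (nat \<Rightarrow> nat) \<times> (nat \<Rightarrow> nat), ('o, 'm) permcat, ('o, 'm) mlmap, ('o, 'm) mltrans) mfun" where
  "bipermutative_multifunctor = \<lparr>F_ob = (\<lambda>_. A), F_o = tensor_fo,
     F_a = (\<lambda>as b u. if u \<in> Sym (length as) \<times> Sym (length as)
       then perm_coh (length as) (fst u) (snd u) else undefined)\<rparr>"

lemma multifunctor_bipermutative: "multifunctor ESigma_operad Perm_multicat bipermutative_multifunctor"
proof (rule multifunctor.intro, goal_cases)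
  case (1 a)
  show ?case using add.permutative_category_axioms by (simp add: bipermutative_multifunctor_def Perm_multicat_def)
next
  case (2 as b)
  let ?C = "indiscrete_cat (Sym (length as))" and ?P = "P_hom (replicate (length as) A) A"
  have "cat_functor ?C ?P (F_o bipermutative_multifunctor as b) (F_a bipermutative_multifunctor as b)"
  proof (intro cat_functor.intro cat_functor_axioms.intro category_indiscrete category_P_hom_pow)
    show "F_o bipermutative_multifunctor as b f \<in> Ob ?P" if "f \<in> Ob ?C" for f
      using that by (simp add: bipermutative_multifunctor_def tensor_fo_def P_hom_simps multilinear_perm_tensor Sym_iff)
    show "F_a bipermutative_multifunctor as b u \<in>
        hom ?P (F_o bipermutative_multifunctor as b f) (F_o bipermutative_multifunctor as b g)"
      if "u \<in> hom ?C f g" for u f g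
      using that multilinear_trans_perm_coh[of f "length as" g]
      by (auto simp: bipermutative_multifunctor_def tensor_fo_def P_hom_simps hom_iff Sym_iff perm_coh_def)
    show "F_a bipermutative_multifunctor as b (ide ?C f) = ide ?P (F_o bipermutative_multifunctor as b f)"
      if "f \<in> Ob ?C" for f
      using that perm_coh_ide[of f "length as"] by (simp add: bipermutative_multifunctor_def tensor_fo_def Sym_iff)
    show "F_a bipermutative_multifunctor as b (cmp ?C v u) =
        cmp ?P (F_a bipermutative_multifunctor as b v) (F_a bipermutative_multifunctor as b u)"
      if "u \<in> hom ?C f g" "v \<in> hom ?C g h" for u v f g h
      using that perm_coh_cmp[of f "length as" g h]
      by (auto simp: bipermutative_multifunctor_def hom_iff Sym_iff)
  qed
  then show ?case
    by (simp add: bipermutative_multifunctor_def Perm_multicat_def ESigma_operad_def map_replicate_const)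
next
  case 3
  show ?case using tensor_fo_laws
    by (simp add: bipermutative_multifunctor_def Perm_multicat_def ESigma_operad_def)
next
  case 4
  let ?F = "\<lambda>as (b :: unit) u. if u \<in> Sym (length as) \<times> Sym (length as)
       then perm_coh (length as) (fst u) (snd u) else undefined"
  have "multifunctor_laws {()} (\<lambda>as b. Sym (length as) \<times> Sym (length as))
     (\<lambda>\<sigma> as b u. (fst u \<circ> \<sigma>, snd u \<circ> \<sigma>)) (\<lambda>a. (id, id))
     (\<lambda>ass bs c v us. (Sym_gam ass (fst v) (map fst us), Sym_gam ass (snd v) (map snd us)))
     P_act_a (\<lambda>a. ide (P_hom [a] a) (P_unit a)) P_gam_a (\<lambda>_. A) ?F"
  proof (unfold_locales, goal_cases)
    case (1 as b u \<sigma>)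
    then show ?case
      using perm_coh_act[of \<sigma> "length as" "fst u" "snd u"]
      by (auto simp: Sym_iff permutes_compose map_replicate_const)
  next
    case (2 a)
    then show ?case
      using perm_coh_ide[of id 1] perm_tensor_unit by (simp add: Sym_iff permutes_id)
  next
    case (3 c v bs ass us)
    have l: "length us = length ass" "length bs = length ass"
      and us: "\<And>i. i < length ass \<Longrightarrow> us ! i \<in> Sym (length (ass ! i)) \<times> Sym (length (ass ! i))"
      using 3(3) by (auto simp: composable_def)
    have v: "fst v permutes {..<length ass}" "snd v permutes {..<length ass}"
      using 3(2) l by (auto simp: Sym_iff)
    have u: "\<And>i. i < length ass \<Longrightarrow> (map fst us ! i) permutes {..<length (ass ! i)}"
      "\<And>i. i < length ass \<Longrightarrow> (map snd us ! i) permutes {..<length (ass ! i)}"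
      using us l by (auto simp: mem_Times_iff Sym_iff)
    have \<rho>: "(Sym_gam ass (fst v) (map fst us), Sym_gam ass (snd v) (map snd us)) \<in>
        Sym (length (concat ass)) \<times> Sym (length (concat ass))"
      using Sym_gam_permutes[OF v(1), of "map fst us"] Sym_gam_permutes[OF v(2), of "map snd us"] u l
      by (simp add: Sym_iff)
    have "map (\<lambda>i. ?F (ass ! i) (bs ! i) (us ! i)) [0..<length bs] =
        map (\<lambda>i. perm_coh (length (ass ! i)) (map fst us ! i) (map snd us ! i)) [0..<length ass]"
      using us l by auto
    moreover have "?F bs c v = perm_coh (length ass) (fst v) (snd v)" using 3(2) l by simp
    ultimately show ?case
      using perm_coh_gam[OF v, of "map fst us" "map snd us"] u l \<rho>
      by (simp only: map_map_const map_replicate_const if_True fst_conv snd_conv length_map)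
  qed
  then show ?case
    by (simp add: bipermutative_multifunctor_def Perm_multicat_def ESigma_operad_def)
next
  case 5
  show ?case by (auto simp: extensional_def ESigma_operad_def)
next
  case (6 as b f)
  then show ?case by (auto simp: bipermutative_multifunctor_def ESigma_operad_def tensor_fo_def)
next
  case (7 as b f)
  then show ?case by (auto simp: bipermutative_multifunctor_def ESigma_operad_def)
qed

lemma bipermutative_of_multifunctor: "bipermutative_of bipermutative_multifunctor = S"
proof -
  have O: "[a, b] \<in> Ob (prod_cat (replicate 2 A)) \<longleftrightarrow> a \<in> Ob A \<and> b \<in> Ob A" for a b
    by (auto simp: Ob_pow)
  have t: "transpose 0 1 permutes {..<2::nat}" by (rule permutes_swap_id) simp_all
  have p: "place (transpose 0 1) [0..<2] = [1, 0]"
    by (rule place_eqI) (use t in \<open>auto simp: less_Suc_eq numeral_2_eq_2\<close>)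
  have "t_comp (perm_coh 2 id (transpose 0 1)) [a, b] = \<tau> a b" for a b
  proof (cases "a \<in> Ob A \<and> b \<in> Ob A")
    case True
    have "[0..<2] = [0, 1::nat]" by (simp add: numeral_2_eq_2)
    then show ?thesis
      using True coh_adjacent[of "[]" 0 "1::nat" "[]" "\<lambda>i. [a, b] ! i"] p
      by (simp add: perm_coh_def O)
  next
    case False
    then show ?thesis using ext_tsym[of a b] by (auto simp: perm_coh_def O)
  qed
  moreover have "id \<in> Sym 2" "id \<in> Sym 0" "transpose 0 1 \<in> Sym 2" using t by (simp_all add: Sym_iff permutes_id)
  moreover have "associative_of bipermutative_multifunctor =
      \<lparr>otimes = otimes S, atimes = atimes S, tone = \<one>, d_l = dl, d_r = dr\<rparr>"
    by (rule associative_of_perm_tensor)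
       (use calculation(2,3) in \<open>simp_all add: bipermutative_multifunctor_def tensor_fo_def numeral_2_eq_2\<close>)
  ultimately show ?thesis
    by (intro sym_tensor.equality)
       (simp_all add: bipermutative_of_def tensor.extend_def bipermutative_multifunctor_def numeral_2_eq_2)
qed

end

lemma associative_of_multifunctor:
  assumes "tensor_category A S"
  shows "associative_of (tensor_category.associative_multifunctor A S) = (S :: ('o, 'm) tensor)"
proof -
  interpret tensor_category A S by fact
  have "associative_of associative_multifunctor =
      \<lparr>otimes = otimes S, atimes = atimes S, tone = \<one>, d_l = dl, d_r = dr\<rparr>"
    by (rule associative_of_perm_tensor)
       (simp_all add: associative_multifunctor_def tensor_fo_def Sym_iff permutes_id numeral_2_eq_2)
  then show ?thesis by simp
qed

section \<open>The structure determined by a multifunctor\<close>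

lemma unit_lists: "as \<in> lists {()}"
  by (simp add: in_lists_conv_set)

lemma Sym_gam_id:
  fixes ass :: "unit list list"
  shows "Sym_gam ass id (map (\<lambda>_. id) ass) = id"
proof (rule Sym_gam_eqI)
  show "Sym_gam ass id (map (\<lambda>_. id) ass) permutes {..<sum_list (map length ass)}"
    unfolding length_concat[symmetric] by (rule Sym_gam_permutes) (auto simp: permutes_id)
  show "id permutes {..<sum_list (map length ass)}" by (rule permutes_id)
  fix xss :: "nat list list" assume xss: "map length xss = map length ass"
  then have "length xss = length ass" by (metis length_map)
  then have "place_each (map (\<lambda>_. id) ass) xss = xss" by (auto intro!: nth_equalityI)
  moreover have "place (Sym_gam ass id (map (\<lambda>_. id) ass)) (concat xss) =
      concat (place id (place_each (map (\<lambda>_. id) ass) xss))"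
    by (rule place_Sym_gam) (use xss in \<open>auto simp: permutes_id\<close>)
  ultimately show "place (Sym_gam ass id (map (\<lambda>_. id) ass)) (concat xss) = place id (concat xss)" by simp
qed

lemma P_gam_o_simps:
  "xs \<in> Ob (prod_cat (concat Css)) \<Longrightarrow>
    m_ob (P_gam_o Css Bs D g fs) xs = m_ob g (map2 m_ob fs (unconcat (map length Css) xs))"
  "us \<in> Ar (prod_cat (concat Css)) \<Longrightarrow>
    m_ar (P_gam_o Css Bs D g fs) us = m_ar g (map2 m_ar fs (unconcat (map length Css) us))"
  "delta_arg (concat Css) i xs x' \<Longrightarrow> m_delta (P_gam_o Css Bs D g fs) i xs x' =
    (case block_pos (map length Css) i of (j, r) \<Rightarrow>
        let xss = unconcat (map length Css) xs; ys = map2 m_ob fs xss in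
        cmp D (m_ar g ((ide (prod_cat Bs) ys)[j := m_delta (fs ! j) r (xss ! j) x']))
          (m_delta g j ys (m_ob (fs ! j) ((xss ! j)[r := x']))))"
  by (simp_all add: P_gam_o_def restrict_mlmap_def)

lemma P_unit_simps:
  "a \<in> Ob A \<Longrightarrow> m_ob (P_unit A) [a] = a" "u \<in> Ar A \<Longrightarrow> m_ar (P_unit A) [u] = u"
  "a \<in> Ob A \<Longrightarrow> a' \<in> Ob A \<Longrightarrow> m_delta (P_unit A) 0 [a] a' = ide A (osum A a a')"
  by (simp_all add: P_unit_def restrict_mlmap_def Ob_prod Ar_prod delta_arg_def)

lemma mlmap_eqI:
  assumes f: "multilinear Cs D f" and g: "multilinear Cs D g"
    and "\<And>xs. xs \<in> Ob (prod_cat Cs) \<Longrightarrow> m_ob f xs = m_ob g xs"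
    "\<And>us. us \<in> Ar (prod_cat Cs) \<Longrightarrow> m_ar f us = m_ar g us"
    "\<And>i xs x'. delta_arg Cs i xs x' \<Longrightarrow> m_delta f i xs x' = m_delta g i xs x'"
  shows "f = g"
proof (rule mlmap.equality)
  show "m_ob f = m_ob g" using multilinear.ext_ob[OF f] multilinear.ext_ob[OF g] assms(3) by (rule extensionalityI)
  show "m_ar f = m_ar g" using multilinear.ext_ar[OF f] multilinear.ext_ar[OF g] assms(4) by (rule extensionalityI)
  have "m_delta f i xs x' = m_delta g i xs x'" for i xs x'
    using multilinear.ext_delta[OF f] multilinear.ext_delta[OF g] assms(5) by (cases "delta_arg Cs i xs x'") simp_all
  then show "m_delta f = m_delta g" by (simp add: fun_eq_iff)
qed simp

text \<open>The part of a multifunctor to \<open>\<^bold>P\<close> that concerns objects. It is the same for \<open>\<Sigma>\<^sub>*\<close> and for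
  \<open>E\<Sigma>\<^sub>*\<close>, which have the same objects.\<close>

locale operad_action = add: permutative_category A for A :: "('o, 'm) permcat" +
  fixes Fo :: "unit list \<Rightarrow> unit \<Rightarrow> (nat \<Rightarrow> nat) \<Rightarrow> ('o, 'm) mlmap"
  assumes laws: "multifunctor_laws {()} (\<lambda>as b. Sym (length as)) (\<lambda>\<sigma> as b f. f \<circ> \<sigma>) (\<lambda>a. id)
     (\<lambda>ass bs c g fs. Sym_gam ass g fs) P_act_o P_unit P_gam_o (\<lambda>_. A) Fo"
  and multilinear: "\<sigma> \<in> Sym (length as) \<Longrightarrow> multilinear (replicate (length as) A) A (Fo as b \<sigma>)"
begin

interpretation F: multifunctor_laws "{()}" "\<lambda>as b. Sym (length as)" "\<lambda>\<sigma> as b f. f \<circ> \<sigma>" "\<lambda>a. id"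
  "\<lambda>ass bs c g fs. Sym_gam ass g fs" P_act_o P_unit P_gam_o "\<lambda>_. A" Fo
  by (rule laws)

definition op :: "nat \<Rightarrow> ('o, 'm) mlmap" where "op k = Fo (replicate k ()) () id"

lemma multilinear_op: "multilinear (replicate k A) A (op k)"
  using multilinear[of id "replicate k ()" "()"] by (simp add: op_def Sym_iff permutes_id)

text \<open>Every permutation is a translate of an identity: \<open>\<sigma> = \<sigma>\<^sup>*1\<close>.\<close>

lemma Fo_op:
  assumes "\<sigma> \<in> Sym (length as)"
  shows "Fo as b \<sigma> = P_act_o \<sigma> (replicate (length as) A) A (op (length as))"
proof -
  have as: "as = replicate (length as) ()" by (auto intro!: nth_equalityI)
  have \<sigma>: "\<sigma> permutes {..<length as}" using assms by (simp add: Sym_iff)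
  have "permute_list \<sigma> as = as" by (subst (1 2) as) (use \<sigma> in simp)
  moreover have "Fo (permute_list \<sigma> as) b (id \<circ> \<sigma>) = P_act_o \<sigma> (map (\<lambda>_. A) as) A (Fo as b id)"
    by (rule F.pres_act) (use \<sigma> in \<open>auto simp: Sym_iff permutes_id\<close>)
  moreover have "Fo as b id = op (length as)" unfolding op_def by (subst as) simp
  ultimately show ?thesis by (simp add: map_replicate_const)
qed

lemma op_1: "op (Suc 0) = P_unit A"
  using F.pres_unit[of "()"] by (simp add: op_def)

lemma op_gam:
  "P_gam_o (map (\<lambda>j. replicate j A) js) (replicate (length js) A) A (op (length js)) (map op js) = op (sum_list js)"
proof -
  let ?ass = "map (\<lambda>j. replicate j ()) js" and ?n = "length js"
  have c: "concat ?ass = replicate (sum_list js) ()" by (induction js) (simp_all add: replicate_add)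
  have "Fo (concat ?ass) () (Sym_gam ?ass id (map (\<lambda>_. id) ?ass)) =
      P_gam_o (map (map (\<lambda>_. A)) ?ass) (map (\<lambda>_. A) (replicate ?n ())) A (Fo (replicate ?n ()) () id)
        (map (\<lambda>i. Fo (?ass ! i) (replicate ?n () ! i) (map (\<lambda>_. id) ?ass ! i)) [0..<length (replicate ?n ())])"
    by (rule F.pres_gam) (auto simp: Sym_iff permutes_id composable_def)
  moreover have "map (\<lambda>i. Fo (?ass ! i) (replicate ?n () ! i) (map (\<lambda>_. id) ?ass ! i)) [0..<length (replicate ?n ())] =
      map op js"
    by (auto simp: op_def intro!: nth_equalityI)
  moreover have "map (map (\<lambda>_. A)) ?ass = map (\<lambda>j. replicate j A) js" by simp
  ultimately show ?thesis by (simp add: Sym_gam_id c op_def del: map_map)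
qed

abbreviation "two \<equiv> op (Suc (Suc 0))"

lemma multilinear_two: "multilinear [A, A] A two"
  using multilinear_op[of "Suc (Suc 0)"] by simp

lemma Ob_2: "[a, b] \<in> Ob (prod_cat [A, A]) \<longleftrightarrow> a \<in> Ob A \<and> b \<in> Ob A"
  and Ar_2: "[u, v] \<in> Ar (prod_cat [A, A]) \<longleftrightarrow> u \<in> Ar A \<and> v \<in> Ar A"
  and hom_2: "[u, v] \<in> hom (prod_cat [A, A]) [a, b] [c, d] \<longleftrightarrow> u \<in> hom A a c \<and> v \<in> hom A b d"
  and arg_2: "delta_arg [A, A] i [a, b] c \<longleftrightarrow> (i = 0 \<or> i = 1) \<and> a \<in> Ob A \<and> b \<in> Ob A \<and> c \<in> Ob A"
  by (auto simp: Ob_prod Ar_prod hom_prod delta_arg_def All_less_Suc2 less_Suc_eq nth_Cons')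

lemma Ob_3: "[a, b, c] \<in> Ob (prod_cat [A, A, A]) \<longleftrightarrow> a \<in> Ob A \<and> b \<in> Ob A \<and> c \<in> Ob A"
  and Ar_3: "[u, v, w] \<in> Ar (prod_cat [A, A, A]) \<longleftrightarrow> u \<in> Ar A \<and> v \<in> Ar A \<and> w \<in> Ar A"
  and arg_3: "delta_arg [A, A, A] i [a, b, c] x \<longleftrightarrow> i < 3 \<and> a \<in> Ob A \<and> b \<in> Ob A \<and> c \<in> Ob A \<and> x \<in> Ob A"
  by (auto simp: Ob_prod Ar_prod delta_arg_def All_less_Suc2 less_Suc_eq nth_Cons' numeral_3_eq_3)

lemma Ob_1: "[a] \<in> Ob (prod_cat [A]) \<longleftrightarrow> a \<in> Ob A"
  and Ar_1: "[u] \<in> Ar (prod_cat [A]) \<longleftrightarrow> u \<in> Ar A"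
  and arg_1: "delta_arg [A] i [a] x \<longleftrightarrow> i = 0 \<and> a \<in> Ob A \<and> x \<in> Ob A"
  by (auto simp: Ob_prod Ar_prod delta_arg_def)

lemma three_left: "P_gam_o [[A, A], [A]] [A, A] A two [two, P_unit A] = op 3"
  and three_right: "P_gam_o [[A], [A, A]] [A, A] A two [P_unit A, two] = op 3"
  and one_left: "P_gam_o [[], [A]] [A, A] A two [op 0, P_unit A] = P_unit A"
  and one_right: "P_gam_o [[A], []] [A, A] A two [P_unit A, op 0] = P_unit A"
  using op_gam[of "[Suc (Suc 0), Suc 0]"] op_gam[of "[Suc 0, Suc (Suc 0)]"] op_gam[of "[0, Suc 0]"] op_gam[of "[Suc 0, 0]"]
  by (simp_all add: op_1 numeral_3_eq_3)

lemma op_0_ar: "m_ar (op 0) [] = ide A (m_ob (op 0) [])" and op_0_ob: "m_ob (op 0) [] \<in> Ob A"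
proof -
  interpret G: cat_functor "prod_cat ([] :: ('o, 'm) permcat list)" A "m_ob (op 0)" "m_ar (op 0)"
    using multilinear.functoriality[OF multilinear_op[of 0]] by simp
  have E: "[] \<in> Ob (prod_cat ([] :: ('o, 'm) permcat list))" by (simp add: Ob_prod)
  show "m_ob (op 0) [] \<in> Ob A" by (rule G.ob_in[OF E])
  show "m_ar (op 0) [] = ide A (m_ob (op 0) [])" using G.ar_ide[OF E] by (simp add: prod_cat_simps)
qed

text \<open>Associativity and the conditions on \<open>d_l\<close> and \<open>d_r\<close> at products are the components of the
  equation \<open>\<Gamma>(1\<^sub>2; 1\<^sub>2, 1\<^sub>1) = 1\<^sub>3 = \<Gamma>(1\<^sub>2; 1\<^sub>1, 1\<^sub>2)\<close>, the distributivity maps giving one condition for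
  each of the three variables. The conditions on \<open>1\<close> are those of
  \<open>\<Gamma>(1\<^sub>2; 1\<^sub>0, 1\<^sub>1) = 1\<^sub>1 = \<Gamma>(1\<^sub>2; 1\<^sub>1, 1\<^sub>0)\<close>. The others say that the value at \<open>1\<^sub>2\<close> is 2-linear.\<close>

lemma distributive_structure_two:
  fixes S :: "('o, 'm, 'z) tensor_scheme"
  assumes S: "otimes S = (\<lambda>a b. m_ob two [a, b])" "atimes S = (\<lambda>u v. m_ar two [u, v])"
    "tone S = m_ob (op 0) []" "d_l S = (\<lambda>a a' b. m_delta two 0 [a, b] a')"
    "d_r S = (\<lambda>a b b'. m_delta two 1 [a, b] b')"
  shows "distributive_structure A S"
    and "a \<in> Ob A \<Longrightarrow> b \<in> Ob A \<Longrightarrow> b' \<in> Ob A \<Longrightarrow> c \<in> Ob A \<Longrightarrow>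
      cmp A (atimes S (d_r S a b b') (ide A c)) (d_l S (otimes S a b) (otimes S a b') c) =
      cmp A (atimes S (ide A a) (d_l S b b' c)) (d_r S a (otimes S b c) (otimes S b' c))"
proof -
  interpret f: multilinear "[A, A]" A two by (rule multilinear_two)
  interpret G: cat_functor "prod_cat [A, A]" A "m_ob two" "m_ar two" by (rule f.functoriality)
  have ob [simp]: "m_ob two [a, b] \<in> Ob A" if "a \<in> Ob A" "b \<in> Ob A" for a b
    using G.ob_in[of "[a, b]"] that by (simp add: Ob_2)
  have hom: "m_ar two [u, v] \<in> hom A (m_ob two [a, b]) (m_ob two [c, d])"
    if "u \<in> hom A a c" "v \<in> hom A b d" for u v a b c d
    using G.ar_in[of "[u, v]" "[a, b]" "[c, d]"] that by (simp add: hom_2)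
  have ar [simp]: "m_ar two [u, v] \<in> Ar A" "cdom A (m_ar two [u, v]) = m_ob two [cdom A u, cdom A v]"
    "ccod A (m_ar two [u, v]) = m_ob two [ccod A u, ccod A v]" if "u \<in> Ar A" "v \<in> Ar A" for u v
    using hom[of u "cdom A u" "ccod A u" v "cdom A v" "ccod A v"] that by (simp_all add: hom_iff)
  have ide: "m_ar two [ide A a, ide A b] = ide A (m_ob two [a, b])" if "a \<in> Ob A" "b \<in> Ob A" for a b
    using G.ar_ide[of "[a, b]"] that by (simp add: Ob_2 prod_cat_simps)
  have dl [simp]: "m_delta two 0 [a, b] a' \<in> Ar A"
      "cdom A (m_delta two 0 [a, b] a') = osum A (m_ob two [a, b]) (m_ob two [a', b])"
      "ccod A (m_delta two 0 [a, b] a') = m_ob two [osum A a a', b]"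
    if "a \<in> Ob A" "a' \<in> Ob A" "b \<in> Ob A" for a a' b
    using f.delta_in[of 0 "[a, b]" a'] that by (simp_all add: arg_2 hom_iff)
  have dr [simp]: "m_delta two (Suc 0) [a, b] b' \<in> Ar A"
      "cdom A (m_delta two (Suc 0) [a, b] b') = osum A (m_ob two [a, b]) (m_ob two [a, b'])"
      "ccod A (m_delta two (Suc 0) [a, b] b') = m_ob two [a, osum A b b']"
    if "a \<in> Ob A" "b \<in> Ob A" "b' \<in> Ob A" for a b b'
    using f.delta_in[of 1 "[a, b]" b'] that by (simp_all add: arg_2 hom_iff)
  note [simp] = P_unit_simps op_0_ob op_0_ar
  \<comment> \<open>\<open>1\<^sub>3\<close> as \<open>\<Gamma>(1\<^sub>2; 1\<^sub>2, 1\<^sub>1)\<close> and as \<open>\<Gamma>(1\<^sub>2; 1\<^sub>1, 1\<^sub>2)\<close>\<close>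
  have assoc_ob: "m_ob two [m_ob two [a, b], c] = m_ob two [a, m_ob two [b, c]]"
    if "a \<in> Ob A" "b \<in> Ob A" "c \<in> Ob A" for a b c
    using arg_cong[OF trans[OF three_left three_right[symmetric]], of "\<lambda>f. m_ob f [a, b, c]"] that
    by (simp add: P_gam_o_simps Ob_3)
  have assoc_ar: "m_ar two [m_ar two [u, v], w] = m_ar two [u, m_ar two [v, w]]"
    if "u \<in> Ar A" "v \<in> Ar A" "w \<in> Ar A" for u v w
    using arg_cong[OF trans[OF three_left three_right[symmetric]], of "\<lambda>f. m_ar f [u, v, w]"] that
    by (simp add: P_gam_o_simps Ar_3)
  have assoc_delta: "m_delta (P_gam_o [[A, A], [A]] [A, A] A two [two, P_unit A]) i xs x =
      m_delta (P_gam_o [[A], [A, A]] [A, A] A two [P_unit A, two]) i xs x" for i xs x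
    by (simp only: three_left three_right)
  have dl_times: "m_delta two 0 [a, m_ob two [b, c]] a' =
      cmp A (m_ar two [m_delta two 0 [a, b] a', ide A c]) (m_delta two 0 [m_ob two [a, b], c] (m_ob two [a', b]))"
    if "a \<in> Ob A" "a' \<in> Ob A" "b \<in> Ob A" "c \<in> Ob A" for a a' b c
    using assoc_delta[of 0 "[a, b, c]" a'] that
    by (simp add: P_gam_o_simps arg_3 Let_def prod_cat_simps ide)
  have middle: "cmp A (m_ar two [m_delta two (Suc 0) [a, b] b', ide A c]) (m_delta two 0 [m_ob two [a, b], c] (m_ob two [a, b'])) =
      cmp A (m_ar two [ide A a, m_delta two 0 [b, c] b']) (m_delta two (Suc 0) [a, m_ob two [b, c]] (m_ob two [b', c]))"
    if "a \<in> Ob A" "b \<in> Ob A" "b' \<in> Ob A" "c \<in> Ob A" for a b b' c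
    using assoc_delta[of "Suc 0" "[a, b, c]" b'] that
    by (simp add: P_gam_o_simps arg_3 Let_def prod_cat_simps)
  have dr_times: "m_delta two (Suc 0) [m_ob two [a, b], c] c' =
      cmp A (m_ar two [ide A a, m_delta two (Suc 0) [b, c] c']) (m_delta two (Suc 0) [a, m_ob two [b, c]] (m_ob two [b, c']))"
    if "a \<in> Ob A" "b \<in> Ob A" "c \<in> Ob A" "c' \<in> Ob A" for a b c c'
    using assoc_delta[of "Suc (Suc 0)" "[a, b, c]" c'] that
    by (simp add: P_gam_o_simps arg_3 Let_def prod_cat_simps ide)
  have unit_ob: "m_ob two [m_ob (op 0) [], a] = a" "m_ob two [a, m_ob (op 0) []] = a" if "a \<in> Ob A" for a
    using arg_cong[OF one_left, of "\<lambda>f. m_ob f [a]"] arg_cong[OF one_right, of "\<lambda>f. m_ob f [a]"] that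
    by (simp_all add: P_gam_o_simps Ob_1)
  have unit_ar: "m_ar two [ide A (m_ob (op 0) []), u] = u" "m_ar two [u, ide A (m_ob (op 0) [])] = u" if "u \<in> Ar A" for u
    using arg_cong[OF one_left, of "\<lambda>f. m_ar f [u]"] arg_cong[OF one_right, of "\<lambda>f. m_ar f [u]"] that
    by (simp_all add: P_gam_o_simps Ar_1)
  have dr_one: "m_delta two (Suc 0) [m_ob (op 0) [], b] b' = ide A (osum A b b')" if "b \<in> Ob A" "b' \<in> Ob A" for b b'
    using arg_cong[OF one_left, of "\<lambda>f. m_delta f 0 [b] b'"] that
    by (simp add: P_gam_o_simps arg_1 Let_def prod_cat_simps ide unit_ob)
  have dl_one: "m_delta two 0 [a, m_ob (op 0) []] a' = ide A (osum A a a')" if "a \<in> Ob A" "a' \<in> Ob A" for a a'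
    using arg_cong[OF one_right, of "\<lambda>f. m_delta f 0 [a] a'"] that
    by (simp add: P_gam_o_simps arg_1 Let_def prod_cat_simps ide unit_ob)
  show "distributive_structure A S"
  proof (unfold_locales, unfold S, goal_cases)
    case (1 a b) then show ?case by simp
  next
    case (2 u a a' v b b') then show ?case by (rule hom)
  next
    case (3 a b) then show ?case by (rule ide)
  next
    case (4 u a a' u' a'' v b b' v' b'')
    then show ?case
      using G.ar_cmp[of "[u, v]" "[a, b]" "[a', b']" "[u', v']" "[a'', b'']"] by (simp add: hom_2 prod_cat_simps)
  next
    case 5 show ?case by simp
  next
    case (6 a b c) then show ?case by (rule assoc_ob)
  next
    case (7 u v w) then show ?case by (rule assoc_ar)
  next
    case (8 a) then show ?case by (rule unit_ob)
  next
    case (9 a) then show ?case by (rule unit_ob)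
  next
    case (10 u) then show ?case by (rule unit_ar)
  next
    case (11 u) then show ?case by (rule unit_ar)
  next
    case (12 a b)
    then show ?case using f.ext_ob extensional_arb[of "m_ob two" _ "[a, b]"] by (auto simp: Ob_2)
  next
    case (13 u v)
    then show ?case using f.ext_ar extensional_arb[of "m_ar two" _ "[u, v]"] by (auto simp: Ar_2)
  next
    case (14 a a' b)
    then show ?case using f.ext_delta[of 0 "[a, b]" a'] by (auto simp: arg_2)
  next
    case (15 a b b')
    then show ?case using f.ext_delta[of 1 "[a, b]" b'] by (auto simp: arg_2)
  next
    case (16 a a' b) then show ?case by (simp add: hom_iff)
  next
    case (17 a b b') then show ?case by (simp add: hom_iff)
  next
    case (18 u a c u' a' c' v b d)
    then show ?case using f.delta_nat[of "[u, v]" "[a, b]" "[c, d]" 0 u' a' c'] by (simp add: hom_2)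
  next
    case (19 u a c v b d v' b' d')
    then show ?case using f.delta_nat[of "[u, v]" "[a, b]" "[c, d]" 1 v' b' d'] by (simp add: hom_2)
  next
    case (20 a) then show ?case using f.zero_ob[of "[a, zero A]" 1] by (simp add: Ob_2)
  next
    case (21 a) then show ?case using f.zero_ob[of "[zero A, a]" 0] by (simp add: Ob_2)
  next
    case (22 u) then show ?case using f.zero_ar[of "[u, ide A (zero A)]" 1] by (simp add: Ar_2)
  next
    case (23 u) then show ?case using f.zero_ar[of "[ide A (zero A), u]" 0] by (simp add: Ar_2)
  next
    case (24 a a' b)
    then show ?case using f.delta_zero[of 0 "[a, b]" a'] by (auto simp: arg_2 Ex_less_Suc2)
  next
    case (25 a b b')
    then show ?case using f.delta_zero[of 1 "[a, b]" b'] by (auto simp: arg_2 Ex_less_Suc2)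
  next
    case (26 a a') then show ?case by (rule dl_one)
  next
    case (27 b b') then show ?case using dr_one by simp
  next
    case (28 a a' a'' b)
    then show ?case using f.delta_assoc[of 0 "[a, b]" a' a''] by (simp add: arg_2)
  next
    case (29 a b b' b'')
    then show ?case using f.delta_assoc[of 1 "[a, b]" b' b''] by (simp add: arg_2)
  next
    case (30 a a' b)
    then show ?case using f.delta_sym[of 0 "[a, b]" a'] by (simp add: arg_2 prod_cat_simps)
  next
    case (31 a b b')
    then show ?case using f.delta_sym[of 1 "[a, b]" b'] by (simp add: arg_2 prod_cat_simps)
  next
    case (32 a a' b c) then show ?case by (rule dl_times)
  next
    case (33 a b c c') then show ?case using dr_times by simp
  next
    case (34 a a' b b')
    then show ?case using f.delta_delta[of 1 "[a, b]" b' 0 a'] by (simp add: arg_2)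
  qed
  show "cmp A (atimes S (d_r S a b b') (ide A c)) (d_l S (otimes S a b) (otimes S a b') c) =
      cmp A (atimes S (ide A a) (d_l S b b' c)) (d_r S a (otimes S b c) (otimes S b' c))"
    if "a \<in> Ob A" "b \<in> Ob A" "b' \<in> Ob A" "c \<in> Ob A"
    using middle[OF that] by (simp add: S)
qed

end

text \<open>\<open>1\<^bsub>k+1\<^esub> = \<Gamma>(1\<^sub>2; 1\<^sub>1, 1\<^sub>k)\<close>, so that \<open>1\<^sub>2\<close> and \<open>1\<^sub>0\<close> generate \<open>\<Sigma>\<^sub>*\<close>.\<close>

lemma operad_action_eqI:
  assumes F: "operad_action A Fo" and G: "operad_action A Go"
    and assoc: "associative_of T = associative_of T'"
    and T: "F_o T = Fo" "F_o T' = Go" and \<sigma>: "\<sigma> \<in> Sym (length as)"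
  shows "Fo as b \<sigma> = Go as b \<sigma>"
proof -
  interpret F: operad_action A Fo by fact
  interpret G: operad_action A Go by fact
  have two: "F.two = Fo [(), ()] () id" "G.two = Go [(), ()] () id" and zero: "F.op 0 = Fo [] () id" "G.op 0 = Go [] () id"
    by (simp_all add: F.op_def G.op_def)
  have eq: "m_ob F.two [a, b] = m_ob G.two [a, b]" "m_ar F.two [u, v] = m_ar G.two [u, v]"
      "m_delta F.two 0 [a, b] a' = m_delta G.two 0 [a, b] a'"
      "m_delta F.two 1 [a, b] b' = m_delta G.two 1 [a, b] b'" "m_ob (F.op 0) [] = m_ob (G.op 0) []"
    for a b a' b' u v
    using assoc unfolding associative_of_def two zero Let_def T by (auto simp: fun_eq_iff)
  have "F.two = G.two"
  proof (rule mlmap_eqI[OF F.multilinear_two G.multilinear_two])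
    fix xs assume "xs \<in> Ob (prod_cat [A, A])"
    then obtain a b where "xs = [a, b]" by (auto simp: Ob_prod length_Suc_conv)
    then show "m_ob F.two xs = m_ob G.two xs" by (simp add: eq)
  next
    fix us assume "us \<in> Ar (prod_cat [A, A])"
    then obtain u v where "us = [u, v]" by (auto simp: Ar_prod length_Suc_conv)
    then show "m_ar F.two us = m_ar G.two us" by (simp add: eq)
  next
    fix i xs x' assume "delta_arg [A, A] i xs x'"
    then obtain a b where "xs = [a, b]" "i = 0 \<or> i = 1"
      by (auto simp: delta_arg_def Ob_prod length_Suc_conv less_Suc_eq)
    then show "m_delta F.two i xs x' = m_delta G.two i xs x'" using eq by auto
  qed
  moreover have "F.op 0 = G.op 0"
    by (rule mlmap_eqI[OF F.multilinear_op G.multilinear_op])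
       (use eq F.op_0_ar G.op_0_ar in \<open>auto simp: Ob_prod Ar_prod delta_arg_def\<close>)
  ultimately have "F.op k = G.op k" for k
  proof (induction k)
    case (Suc k)
    then show ?case
      using F.op_gam[of "[Suc 0, k]"] G.op_gam[of "[Suc 0, k]"] F.op_1 G.op_1 by simp
  qed simp
  then show ?thesis using F.Fo_op[OF \<sigma>] G.Fo_op[OF \<sigma>] by simp
qed

lemma operad_action_Sigma:
  assumes T: "multifunctor Sigma_operad Perm_multicat T" and A: "permutative_category A" and F: "F_ob T () = A"
  shows "operad_action A (F_o T)"
proof -
  interpret T: multifunctor Sigma_operad Perm_multicat T by fact
  interpret A: permutative_category A by fact
  have Fob: "F_ob T = (\<lambda>_. A)" using F by (auto simp: fun_eq_iff)
  show ?thesis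
  proof (intro operad_action.intro operad_action_axioms.intro A)
    show "multifunctor_laws {()} (\<lambda>as b. Sym (length as)) (\<lambda>\<sigma> as b f. f \<circ> \<sigma>) (\<lambda>a. id)
       (\<lambda>ass bs c g fs. Sym_gam ass g fs) P_act_o P_unit P_gam_o (\<lambda>_. A) (F_o T)"
      using T.laws_o by (simp add: Sigma_operad_def Perm_multicat_def Fob)
    show "multilinear (replicate (length as) A) A (F_o T as b \<sigma>)" if "\<sigma> \<in> Sym (length as)" for \<sigma> as b
      using cat_functor.ob_in[OF T.hom_functor[of as b], of \<sigma>] that unit_lists[of as]
      by (simp add: Sigma_operad_def Perm_multicat_def Fob P_hom_simps map_replicate_const)
  qed
qed

theorem associative_bij:
  assumes A: "permutative_category (A :: ('o, 'm) permcat)"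
  shows "bij_betw associative_of
    {T. multifunctor Sigma_operad Perm_multicat T \<and> F_ob T () = A} {S. associative_structure A S}"
proof (rule bij_betwI')
  fix T T' :: "(unit, nat \<Rightarrow> nat, nat \<Rightarrow> nat, ('o, 'm) permcat, ('o, 'm) mlmap, ('o, 'm) mltrans) mfun"
  assume "T \<in> {T. multifunctor Sigma_operad Perm_multicat T \<and> F_ob T () = A}"
    and "T' \<in> {T. multifunctor Sigma_operad Perm_multicat T \<and> F_ob T () = A}"
  then have T: "multifunctor Sigma_operad Perm_multicat T" "F_ob T () = A"
    and T': "multifunctor Sigma_operad Perm_multicat T'" "F_ob T' () = A" by auto
  interpret T: multifunctor Sigma_operad Perm_multicat T by (rule T(1))
  interpret T': multifunctor Sigma_operad Perm_multicat T' by (rule T'(1))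
  show "(associative_of T = associative_of T') = (T = T')"
  proof
    assume eq: "associative_of T = associative_of T'"
    have ob: "F_ob T = F_ob T'" using T(2) T'(2) by (auto simp: fun_eq_iff)
    have o: "F_o T as b f = F_o T' as b f" for as b f
    proof (cases "f \<in> Sym (length as)")
      case True
      then show ?thesis
        using operad_action_eqI[OF operad_action_Sigma[OF T(1) A T(2)] operad_action_Sigma[OF T'(1) A T'(2)] eq] by simp
    next
      case False
      then show ?thesis using T.ext_o[of as b f] T'.ext_o[of as b f] by (simp add: Sigma_operad_def)
    qed
    have a: "F_a T as b f = F_a T' as b f" for as b f
    proof (cases "f \<in> Sym (length as)")
      case True
      then show ?thesis
        using cat_functor.ar_ide[OF T.hom_functor[of as b], of f] cat_functor.ar_ide[OF T'.hom_functor[of as b], of f] unit_lists[of as]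
        by (simp add: Sigma_operad_def o ob)
    next
      case False
      then show ?thesis using T.ext_a[of as b f] T'.ext_a[of as b f] by (simp add: Sigma_operad_def)
    qed
    show "T = T'" by (rule mfun.equality) (use ob o a in \<open>auto simp: fun_eq_iff\<close>)
  qed simp
next
  fix T :: "(unit, nat \<Rightarrow> nat, nat \<Rightarrow> nat, ('o, 'm) permcat, ('o, 'm) mlmap, ('o, 'm) mltrans) mfun"
  assume "T \<in> {T. multifunctor Sigma_operad Perm_multicat T \<and> F_ob T () = A}"
  then interpret operad_action A "F_o T" using operad_action_Sigma A by auto
  have "distributive_structure A (associative_of T)"
    by (rule distributive_structure_two) (simp_all add: associative_of_def Let_def op_def)
  moreover have "associative_structure_axioms A (associative_of T)"
    by unfold_locales (rule distributive_structure_two, simp_all add: associative_of_def Let_def op_def)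
  ultimately show "associative_of T \<in> {S. associative_structure A S}"
    by (simp add: associative_structure_def)
next
  fix S :: "('o, 'm) tensor" assume "S \<in> {S. associative_structure A S}"
  then interpret associative_structure A S by simp
  interpret T: tensor_category A S
    by (intro tensor_category.intro distributive_structure_axioms A tensor_category_axioms.intro) (rule d_r_d_l_times)
  have "F_ob T.associative_multifunctor () = A" by (simp add: T.associative_multifunctor_def)
  then show "\<exists>T \<in> {T. multifunctor Sigma_operad Perm_multicat T \<and> F_ob T () = A}. S = associative_of T"
    using T.multifunctor_associative associative_of_multifunctor[OF T.tensor_category_axioms]
    by (intro bexI[of _ T.associative_multifunctor]) simp_all
qed

section \<open>The symmetry determined by a multifunctor\<close>

text \<open>Together with the conditions on objects, these are all conditions on a multifunctor from
  \<open>E\<Sigma>\<^sub>*\<close> to \<open>\<^bold>P\<close>.\<close>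

locale symmetric_action = operad_action A Fo for A :: "('o, 'm) permcat" and Fo +
  fixes Fa :: "unit list \<Rightarrow> unit \<Rightarrow> (nat \<Rightarrow> nat) \<times> (nat \<Rightarrow> nat) \<Rightarrow> ('o, 'm) mltrans"
  assumes Fa_functor: "cat_functor (indiscrete_cat (Sym (length as))) (P_hom (replicate (length as) A) A) (Fo as b) (Fa as b)"
  and arrow_laws: "multifunctor_laws {()} (\<lambda>as b. Sym (length as) \<times> Sym (length as))
     (\<lambda>\<sigma> as b u. (fst u \<circ> \<sigma>, snd u \<circ> \<sigma>)) (\<lambda>a. (id, id))
     (\<lambda>ass bs c v us. (Sym_gam ass (fst v) (map fst us), Sym_gam ass (snd v) (map snd us)))
     P_act_a (\<lambda>a. ide (P_hom [a] a) (P_unit a)) P_gam_a (\<lambda>_. A) Fa"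
begin

interpretation F: multifunctor_laws "{()}" "\<lambda>as b. Sym (length as) \<times> Sym (length as)"
  "\<lambda>\<sigma> as b u. (fst u \<circ> \<sigma>, snd u \<circ> \<sigma>)" "\<lambda>a. (id, id)"
  "\<lambda>ass bs c v us. (Sym_gam ass (fst v) (map fst us), Sym_gam ass (snd v) (map snd us))"
  P_act_a "\<lambda>a. ide (P_hom [a] a) (P_unit a)" P_gam_a "\<lambda>_. A" Fa
  by (rule arrow_laws)

definition opa :: "nat \<Rightarrow> (nat \<Rightarrow> nat) \<Rightarrow> (nat \<Rightarrow> nat) \<Rightarrow> ('o, 'm) mltrans" where
  "opa k \<sigma> \<rho> = Fa (replicate k ()) () (\<sigma>, \<rho>)"

lemma opa_ide: "opa k id id = ide (P_hom (replicate k A) A) (op k)"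
  using cat_functor.ar_ide[OF Fa_functor[of "replicate k ()" "()"], of id]
  by (simp add: opa_def op_def Sym_iff permutes_id)

lemma opa_hom:
  assumes "\<sigma> permutes {..<k}" "\<rho> permutes {..<k}"
  shows "multilinear_trans (replicate k A) A (opa k \<sigma> \<rho>)"
    and "t_src (opa k \<sigma> \<rho>) = P_act_o \<sigma> (replicate k A) A (op k)"
    and "t_tgt (opa k \<sigma> \<rho>) = P_act_o \<rho> (replicate k A) A (op k)"
  using cat_functor.ar_in[OF Fa_functor[of "replicate k ()" "()"], of "(\<sigma>, \<rho>)" \<sigma> \<rho>]
    Fo_op[of \<sigma> "replicate k ()" "()"] Fo_op[of \<rho> "replicate k ()" "()"] assms
  by (simp_all add: opa_def hom_iff P_hom_simps Sym_iff)

lemma opa_cmp: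
  assumes "\<sigma> permutes {..<k}" "\<rho> permutes {..<k}" "\<pi> permutes {..<k}"
  shows "cmp (P_hom (replicate k A) A) (opa k \<rho> \<pi>) (opa k \<sigma> \<rho>) = opa k \<sigma> \<pi>"
  using cat_functor.ar_cmp[OF Fa_functor[of "replicate k ()" "()"], of "(\<sigma>, \<rho>)" \<sigma> \<rho> "(\<rho>, \<pi>)" \<pi>] assms
  by (simp add: opa_def hom_iff Sym_iff)

lemma opa_act:
  assumes "\<sigma> permutes {..<k}" "\<rho> permutes {..<k}" "\<pi> permutes {..<k}"
  shows "P_act_a \<pi> (replicate k A) A (opa k \<sigma> \<rho>) = opa k (\<sigma> \<circ> \<pi>) (\<rho> \<circ> \<pi>)"
  using F.pres_act[of "replicate k ()" "()" "(\<sigma>, \<rho>)" \<pi>] assms unit_lists[of "replicate k ()"]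
  by (simp add: opa_def Sym_iff map_replicate_const)

lemma opa_gam:
  assumes gh: "g permutes {..<length js}" "h permutes {..<length js}"
    and l: "length fs = length js" "length hs = length js"
    and f: "\<And>i. i < length js \<Longrightarrow> (fs ! i) permutes {..<js ! i} \<and> (hs ! i) permutes {..<js ! i}"
  defines "ass \<equiv> map (\<lambda>j. replicate j ()) js"
  shows "P_gam_a (map (\<lambda>j. replicate j A) js) (replicate (length js) A) A (opa (length js) g h)
      (map (\<lambda>i. opa (js ! i) (fs ! i) (hs ! i)) [0..<length js]) =
    opa (sum_list js) (Sym_gam ass g fs) (Sym_gam ass h hs)"
proof -
  let ?n = "length js" and ?us = "zip fs hs"
  have c: "concat ass = replicate (sum_list js) ()" unfolding ass_def by (induction js) (simp_all add: replicate_add)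
  have "Fa (concat ass) () (Sym_gam ass (fst (g, h)) (map fst ?us), Sym_gam ass (snd (g, h)) (map snd ?us)) =
      P_gam_a (map (map (\<lambda>_. A)) ass) (map (\<lambda>_. A) (replicate ?n ())) A (Fa (replicate ?n ()) () (g, h))
        (map (\<lambda>i. Fa (ass ! i) (replicate ?n () ! i) (?us ! i)) [0..<length (replicate ?n ())])"
    by (rule F.pres_gam) (use gh l f in \<open>auto simp: Sym_iff composable_def ass_def\<close>)
  moreover have "map (\<lambda>i. Fa (ass ! i) (replicate ?n () ! i) (?us ! i)) [0..<length (replicate ?n ())] =
      map (\<lambda>i. opa (js ! i) (fs ! i) (hs ! i)) [0..<length js]"
    using l by (auto simp: opa_def ass_def)
  moreover have "map (map (\<lambda>_. A)) ass = map (\<lambda>j. replicate j A) js" by (simp add: ass_def)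
  moreover have "map (\<lambda>_. A) (replicate ?n ()) = replicate ?n A" by simp
  ultimately show ?thesis
    using l by (simp only: c opa_def[symmetric] map_fst_zip map_snd_zip fst_conv snd_conv)
qed

end

lemma Sym_gam_permutes_2:
  assumes "g permutes {..<Suc (Suc 0)}" "f permutes {..<length a}" "f' permutes {..<length b}"
  shows "Sym_gam [a, b] g [f, f'] permutes {..<length a + length b}"
proof -
  have "Sym_gam [a, b] g [f, f'] permutes {..<length (concat [a, b])}"
    by (rule Sym_gam_permutes) (use assms in \<open>auto simp: less_Suc_eq\<close>)
  then show ?thesis by simp
qed

lemma place_Sym_gam_2:
  assumes "g permutes {..<Suc (Suc 0)}" "f permutes {..<length a}" "f' permutes {..<length b}"
    "length xs = length a" "length ys = length b"
  shows "place (Sym_gam [a, b] g [f, f']) (xs @ ys) = concat (place g [place f xs, place f' ys])"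
proof -
  have "place (Sym_gam [a, b] g [f, f']) (concat [xs, ys]) = concat (place g (place_each [f, f'] [xs, ys]))"
    by (rule place_Sym_gam) (use assms in \<open>auto simp: less_Suc_eq\<close>)
  then show ?thesis by simp
qed

lemma place_transpose:
  "place (transpose 0 (Suc 0)) [x, y] = [y, x]" "permute_list (transpose 0 (Suc 0)) [x, y] = [y, x]"
  by (simp_all add: permute_list_def)

lemma transpose_permutes_2: "transpose 0 (Suc 0) permutes {..<Suc (Suc 0)}"
  by (rule permutes_swap_id) simp_all

context symmetric_action
begin

lemma opa_gam_2:
  assumes "g permutes {..<Suc (Suc 0)}" "h permutes {..<Suc (Suc 0)}" "f permutes {..<j}" "f' permutes {..<l}"
    "k permutes {..<j}" "k' permutes {..<l}"
  shows "P_gam_a [replicate j A, replicate l A] [A, A] A (opa (Suc (Suc 0)) g h) [opa j f k, opa l f' k'] =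
    opa (j + l) (Sym_gam [replicate j (), replicate l ()] g [f, f']) (Sym_gam [replicate j (), replicate l ()] h [k, k'])"
proof -
  have "([f, f'] ! i) permutes {..<[j, l] ! i} \<and> ([k, k'] ! i) permutes {..<[j, l] ! i}" if "i < length [j, l]" for i
    using that assms by (auto simp: less_Suc_eq)
  from opa_gam[of g "[j, l]" h "[f, f']" "[k, k']", OF _ _ _ _ this] assms(1,2) show ?thesis by simp
qed

abbreviation "sw \<equiv> transpose 0 (Suc 0)"

definition \<chi> :: "'o \<Rightarrow> 'o \<Rightarrow> 'm" where "\<chi> a b = t_comp (opa (Suc (Suc 0)) id sw) [a, b]"

lemmas opa_sw = opa_hom[OF permutes_id transpose_permutes_2, simplified]

text \<open>The axioms of a symmetry are images of equations between arrows of \<open>E\<Sigma>\<^sub>*\<close>. Such an equation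
  holds as soon as the sources and the targets agree. The relation of the symmetry to \<open>d_l\<close> and
  \<open>d_r\<close> says that the image of \<open>(1\<^sub>2, sw)\<close> is compatible with the distributivity maps.\<close>

lemma bipermutative_structure_two:
  fixes S :: "('o, 'm) sym_tensor"
  assumes S: "otimes S = (\<lambda>a b. m_ob two [a, b])" "atimes S = (\<lambda>u v. m_ar two [u, v])"
    "tone S = m_ob (op 0) []" "d_l S = (\<lambda>a a' b. m_delta two 0 [a, b] a')"
    "d_r S = (\<lambda>a b b'. m_delta two 1 [a, b] b')" and tsym: "tsym S = \<chi>"
  shows "bipermutative_structure A S"
proof -
  interpret D: distributive_structure A S by (rule distributive_structure_two[OF S])
  interpret X: multilinear_trans "[A, A]" A "opa (Suc (Suc 0)) id sw" by (rule opa_sw(1))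
  interpret N: nat_trans "prod_cat [A, A]" A "m_ob (t_src (opa (Suc (Suc 0)) id sw))" "m_ar (t_src (opa (Suc (Suc 0)) id sw))"
    "m_ob (t_tgt (opa (Suc (Suc 0)) id sw))" "m_ar (t_tgt (opa (Suc (Suc 0)) id sw))" "t_comp (opa (Suc (Suc 0)) id sw)"
    by (rule X.naturality)
  note act = P_act_o_pow[OF transpose_permutes_2, of A two, simplified] P_act_o_pow[OF permutes_id, of "Suc (Suc 0)" A two, simplified]
  have ot [simp]: "m_ob two [a, b] = otimes S a b" "m_ar two [u, v] = atimes S u v"
    "m_delta two 0 [a, b] a' = d_l S a a' b" "m_delta two (Suc 0) [a, b] b' = d_r S a b b'" "m_ob (op 0) [] = tone S"
    for a b u v a' b' by (simp_all add: S)
  have chi_in: "\<chi> a b \<in> hom A (otimes S a b) (otimes S b a)" if "a \<in> Ob A" "b \<in> Ob A" for a b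
    using N.component_in[of "[a, b]"] that by (simp add: \<chi>_def opa_sw act Ob_2 place_transpose)
  then have chi [simp]: "\<chi> a b \<in> Ar A" "cdom A (\<chi> a b) = otimes S a b" "ccod A (\<chi> a b) = otimes S b a"
    if "a \<in> Ob A" "b \<in> Ob A" for a b
    using that by (simp_all add: hom_iff)
  note [simp] = P_unit_simps op_0_ob op_0_ar
  have ide_comp: "t_comp (ide (P_hom Cs A) f) xs = ide A (m_ob f xs)" if "xs \<in> Ob (prod_cat Cs)" for f :: "('o, 'm) mlmap" and Cs xs
    using that by (simp add: P_hom_simps)
  have ide_st: "t_src (ide (P_hom Cs A) f) = f" "t_tgt (ide (P_hom Cs A) f) = f" for f :: "('o, 'm) mlmap" and Cs
    by (simp_all add: P_hom_simps)
  have gam_comp: "t_comp (P_gam_a Css Bs A \<psi> \<phi>s) xs = (let xss = unconcat (map length Css) xs in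
      cmp A (t_comp \<psi> (map2 m_ob (map t_tgt \<phi>s) xss)) (m_ar (t_src \<psi>) (map2 t_comp \<phi>s xss)))"
    if "xs \<in> Ob (prod_cat (concat Css))" for Css Bs \<psi> \<phi>s xs
    using that by (simp add: P_gam_a_def)
  let ?c = "opa (Suc (Suc 0)) id sw" and ?i = "opa (Suc (Suc 0)) id id" and ?u = "opa (Suc 0) id id" and ?z = "opa 0 id id"
  have i: "?i = ide (P_hom [A, A] A) two" and u: "?u = ide (P_hom [A] A) (P_unit A)" and z: "?z = ide (P_hom [] A) (op 0)"
    using opa_ide[of "Suc (Suc 0)"] opa_ide[of "Suc 0"] opa_ide[of 0] op_1 by simp_all
  have ii [simp]: "atimes S (ide A a) (ide A b) = ide A (otimes S a b)" if "a \<in> Ob A" "b \<in> Ob A" for a b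
    using D.ta_ide that by simp
  \<comment> \<open>\<open>\<Gamma>((1\<^sub>2, sw); 1\<^sub>1, 1\<^sub>0)\<close> is an arrow of \<open>E\<Sigma>\<^sub>1\<close>, hence an identity\<close>
  have one_arrow: "Sym_gam ass g fs = id" if "Sym_gam ass g fs permutes {..<Suc 0}" for ass g fs
    using that by (simp add: lessThan_Suc)
  have unit: "\<chi> a (tone S) = ide A a" if a: "a \<in> Ob A" for a
  proof -
    let ?ass = "[replicate (Suc 0) (), replicate 0 ()]"
    have p: "g permutes {..<Suc (Suc 0)} \<Longrightarrow> Sym_gam ?ass g [id, id] permutes {..<Suc 0}" for g
      using Sym_gam_permutes_2[of g id "replicate (Suc 0) ()" id "replicate 0 ()"] by (simp add: permutes_id)
    have "P_gam_a [[A], []] [A, A] A ?c [?u, ?z] = opa (Suc 0) (Sym_gam ?ass id [id, id]) (Sym_gam ?ass sw [id, id])"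
      using opa_gam_2[of id sw id "Suc 0" id 0 id id] transpose_permutes_2 by (simp add: permutes_id)
    also have "\<dots> = ?u"
      using one_arrow[OF p[OF permutes_id]] one_arrow[OF p[OF transpose_permutes_2]] by (simp only:)
    finally have "t_comp (P_gam_a [[A], []] [A, A] A ?c [?u, ?z]) [a] = t_comp ?u [a]" by simp
    then show ?thesis
      using a by (simp add: gam_comp Ob_1 Let_def u z ide_comp ide_st Ob_prod opa_sw act Ar_2 \<chi>_def[symmetric])
  qed
  \<comment> \<open>\<open>sw\<^sup>*(1\<^sub>2, sw) = (sw, 1\<^sub>2)\<close> is inverse to \<open>(1\<^sub>2, sw)\<close>\<close>
  have sw_sw: "sw \<circ> sw = id" by (simp add: fun_eq_iff)
  have inverse: "cmp A (\<chi> b a) (\<chi> a b) = ide A (otimes S a b)" if ab: "a \<in> Ob A" "b \<in> Ob A" for a b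
  proof -
    have "P_act_a sw [A, A] A ?c = opa (Suc (Suc 0)) sw id"
      using opa_act[OF permutes_id transpose_permutes_2 transpose_permutes_2] sw_sw by simp
    then have "cmp (P_hom [A, A] A) (P_act_a sw [A, A] A ?c) ?c = ?i"
      using opa_cmp[OF permutes_id transpose_permutes_2 permutes_id] by simp
    then have "t_comp (cmp (P_hom [A, A] A) (P_act_a sw [A, A] A ?c) ?c) [a, b] = t_comp ?i [a, b]" by simp
    then show ?thesis
      using ab permute_list_replicate[OF transpose_permutes_2, of A]
      by (simp add: P_hom_simps i P_act_a_def Ob_2 place_transpose \<chi>_def)
  qed
  \<comment> \<open>in \<open>E\<Sigma>\<^sub>3\<close>, moving two factors together past the third is a composite of two exchanges;
    the second one is the translate of \<open>(1\<^sub>3, ?t)\<close> by \<open>?s\<close>\<close>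
  let ?ass = "[replicate (Suc (Suc 0)) (), replicate (Suc 0) ()]" and ?bss = "[replicate (Suc 0) (), replicate (Suc (Suc 0)) ()]"
  let ?r = "Sym_gam ?ass sw [id, id]" and ?s = "Sym_gam ?bss id [id, sw]" and ?t = "Sym_gam ?ass id [sw, id]"
  note two_perm = transpose_permutes_2 permutes_id
  have perm: "?r permutes {..<3}" "?s permutes {..<3}" "?t permutes {..<3}"
    using Sym_gam_permutes_2[of sw id "replicate (Suc (Suc 0)) ()" id "replicate (Suc 0) ()"]
      Sym_gam_permutes_2[of id id "replicate (Suc 0) ()" sw "replicate (Suc (Suc 0)) ()"]
      Sym_gam_permutes_2[of id sw "replicate (Suc (Suc 0)) ()" id "replicate (Suc 0) ()"]
    by (simp_all add: two_perm numeral_3_eq_3)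
  have pl: "place ?r [a, b, c] = [c, a, b]" "place ?s [a, b, c] = [a, c, b]" "place ?t [a, b, c] = [b, a, c]" for a b c :: 'c
    using place_Sym_gam_2[of sw id "replicate (Suc (Suc 0)) ()" id "replicate (Suc 0) ()" "[a, b]" "[c]"]
      place_Sym_gam_2[of id id "replicate (Suc 0) ()" sw "replicate (Suc (Suc 0)) ()" "[a]" "[b, c]"]
      place_Sym_gam_2[of id sw "replicate (Suc (Suc 0)) ()" id "replicate (Suc 0) ()" "[a, b]" "[c]"]
    by (simp_all add: two_perm place_transpose)
  have upt3: "[0..<3] = [0, Suc 0, Suc (Suc 0)]" by (simp add: numeral_3_eq_3)
  have rts: "?r = ?t \<circ> ?s"
  proof (rule place_upt_inject[OF perm(1) permutes_compose[OF perm(2,3)]])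
    show "place ?r [0..<3] = place (?t \<circ> ?s) [0..<3]"
    proof -
      have "place (?t \<circ> ?s) [0..<3] = place ?t (place ?s [0..<3])"
        by (rule place_compose) (use perm in simp_all)
      then show ?thesis by (simp only: pl upt3)
    qed
  qed
  have three: "replicate 3 A = [A, A, A]" by (simp add: numeral_3_eq_3)
  have gr: "P_gam_a [[A, A], [A]] [A, A] A ?c [?i, ?u] = opa 3 id ?r"
    using opa_gam_2[of id sw id "Suc (Suc 0)" id "Suc 0" id id] Sym_gam_id[of ?ass]
    by (simp add: two_perm numeral_3_eq_3)
  have gs: "P_gam_a [[A], [A, A]] [A, A] A ?i [?u, ?c] = opa 3 id ?s"
    using opa_gam_2[of id id id "Suc 0" id "Suc (Suc 0)" id sw] Sym_gam_id[of ?bss]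
    by (simp add: two_perm numeral_3_eq_3)
  have gt: "P_gam_a [[A, A], [A]] [A, A] A ?i [?c, ?u] = opa 3 id ?t"
    using opa_gam_2[of id id id "Suc (Suc 0)" id "Suc 0" sw id] Sym_gam_id[of ?ass]
    by (simp add: two_perm numeral_3_eq_3)
  have hexagon: "\<chi> (otimes S a b) c = cmp A (atimes S (\<chi> a c) (ide A b)) (atimes S (ide A a) (\<chi> b c))"
    if abc: "a \<in> Ob A" "b \<in> Ob A" "c \<in> Ob A" for a b c
  proof -
    have "opa 3 id ?r = cmp (P_hom [A, A, A] A) (P_act_a ?s [A, A, A] A (opa 3 id ?t)) (opa 3 id ?s)"
      using opa_cmp[OF permutes_id perm(2) perm(1)] opa_act[OF permutes_id perm(3) perm(2)] rts three by simp
    then have "t_comp (opa 3 id ?r) [a, b, c] = cmp A (t_comp (opa 3 id ?t) (place ?s [a, b, c])) (t_comp (opa 3 id ?s) [a, b, c])"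
      using abc permute_list_replicate[OF perm(2), of A] three
      by (simp add: P_hom_simps P_act_a_def Ob_3)
    moreover have "t_comp (opa 3 id ?r) [a, b, c] = \<chi> (otimes S a b) c"
      unfolding gr[symmetric] using abc
      by (simp add: gam_comp Ob_3 Let_def i u ide_comp ide_st Ob_1 Ob_2 opa_sw act Ar_2 \<chi>_def[symmetric])
    moreover have "t_comp (opa 3 id ?s) [a, b, c] = atimes S (ide A a) (\<chi> b c)"
      unfolding gs[symmetric] using abc
      by (simp add: gam_comp Ob_3 Let_def i u ide_comp ide_st Ob_1 Ob_2 opa_sw act Ar_2 place_transpose \<chi>_def[symmetric])
    moreover have "t_comp (opa 3 id ?t) [a, c, b] = atimes S (\<chi> a c) (ide A b)"
      unfolding gt[symmetric] using abc
      by (simp add: gam_comp Ob_3 Let_def i u ide_comp ide_st Ob_1 Ob_2 opa_sw act Ar_2 place_transpose \<chi>_def[symmetric])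
    ultimately show ?thesis by (simp only: pl)
  qed
  show ?thesis
  proof (intro bipermutative_structure.intro D.distributive_structure_axioms permutative_structure.intro
      D.strict_monoidal_structure_axioms permutative_structure_axioms.intro bipermutative_structure_axioms.intro, unfold tsym, goal_cases)
    case (1 a b) then show ?case by (rule chi_in)
  next
    case (2 u a a' v b b')
    then have uv: "[u, v] \<in> hom (prod_cat [A, A]) [a, b] [a', b']" by (simp add: hom_2)
    moreover have "u \<in> Ar A" "v \<in> Ar A" using 2 by (simp_all add: hom_iff)
    ultimately show ?case
      using N.naturality[OF uv] by (simp add: opa_sw act Ar_2 place_transpose \<chi>_def)
  next
    case (3 a) then show ?case by (rule unit)
  next
    case (4 a b) then show ?case by (rule inverse)
  next
    case (5 a b c) then show ?case by (rule hexagon)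
  next
    case (6 a b)
    then show ?case using X.ext_comp extensional_arb[of "t_comp ?c" _ "[a, b]"] by (auto simp: Ob_2 \<chi>_def)
  next
    case (7 a a' b)
    then show ?case using X.comp_delta[of 0 "[a, b]" a'] by (simp add: arg_2 opa_sw act place_transpose \<chi>_def)
  qed
qed

end

text \<open>The arrows of \<open>E\<Sigma>\<^sub>k\<close> are composites of translates of arrows \<open>(1\<^sub>k, t)\<close> for exchanges \<open>t\<close> of
  neighbours, and these are \<open>\<Gamma>(1\<^sub>3; 1\<^sub>p, (1\<^sub>2, sw), 1\<^sub>q)\<close>. The induction treats the arrows
  \<open>(\<sigma>, 1\<^sub>k)\<close>. Such an arrow is \<open>(\<sigma>, t \<circ> \<sigma>) = \<sigma>\<^sup>*(1\<^sub>k, t)\<close>, followed by \<open>(t \<circ> \<sigma>, 1\<^sub>k)\<close>.\<close>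

lemma symmetric_action_eqI:
  assumes F: "symmetric_action A Fo Fa" and G: "symmetric_action A Fo Ga"
    and eq: "Fa [(), ()] () (id, transpose 0 1) = Ga [(), ()] () (id, transpose 0 1)"
    and \<sigma>: "\<sigma> permutes {..<k}" and \<rho>: "\<rho> permutes {..<k}"
  shows "Fa (replicate k ()) () (\<sigma>, \<rho>) = Ga (replicate k ()) () (\<sigma>, \<rho>)"
proof -
  interpret F: symmetric_action A Fo Fa by fact
  interpret G: symmetric_action A Fo Ga by fact
  have two: "F.opa (Suc (Suc 0)) id (transpose 0 (Suc 0)) = G.opa (Suc (Suc 0)) id (transpose 0 (Suc 0))"
    using eq by (simp add: F.opa_def G.opa_def)
  have ide: "F.opa j id id = G.opa j id id" for j
    using F.opa_ide[of j] G.opa_ide[of j] by simp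
  have *: "\<forall>\<sigma>. \<sigma> permutes {..<k} \<longrightarrow> place \<sigma> [0..<k] = ls \<longrightarrow> F.opa k \<sigma> id = G.opa k \<sigma> id"
    if "mset ls = mset [0..<k]" for ls
    using that
  proof (rule adjacent_swap_induct)
    show "\<forall>\<sigma>. \<sigma> permutes {..<k} \<longrightarrow> place \<sigma> [0..<k] = [0..<k] \<longrightarrow> F.opa k \<sigma> id = G.opa k \<sigma> id"
    proof (intro allI impI)
      fix \<sigma> assume "\<sigma> permutes {..<k}" "place \<sigma> [0..<k] = [0..<k]"
      then have "\<sigma> = id" using place_upt_inject[of \<sigma> k id] by (simp add: permutes_id)
      then show "F.opa k \<sigma> id = G.opa k \<sigma> id" using ide by simp
    qed
  next
    fix p a b q assume m: "mset (p @ a # b # q) = mset [0..<k]"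
      and IH: "\<forall>\<sigma>. \<sigma> permutes {..<k} \<longrightarrow> place \<sigma> [0..<k] = p @ b # a # q \<longrightarrow> F.opa k \<sigma> id = G.opa k \<sigma> id"
    have k: "k = length p + (2 + length q)" using arg_cong[OF m, of size] by simp
    show "\<forall>\<sigma>. \<sigma> permutes {..<k} \<longrightarrow> place \<sigma> [0..<k] = p @ a # b # q \<longrightarrow> F.opa k \<sigma> id = G.opa k \<sigma> id"
    proof (intro allI impI)
      fix \<sigma> assume \<sigma>: "\<sigma> permutes {..<k}" and pl: "place \<sigma> [0..<k] = p @ a # b # q"
      let ?js = "[length p, Suc (Suc 0), length q]"
      let ?ass = "map (\<lambda>j. replicate j ()) ?js" and ?fs = "[id, transpose 0 (Suc 0), id]"
      let ?t = "Sym_gam ?ass id ?fs"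
      have fs: "?fs ! i permutes {..<length (?ass ! i)}" if "i < length ?ass" for i
        using that transpose_permutes_2 by (auto simp: less_Suc_eq permutes_id)
      have "?t permutes {..<length (concat ?ass)}"
        by (rule Sym_gam_permutes[OF permutes_id _ fs]) simp_all
      then have t: "?t permutes {..<k}" by (simp add: k)
      have "place ?t (p @ a # b # q) = p @ b # a # q"
        using place_Sym_gam[OF permutes_id _ fs, of "[p, [a, b], q]"] by (simp add: place_transpose)
      then have "place (?t \<circ> \<sigma>) [0..<k] = p @ b # a # q"
        using place_compose[of ?t "[0..<k]" \<sigma>] t \<sigma> pl by simp
      moreover have t\<sigma>: "?t \<circ> \<sigma> permutes {..<k}" using \<sigma> t by (rule permutes_compose)
      ultimately have 1: "F.opa k (?t \<circ> \<sigma>) id = G.opa k (?t \<circ> \<sigma>) id" using IH by blast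
      have arg: "\<And>i. i < length ?js \<Longrightarrow> (replicate 3 id ! i) permutes {..<?js ! i} \<and> (?fs ! i) permutes {..<?js ! i}"
        using transpose_permutes_2 by (auto simp: less_Suc_eq nth_Cons' permutes_id numeral_3_eq_3)
      have "F.opa (sum_list ?js) (Sym_gam ?ass id (replicate 3 id)) ?t = G.opa (sum_list ?js) (Sym_gam ?ass id (replicate 3 id)) ?t"
        using F.opa_gam[of id ?js id "replicate 3 id" ?fs] G.opa_gam[of id ?js id "replicate 3 id" ?fs] arg two ide
        by (simp add: permutes_id numeral_3_eq_3)
      moreover have "Sym_gam ?ass id (replicate 3 id) = id"
        using Sym_gam_id[of ?ass] by (simp add: numeral_3_eq_3)
      ultimately have "F.opa k id ?t = G.opa k id ?t" by (simp add: k)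
      then have "F.opa k \<sigma> (?t \<circ> \<sigma>) = G.opa k \<sigma> (?t \<circ> \<sigma>)"
        using F.opa_act[OF permutes_id t \<sigma>] G.opa_act[OF permutes_id t \<sigma>] by simp
      then show "F.opa k \<sigma> id = G.opa k \<sigma> id"
        using 1 F.opa_cmp[OF \<sigma> t\<sigma> permutes_id] G.opa_cmp[OF \<sigma> t\<sigma> permutes_id] by simp
    qed
  qed
  have p: "\<sigma> \<circ> inv \<rho> permutes {..<k}" by (rule permutes_compose[OF permutes_inv[OF \<rho>] \<sigma>])
  have "F.opa k (\<sigma> \<circ> inv \<rho>) id = G.opa k (\<sigma> \<circ> inv \<rho>) id"
    using *[OF permutes_mset_upt[OF p]] p by blast
  then have "F.opa k (\<sigma> \<circ> inv \<rho> \<circ> \<rho>) (id \<circ> \<rho>) = G.opa k (\<sigma> \<circ> inv \<rho> \<circ> \<rho>) (id \<circ> \<rho>)"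
    using F.opa_act[OF p permutes_id \<rho>] G.opa_act[OF p permutes_id \<rho>] by simp
  moreover have "\<sigma> \<circ> inv \<rho> \<circ> \<rho> = \<sigma>" using permutes_inv_o(2)[OF \<rho>] by (simp add: comp_assoc)
  ultimately show ?thesis by (simp add: F.opa_def G.opa_def)
qed

lemma symmetric_action_ESigma:
  assumes T: "multifunctor ESigma_operad Perm_multicat T" and A: "permutative_category A" and F: "F_ob T () = A"
  shows "symmetric_action A (F_o T) (F_a T)"
proof -
  interpret T: multifunctor ESigma_operad Perm_multicat T by fact
  have Fob: "F_ob T = (\<lambda>_. A)" using F by (auto simp: fun_eq_iff)
  have hom: "cat_functor (indiscrete_cat (Sym (length as))) (P_hom (replicate (length as) A) A) (F_o T as b) (F_a T as b)" for as b
    using T.hom_functor[of as b] unit_lists[of as]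
    by (simp add: ESigma_operad_def Perm_multicat_def Fob map_replicate_const)
  show ?thesis
  proof (intro symmetric_action.intro operad_action.intro operad_action_axioms.intro symmetric_action_axioms.intro A hom)
    show "multifunctor_laws {()} (\<lambda>as b. Sym (length as)) (\<lambda>\<sigma> as b f. f \<circ> \<sigma>) (\<lambda>a. id)
       (\<lambda>ass bs c g fs. Sym_gam ass g fs) P_act_o P_unit P_gam_o (\<lambda>_. A) (F_o T)"
      using T.laws_o by (simp add: ESigma_operad_def Perm_multicat_def Fob)
    show "multilinear (replicate (length as) A) A (F_o T as b \<sigma>)" if "\<sigma> \<in> Sym (length as)" for \<sigma> as b
      using cat_functor.ob_in[OF hom[of as b], of \<sigma>] that by (simp add: P_hom_simps)
    show "multifunctor_laws {()} (\<lambda>as b. Sym (length as) \<times> Sym (length as))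
       (\<lambda>\<sigma> as b u. (fst u \<circ> \<sigma>, snd u \<circ> \<sigma>)) (\<lambda>a. (id, id))
       (\<lambda>ass bs c v us. (Sym_gam ass (fst v) (map fst us), Sym_gam ass (snd v) (map snd us)))
       P_act_a (\<lambda>a. ide (P_hom [a] a) (P_unit a)) P_gam_a (\<lambda>_. A) (F_a T)"
      using T.laws_a by (simp add: ESigma_operad_def Perm_multicat_def Fob)
  qed
qed

theorem bipermutative_bij:
  assumes A: "permutative_category (A :: ('o, 'm) permcat)"
  shows "bij_betw bipermutative_of
    {T. multifunctor ESigma_operad Perm_multicat T \<and> F_ob T () = A} {S. bipermutative_structure A S}"
proof (rule bij_betwI')
  fix T T' :: "(unit, nat \<Rightarrow> nat, (nat \<Rightarrow> nat) \<times> (nat \<Rightarrow> nat), ('o, 'm) permcat, ('o, 'm) mlmap, ('o, 'm) mltrans) mfun"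
  assume "T \<in> {T. multifunctor ESigma_operad Perm_multicat T \<and> F_ob T () = A}"
    and "T' \<in> {T. multifunctor ESigma_operad Perm_multicat T \<and> F_ob T () = A}"
  then have T: "multifunctor ESigma_operad Perm_multicat T" "F_ob T () = A"
    and T': "multifunctor ESigma_operad Perm_multicat T'" "F_ob T' () = A" by auto
  interpret T: multifunctor ESigma_operad Perm_multicat T by (rule T(1))
  interpret T': multifunctor ESigma_operad Perm_multicat T' by (rule T'(1))
  note F = symmetric_action_ESigma[OF T(1) A T(2)] and G = symmetric_action_ESigma[OF T'(1) A T'(2)]
  interpret F: symmetric_action A "F_o T" "F_a T" by (rule F)
  interpret G: symmetric_action A "F_o T'" "F_a T'" by (rule G)
  show "(bipermutative_of T = bipermutative_of T') = (T = T')"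
  proof
    assume eq: "bipermutative_of T = bipermutative_of T'"
    then have assoc: "associative_of T = associative_of T'"
      and comp: "\<And>a b. t_comp (F_a T [(), ()] () (id, transpose 0 1)) [a, b] = t_comp (F_a T' [(), ()] () (id, transpose 0 1)) [a, b]"
      by (auto simp: bipermutative_of_def tensor.extend_def associative_of_def Let_def fun_eq_iff)
    have ob: "F_ob T = F_ob T'" using T(2) T'(2) by (auto simp: fun_eq_iff)
    have o: "F_o T as b f = F_o T' as b f" for as b f
    proof (cases "f \<in> Sym (length as)")
      case True
      then show ?thesis
        using operad_action_eqI[OF F.operad_action_axioms G.operad_action_axioms assoc] by simp
    next
      case False
      then show ?thesis using T.ext_o[of as b f] T'.ext_o[of as b f] by (simp add: ESigma_operad_def)
    qed
    then have oo: "F_o T = F_o T'" by (simp add: fun_eq_iff)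
    have "F_a T [(), ()] () (id, transpose 0 1) = F_a T' [(), ()] () (id, transpose 0 1)"
    proof (rule mltrans.equality)
      note f = F.opa_sw[unfolded F.opa_def] and g = G.opa_sw[unfolded G.opa_def]
      show "t_src (F_a T [(), ()] () (id, transpose 0 1)) = t_src (F_a T' [(), ()] () (id, transpose 0 1))"
        "t_tgt (F_a T [(), ()] () (id, transpose 0 1)) = t_tgt (F_a T' [(), ()] () (id, transpose 0 1))"
        using f g by (simp_all add: F.op_def G.op_def oo)
      show "t_comp (F_a T [(), ()] () (id, transpose 0 1)) = t_comp (F_a T' [(), ()] () (id, transpose 0 1))"
      proof (rule extensionalityI)
        show "t_comp (F_a T [(), ()] () (id, transpose 0 1)) \<in> extensional (Ob (prod_cat [A, A]))"
          "t_comp (F_a T' [(), ()] () (id, transpose 0 1)) \<in> extensional (Ob (prod_cat [A, A]))"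
          using multilinear_trans.ext_comp[OF f(1)] multilinear_trans.ext_comp[OF g(1)] by simp_all
        fix xs assume "xs \<in> Ob (prod_cat [A, A])"
        then obtain a b where "xs = [a, b]" by (auto simp: Ob_prod length_Suc_conv)
        then show "t_comp (F_a T [(), ()] () (id, transpose 0 1)) xs = t_comp (F_a T' [(), ()] () (id, transpose 0 1)) xs"
          using comp by simp
      qed
    qed simp
    then have sym: "F_a T (replicate k ()) () (\<sigma>, \<rho>) = F_a T' (replicate k ()) () (\<sigma>, \<rho>)"
      if "\<sigma> permutes {..<k}" "\<rho> permutes {..<k}" for k \<sigma> \<rho>
      using symmetric_action_eqI[OF F[unfolded oo] G] that by blast
    have a: "F_a T as b u = F_a T' as b u" for as b u
    proof (cases "u \<in> Sym (length as) \<times> Sym (length as)")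
      case True
      have "as = replicate (length as) ()" by (auto intro!: nth_equalityI)
      then show ?thesis using sym[of "fst u" "length as" "snd u"] True by (simp add: mem_Times_iff Sym_iff)
    next
      case False
      then show ?thesis using T.ext_a[of as b u] T'.ext_a[of as b u] by (simp add: ESigma_operad_def)
    qed
    show "T = T'" by (rule mfun.equality) (use ob o a in \<open>auto simp: fun_eq_iff\<close>)
  qed simp
next
  fix T :: "(unit, nat \<Rightarrow> nat, (nat \<Rightarrow> nat) \<times> (nat \<Rightarrow> nat), ('o, 'm) permcat, ('o, 'm) mlmap, ('o, 'm) mltrans) mfun"
  assume "T \<in> {T. multifunctor ESigma_operad Perm_multicat T \<and> F_ob T () = A}"
  then interpret symmetric_action A "F_o T" "F_a T" using symmetric_action_ESigma A by auto
  have "bipermutative_structure A (bipermutative_of T)"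
    by (rule bipermutative_structure_two)
       (simp_all add: bipermutative_of_def tensor.extend_def associative_of_def Let_def op_def opa_def \<chi>_def fun_eq_iff)
  then show "bipermutative_of T \<in> {S. bipermutative_structure A S}" by simp
next
  fix S :: "('o, 'm) sym_tensor" assume "S \<in> {S. bipermutative_structure A S}"
  then interpret B: bipermutative_category A S
    by (intro bipermutative_category.intro A) simp
  have "F_ob B.bipermutative_multifunctor () = A" by (simp add: B.bipermutative_multifunctor_def)
  then show "\<exists>T \<in> {T. multifunctor ESigma_operad Perm_multicat T \<and> F_ob T () = A}. S = bipermutative_of T"
    using B.multifunctor_bipermutative B.bipermutative_of_multifunctor
    by (intro bexI[of _ B.bipermutative_multifunctor]) simp_all
qed

theorem theorem1p2:
  shows "operad Sigma_operad \<and>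
    (\<forall>A :: ('o, 'm) permcat. permutative_category A \<longrightarrow>
      bij_betw associative_of
        {T. multifunctor Sigma_operad Perm_multicat T \<and> F_ob T () = A}
        {S. associative_structure A S}) \<and>
    E_infinity_operad ESigma_operad \<and>
    (\<forall>R :: ('o, 'm) permcat. permutative_category R \<longrightarrow>
      bij_betw bipermutative_of
        {T. multifunctor ESigma_operad Perm_multicat T \<and> F_ob T () = R}
        {S. bipermutative_structure R S})"
  using operad_Sigma E_infinity_ESigma associative_bij bipermutative_bij by blast

end
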